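(* Assume that $\frac12<H<1$. Let $\theta=(\mu_1,\dots,\mu_p,\alpha)^{\top}$ and let $\widetilde{\theta}_n=\widetilde Q_n^{-1}\widetilde P_n$ be the least squares estimator of $\theta$ for the fractional Ornstein-Uhlenbeck process of the second kind with periodic mean $X^{(1)}$ given by $$dX^{(1)}_t=\Big(\sum_{i=1}^p\mu_i\varphi_i(t)-\alpha X^{(1)}_t\Big)dt+dY^{(1)}_t,\qquad X^{(1)}_0=0,$$ observed continuously on $[0,n]$ (with $Y^{(1)},\widetilde P_n,\widetilde Q_n$ as defined in the context). Then $\widetilde{\theta}_n\longrightarrow\theta$ almost surely as $n\to\infty$.
   Context: Setting. $B^H=\{B^H_t,t\ge 0\}$ is a fractional Brownian motion with Hurst parameter $H$ (centered Gaussian with covariance $\frac12(t^{2H}+s^{2H}-|t-s|^{2H})$), $a_t=He^{t/H}$, and $Y^{(1)}_t=\int_0^te^{-s}dB^H_{a_s}$ (pathwise integral). The integer $p\ge1$ and the functions $\varphi_1,\dots,\varphi_p:[0,\infty)\to\mathbb{R}$ are given; the $\varphi_i$ are bounded by a constant $C>0$, periodic with period $1$ (extended periodically to $\mathbb{R}$), and orthonormal: $\int_0^1\varphi_i(t)\varphi_j(t)\,dt=\delta_{ij}$. The parameters $\mu_1,\dots,\mu_p\in\mathbb{R}$ and $\alpha>0$ are unknown. Skorohod integral. $\int_0^nu_t\,\delta Y^{(1)}_t$ denotes the Skorohod (divergence) integral with respect to the Gaussian process $Y^{(1)}$: let $\mathcal H$ be the closure of the real step functions on $[0,n]$ for $\langle\mathbf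 1_{[0,t]},\mathbf 1_{[0,s]}\rangle_{\mathcal H}=E[Y^{(1)}_tY^{(1)}_s]$, $Y^{(1)}(\phi)$ the isometry extending $\mathbf 1_{[0,t]}\mapsto Y^{(1)}_t$, $DF=\sum_i\partial_if(Y^{(1)}(\phi_1),\dots,Y^{(1)}(\phi_k))\phi_i$ for $F=f(Y^{(1)}(\phi_1),\dots,Y^{(1)}(\phi_k))$ with $f$ smooth of polynomial growth together with all its derivatives; the Skorohod integral $\delta$ is the adjoint of $D$, $E[F\delta(u)]=E[\langle DF,u\rangle_{\mathcal H}]$. For deterministic integrands it is the Wiener integral. Estimator. $$\widetilde P_n=\Big(\int_0^n\varphi_1(t)dX^{(1)}_t,\dots,\int_0^n\varphi_p(t)dX^{(1)}_t,-\int_0^nX^{(1)}_t\,dX^{(1)}_t\Big)^{\top},\qquad \widetilde Q_n=\begin{pmatrix}G_n&-\widetilde a_n\\-\widetilde a_n^{\top}&\widetilde b_n\end{pmatrix},$$ where $G_n=\big(\int_0^n\varphi_i(t)\varphi_j(t)dt\big)_{1\le i,j\le p}$, $\widetilde a_n^{\top}=\big(\int_0^n\varphi_1(t)X^{(1)}_tdt,\dots,\int_0^n\varphi_p(t)X^{(1)}_tdt\big)$, $\widetilde b_n=\int_0^n(X^{(1)}_t)^2dt$. The integral $\int_0^nX^{(1)}_tdX^{(1)}_t$ is understood in the Skorohod sense, i.e. as $\int_0^nX^{(1)}_t\big(\sum_i\mu_i\varphi_i(t)-\alpha X^{(1)}_t\big)dt+\int_0^nX^{(1)}_t\,\delta Y^{(1)}_t$.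 Equivalently $\widetilde\theta_n=\theta+\widetilde Q_n^{-1}\widetilde R_n$ with $\widetilde R_n=\big(\int_0^n\varphi_1dY^{(1)},\dots,\int_0^n\varphi_pdY^{(1)},-\int_0^nX^{(1)}_t\,\delta Y^{(1)}_t\big)^{\top}$. *)

theory Defs
  imports "HOL-Probability.Probability" "HOL-Library.Poly_Mapping"
begin

section \<open>Fractional Brownian motion\<close>

text \<open>All finite linear combinations are centred normal; the degenerate law at 0 is allowed.\<close>

definition centered_gaussian_process :: "'a measure \<Rightarrow> real set \<Rightarrow> (real \<Rightarrow> 'a \<Rightarrow> real) \<Rightarrow> bool" where
  "centered_gaussian_process M I Z \<longleftrightarrow>
     (\<forall>t\<in>I. Z t \<in> borel_measurable M) \<and>
     (\<forall>S c. finite S \<and> S \<subseteq> I \<longrightarrow>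
        (AE \<omega> in M. (\<Sum>t\<in>S. c t * Z t \<omega>) = 0) \<or>
        (\<exists>\<sigma>>0. distributed M lborel (\<lambda>\<omega>. \<Sum>t\<in>S. c t * Z t \<omega>) (normal_density 0 \<sigma>)))"

definition fractional_brownian_motion :: "'a measure \<Rightarrow> real \<Rightarrow> (real \<Rightarrow> 'a \<Rightarrow> real) \<Rightarrow> bool" where
  "fractional_brownian_motion M H B \<longleftrightarrow>
     centered_gaussian_process M {0..} B \<and>
     (\<forall>s\<ge>0. \<forall>t\<ge>0. (\<integral>\<omega>. B s \<omega> * B t \<omega> \<partial>M)
        = 1/2 * (t powr (2*H) + s powr (2*H) - \<bar>t - s\<bar> powr (2*H))) \<and>
     (\<forall>\<omega>\<in>space M. continuous_on {0..} (\<lambda>t. B t \<omega>))"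


section \<open>The driving noise as a pathwise integral\<close>

text \<open>Riemann--Stieltjes integral: limit of tagged sums as the mesh tends to 0.\<close>

definition has_rs_integral ::
  "(real \<Rightarrow> real) \<Rightarrow> (real \<Rightarrow> real) \<Rightarrow> real \<Rightarrow> real \<Rightarrow> real \<Rightarrow> bool" where
  "has_rs_integral f g a b I \<longleftrightarrow>
     (\<forall>e>0. \<exists>d>0. \<forall>\<D>. \<D> tagged_division_of {a..b} \<and> (\<forall>(x, K)\<in>\<D>. Sup K - Inf K < d) \<longrightarrow>
        \<bar>(\<Sum>(x, K)\<in>\<D>. f x * (g (Sup K) - g (Inf K))) - I\<bar> < e)"

definition rs_integral :: "(real \<Rightarrow> real) \<Rightarrow> (real \<Rightarrow> real) \<Rightarrow> real \<Rightarrow> real \<Rightarrow> real" where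
  "rs_integral f g a b = (THE I. has_rs_integral f g a b I)"

definition Y1 :: "real \<Rightarrow> (real \<Rightarrow> 'a \<Rightarrow> real) \<Rightarrow> real \<Rightarrow> 'a \<Rightarrow> real" where
  "Y1 H B t \<omega> = rs_integral (\<lambda>s. exp (- s)) (\<lambda>s. B (H * exp (s / H)) \<omega>) 0 t"


section \<open>The Hilbert space of a Gaussian process on a compact interval\<close>

text \<open>
  A finitely supported \<open>c\<close> encodes the step function \<open>\<Sum>\<^sub>t c\<^sub>t 1\<^bsub>[0,t]\<^esub>\<close>; the encoding is
  one-to-one because these indicators are linearly independent.
\<close>

type_synonym step = "real \<Rightarrow>\<^sub>0 real"

definition step_fun :: "step \<Rightarrow> real \<Rightarrow> real" where
  "step_fun c s = (\<Sum>t\<in>Poly_Mapping.keys c. Poly_Mapping.lookup c t * indicator {0..t} s)"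

definition step_integral :: "(real \<Rightarrow> 'a \<Rightarrow> real) \<Rightarrow> step \<Rightarrow> 'a \<Rightarrow> real" where
  "step_integral Y c \<omega> = (\<Sum>t\<in>Poly_Mapping.keys c. Poly_Mapping.lookup c t * Y t \<omega>)"

definition step_inner :: "'a measure \<Rightarrow> (real \<Rightarrow> 'a \<Rightarrow> real) \<Rightarrow> step \<Rightarrow> step \<Rightarrow> real" where
  "step_inner M Y c d =
     (\<Sum>t\<in>Poly_Mapping.keys c. \<Sum>s\<in>Poly_Mapping.keys d.
        Poly_Mapping.lookup c t * Poly_Mapping.lookup d s * (\<integral>\<omega>. Y t \<omega> * Y s \<omega> \<partial>M))"

text \<open>
  The closure of the step functions on \<open>[0,T]\<close> for \<open>step_inner\<close>, as an abstract completion: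
  its elements are represented by Cauchy sequences of step functions. No quotient is taken;
  everything below is independent of the representative.
\<close>

definition hilb :: "'a measure \<Rightarrow> (real \<Rightarrow> 'a \<Rightarrow> real) \<Rightarrow> real \<Rightarrow> (nat \<Rightarrow> step) set" where
  "hilb M Y T = {h. (\<forall>k. Poly_Mapping.keys (h k) \<subseteq> {0..T}) \<and>
     (\<forall>e>0. \<exists>N. \<forall>j\<ge>N. \<forall>k\<ge>N. step_inner M Y (h j - h k) (h j - h k) < e)}"

definition hinner :: "'a measure \<Rightarrow> (real \<Rightarrow> 'a \<Rightarrow> real) \<Rightarrow> (nat \<Rightarrow> step) \<Rightarrow> (nat \<Rightarrow> step) \<Rightarrow> real" where
  "hinner M Y g h = lim (\<lambda>k. step_inner M Y (g k) (h k))"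

text \<open>
  Identification of a function on \<open>[0,T]\<close> with an element of the completion: it is the limit of
  step functions converging to it in \<open>L\<^sup>2([0,T])\<close>. For the noise above with Hurst index greater
  than 1/2, the \<open>step_inner\<close> norm is dominated by a multiple of the \<open>L\<^sup>2([0,T])\<close> norm, so every
  square-integrable function is represented, by exactly one element.
\<close>

definition represents ::
  "'a measure \<Rightarrow> (real \<Rightarrow> 'a \<Rightarrow> real) \<Rightarrow> real \<Rightarrow> (nat \<Rightarrow> step) \<Rightarrow> (real \<Rightarrow> real) \<Rightarrow> bool" where
  "represents M Y T h f \<longleftrightarrow> h \<in> hilb M Y T \<and>
     (\<forall>k. (\<lambda>s. (step_fun (h k) s - f s)\<^sup>2) integrable_on {0..T}) \<and>
     (\<lambda>k. integral {0..T} (\<lambda>s. (step_fun (h k) s - f s)\<^sup>2)) \<longlonglongrightarrow> 0"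

definition hilb_of :: "'a measure \<Rightarrow> (real \<Rightarrow> 'a \<Rightarrow> real) \<Rightarrow> real \<Rightarrow> (real \<Rightarrow> real) \<Rightarrow> nat \<Rightarrow> step" where
  "hilb_of M Y T f = (SOME h. represents M Y T h f)"

text \<open>
  The isometry extending \<open>1\<^bsub>[0,t]\<^esub> \<mapsto> Y\<^sub>t\<close>, with values in \<open>L\<^sup>2\<close>; as for every \<open>L\<^sup>2\<close> object,
  \<open>SOME\<close> picks one almost sure version.
\<close>

definition iso :: "'a measure \<Rightarrow> (real \<Rightarrow> 'a \<Rightarrow> real) \<Rightarrow> (nat \<Rightarrow> step) \<Rightarrow> 'a \<Rightarrow> real" where
  "iso M Y h = (SOME Z. Z \<in> borel_measurable M \<and> integrable M (\<lambda>\<omega>. (Z \<omega>)\<^sup>2) \<and>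
     (\<lambda>k. \<integral>\<omega>. (Z \<omega> - step_integral Y (h k) \<omega>)\<^sup>2 \<partial>M) \<longlonglongrightarrow> 0)"

definition wiener_integral ::
  "'a measure \<Rightarrow> (real \<Rightarrow> 'a \<Rightarrow> real) \<Rightarrow> real \<Rightarrow> (real \<Rightarrow> real) \<Rightarrow> 'a \<Rightarrow> real" where
  "wiener_integral M Y T f = iso M Y (hilb_of M Y T f)"


section \<open>The Skorohod integral\<close>

text \<open>
  Functions of \<open>k\<close> real variables, for varying \<open>k\<close>, are functions on \<open>nat \<Rightarrow> real\<close> that depend
  only on the first \<open>k\<close> coordinates.
\<close>

definition partial_deriv :: "nat \<Rightarrow> ((nat \<Rightarrow> real) \<Rightarrow> real) \<Rightarrow> (nat \<Rightarrow> real) \<Rightarrow> real" where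
  "partial_deriv i f x = deriv (\<lambda>y. f (x(i := y))) (x i)"

definition partial_derivs :: "nat list \<Rightarrow> ((nat \<Rightarrow> real) \<Rightarrow> real) \<Rightarrow> (nat \<Rightarrow> real) \<Rightarrow> real" where
  "partial_derivs is f = foldr partial_deriv is f"

definition smooth_poly_growth :: "nat \<Rightarrow> ((nat \<Rightarrow> real) \<Rightarrow> real) \<Rightarrow> bool" where
  "smooth_poly_growth k f \<longleftrightarrow>
     (\<forall>x y. (\<forall>i<k. x i = y i) \<longrightarrow> f x = f y) \<and>
     (\<forall>is. set is \<subseteq> {..<k} \<longrightarrow>
        continuous_on UNIV (partial_derivs is f) \<and>
        (\<forall>i<k. \<forall>x. (\<lambda>y. partial_derivs is f (x(i := y))) differentiable at (x i)) \<and>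
        (\<exists>C m. \<forall>x. \<bar>partial_derivs is f x\<bar> \<le> C * (1 + (\<Sum>i<k. \<bar>x i\<bar>)) ^ m))"

definition functional ::
  "'a measure \<Rightarrow> (real \<Rightarrow> 'a \<Rightarrow> real) \<Rightarrow> ((nat \<Rightarrow> real) \<Rightarrow> real) \<Rightarrow> (nat \<Rightarrow> nat \<Rightarrow> step) \<Rightarrow> 'a \<Rightarrow> real" where
  "functional M Y f h \<omega> = f (\<lambda>i. iso M Y (h i) \<omega>)"

text \<open>
  \<open>\<langle>DF, g\<rangle>\<close> at \<open>\<omega>\<close>, for \<open>F = functional M Y f h\<close> with \<open>k\<close> variables and
  \<open>DF = \<Sum>\<^bsub>i<k\<^esub> \<partial>\<^sub>i f (Y(h\<^sub>0), \<dots>, Y(h\<^bsub>k-1\<^esub>)) h\<^sub>i\<close>.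
\<close>

definition D_inner ::
  "'a measure \<Rightarrow> (real \<Rightarrow> 'a \<Rightarrow> real) \<Rightarrow> nat \<Rightarrow> ((nat \<Rightarrow> real) \<Rightarrow> real) \<Rightarrow> (nat \<Rightarrow> nat \<Rightarrow> step)
     \<Rightarrow> (nat \<Rightarrow> step) \<Rightarrow> 'a \<Rightarrow> real" where
  "D_inner M Y k f h g \<omega> =
     (\<Sum>i<k. functional M Y (partial_deriv i f) h \<omega> * hinner M Y (h i) g)"

definition L2_hilb :: "'a measure \<Rightarrow> (real \<Rightarrow> 'a \<Rightarrow> real) \<Rightarrow> real \<Rightarrow> (real \<Rightarrow> 'a \<Rightarrow> real) \<Rightarrow> bool" where
  "L2_hilb M Y T u \<longleftrightarrow>
     (\<forall>\<omega>\<in>space M. \<exists>h. represents M Y T h (\<lambda>t. u t \<omega>)) \<and>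
     (\<forall>g\<in>hilb M Y T. (\<lambda>\<omega>. hinner M Y g (hilb_of M Y T (\<lambda>t. u t \<omega>))) \<in> borel_measurable M) \<and>
     integrable M (\<lambda>\<omega>. hinner M Y (hilb_of M Y T (\<lambda>t. u t \<omega>)) (hilb_of M Y T (\<lambda>t. u t \<omega>)))"

text \<open>
  The adjoint of \<open>D\<close> takes values in \<open>L\<^sup>2\<close> of the \<open>\<sigma>\<close>-algebra generated by \<open>Y\<close> on \<open>[0,T]\<close>;
  without this measurability requirement the duality would not determine it.
\<close>

definition is_skorohod_integral ::
  "'a measure \<Rightarrow> (real \<Rightarrow> 'a \<Rightarrow> real) \<Rightarrow> real \<Rightarrow> (real \<Rightarrow> 'a \<Rightarrow> real) \<Rightarrow> ('a \<Rightarrow> real) \<Rightarrow> bool" where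
  "is_skorohod_integral M Y T u G \<longleftrightarrow>
     L2_hilb M Y T u \<and>
     G \<in> borel_measurable (sigma (space M) {Y t -` A \<inter> space M | t A. t \<in> {0..T} \<and> A \<in> sets borel}) \<and>
     integrable M (\<lambda>\<omega>. (G \<omega>)\<^sup>2) \<and>
     (\<forall>k f h. smooth_poly_growth k f \<and> (\<forall>i<k. h i \<in> hilb M Y T) \<longrightarrow>
        (\<integral>\<omega>. functional M Y f h \<omega> * G \<omega> \<partial>M)
        = (\<integral>\<omega>. D_inner M Y k f h (hilb_of M Y T (\<lambda>t. u t \<omega>)) \<omega> \<partial>M))"

definition skorohod_integral ::
  "'a measure \<Rightarrow> (real \<Rightarrow> 'a \<Rightarrow> real) \<Rightarrow> real \<Rightarrow> (real \<Rightarrow> 'a \<Rightarrow> real) \<Rightarrow> 'a \<Rightarrow> real" where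
  "skorohod_integral M Y T u = (SOME G. is_skorohod_integral M Y T u G)"


section \<open>The Ornstein--Uhlenbeck process and the estimator\<close>

definition drift ::
  "('p::finite \<Rightarrow> real \<Rightarrow> real) \<Rightarrow> real ^ 'p \<Rightarrow> real \<Rightarrow> (real \<Rightarrow> 'a \<Rightarrow> real) \<Rightarrow> real \<Rightarrow> 'a \<Rightarrow> real" where
  "drift \<phi> \<mu> \<alpha> X t \<omega> = (\<Sum>i\<in>UNIV. \<mu> $ i * \<phi> i t) - \<alpha> * X t \<omega>"

definition ou_solution ::
  "'a measure \<Rightarrow> (real \<Rightarrow> 'a \<Rightarrow> real) \<Rightarrow> ('p::finite \<Rightarrow> real \<Rightarrow> real) \<Rightarrow> real ^ 'p \<Rightarrow> real
     \<Rightarrow> (real \<Rightarrow> 'a \<Rightarrow> real) \<Rightarrow> bool" where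
  "ou_solution M Y \<phi> \<mu> \<alpha> X \<longleftrightarrow>
     (\<forall>\<omega>\<in>space M. X 0 \<omega> = 0 \<and>
        (\<forall>t\<ge>0. ((\<lambda>s. drift \<phi> \<mu> \<alpha> X s \<omega>) has_integral (X t \<omega> - Y t \<omega>)) {0..t}))"

text \<open>
  Vectors in dimension \<open>p + 1\<close> are indexed by \<open>'p option\<close>: \<open>Some i\<close> for the first \<open>p\<close>
  coordinates, \<open>None\<close> for the last one.
\<close>

definition parameter :: "real ^ ('p::finite) \<Rightarrow> real \<Rightarrow> real ^ ('p option)" where
  "parameter \<mu> \<alpha> = (\<chi> i. case i of Some j \<Rightarrow> \<mu> $ j | None \<Rightarrow> \<alpha>)"

definition P_tilde ::
  "'a measure \<Rightarrow> (real \<Rightarrow> 'a \<Rightarrow> real) \<Rightarrow> ('p::finite \<Rightarrow> real \<Rightarrow> real) \<Rightarrow> real ^ 'p \<Rightarrow> real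
     \<Rightarrow> (real \<Rightarrow> 'a \<Rightarrow> real) \<Rightarrow> real \<Rightarrow> 'a \<Rightarrow> real ^ ('p option)" where
  "P_tilde M Y \<phi> \<mu> \<alpha> X T \<omega> =
     (\<chi> i. case i of
        Some j \<Rightarrow> integral {0..T} (\<lambda>t. \<phi> j t * drift \<phi> \<mu> \<alpha> X t \<omega>) + wiener_integral M Y T (\<phi> j) \<omega>
      | None \<Rightarrow> - (integral {0..T} (\<lambda>t. X t \<omega> * drift \<phi> \<mu> \<alpha> X t \<omega>) + skorohod_integral M Y T X \<omega>))"

definition Q_tilde ::
  "('p::finite \<Rightarrow> real \<Rightarrow> real) \<Rightarrow> (real \<Rightarrow> 'a \<Rightarrow> real) \<Rightarrow> real \<Rightarrow> 'a
     \<Rightarrow> real ^ ('p option) ^ ('p option)" where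
  "Q_tilde \<phi> X T \<omega> =
     (\<chi> i j. case (i, j) of
        (Some k, Some l) \<Rightarrow> integral {0..T} (\<lambda>t. \<phi> k t * \<phi> l t)
      | (Some k, None) \<Rightarrow> - integral {0..T} (\<lambda>t. \<phi> k t * X t \<omega>)
      | (None, Some l) \<Rightarrow> - integral {0..T} (\<lambda>t. \<phi> l t * X t \<omega>)
      | (None, None) \<Rightarrow> integral {0..T} (\<lambda>t. (X t \<omega>)\<^sup>2))"

definition lse ::
  "'a measure \<Rightarrow> (real \<Rightarrow> 'a \<Rightarrow> real) \<Rightarrow> ('p::finite \<Rightarrow> real \<Rightarrow> real) \<Rightarrow> real ^ 'p \<Rightarrow> real
     \<Rightarrow> (real \<Rightarrow> 'a \<Rightarrow> real) \<Rightarrow> real \<Rightarrow> 'a \<Rightarrow> real ^ ('p option)" where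
  "lse M Y \<phi> \<mu> \<alpha> X T \<omega> = matrix_inv (Q_tilde \<phi> X T \<omega>) *v P_tilde M Y \<phi> \<mu> \<alpha> X T \<omega>"

end

theory Submission
  imports Defs
begin

text \<open>
  The noise is a functional of the stationary Gaussian process \<open>U\<^sub>t = e\<^sup>-\<^sup>t B\<^bsub>a(t)\<^esub>\<close>: integration by
  parts gives \<open>Y\<^sub>t = U\<^sub>t - U\<^sub>0 + \<integral>\<^sub>0\<^sup>t U\<^sub>s ds\<close> (\<open>rs_integral_exp\<close>). For \<open>H > 1/2\<close> the covariance function
  \<open>\<gamma>\<close> of \<open>U\<close> is positive, decays exponentially and satisfies \<open>\<gamma> 0 - \<gamma> x \<le> 2 x\<^bsup>2H\<^esup>\<close> for \<open>x \<le> 1\<close>. The solution splits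
  as \<open>X = m + Z\<close> with a bounded deterministic mean \<open>m\<close> and a centred Gaussian process \<open>Z\<close> that is a
  linear functional of \<open>U\<close>. Hence the correlations of \<open>Z\<close> decay exponentially (\<open>Z_correlation\<close>) and
  its variance stays away from zero (\<open>Z_variance_lower\<close>).

  The estimation error is \<open>Q\<inverse>\<close> applied to the noise vector, that is to the integrals of the
  \<open>\<phi>\<^sub>i\<close> and of \<open>- X\<close> against \<open>Y\<close>, so that it suffices to see that the noise is \<open>o(n)\<close> and that \<open>Q\<close> is
  coercive of order \<open>n\<close>.

  For the coercivity, \<open>Q\<close> is the Gram matrix of \<open>\<phi>\<^sub>1, \<dots>, \<phi>\<^sub>p, - X\<close> on \<open>[0,n]\<close>. The \<open>\<phi>\<^sub>i\<close> are orthogonal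
  there by orthonormality and periodicity, the deterministic part of \<open>X\<close> is bounded, its random part \<open>Z\<close>
  is asymptotically orthogonal to bounded functions, and \<open>\<integral>\<^sub>0\<^sup>n Z\<^sup>2\<close> grows linearly by its law of large
  numbers.

  For the noise, the integral of \<open>\<phi>\<^sub>i\<close> is Gaussian with variance of order \<open>n\<close>, and a Gaussian sequence
  with such variances is almost surely \<open>o(n)\<close> by a fourth moment bound and Borel-Cantelli. The
  Skorohod integral of \<open>X\<close> is not available pathwise and has to be computed first. Let \<open>Fx\<close> be what
  the differential equation gives for the pathwise integral \<open>\<integral> X dY\<close>, namely \<open>X\<^sub>n\<^sup>2/2\<close> minus an ordinary
  integral. Riemann sums of \<open>X\<close> against \<open>Y\<close> tend to \<open>Fx\<close> in mean square, as the quadratic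
  variation of \<open>X\<close> vanishes for \<open>H > 1/2\<close>. For the Riemann sums, Gaussian integration by parts
  (\<open>gaussian_integration_by_parts\<close>) is the duality relation of the divergence up to expectations, so
  that in the limit \<open>Sk = Fx - E Fx\<close> satisfies the duality relation (\<open>Sk_duality\<close>). Testing with
  trigonometric functionals shows that the duality relation has only one solution among the functionals
  of \<open>Y\<close>; thus \<open>Sk\<close> is the Skorohod integral (\<open>skorohod_integral_eq\<close>). Finally \<open>Sk\<close> consists of \<open>Z\<^sub>n\<close>, \<open>Z\<^sub>n\<^sup>2\<close>, linear
  integrals of \<open>Z\<close> and \<open>\<integral>\<^sub>0\<^sup>n (Z\<^sup>2 - E Z\<^sup>2)\<close>, which are all \<open>o(n)\<close> (\<open>Sk_LLN\<close>).\<close>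

lemmas bochner_cong = Bochner_Integration.integral_cong
 and hk_cong = Henstock_Kurzweil_Integration.integral_cong
 and hk_combine = Henstock_Kurzweil_Integration.integral_combine
 and bochner_sum = Bochner_Integration.integral_sum
 and bochner_integrable_bound = Bochner_Integration.integrable_bound
 and hk_add = Henstock_Kurzweil_Integration.integral_add
 and hk_diff = Henstock_Kurzweil_Integration.integral_diff
 and hk_nonneg = Henstock_Kurzweil_Integration.integral_nonneg
 and bochner_diff = Bochner_Integration.integral_diff
 and real_vector_derivative = has_real_derivative_iff_has_vector_derivative

section \<open>Square integrable random variables\<close>

definition sqint :: "'a measure => ('a => real) => bool" where
 "sqint M f \<longleftrightarrow> f \<in> borel_measurable M \<and> integrable M (%x. (f x)^2)"

definition l2 :: "'a measure => ('a => real) => real" where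
 "l2 M f = sqrt (\<integral>x. (f x)^2 \<partial>M)"

abbreviation dl2 :: "'a measure => ('a => real) => ('a => real) => real" where
 "dl2 M f g \<equiv> l2 M (%x. f x - g x)"

abbreviation std_gauss :: "real measure" where "std_gauss \<equiv> std_normal_distribution"

lemma sqint_measurable[measurable_dest]: "sqint M f ==> f \<in> borel_measurable M"
 by (simp add: sqint_def)

lemma sqint_square: "sqint M f ==> integrable M (%x. (f x)^2)"
 by (simp add: sqint_def)

lemma l2_nonneg[simp]: "0 <= l2 M f"
 by (simp add: l2_def)

lemma l2_squared: "(l2 M f)^2 = (\<integral>x. (f x)^2 \<partial>M)"
 by (simp add: l2_def)

lemma sqint_mult:
 assumes f: "sqint M f" and g: "sqint M g"
 shows "integrable M (%x. f x * g x)"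
proof (rule bochner_integrable_bound)
 show "integrable M (%x. (f x)^2 + (g x)^2)"
  using f g by (auto simp: sqint_def)
 show "(%x. f x * g x) \<in> borel_measurable M"
  using f g by (auto simp: sqint_def)
 have "\<bar>a * b\<bar> <= a^2 + b^2" for a b :: real
 proof -
  have "0 <= (\<bar>a\<bar> - \<bar>b\<bar>)^2" by simp
  hence "2 * \<bar>a * b\<bar> <= a^2 + b^2" by (simp add: power2_diff abs_mult)
  thus ?thesis by (smt (verit) zero_le_power2 abs_ge_zero)
 qed
 thus "AE x in M. norm (f x * g x) <= norm ((f x)^2 + (g x)^2)"
  by auto
qed

lemma sqint_add: assumes f: "sqint M f" and g: "sqint M g" shows "sqint M (%x. f x + g x)"
proof -
 have "integrable M (%x. (f x)^2 + 2 * (f x * g x) + (g x)^2)"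
  using f g sqint_mult[OF f g] by (auto simp: sqint_def)
 thus ?thesis using f g by (auto simp: sqint_def power2_sum algebra_simps)
qed

lemma sqint_cmult: "sqint M f ==> sqint M (%x. c * f x)"
 by (auto simp: sqint_def power_mult_distrib)

lemma sqint_uminus: "sqint M f ==> sqint M (%x. - f x)"
 by (auto simp: sqint_def)

lemma sqint_diff: "sqint M f ==> sqint M g ==> sqint M (%x. f x - g x)"
 using sqint_add[OF _ sqint_uminus, of M f g] by simp

lemma sqint_zero[simp]: "sqint M (%x. 0)"
 by (simp add: sqint_def)

lemma sqint_sum: "(!!i. i \<in> I ==> sqint M (f i)) ==> sqint M (%x. \<Sum>i\<in>I. f i x)"
 by (induction I rule: infinite_finite_induct) (auto intro: sqint_add)

lemma cauchy_schwarz: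
 assumes f: "sqint M f" and g: "sqint M g"
 shows "\<bar>\<integral>x. f x * g x \<partial>M\<bar> <= l2 M f * l2 M g"
proof -
 define a b c where "a = (\<integral>x. (f x)^2 \<partial>M)" and "b = (\<integral>x. f x * g x \<partial>M)" and "c = (\<integral>x. (g x)^2 \<partial>M)"
 have a: "a \<ge> 0" and c: "c \<ge> 0" by (auto simp: a_def c_def)
 have q: "a * s^2 + 2 * b * s * t + c * t^2 \<ge> 0" for s t
 proof -
  have "0 <= (\<integral>x. (s * f x + t * g x)^2 \<partial>M)" by simp
  also have "\<dots> = (\<integral>x. s^2 * (f x)^2 + 2 * s * t * (f x * g x) + t^2 * (g x)^2 \<partial>M)"
   by (rule bochner_cong) (auto simp: power2_eq_square algebra_simps)
  also have "\<dots> = s^2 * a + 2 * s * t * b + t^2 * c"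
   unfolding a_def b_def c_def
   using sqint_square[OF f] sqint_square[OF g] sqint_mult[OF f g] by simp
  finally show ?thesis by (simp add: algebra_simps)
 qed
 have "b^2 <= a * c"
 proof (cases "a = 0")
  case True
  have b: "b = 0"
  proof (rule ccontr)
   assume b: "b \<noteq> 0"
   from q[of "- (c + 1) / (2 * b)" 1] True b show False by (simp add: field_simps)
  qed
  show ?thesis unfolding b True by simp
 next
  case False
  hence "a > 0" using a by simp
  have "a * (- b)^2 + 2 * b * (- b) * a + c * a^2 \<ge> 0" by (rule q)
  hence "a * (a * c - b^2) \<ge> 0" by (simp add: power2_eq_square algebra_simps)
  thus ?thesis using \<open>a > 0\<close> by (simp add: zero_le_mult_iff)
 qed
 hence "sqrt (b^2) <= sqrt (a * c)" by (rule real_sqrt_le_mono)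
 thus ?thesis by (simp add: l2_def a_def b_def c_def real_sqrt_mult)
qed

lemma l2_triangle:
 assumes f: "sqint M f" and g: "sqint M g"
 shows "l2 M (%x. f x + g x) <= l2 M f + l2 M g"
proof (rule power2_le_imp_le)
 have "(l2 M (%x. f x + g x))^2 = (\<integral>x. (f x)^2 + 2 * (f x * g x) + (g x)^2 \<partial>M)"
  unfolding l2_squared by (rule bochner_cong) (auto simp: power2_sum)
 also have "\<dots> = (l2 M f)^2 + 2 * (\<integral>x. f x * g x \<partial>M) + (l2 M g)^2"
  unfolding l2_squared using sqint_square[OF f] sqint_square[OF g] sqint_mult[OF f g] by simp
 also have "\<dots> <= (l2 M f + l2 M g)^2"
  using cauchy_schwarz[OF f g] by (simp add: power2_sum)
 finally show "(l2 M (%x. f x + g x))^2 <= (l2 M f + l2 M g)^2" .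
qed simp

lemma l2_cmult: "l2 M (%x. c * f x) = \<bar>c\<bar> * l2 M f"
 by (simp add: l2_def power_mult_distrib real_sqrt_mult)

lemma l2_uminus: "l2 M (%x. - f x) = l2 M f"
 by (simp add: l2_def)

lemma l2_zero[simp]: "l2 M (%x. 0) = 0"
 by (simp add: l2_def)

lemma l2_minus_commute: "l2 M (%x. f x - g x) = l2 M (%x. g x - f x)"
 by (simp add: l2_def power2_commute)

lemma l2_triangle_diff:
 assumes f: "sqint M f" and g: "sqint M g"
 shows "l2 M (%x. f x - g x) <= l2 M f + l2 M g"
 using l2_triangle[OF f sqint_uminus[OF g]] by (simp add: l2_uminus)

lemma l2_triangle3:
 assumes "sqint M f" "sqint M g" "sqint M h"
 shows "l2 M (%x. f x - h x) <= l2 M (%x. f x - g x) + l2 M (%x. g x - h x)"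
 using l2_triangle[OF sqint_diff[OF assms(1,2)] sqint_diff[OF assms(2,3)]] by simp

lemma l2_reverse_triangle:
 assumes f: "sqint M f" and g: "sqint M g"
 shows "\<bar>l2 M f - l2 M g\<bar> <= l2 M (%x. f x - g x)"
 using l2_triangle[OF sqint_diff[OF f g] g] l2_triangle[OF sqint_diff[OF g f] f]
 by (simp add: l2_minus_commute[of M g f])

lemma l2_sum:
 assumes "!!i. i \<in> I ==> sqint M (f i)"
 shows "l2 M (%x. \<Sum>i\<in>I. f i x) <= (\<Sum>i\<in>I. l2 M (f i))"
 using assms
proof (induction I rule: infinite_finite_induct)
 case (insert i I)
 have "l2 M (%x. f i x + (\<Sum>i\<in>I. f i x)) <= l2 M (f i) + l2 M (%x. \<Sum>i\<in>I. f i x)"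
  using insert.prems by (intro l2_triangle sqint_sum) auto
 thus ?case using insert by force
qed auto

lemma l2_cong_AE:
 assumes "f \<in> borel_measurable M" "g \<in> borel_measurable M" "AE x in M. f x = g x"
 shows "l2 M f = l2 M g"
 unfolding l2_def by (subst integral_cong_AE[of _ M "%x. (g x)^2"]) (use assms in auto)

lemma l2_eq_0_AE:
 assumes "sqint M f" "l2 M f = 0" shows "AE x in M. f x = 0"
proof -
 have "(\<integral>x. (f x)^2 \<partial>M) = 0" using assms(2) by (simp add: l2_def)
 hence "AE x in M. (f x)\<^sup>2 = 0"
  using integral_nonneg_eq_0_iff_AE[OF sqint_square[OF assms(1)]] by simp
 thus ?thesis by auto
qed

lemma l2_tendsto_norm:
 assumes "!!k. sqint M (f k)" "sqint M g" "(%k. l2 M (%x. f k x - g x)) \<longlonglongrightarrow> 0"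
 shows "(%k. l2 M (f k)) \<longlonglongrightarrow> l2 M g"
proof (rule LIM_zero_cancel, rule tendsto_0_le[OF assms(3), where K=1])
 show "\<forall>\<^sub>F k in sequentially. norm (l2 M (f k) - l2 M g) <= norm (l2 M (%x. f k x - g x)) * 1"
  using l2_reverse_triangle[OF assms(1,2)] by (intro always_eventually) auto
qed

lemma l2_tendsto_inner:
 assumes f: "!!k. sqint M (f k)" "sqint M F" and fl: "(%k. l2 M (%x. f k x - F x)) \<longlonglongrightarrow> 0"
  and g: "!!k. sqint M (g k)" "sqint M G" and gl: "(%k. l2 M (%x. g k x - G x)) \<longlonglongrightarrow> 0"
 shows "(%k. \<integral>x. f k x * g k x \<partial>M) \<longlonglongrightarrow> (\<integral>x. F x * G x \<partial>M)"
proof (rule LIM_zero_cancel, rule tendsto_0_le[where K=1])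
 have *: "(%k. l2 M (g k)) \<longlonglongrightarrow> l2 M G" by (rule l2_tendsto_norm[OF g gl])
 show "(%k. l2 M (%x. f k x - F x) * l2 M (g k) + l2 M F * l2 M (%x. g k x - G x)) \<longlonglongrightarrow> 0"
  using tendsto_add[OF tendsto_mult[OF fl *] tendsto_mult[OF tendsto_const[of "l2 M F"] gl]] by simp
 show "\<forall>\<^sub>F k in sequentially. norm ((\<integral>x. f k x * g k x \<partial>M) - (\<integral>x. F x * G x \<partial>M))
  <= norm (l2 M (%x. f k x - F x) * l2 M (g k) + l2 M F * l2 M (%x. g k x - G x)) * 1"
 proof (intro always_eventually allI)
  fix k
  have "(\<integral>x. f k x * g k x \<partial>M) - (\<integral>x. F x * G x \<partial>M)
   = (\<integral>x. (f k x - F x) * g k x + F x * (g k x - G x) \<partial>M)"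
   using sqint_mult[OF f(1)[of k] g(1)[of k]] sqint_mult[OF f(2) g(2)]
   by (subst bochner_diff[symmetric]) (auto simp: algebra_simps)
  also have "\<dots> = (\<integral>x. (f k x - F x) * g k x \<partial>M) + (\<integral>x. F x * (g k x - G x) \<partial>M)"
   by (intro Bochner_Integration.integral_add sqint_mult sqint_diff f g)
  finally show "norm ((\<integral>x. f k x * g k x \<partial>M) - (\<integral>x. F x * G x \<partial>M))
  <= norm (l2 M (%x. f k x - F x) * l2 M (g k) + l2 M F * l2 M (%x. g k x - G x)) * 1"
   using cauchy_schwarz[OF sqint_diff[OF f(1)[of k] f(2)] g(1)[of k]]
    cauchy_schwarz[OF f(2) sqint_diff[OF g(1)[of k] g(2)]] by simp
 qed
qed

context prob_space begin

abbreviation ip :: "('a => real) => ('a => real) => real" where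
 "ip f g \<equiv> expectation (%x. f x * g x)"

lemma sqint_const[simp]: "sqint M (%x. c)"
 by (simp add: sqint_def)

lemma sqint_integrable: "sqint M f ==> integrable M f"
 using sqint_mult[of M f "%x. 1"] by simp

lemma l2_const[simp]: "l2 M (%x. c) = \<bar>c\<bar>"
 by (simp add: l2_def prob_space)

lemma abs_expectation_le_l2: "sqint M f ==> \<bar>expectation f\<bar> <= l2 M f"
 using cauchy_schwarz[of M f "%x. 1"] by (simp add: prob_space)

lemma expectation_abs_le_l2: "sqint M f ==> expectation (%x. \<bar>f x\<bar>) <= l2 M f"
 using abs_expectation_le_l2[of "%x. \<bar>f x\<bar>"] by (auto simp: sqint_def l2_def)

text \<open>A sequence that is Cauchy in mean square has a subsequence whose increments are summable
 in the mean, hence almost surely; Fatou's lemma shows that the pointwise limit is the limit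
 in mean square.\<close>

lemma l2_complete:
 assumes f: "!!k. sqint M (f k)"
  and cauchy: "!!e. e > 0 ==> \<exists>N. \<forall>j\<ge>N. \<forall>k\<ge>N. l2 M (%x. f j x - f k x) < e"
 obtains g where "sqint M g" "(%k. l2 M (%x. f k x - g x)) \<longlonglongrightarrow> 0"
proof -
 have meas[measurable]: "f k \<in> borel_measurable M" for k using f by (simp add: sqint_def)
 have "\<exists>N. \<forall>e. \<forall>j\<ge>N e. \<forall>k\<ge>N e. e > 0 \<longrightarrow> l2 M (%x. f j x - f k x) < e"
  using cauchy by (intro choice) blast
 then obtain N where N: "!!e j k. e > 0 ==> j \<ge> N e ==> k \<ge> N e ==> l2 M (%x. f j x - f k x) < e"
  by blast
 \<comment> \<open>The summand \<open>k\<close> makes the indices tend to infinity, the sum makes them exceed every earlier bound.\<close>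
 define r where "r = (%k::nat. (\<Sum>i\<le>k. N ((1/2)^i)) + k)"
 have rk: "r k \<ge> N ((1/2)^k)" for k
  unfolding r_def by (rule trans_le_add1, rule member_le_sum) auto
 have rS: "r (Suc k) \<ge> N ((1/2)^k)" for k
  using rk[of k] by (simp add: r_def)
 have rge: "r k \<ge> k" for k by (simp add: r_def)
 define d where "d k x = f (r (Suc k)) x - f (r k) x" for k x
 have d: "l2 M (d k) < (1/2)^k" for k
  unfolding d_def by (rule N) (use rk rS in auto)
 have dq: "sqint M (d k)" for k unfolding d_def by (intro sqint_diff f)
 have [measurable]: "d k \<in> borel_measurable M" for k using dq by (simp add: sqint_def)
 have "(\<integral>\<^sup>+x. suminf (%k. ennreal \<bar>d k x\<bar>) \<partial>M) = suminf (%k. \<integral>\<^sup>+x. ennreal \<bar>d k x\<bar> \<partial>M)"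
  by (rule nn_integral_suminf) auto
 also have "\<dots> <= suminf (%k. ennreal ((1/2)^k))"
 proof (rule suminf_le)
  fix k
  have "(\<integral>\<^sup>+x. ennreal \<bar>d k x\<bar> \<partial>M) = ennreal (expectation (%x. \<bar>d k x\<bar>))"
   by (rule nn_integral_eq_integral) (use sqint_integrable[OF dq] in auto)
  also have "\<dots> <= ennreal ((1/2)^k)"
   by (rule ennreal_leI) (use expectation_abs_le_l2[OF dq] d in \<open>force intro: order_trans less_imp_le\<close>)
  finally show "(\<integral>\<^sup>+x. ennreal \<bar>d k x\<bar> \<partial>M) <= ennreal ((1/2)^k)" .
 qed auto
 also have "\<dots> = ennreal (suminf (%k. (1/2)^k))"
  by (rule suminf_ennreal2) (auto intro: summable_geometric)
 also have "\<dots> < \<infinity>" by simp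
 finally have "AE x in M. suminf (%k. ennreal \<bar>d k x\<bar>) \<noteq> \<infinity>"
  by (intro nn_integral_noteq_infinite) auto
 hence "AE x in M. convergent (%k. f (r k) x)"
 proof eventually_elim
  case (elim x)
  hence "summable (%k. \<bar>d k x\<bar>)"
   by (intro summable_suminf_not_top) auto
  hence "summable (%k. d k x)" by (rule summable_rabs_cancel)
  hence "(%n. \<Sum>k<n. d k x) \<longlonglongrightarrow> suminf (%k. d k x)" by (rule summable_LIMSEQ)
  moreover have "(\<Sum>k<n. d k x) = f (r n) x - f (r 0) x" for n
   unfolding d_def by (rule sum_lessThan_telescope)
  ultimately have "(%n. f (r n) x - f (r 0) x + f (r 0) x) \<longlonglongrightarrow> (suminf (%k. d k x)) + f (r 0) x"
   by (intro tendsto_add) auto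
  thus ?case by (auto simp: convergent_def)
 qed
 hence lim: "AE x in M. (%k. f (r k) x) \<longlonglongrightarrow> lim (%k. f (r k) x)"
  by (simp add: convergent_LIMSEQ_iff)
 define g where "g x = lim (%k. f (r k) x)" for x
 have [measurable]: "g \<in> borel_measurable M" unfolding g_def by measurable
 have bound: "(\<integral>\<^sup>+x. ennreal ((f m x - g x)^2) \<partial>M) <= ennreal (e^2)" if e: "e > 0" and m: "m \<ge> N e" for m e
 proof -
  have "(\<integral>\<^sup>+x. ennreal ((f m x - g x)^2) \<partial>M) = (\<integral>\<^sup>+x. liminf (%k. ennreal ((f m x - f (r k) x)^2)) \<partial>M)"
  proof (rule nn_integral_cong_AE, use lim in eventually_elim)
   case (elim x)
   have "(%k. ennreal ((f m x - f (r k) x)^2)) \<longlonglongrightarrow> ennreal ((f m x - g x)^2)"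
    unfolding g_def by (intro tendsto_intros tendsto_ennrealI elim)
   thus ?case by (rule lim_imp_Liminf[symmetric, OF trivial_limit_sequentially])
  qed
  also have "\<dots> <= liminf (%k. \<integral>\<^sup>+x. ennreal ((f m x - f (r k) x)^2) \<partial>M)"
   by (rule nn_integral_liminf) auto
  also have "\<dots> <= ennreal (e^2)"
  proof (rule Liminf_le)
   have "(\<integral>\<^sup>+x. ennreal ((f m x - f (r k) x)^2) \<partial>M) <= ennreal (e^2)" if k: "k \<ge> N e" for k
   proof -
    have "(\<integral>\<^sup>+x. ennreal ((f m x - f (r k) x)^2) \<partial>M) = ennreal ((l2 M (%x. f m x - f (r k) x))^2)"
     unfolding l2_squared
     by (rule nn_integral_eq_integral) (use sqint_square[OF sqint_diff[OF f f]] in auto)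
    also have "\<dots> <= ennreal (e^2)"
     using N[OF e m, of "r k"] rge[of k] k by (intro ennreal_leI power_mono) auto
    finally show ?thesis .
   qed
   thus "\<forall>\<^sub>F k in sequentially. (\<integral>\<^sup>+x. ennreal ((f m x - f (r k) x)^2) \<partial>M) <= ennreal (e^2)"
    by (auto simp: eventually_sequentially)
  qed auto
  finally show ?thesis .
 qed
 have sq: "sqint M (%x. f m x - g x)" if "m \<ge> N 1" for m
  unfolding sqint_def
 proof
  show "integrable M (%x. (f m x - g x)^2)"
   using bound[of 1 m] that by (intro integrableI_bounded) (auto simp: le_less_trans)
 qed simp
 have g: "sqint M g"
  using sqint_diff[OF f[of "N 1"] sq[of "N 1"]] by simp
 have "(%k. l2 M (%x. f k x - g x)) \<longlonglongrightarrow> 0"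
 proof (rule LIMSEQ_I)
  fix e :: real assume e: "e > 0"
  show "\<exists>no. \<forall>n\<ge>no. norm (l2 M (%x. f n x - g x) - 0) < e"
  proof (intro exI allI impI)
   fix n assume n: "n \<ge> N (e/2)"
   have "ennreal ((l2 M (%x. f n x - g x))^2) = (\<integral>\<^sup>+x. ennreal ((f n x - g x)^2) \<partial>M)"
    unfolding l2_squared
    by (rule nn_integral_eq_integral[symmetric]) (use sqint_square[OF sqint_diff[OF f g]] in auto)
   also have "\<dots> <= ennreal ((e/2)^2)" using bound[of "e/2" n] e n by simp
   finally have "(l2 M (%x. f n x - g x))^2 <= (e/2)^2" by simp
   hence "l2 M (%x. f n x - g x) <= e/2" by (rule power2_le_imp_le) (use e in auto)
   thus "norm (l2 M (%x. f n x - g x) - 0) < e" using e by simp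
  qed
 qed
 with g show ?thesis using that by blast
qed

end

section \<open>Integrals of processes over time\<close>

context prob_space begin

text \<open>Tonelli's theorem; it licenses exchanging the expectation with an integral over a bounded time interval.\<close>

lemma integrable_process:
 fixes h :: "real => 'a => real"
 assumes h: "case_prod h \<in> borel_measurable (borel \<Otimes>\<^sub>M M)"
  and c: "!!t. t \<in> {a..b} ==> integrable M (h t) \<and> expectation (%w. \<bar>h t w\<bar>) <= c"
 shows "integrable (lborel \<Otimes>\<^sub>M M) (%(t, w). indicator {a..b} t * h t w)"
proof (rule integrableI_bounded)
 have s: "sets (lborel \<Otimes>\<^sub>M M) = sets (borel \<Otimes>\<^sub>M M)" by (rule sets_pair_measure_cong) auto
 have [measurable]: "(%x. h (fst x) (snd x)) \<in> borel_measurable (lborel \<Otimes>\<^sub>M M)"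
  using h by (simp add: case_prod_unfold measurable_cong_sets[OF s refl])
 show m: "(%(t, w). indicator {a..b} t * h t w) \<in> borel_measurable (lborel \<Otimes>\<^sub>M M)"
  unfolding case_prod_unfold by measurable
 have "(\<integral>\<^sup>+x. ennreal (norm (case x of (t, w) => indicator {a..b} t * h t w)) \<partial>(lborel \<Otimes>\<^sub>M M))
   = (\<integral>\<^sup>+t. \<integral>\<^sup>+w. ennreal (norm (indicator {a..b} t * h t w)) \<partial>M \<partial>lborel)"
  using m by (subst nn_integral_fst[symmetric]) (auto simp: case_prod_unfold)
 also have "\<dots> <= (\<integral>\<^sup>+t. ennreal c * indicator {a..b} t \<partial>lborel)"
 proof (rule nn_integral_mono)
  fix t
  show "(\<integral>\<^sup>+w. ennreal (norm (indicator {a..b} t * h t w)) \<partial>M) <= ennreal c * indicator {a..b} t"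
  proof (cases "t \<in> {a..b}")
   case True
   have "(\<integral>\<^sup>+w. ennreal \<bar>h t w\<bar> \<partial>M) = ennreal (expectation (%w. \<bar>h t w\<bar>))"
    by (rule nn_integral_eq_integral) (use c[OF True] in auto)
   thus ?thesis using True c[OF True] by (simp add: ennreal_leI)
  qed auto
 qed
 also have "\<dots> = ennreal c * emeasure lborel {a..b}" by (simp add: nn_integral_cmult_indicator)
 also have "\<dots> < \<infinity>" by (simp add: ennreal_mult_less_top emeasure_lborel_Icc_eq)
 finally show "(\<integral>\<^sup>+x. ennreal (norm (case x of (t, w) => indicator {a..b} t * h t w)) \<partial>(lborel \<Otimes>\<^sub>M M)) < \<infinity>" .
qed

text \<open>By the Cauchy-Schwarz inequality in time, the square of the integral is at most \<open>b - a\<close> times the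
 integral of the squares; everything else is an exchange of integrals.\<close>

lemma sqint_bounded_process_integral:
 fixes q :: "real => 'a => real"
 assumes q[measurable]: "case_prod q \<in> borel_measurable (borel \<Otimes>\<^sub>M M)"
  and ab: "a <= b" and K: "!!t. t \<in> {a..b} ==> sqint M (q t) \<and> l2 M (q t) <= K"
 shows process_integral_sqint: "sqint M (%w. LBINT t:{a..b}. q t w)" (is "sqint M ?I")
  and process_integral_l2: "l2 M (%w. LBINT t:{a..b}. q t w) <= (b - a) * K"
  and process_integral_inner: "!!\<xi>. sqint M \<xi> ==>
   (%t. ip \<xi> (q t)) \<in> borel_measurable borel \<and> set_integrable lborel {a..b} (%t. ip \<xi> (q t)) \<and>
   ip \<xi> (%w. LBINT t:{a..b}. q t w) = (LBINT t:{a..b}. ip \<xi> (q t))"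
  and process_integrable_AE: "AE w in M. set_integrable lborel {a..b} (%t. q t w)"
proof -
 interpret PS: pair_sigma_finite lborel M ..
 have K0: "0 <= K" using K[of a] ab by (auto intro: order_trans[OF l2_nonneg])
 have int: "integrable (lborel \<Otimes>\<^sub>M M) (%(t, w). indicator {a..b} t * (\<xi> w * q t w))" if xi: "sqint M \<xi>" for \<xi>
 proof (rule integrable_process)
  have [measurable]: "\<xi> \<in> borel_measurable M" using xi by (simp add: sqint_def)
  show "case_prod (%t w. \<xi> w * q t w) \<in> borel_measurable (borel \<Otimes>\<^sub>M M)" by measurable
  fix t assume t: "t \<in> {a..b}"
  have sq: "sqint M (%w. \<bar>\<xi> w\<bar>)" "sqint M (%w. \<bar>q t w\<bar>)" using xi K[OF t] by (auto simp: sqint_def)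
  have "expectation (%w. \<bar>\<xi> w * q t w\<bar>) <= l2 M \<xi> * l2 M (q t)"
   using cauchy_schwarz[OF sq] by (simp add: l2_def abs_mult)
  also have "\<dots> <= l2 M \<xi> * K" using K[OF t] by (intro mult_left_mono) auto
  finally show "integrable M (%w. \<xi> w * q t w) \<and> expectation (%w. \<bar>\<xi> w * q t w\<bar>) <= l2 M \<xi> * K"
   using sqint_mult[OF xi] K[OF t] by blast
 qed
 have eq: "(\<integral>t. indicator {a..b} t * (\<xi> w * q t w) \<partial>lborel) = \<xi> w * ?I w" for \<xi> w
  by (simp add: set_lebesgue_integral_def mult.left_commute[of "indicator {a..b} _"])
 show "(%t. ip \<xi> (q t)) \<in> borel_measurable borel \<and> set_integrable lborel {a..b} (%t. ip \<xi> (q t)) \<and>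
   ip \<xi> ?I = (LBINT t:{a..b}. ip \<xi> (q t))" if xi: "sqint M \<xi>" for \<xi>
 proof -
  have [measurable]: "\<xi> \<in> borel_measurable M" using xi by (simp add: sqint_def)
  have "(%t. ip \<xi> (q t)) \<in> borel_measurable borel" by measurable
  thus ?thesis
   using PS.integrable_fst[OF int[OF xi]] PS.Fubini_integral[OF int[OF xi]]
   unfolding eq set_integrable_def set_lebesgue_integral_def[of lborel] by simp
 qed
 have "integrable (lborel \<Otimes>\<^sub>M M) (%(t, w). indicator {a..b} t * (1 * q t w))" by (rule int) simp
 from PS.AE_integrable_snd[OF this] show "AE w in M. set_integrable lborel {a..b} (%t. q t w)" by (simp add: set_integrable_def)
 \<comment> \<open>The Cauchy-Schwarz inequality in \<open>t\<close> reduces the mean square of the integral to the integral of the mean squares.\<close>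
 have D: "integrable (lborel \<Otimes>\<^sub>M M) (%(t, w). indicator {a..b} t * (q t w)^2)"
 proof (rule integrable_process[where c="K^2"])
  show "case_prod (%t w. (q t w)^2) \<in> borel_measurable (borel \<Otimes>\<^sub>M M)" by measurable
  show "integrable M (%w. (q t w)^2) \<and> expectation (%w. \<bar>(q t w)\<^sup>2\<bar>) <= K^2" if "t \<in> {a..b}" for t
   using K[OF that] power_mono[of "l2 M (q t)" K 2] by (simp add: sqint_square l2_squared[symmetric])
 qed
 define S where "S w = (\<integral>t. indicator {a..b} t * (q t w)^2 \<partial>lborel)" for w
 have iS: "integrable M S" using PS.integrable_snd[OF D] by (simp add: S_def[abs_def])
 have "expectation S = (\<integral>t. indicator {a..b} t * expectation (%w. (q t w)^2) \<partial>lborel)"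
  using PS.Fubini_integral[OF D] by (simp add: S_def[abs_def])
 also have "\<dots> <= (\<integral>t. indicator {a..b} t * K^2 \<partial>lborel)"
 proof (rule integral_mono)
  show "integrable lborel (%t. indicator {a..b} t * expectation (%w. (q t w)^2))" using PS.integrable_fst[OF D] by simp
  show "integrable lborel (%t. indicator {a..b} t * K^2)" by (simp add: emeasure_lborel_Icc_eq)
  show "indicator {a..b} t * expectation (%w. (q t w)^2) <= indicator {a..b} t * K^2" for t
   using K[of t] power_mono[of "l2 M (q t)" K 2] by (auto simp: indicator_def l2_squared[symmetric])
 qed
 also have "\<dots> = (b - a) * K^2" using ab by simp
 finally have ES: "expectation S <= (b - a) * K^2" .
 have [measurable]: "?I \<in> borel_measurable M"
  using borel_measurable_integrable[OF PS.integrable_snd[OF int[of "%_. 1"]]] by (simp add: set_lebesgue_integral_def)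
 have ae: "AE w in M. (?I w)\<^sup>2 <= (b - a) * S w"
  using PS.AE_integrable_snd[OF D] AE_space
 proof eventually_elim
  case (elim w)
  have [measurable]: "(%t. q t w) \<in> borel_measurable borel"
   using measurable_compose[OF measurable_Pair2'[OF elim(2)] q] by simp
  have f: "sqint lborel (indicat_real {a..b})" "l2 lborel (indicat_real {a..b}) = sqrt (b - a)"
   using ab by (auto simp: sqint_def l2_def power2_eq_square indicator_inter_arith[symmetric] emeasure_lborel_Icc_eq)
  have sqr: "(indicat_real {a..b} t * q t w)^2 = indicator {a..b} t * (q t w)^2" for t by (simp add: indicator_def)
  have g: "sqint lborel (%t. indicat_real {a..b} t * q t w)" "l2 lborel (%t. indicat_real {a..b} t * q t w) = sqrt (S w)"
   using elim(1) by (simp_all add: sqint_def l2_def sqr S_def)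
  have "?I w = (\<integral>t. indicat_real {a..b} t * (indicat_real {a..b} t * q t w) \<partial>lborel)"
   unfolding set_lebesgue_integral_def by (rule bochner_cong) (auto simp: indicator_def)
  hence "\<bar>?I w\<bar> <= sqrt (b - a) * sqrt (S w)" using cauchy_schwarz[OF f(1) g(1)] unfolding f(2) g(2) by simp
  hence "\<bar>?I w\<bar>\<^sup>2 <= (sqrt (b - a) * sqrt (S w))^2" by (rule power_mono) simp
  moreover have "0 <= S w" unfolding S_def by simp
  ultimately show ?case using ab by (simp add: power_mult_distrib)
 qed
 have iI: "integrable M (%w. (?I w)^2)"
 proof (rule bochner_integrable_bound[OF integrable_mult_right[OF iS, of "b - a"]])
  show "AE w in M. norm ((?I w)^2) <= norm ((b - a) * S w)" using ae by eventually_elim simp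
 qed measurable
 thus "sqint M ?I" by (simp add: sqint_def)
 have "(l2 M ?I)^2 <= (b - a) * expectation S"
  unfolding l2_squared using integral_mono_AE[OF iI integrable_mult_right[OF iS] ae] by simp
 also have "\<dots> <= (b - a) * ((b - a) * K^2)" using ES ab by (intro mult_left_mono) auto
 also have "\<dots> = ((b - a) * K)^2" by (simp add: power2_eq_square)
 finally show "l2 M ?I <= (b - a) * K" by (rule power2_le_imp_le) (use ab K0 in simp)
qed

end

section \<open>Gaussian random variables\<close>

context prob_space begin

text \<open>Centred Gaussian, written as a scaled standard normal variable so that the variance zero is
 included.\<close>

definition gaussian :: "('a => real) => bool" where
 "gaussian Z \<longleftrightarrow> sqint M Z \<and> distr M borel Z = distr std_gauss borel (%x. l2 M Z * x)"

lemma gaussian_sqint: "gaussian Z ==> sqint M Z"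
 by (simp add: gaussian_def)

lemma expectation_gaussian:
 fixes g :: "real => real"
 assumes Z: "gaussian Z" and g[measurable]: "g \<in> borel_measurable borel"
 shows "(\<integral>w. g (Z w) \<partial>M) = (\<integral>x. g (l2 M Z * x) \<partial>std_gauss)"
  and "integrable M (%w. g (Z w)) \<longleftrightarrow> integrable std_gauss (%x. g (l2 M Z * x))"
proof -
 have [measurable]: "Z \<in> borel_measurable M" using Z by (simp add: gaussian_def sqint_def)
 have d: "distr M borel Z = distr std_gauss borel (%x. l2 M Z * x)"
  using Z by (simp add: gaussian_def)
 show "(\<integral>w. g (Z w) \<partial>M) = (\<integral>x. g (l2 M Z * x) \<partial>std_gauss)"
  using integral_distr[of Z M borel g] integral_distr[of "%x. l2 M Z * x" std_gauss borel g] d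
  by simp
 show "integrable M (%w. g (Z w)) \<longleftrightarrow> integrable std_gauss (%x. g (l2 M Z * x))"
  using integrable_distr_eq[of Z M borel g] integrable_distr_eq[of "%x. l2 M Z * x" std_gauss borel g] d
  by simp
qed

lemma gaussian_moments:
 assumes Z: "gaussian Z"
 shows "integrable M (%w. Z w ^ m)" and "integrable M (%w. \<bar>Z w\<bar> ^ m)"
proof -
 show *: "integrable M (%w. Z w ^ m)" for m
  using expectation_gaussian(2)[OF Z, of "%x. x ^ m"] integrable_std_normal_distribution_moment[of m]
  by (simp add: power_mult_distrib)
 show "integrable M (%w. \<bar>Z w\<bar> ^ m)"
  using integrable_abs[OF *[of m]] by (simp add: power_abs)
qed

lemma gaussian_mean: "gaussian Z ==> expectation Z = 0"
 using expectation_gaussian(1)[of Z "%x. x"] integral_std_normal_distribution_moment_odd[of 1]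
 by simp

lemma gaussian_fourth_moment: "gaussian Z ==> (\<integral>w. Z w ^ 4 \<partial>M) = 3 * l2 M Z ^ 4"
 using expectation_gaussian(1)[of Z "%x. x ^ 4"] std_normal_distribution_even_moments(1)[of 2]
 by (simp add: power_mult_distrib fact_numeral)

lemma char_distr:
 assumes [measurable]: "Z \<in> borel_measurable M"
 shows "char (distr M borel Z) t = (CLINT w|M. iexp (t * Z w))"
 unfolding char_def by (subst integral_distr) auto

lemma gaussianI_char:
 assumes Z: "sqint M Z" and ch: "!!t. char (distr M borel Z) t = exp (- (t * l2 M Z)\<^sup>2 / 2)"
 shows "gaussian Z"
 unfolding gaussian_def
proof
 have [measurable]: "Z \<in> borel_measurable M" using Z by (simp add: sqint_def)
 interpret N: real_distribution std_gauss by (rule real_dist_normal_dist)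
 have 1: "real_distribution (distr M borel Z)" by (rule real_distribution_distr) auto
 have 2: "real_distribution (distr std_gauss borel (%x. l2 M Z * x))"
  by (rule N.real_distribution_distr) auto
 have "char (distr std_gauss borel (%x. l2 M Z * x)) t = exp (- (t * l2 M Z)\<^sup>2 / 2)" for t
 proof -
  have "char (distr std_gauss borel (%x. l2 M Z * x)) t = (CLINT x|std_gauss. iexp (t * (l2 M Z * x)))"
   by (rule N.char_distr) auto
  also have "\<dots> = char std_gauss (t * l2 M Z)" by (simp add: char_def mult.assoc)
  finally show ?thesis by (simp add: char_std_normal_distribution)
 qed
 thus "distr M borel Z = distr std_gauss borel (%x. l2 M Z * x)"
  using ch by (intro Levy_uniqueness[OF 1 2]) (auto intro!: ext)
qed (fact Z)

lemma gaussian_char: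
 assumes Z: "gaussian Z" shows "char (distr M borel Z) t = exp (- (t * l2 M Z)\<^sup>2 / 2)"
proof -
 interpret N: real_distribution std_gauss by (rule real_dist_normal_dist)
 have "char (distr M borel Z) t = char (distr std_gauss borel (%x. l2 M Z * x)) t"
  using Z by (simp add: gaussian_def)
 also have "\<dots> = (CLINT x|std_gauss. iexp (t * (l2 M Z * x)))"
  by (rule N.char_distr) auto
 also have "\<dots> = char std_gauss (t * l2 M Z)" by (simp add: char_def mult.assoc)
 finally show ?thesis by (simp add: char_std_normal_distribution)
qed

lemma gaussian_expectation_cos_sin:
 assumes Z: "gaussian Z"
 shows "expectation (%w. cos (Z w)) = exp (- (l2 M Z)\<^sup>2 / 2)" "expectation (%w. sin (Z w)) = 0"
proof -
 have [measurable]: "Z \<in> borel_measurable M" using Z by (simp add: gaussian_def sqint_def)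
 have "(CLINT w|M. iexp (1 * Z w)) = exp (- (1 * l2 M Z)\<^sup>2 / 2)"
  using gaussian_char[OF Z, of 1] char_distr[of Z 1] by simp
 hence *: "(CLINT w|M. iexp (Z w)) = complex_of_real (exp (- (l2 M Z)\<^sup>2 / 2))" by simp
 have i: "integrable M (%w. iexp (Z w))"
  by (rule integrable_const_bound[of _ 1]) auto
 have "expectation (%w. Re (iexp (Z w))) = Re (CLINT w|M. iexp (Z w))" by (rule integral_Re[OF i])
 thus "expectation (%w. cos (Z w)) = exp (- (l2 M Z)\<^sup>2 / 2)" unfolding * by (simp add: Re_exp)
 have "expectation (%w. Im (iexp (Z w))) = Im (CLINT w|M. iexp (Z w))" by (rule integral_Im[OF i])
 thus "expectation (%w. sin (Z w)) = 0" unfolding * by (simp add: Im_exp)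
qed

lemma gaussian_null:
 assumes "Z \<in> borel_measurable M" "AE w in M. Z w = 0"
 shows "gaussian Z"
proof (rule gaussianI_char)
 have [measurable]: "Z \<in> borel_measurable M" by fact
 have "integrable M (%w. (Z w)^2)"
  by (subst integrable_cong_AE[of _ _ "%_. 0"]) (use assms in auto)
 thus "sqint M Z" by (simp add: sqint_def)
 have "l2 M Z = l2 M (%_. 0)" by (rule l2_cong_AE) (use assms in auto)
 hence l: "l2 M Z = 0" by simp
 show "char (distr M borel Z) t = exp (- (t * l2 M Z)\<^sup>2 / 2)" for t
 proof -
  have "char (distr M borel Z) t = (CLINT w|M. 1)"
   unfolding char_distr[OF assms(1)] by (rule integral_cong_AE) (use assms in auto)
  thus ?thesis by (simp add: l prob_space)
 qed
qed

lemma gaussian_distributed: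
 assumes s: "\<sigma> > 0" and D: "distributed M lborel Z (normal_density 0 \<sigma>)"
 shows "gaussian Z"
proof -
 have [measurable]: "Z \<in> borel_measurable M" using D by (simp add: distributed_def)
 have D1: "distributed M lborel (%w. Z w / \<sigma>) std_normal_density"
  using D normal_standard_normal_convert[OF s, of Z 0] by simp
 hence "distr M lborel (%w. Z w / \<sigma>) = std_gauss" by (simp add: distributed_def)
 hence d1: "distr M borel (%w. Z w / \<sigma>) = std_gauss"
  by (metis distr_cong sets_lborel)
 have d2: "distr M borel Z = distr std_gauss borel (%x. \<sigma> * x)"
 proof -
  have "distr (distr M borel (%w. Z w / \<sigma>)) borel (%x. \<sigma> * x) = distr M borel ((%x. \<sigma> * x) \<circ> (%w. Z w / \<sigma>))"
   by (rule distr_distr) auto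
  also have "(%x. \<sigma> * x) \<circ> (%w. Z w / \<sigma>) = Z" using s by auto
  finally show ?thesis using d1 by simp
 qed
 have i: "integrable M (%w. (Z w)^2)"
 proof -
  have "integrable std_gauss (%x. (\<sigma> * x)^2)"
   using integrable_std_normal_distribution_moment[of 2] by (simp add: power_mult_distrib)
  hence "integrable (distr std_gauss borel (%x. \<sigma> * x)) (%x. x^2)"
   by (subst integrable_distr_eq) auto
  thus ?thesis unfolding d2[symmetric] by (subst (asm) integrable_distr_eq) auto
 qed
 have "(\<integral>w. (Z w)^2 \<partial>M) = \<sigma>^2"
  using normal_distributed_variance[OF s D] normal_distributed_expectation[OF s D] by simp
 hence "l2 M Z = \<sigma>" using s by (simp add: l2_def)
 with d2 i show ?thesis by (simp add: gaussian_def sqint_def)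
qed

text \<open>The characteristic functions converge to that of the limit, and they depend only on the variances.\<close>

lemma gaussian_l2_limit:
 assumes Z: "!!k. gaussian (Zs k)" and Y: "sqint M Y" and lim: "(%k. l2 M (%x. Zs k x - Y x)) \<longlonglongrightarrow> 0"
 shows "gaussian Y"
proof (rule gaussianI_char[OF Y])
 fix t
 have [measurable]: "Y \<in> borel_measurable M" "Zs k \<in> borel_measurable M" for k
  using Y Z gaussian_sqint by (auto simp: sqint_def)
 have sq: "sqint M (Zs k)" for k using Z gaussian_sqint by auto
 have i: "integrable M (%w. iexp (t * W w))" if [measurable]: "W \<in> borel_measurable M" for W
  by (rule integrable_const_bound[of _ 1]) auto
 have ie: "cmod (iexp a - iexp b) <= \<bar>a - b\<bar>" for a b :: real
 proof -
  have "iexp a - iexp b = iexp b * (iexp (a - b) - 1)"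
   by (simp add: algebra_simps exp_add[symmetric])
  hence "cmod (iexp a - iexp b) = cmod (iexp (a - b) - 1)" by (simp add: norm_mult)
  thus ?thesis using iexp_approx1[of "a - b" 0] by simp
 qed
 have "(%k. char (distr M borel (Zs k)) t) \<longlonglongrightarrow> char (distr M borel Y) t"
 proof (rule LIM_zero_cancel, rule tendsto_0_le[OF lim, where K="\<bar>t\<bar>"], rule always_eventually, rule allI)
  fix k
  have "norm (char (distr M borel (Zs k)) t - char (distr M borel Y) t)
   = norm (CLINT w|M. iexp (t * Zs k w) - iexp (t * Y w))"
   by (subst bochner_diff[OF i i]) (simp_all add: char_distr)
  also have "\<dots> <= expectation (%w. norm (iexp (t * Zs k w) - iexp (t * Y w)))"
   by (rule integral_norm_bound)
  also have "\<dots> <= expectation (%w. \<bar>t\<bar> * \<bar>Zs k w - Y w\<bar>)"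
  proof (rule integral_mono)
   show "integrable M (%w. norm (iexp (t * Zs k w) - iexp (t * Y w)))"
    by (intro integrable_norm Bochner_Integration.integrable_diff i) auto
   show "integrable M (%w. \<bar>t\<bar> * \<bar>Zs k w - Y w\<bar>)"
    using sqint_integrable[OF sqint_diff[OF sq Y]] by auto
   show "norm (iexp (t * Zs k w) - iexp (t * Y w)) <= \<bar>t\<bar> * \<bar>Zs k w - Y w\<bar>" for w
    using ie[of "t * Zs k w" "t * Y w"] by (simp add: abs_mult[symmetric] algebra_simps)
  qed
  also have "\<dots> <= \<bar>t\<bar> * dl2 M (Zs k) Y"
   using expectation_abs_le_l2[OF sqint_diff[OF sq Y], of k] by (auto intro: mult_left_mono)
  finally show "norm (char (distr M borel (Zs k)) t - char (distr M borel Y) t) <= norm (l2 M (%x. Zs k x - Y x)) * \<bar>t\<bar>"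
   by (simp add: mult.commute)
 qed
 moreover have "(%k. char (distr M borel (Zs k)) t) \<longlonglongrightarrow> complex_of_real (exp (- (t * l2 M Y)\<^sup>2 / 2))"
  unfolding gaussian_char[OF Z]
  by (intro tendsto_of_real tendsto_intros l2_tendsto_norm[OF sq Y lim]) auto
 ultimately show "char (distr M borel Y) t = complex_of_real (exp (- (t * l2 M Y)\<^sup>2 / 2))"
  using LIMSEQ_unique by blast
qed

subsection \<open>Random variables with moments of all orders\<close>

definition all_moments :: "('a => real) => bool" where
 "all_moments W \<longleftrightarrow> W \<in> borel_measurable M \<and> (\<forall>m. integrable M (%w. \<bar>W w\<bar> ^ m))"

lemma all_moments_measurable: "all_moments W ==> W \<in> borel_measurable M"
 by (simp add: all_moments_def)

lemma all_moments_integrable: "all_moments W ==> integrable M W"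
proof -
 assume W: "all_moments W"
 hence "integrable M (%w. \<bar>W w\<bar> ^ 1)" unfolding all_moments_def by blast
 with W show ?thesis by (subst integrable_abs_iff[symmetric]) (auto simp: all_moments_def)
qed

lemma all_moments_bound:
 assumes W: "all_moments W" and [measurable]: "V \<in> borel_measurable M" and b: "!!w. w \<in> space M ==> \<bar>V w\<bar> <= \<bar>W w\<bar>"
 shows "all_moments V"
 unfolding all_moments_def
proof safe
 fix m
 have [measurable]: "W \<in> borel_measurable M" using W by (simp add: all_moments_def)
 show "integrable M (%w. \<bar>V w\<bar> ^ m)"
  by (rule bochner_integrable_bound[of M "%w. \<bar>W w\<bar> ^ m"])
   (use W b in \<open>auto simp: all_moments_def power_mono intro!: AE_I2\<close>)
qed fact

lemma all_moments_const: "all_moments (%w. c)"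
 by (simp add: all_moments_def)

lemma all_moments_abs: "all_moments W ==> all_moments (%w. \<bar>W w\<bar>)"
 by (auto simp: all_moments_def)

lemma all_moments_mult:
 assumes V: "all_moments V" and W: "all_moments W" shows "all_moments (%w. V w * W w)"
 unfolding all_moments_def
proof safe
 have [measurable]: "W \<in> borel_measurable M" "V \<in> borel_measurable M" using V W by (auto simp: all_moments_def)
 show "(%w. V w * W w) \<in> borel_measurable M" by measurable
 fix m
 have *: "sqint M (%w. \<bar>V w\<bar> ^ m)" "sqint M (%w. \<bar>W w\<bar> ^ m)"
  using V W by (auto simp: all_moments_def sqint_def power_mult[symmetric])
 show "integrable M (%w. \<bar>V w * W w\<bar> ^ m)"
  using sqint_mult[OF *] by (simp add: abs_mult power_mult_distrib)
qed

lemma all_moments_add: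
 assumes V: "all_moments V" and W: "all_moments W" shows "all_moments (%w. V w + W w)"
 unfolding all_moments_def
proof safe
 have [measurable]: "W \<in> borel_measurable M" "V \<in> borel_measurable M" using V W by (auto simp: all_moments_def)
 show "(%w. V w + W w) \<in> borel_measurable M" by measurable
 fix m
 show "integrable M (%w. \<bar>V w + W w\<bar> ^ m)"
 proof (rule bochner_integrable_bound)
  show "integrable M (%w. 2 ^ m * (\<bar>V w\<bar> ^ m + \<bar>W w\<bar> ^ m))"
   using V W by (auto simp: all_moments_def)
  have "\<bar>a + b\<bar> ^ m <= 2 ^ m * (\<bar>a\<bar> ^ m + \<bar>b\<bar> ^ m)" for a b :: real
  proof -
   have "\<bar>a + b\<bar> ^ m <= (2 * max \<bar>a\<bar> \<bar>b\<bar>) ^ m" by (rule power_mono) auto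
   also have "\<dots> = 2 ^ m * (max \<bar>a\<bar> \<bar>b\<bar>) ^ m" by (simp add: power_mult_distrib)
   also have "\<dots> <= 2 ^ m * (\<bar>a\<bar> ^ m + \<bar>b\<bar> ^ m)" by (intro mult_left_mono) (auto simp: max_def)
   finally show ?thesis .
  qed
  thus "AE w in M. norm (\<bar>V w + W w\<bar> ^ m) <= norm (2 ^ m * (\<bar>V w\<bar> ^ m + \<bar>W w\<bar> ^ m))"
   by (auto intro!: AE_I2)
 qed simp
qed

lemma all_moments_sum: "(!!i. i \<in> I ==> all_moments (f i)) ==> all_moments (%w. \<Sum>i\<in>I. f i w)"
 by (induction I rule: infinite_finite_induct) (auto intro: all_moments_add all_moments_const)

lemma all_moments_power: "all_moments W ==> all_moments (%w. W w ^ n)"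
 by (induction n) (auto intro: all_moments_mult all_moments_const)

lemma all_moments_sqint: "all_moments W ==> sqint M W"
 by (auto simp: all_moments_def sqint_def dest: spec[of _ 2])

lemma gaussian_all_moments: "gaussian Z ==> all_moments Z"
 using gaussian_moments(2) gaussian_sqint by (auto simp: all_moments_def sqint_def)

lemma all_moments_diff: "all_moments V ==> all_moments W ==> all_moments (%w. V w - W w)"
 using all_moments_add[of V "%w. (-1) * W w"] all_moments_mult[OF all_moments_const, of W "-1"] by simp

end

text \<open>A closed linear space of centred Gaussian variables: its members are jointly Gaussian, and limits in
 mean square, such as Wiener integrals and integrals over time, stay in it.\<close>

locale gaussian_space = prob_space M for M :: "'a measure" +
 fixes G :: "('a => real) set"
 assumes gaussian_G: "Z \<in> G ==> gaussian Z"
  and G_zero: "(%w. 0) \<in> G"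
  and G_add: "Z \<in> G ==> W \<in> G ==> (%w. Z w + W w) \<in> G"
  and G_cmult: "Z \<in> G ==> (%w. c * Z w) \<in> G"
  and G_closed: "sqint M Z ==> (!!e. e > 0 ==> \<exists>W\<in>G. dl2 M W Z < e) ==> Z \<in> G"
begin

lemma sqint_G: "Z \<in> G ==> sqint M Z"
 using gaussian_G gaussian_sqint by blast

lemma measurable_G[measurable_dest]: "Z \<in> G ==> Z \<in> borel_measurable M"
 using sqint_G by (auto simp: sqint_def)

lemma all_moments_G: "Z \<in> G ==> all_moments Z"
 using gaussian_G gaussian_all_moments by blast

lemma G_diff: "Z \<in> G ==> W \<in> G ==> (%w. Z w - W w) \<in> G"
 using G_add[of Z "%w. (-1) * W w"] G_cmult[of W "-1"] by simp

lemma G_sum: "(!!i. i \<in> I ==> f i \<in> G) ==> (%w. \<Sum>i\<in>I. f i w) \<in> G"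
 by (induction I rule: infinite_finite_induct) (auto intro: G_add G_zero)

lemma G_limit:
 assumes "!!k::nat. Zs k \<in> G" "sqint M Z" "(%k. dl2 M (Zs k) Z) \<longlonglongrightarrow> 0"
 shows "Z \<in> G"
proof (rule G_closed[OF assms(2)])
 fix e :: real assume "e > 0"
 with assms(3) obtain k where "norm (dl2 M (Zs k) Z - 0) < e"
  by (meson LIMSEQ_iff order_refl)
 thus "\<exists>W\<in>G. dl2 M W Z < e" using assms(1) by auto
qed

lemma G_cong_AE:
 assumes Z: "Z \<in> G" and W: "W \<in> borel_measurable M" and ae: "AE w in M. Z w = W w"
 shows "W \<in> G"
proof (rule G_limit[of "%_. Z"])
 have [measurable]: "Z \<in> borel_measurable M" using Z by measurable
 have "integrable M (%w. (W w)^2)"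
  by (subst integrable_cong_AE[of _ _ "%w. (Z w)^2"])
   (use assms sqint_square[OF sqint_G[OF Z]] in auto)
 thus "sqint M W" using W by (simp add: sqint_def)
 have "dl2 M Z W = l2 M (%w. 0)"
  by (rule l2_cong_AE) (use assms in auto)
 thus "(%k. dl2 M Z W) \<longlonglongrightarrow> 0" by simp
qed (fact Z)

text \<open>The covariance of two squares is obtained by polarisation from the fourth moments of \<open>V + W\<close> and
 \<open>V - W\<close>, which again belong to the Gaussian space.\<close>

lemma gaussian_square_covariance:
 assumes Z: "Z \<in> G" and W: "W \<in> G"
 shows "expectation (%w. ((Z w)^2 - (l2 M Z)^2) * ((W w)^2 - (l2 M W)^2)) = 2 * (ip Z W)^2"
proof -
 define a b r where "a = (l2 M Z)^2" and "b = (l2 M W)^2" and "r = ip Z W"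
 have mZ: "all_moments Z" and mW: "all_moments W" using Z W all_moments_G by auto
 note am = all_moments_integrable all_moments_mult all_moments_power mZ mW all_moments_const
 have i: "integrable M (%w. Z w ^ 4)" "integrable M (%w. W w ^ 4)" "integrable M (%w. (Z w)^2 * (W w)^2)"
  "integrable M (%w. (Z w)^2)" "integrable M (%w. (W w)^2)" "integrable M (%w. Z w * W w)"
  by (auto intro!: am)
 have v1: "(l2 M (%w. Z w + W w))^2 = a + 2 * r + b"
  using i unfolding a_def b_def r_def l2_squared by (simp add: power2_sum mult.assoc)
 have v2: "(dl2 M Z W)^2 = a - 2 * r + b"
  using i unfolding a_def b_def r_def l2_squared by (simp add: power2_diff mult.assoc)
 have p4: "x ^ 4 = (x^2)^2" for x :: real by simp
 have "(\<integral>w. (Z w + W w) ^ 4 \<partial>M) + (\<integral>w. (Z w - W w) ^ 4 \<partial>M)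
  = (\<integral>w. (Z w + W w) ^ 4 + (Z w - W w) ^ 4 \<partial>M)"
  by (rule Bochner_Integration.integral_add[symmetric])
   (auto intro!: all_moments_integrable all_moments_power all_moments_add all_moments_diff mZ mW)
 also have "\<dots> = (\<integral>w. 2 * Z w ^ 4 + 12 * ((Z w)^2 * (W w)^2) + 2 * W w ^ 4 \<partial>M)"
  by (rule bochner_cong) (auto simp: power4_eq_xxxx power2_eq_square algebra_simps)
 also have "\<dots> = 2 * (\<integral>w. Z w ^ 4 \<partial>M) + 12 * (\<integral>w. (Z w)^2 * (W w)^2 \<partial>M) + 2 * (\<integral>w. W w ^ 4 \<partial>M)"
  using i by simp
 finally have "3 * (a + 2 * r + b)^2 + 3 * (a - 2 * r + b)^2 = 6 * a^2 + 12 * (\<integral>w. (Z w)^2 * (W w)^2 \<partial>M) + 6 * b^2"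
  using gaussian_fourth_moment[OF gaussian_G[OF G_add[OF Z W]]] gaussian_fourth_moment[OF gaussian_G[OF G_diff[OF Z W]]]
   gaussian_fourth_moment[OF gaussian_G[OF Z]] gaussian_fourth_moment[OF gaussian_G[OF W]]
  by (simp only: p4 v1 v2 a_def b_def)
 hence e: "(\<integral>w. (Z w)^2 * (W w)^2 \<partial>M) = a * b + 2 * r^2"
  by (simp add: power2_eq_square algebra_simps)
 have "expectation (%w. ((Z w)^2 - a) * ((W w)^2 - b)) = expectation (%w. (Z w)^2 * (W w)^2 - b * (Z w)^2 - a * (W w)^2 + a * b)"
  by (rule bochner_cong) (auto simp: algebra_simps)
 also have "\<dots> = (a * b + 2 * r^2) - b * a - a * b + a * b"
  using i e by (simp add: a_def b_def l2_squared prob_space)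
 finally show ?thesis by (simp add: a_def b_def r_def)
qed

end

section \<open>Fourier uniqueness and independence\<close>

lemma abs_mult_le_1: "\<bar>a\<bar> <= 1 ==> \<bar>b\<bar> <= 1 ==> \<bar>a * b\<bar> <= 1" for a b :: real
 by (simp add: abs_mult mult_le_one)

context prob_space begin

text \<open>If \<open>E[W cos(a + t \<zeta>)]\<close> vanishes for all \<open>a\<close> and \<open>t\<close>, then \<open>W\<close> is uncorrelated with every bounded
 function of \<open>\<zeta>\<close>: the positive and the negative part of \<open>W\<close>, used as densities and pushed forward by \<open>\<zeta>\<close>,
 are two measures with the same characteristic function.\<close>

lemma weighted_char_zero:
 fixes W \<zeta> :: "'a => real"
 assumes W: "integrable M W" and z[measurable]: "\<zeta> \<in> borel_measurable M"
  and c: "!!a t. expectation (%w. W w * cos (a + t * \<zeta> w)) = 0"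
  and A[measurable]: "A \<in> sets borel"
 shows "expectation (%w. W w * indicator A (\<zeta> w)) = 0"
proof -
 have [measurable]: "W \<in> borel_measurable M" using W by auto
 define P N where "P w = max 0 (W w)" and "N w = max 0 (- W w)" for w
 have [measurable]: "P \<in> borel_measurable M" "N \<in> borel_measurable M" unfolding P_def[abs_def] N_def[abs_def] by measurable
 have iP: "integrable M P" and iN: "integrable M N" unfolding P_def N_def using W by auto
 have WPN: "W w = P w - N w" for w by (auto simp: P_def N_def)
 have P0: "P w \<ge> 0" and N0: "N w \<ge> 0" for w by (auto simp: P_def N_def)
 have ib: "integrable M (%w. F w * g (\<zeta> w))"
  if "integrable M F" "!!x. \<bar>g x\<bar> <= 1" and [measurable]: "g \<in> borel_measurable borel" for F and g :: "real => real"
 proof (rule bochner_integrable_bound[OF that(1)])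
  have [measurable]: "F \<in> borel_measurable M" using that(1) by auto
  show "(%w. F w * g (\<zeta> w)) \<in> borel_measurable M" by measurable
  show "AE x in M. norm (F x * g (\<zeta> x)) <= norm (F x)"
   using that(2) by (intro AE_I2) (auto simp: abs_mult mult_left_le)
 qed
 have PN: "expectation (%w. P w * g (\<zeta> w)) = expectation (%w. N w * g (\<zeta> w))"
  if "expectation (%w. W w * g (\<zeta> w)) = 0" "!!x. \<bar>g x\<bar> <= 1" "g \<in> borel_measurable borel" for g :: "real => real"
  using that(1) ib[OF iP that(2,3)] ib[OF iN that(2,3)] by (simp add: WPN left_diff_distrib)
 define k where "k = expectation P"
 have k: "expectation N = k" using PN[of "%_. 1"] c[of 0 0] by (simp add: k_def)
 have k0: "k \<ge> 0" unfolding k_def using P0 by simp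
 show ?thesis
 proof (cases "k = 0")
  case True
  have "AE w in M. P w = 0" using integral_nonneg_eq_0_iff_AE[OF iP] True P0 by (simp add: k_def)
  moreover have "AE w in M. N w = 0" using integral_nonneg_eq_0_iff_AE[OF iN] True N0 by (simp add: k)
  ultimately have "AE w in M. W w * indicator A (\<zeta> w) = 0" by eventually_elim (simp add: WPN)
  thus ?thesis by (rule integral_eq_zero_AE)
 next
  case False
  hence kp: "k > 0" using k0 by simp
  define D where "D F = density M (%w. ennreal (F w / k))" for F :: "'a => real"
  define Q where "Q F = distr (D F) borel \<zeta>" for F :: "'a => real"
  have rd: "real_distribution (Q F)" if F: "integrable M F" "!!w. F w \<ge> 0" "expectation F = k" for F
  proof -
   have [measurable]: "F \<in> borel_measurable M" using F by auto
   have "emeasure (D F) (space (D F)) = (\<integral>\<^sup>+w. ennreal (F w / k) \<partial>M)"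
    unfolding D_def by (simp add: emeasure_density)
   also have "\<dots> = ennreal (expectation (%w. F w / k))"
    by (rule nn_integral_eq_integral) (use F kp in auto)
   also have "\<dots> = 1" using F kp by simp
   finally interpret DF: prob_space "D F" by (rule prob_spaceI)
   show ?thesis unfolding Q_def by (rule DF.real_distribution_distr) (simp add: D_def)
  qed
  have chQ: "(\<integral>x. g x \<partial>Q F) = expectation (%w. F w * g (\<zeta> w)) / k"
   if F: "integrable M F" "!!w. F w \<ge> 0" and g[measurable]: "g \<in> borel_measurable borel" for F and g :: "real => real"
  proof -
   have [measurable]: "F \<in> borel_measurable M" using F by auto
   have "(\<integral>x. g x \<partial>Q F) = (\<integral>w. g (\<zeta> w) \<partial>D F)"
    unfolding Q_def by (rule integral_distr) (auto simp: D_def)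
   also have "\<dots> = (\<integral>w. F w / k * g (\<zeta> w) \<partial>M)"
    unfolding D_def by (rule integral_real_density) (use F kp in auto)
   also have "\<dots> = expectation (%w. F w * g (\<zeta> w)) / k" by simp
   finally show ?thesis .
  qed
  note rP = rd[OF iP P0 k_def[symmetric]] and rN = rd[OF iN N0 k]
  have eq: "(\<integral>x. g x \<partial>Q P) = (\<integral>x. g x \<partial>Q N)"
   if "expectation (%w. W w * g (\<zeta> w)) = 0" "!!x. \<bar>g x\<bar> <= 1" "g \<in> borel_measurable borel" for g :: "real => real"
   using chQ[OF iP P0 that(3)] chQ[OF iN N0 that(3)] PN[OF that] by simp
  have "char (Q P) t = char (Q N) t" for t
  proof -
   have "cos (- (pi / 2) + x) = sin x" for x :: real
    unfolding cos_add cos_minus sin_minus cos_pi_half sin_pi_half by simp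
   note s = c[of "- (pi / 2)" t, unfolded this]
   have re: "char (Q F) t = Complex (\<integral>x. cos (t * x) \<partial>Q F) (\<integral>x. sin (t * x) \<partial>Q F)" if rF: "real_distribution (Q F)" for F
   proof -
    interpret QF: real_distribution "Q F" by fact
    have i: "integrable (Q F) (%x. iexp (t * x))"
     by (rule QF.integrable_const_bound[of _ 1]) auto
    show ?thesis unfolding char_def
    proof (rule complex_eqI)
     show "Re (CLINT x|Q F. iexp (t * x)) = Re (Complex (\<integral>x. cos (t * x) \<partial>Q F) (\<integral>x. sin (t * x) \<partial>Q F))"
      by (subst integral_Re[OF i, symmetric]) (simp add: Re_exp)
     show "Im (CLINT x|Q F. iexp (t * x)) = Im (Complex (\<integral>x. cos (t * x) \<partial>Q F) (\<integral>x. sin (t * x) \<partial>Q F))"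
      by (subst integral_Im[OF i, symmetric]) (simp add: Im_exp)
    qed
   qed
   show ?thesis unfolding re[OF rP] re[OF rN]
    using eq[of "%x. cos (t * x)"] eq[of "%x. sin (t * x)"] c[of 0 t] s by simp
  qed
  hence "Q P = Q N" using rP rN by (intro Levy_uniqueness) auto
  hence "(\<integral>x. indicator A x \<partial>Q P) = (\<integral>x. indicator A x \<partial>Q N :: real)" by simp
  hence "expectation (%w. P w * indicator A (\<zeta> w)) = expectation (%w. N w * indicator A (\<zeta> w))"
   using chQ[OF iP P0, of "indicator A"] chQ[OF iN N0, of "indicator A"] kp by simp
  moreover have "integrable M (%w. P w * indicator A (\<zeta> w))" "integrable M (%w. N w * indicator A (\<zeta> w))"
   by (rule ib; use iP iN in \<open>auto simp: indicator_def\<close>)+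
  ultimately show ?thesis by (simp add: WPN left_diff_distrib)
 qed
qed

text \<open>In several dimensions, the trigonometric factors are exchanged for indicators one variable at
 a time; the sets obtained in this way form a \<open>\<pi>\<close>-system that generates \<open>\<sigma>(\<xi>)\<close>.\<close>

lemma weighted_char_zero_family:
 fixes W :: "'a => real" and \<xi> :: "'i => 'a => real"
 assumes W: "integrable M W" and xi: "!!i. i \<in> I ==> \<xi> i \<in> borel_measurable M"
  and cs: "!!S c a. finite S ==> S \<subseteq> I ==> expectation (%w. W w * cos (a + (\<Sum>i\<in>S. c i * \<xi> i w))) = 0"
  and A: "A \<in> sigma_sets (space M) {\<xi> i -` B \<inter> space M | i B. i \<in> I \<and> B \<in> sets borel}"
 shows "ip W (indicator A) = 0"
proof -
 have [measurable]: "W \<in> borel_measurable M" using W by auto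
 have ib: "integrable M (%w. W w * g w)" if [measurable]: "g \<in> borel_measurable M" and "!!w. \<bar>g w\<bar> <= 1" for g
 proof (rule bochner_integrable_bound[OF W])
  show "AE x in M. norm (W x * g x) <= norm (W x)"
   using that(2) by (intro AE_I2) (auto simp: abs_mult mult_left_le)
 qed simp
 \<comment> \<open>The variables that have not yet been exchanged keep a trigonometric factor with arbitrary phase and frequencies.\<close>
 have box: "expectation (%w. W w * (\<Prod>i\<in>S. indicator (B i) (\<xi> i w)) * cos (a + (\<Sum>i\<in>R. c i * \<xi> i w))) = 0"
  if "finite S" "S \<subseteq> I" "!!i. B i \<in> sets borel" "finite R" "R \<subseteq> I" "R \<inter> S = {}" for S R c B a
  using that
 proof (induction S arbitrary: R c a rule: finite_induct)
  case empty
  thus ?case using cs by simp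
 next
  case (insert j S)
  have [measurable]: "B i \<in> sets borel" for i by (rule insert.prems)
  have jI: "j \<in> I" and SI: "S \<subseteq> I" using insert.prems by auto
  have [measurable]: "\<xi> j \<in> borel_measurable M" by (rule xi[OF jI])
  have [measurable]: "(%w. (\<Prod>i\<in>S. indicator (B i) (\<xi> i w)) :: real) \<in> borel_measurable M"
   using SI xi insert.prems(2) by (intro borel_measurable_prod measurable_compose[OF xi]) auto
  have pb: "\<bar>\<Prod>i\<in>S. indicator (B i) (\<xi> i w)\<bar> <= (1::real)" for w
   unfolding abs_prod by (rule prod_le_1) auto
  have jR: "finite (insert j R)" "insert j R \<subseteq> I" "insert j R \<inter> S = {}"
   using insert by auto
  define V where "V w = W w * (\<Prod>i\<in>S. indicator (B i) (\<xi> i w))" for w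
  define L where "L w = (\<Sum>i\<in>R. c i * \<xi> i w)" for w
  have [measurable]: "L \<in> borel_measurable M"
   unfolding L_def using insert.prems xi by (intro borel_measurable_sum borel_measurable_times) auto
  have [measurable]: "V \<in> borel_measurable M" unfolding V_def by measurable
  have iV: "integrable M (%w. V w * cos (f w))" if [measurable]: "f \<in> borel_measurable M" for f
   unfolding V_def mult.assoc by (rule ib) (auto intro!: abs_mult_le_1 pb)
  have IH: "expectation (%w. V w * cos (a + (t * \<xi> j w + L w))) = 0" for a t
  proof -
   have "(\<Sum>i\<in>insert j R. (c(j := t)) i * \<xi> i w) = t * \<xi> j w + L w" for w
    unfolding L_def using insert by (subst sum.insert) (auto intro!: sum.cong)
   thus ?thesis using insert.IH[OF SI insert.prems(2) jR, of a "c(j := t)"] by (simp add: V_def)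
  qed
  have "expectation (%w. V w * cos (a + L w) * indicator (B j) (\<xi> j w)) = 0"
  proof (rule weighted_char_zero[OF iV])
   fix b t
   have pw: "V w * cos (a + L w) * cos (b + t * \<xi> j w)
     = (V w * cos ((a - b) + (- t * \<xi> j w + L w)) + V w * cos ((a + b) + (t * \<xi> j w + L w))) / 2" for w
    unfolding mult.assoc cos_times_cos by (simp add: algebra_simps)
   show "expectation (%w. V w * cos (a + L w) * cos (b + t * \<xi> j w)) = 0"
    unfolding pw using IH[of "a - b" "- t"] IH[of "a + b" t] iV by simp
  qed auto
  thus ?case using insert.hyps by (simp add: V_def L_def ac_simps)
 qed
 define E where "E = {(\<Inter>i\<in>S. \<xi> i -` B i) \<inter> space M | S B. finite S \<and> S \<subseteq> I \<and> (\<forall>i. B i \<in> sets (borel :: real measure))}"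
 have EM: "X \<in> sets M" if "X \<in> E" for X
 proof -
  from that obtain S B where X: "X = (\<Inter>i\<in>S. \<xi> i -` B i) \<inter> space M" "finite S" "S \<subseteq> I" "!!i. B i \<in> sets (borel :: real measure)"
   unfolding E_def by blast
  have "X = {w\<in>space M. \<forall>i\<in>S. \<xi> i w \<in> B i}" unfolding X by auto
  also have "\<dots> \<in> sets M"
   using X xi by (intro sets.sets_Collect_finite_All' sets.sets_Collect_finite_All)
    (auto simp: vimage_def Int_def conj_commute dest: measurable_sets[OF xi])
  finally show ?thesis .
 qed
 have stable: "Int_stable E"
 proof (rule Int_stableI)
  fix X Y assume "X \<in> E" "Y \<in> E"
  then obtain S B S' B' where X: "X = (\<Inter>i\<in>S. \<xi> i -` B i) \<inter> space M" "finite S" "S \<subseteq> I" "!!i. B i \<in> sets (borel :: real measure)"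
   and Y: "Y = (\<Inter>i\<in>S'. \<xi> i -` B' i) \<inter> space M" "finite S'" "S' \<subseteq> I" "!!i. B' i \<in> sets (borel :: real measure)"
   unfolding E_def by blast
  define C where "C i = {x. (i \<in> S \<longrightarrow> x \<in> B i) \<and> (i \<in> S' \<longrightarrow> x \<in> B' i)}" for i
  have "X \<inter> Y = (\<Inter>i\<in>S \<union> S'. \<xi> i -` C i) \<inter> space M"
   unfolding X Y C_def by auto
  moreover have "C i \<in> sets borel" for i
  proof -
   have "C i = (if i \<in> S then B i else UNIV) \<inter> (if i \<in> S' then B' i else UNIV)" by (auto simp: C_def)
   also have "\<dots> \<in> sets borel" using X Y by auto
   finally show ?thesis .
  qed
  ultimately show "X \<inter> Y \<in> E"
   unfolding E_def using X(2,3) Y(2,3) by (intro CollectI exI[of _ "S \<union> S'"] exI[of _ C]) auto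
 qed
 have gen: "sigma_sets (space M) {\<xi> i -` B \<inter> space M | i B. i \<in> I \<and> B \<in> sets borel} \<subseteq> sigma_sets (space M) E"
 proof (rule sigma_sets_mono, safe)
  fix i B assume i: "i \<in> I" "B \<in> sets (borel :: real measure)"
  have "\<xi> i -` B \<inter> space M = (\<Inter>i\<in>{i}. \<xi> i -` B) \<inter> space M" by simp
  moreover have "(\<Inter>i\<in>{i}. \<xi> i -` (%_. B) i) \<inter> space M \<in> E"
   unfolding E_def using i by (intro CollectI exI[of _ "{i}"] exI[of _ "%_. B"]) auto
  ultimately show "\<xi> i -` B \<inter> space M \<in> sigma_sets (space M) E" by auto
 qed
 have ES: "E \<subseteq> Pow (space M)" using EM sets.sets_into_space by blast
 have SM: "X \<in> sets M" if "X \<in> sigma_sets (space M) E" for X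
  using that EM sets.sigma_sets_subset[of E M] by auto
 have W0: "expectation W = 0" using cs[of "{}" 0] by simp
 from A gen have "A \<in> sigma_sets (space M) E" by auto
 from stable ES this show ?thesis
 proof (induction rule: sigma_sets_induct_disjoint)
  case (basic X)
  then obtain S B where X: "X = (\<Inter>i\<in>S. \<xi> i -` B i) \<inter> space M" "finite S" "S \<subseteq> I" "!!i. B i \<in> sets (borel :: real measure)"
   unfolding E_def by blast
  have "(\<Prod>i\<in>S. indicator (B i) (\<xi> i w) :: real) = indicator X w" if "w \<in> space M" for w
  proof (cases "\<forall>i\<in>S. \<xi> i w \<in> B i")
   case True thus ?thesis using that X by (auto simp: indicator_def)
  next
   case False
   then obtain i where "i \<in> S" "\<xi> i w \<notin> B i" by auto
   hence "(\<Prod>i\<in>S. indicator (B i) (\<xi> i w) :: real) = 0" using X by (intro prod_zero bexI[of _ i]) auto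
   moreover have "w \<notin> X" using False X by auto
   ultimately show ?thesis by simp
  qed
  hence "ip W (indicator X) = expectation (%w. W w * (\<Prod>i\<in>S. indicator (B i) (\<xi> i w)))"
   by (intro bochner_cong) auto
  thus ?case using box[OF X(2,3,4), of "{}" _ 0] by simp
 next
  case empty
  show ?case by simp
 next
  case (compl X)
  have [measurable]: "X \<in> sets M" using compl SM by auto
  have "ip W (indicator (space M - X)) = expectation (%w. W w - W w * indicator X w)"
   by (rule bochner_cong) (auto simp: indicator_def)
  also have "\<dots> = 0"
   using W ib[of "indicator X"] compl W0 by (subst bochner_diff) auto
  finally show ?case .
 next
  case (union X)
  have [measurable]: "X i \<in> sets M" for i using union SM by auto
  have i: "set_integrable M (\<Union>i. X i) W"
   unfolding set_integrable_def using ib[of "indicator (\<Union>i. X i)"] by (simp add: mult.commute)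
  have "(\<integral>w\<in>(\<Union>i. X i). W w \<partial>M) = suminf (%i. \<integral>w\<in>X i. W w \<partial>M)"
   by (rule lebesgue_integral_countable_add[OF _ _ i]) (use union in \<open>auto simp: disjoint_family_on_def\<close>)
  also have "\<dots> = 0" using union by (simp add: set_lebesgue_integral_def mult.commute)
  finally show ?case by (simp add: set_lebesgue_integral_def mult.commute)
 qed
qed

end

context gaussian_space begin

text \<open>For trigonometric test functions the expectation of the product factorises, because the variances
 of \<open>z + L\<close> and \<open>z - L\<close> are both the sum of the variances when \<open>z\<close> and \<open>L\<close> are uncorrelated; Fourier
 uniqueness extends this to events.\<close>

lemma uncorrelated_product_law:
 assumes zeta: "\<zeta> \<in> G" and eta: "!!i. i < k ==> \<eta> i \<in> G"
  and unc: "!!i. i < k ==> ip (\<eta> i) \<zeta> = 0"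
  and A: "A \<in> sigma_sets (space M) {\<eta> i -` B \<inter> space M | i B. i \<in> {..<k} \<and> B \<in> sets borel}"
  and B[measurable]: "B \<in> sets borel"
 shows "expectation (%w. indicat_real A w * indicat_real B (\<zeta> w)) = expectation (indicat_real A) * expectation (%w. indicat_real B (\<zeta> w))"
proof -
 have zm[measurable]: "\<zeta> \<in> borel_measurable M" using zeta by measurable
 have em: "\<eta> i \<in> borel_measurable M" if "i \<in> {..<k}" for i using eta that measurable_G by auto
 have bi: "integrable M f" if "f \<in> borel_measurable M" "!!w. \<bar>f w\<bar> <= 1" for f :: "'a => real"
  by (rule integrable_const_bound[of _ 1]) (use that in auto)
 have AM[measurable]: "A \<in> sets M"
 proof -
  have "{\<eta> i -` B \<inter> space M | i B. i \<in> {..<k} \<and> B \<in> sets borel} \<subseteq> sets M" using em measurable_sets by blast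
  thus ?thesis using A sets.sigma_sets_subset by blast
 qed
 have ib: "integrable M (%w. f w * g w)"
  if "f \<in> borel_measurable M" "g \<in> borel_measurable M" "!!x. \<bar>f x\<bar> <= 1" "!!x. \<bar>g x\<bar> <= 1" for f g :: "'a => real"
  using that by (auto intro!: bi abs_mult_le_1)
 have shift: "expectation (%w. cos (a + Z w)) = cos a * exp (- (l2 M Z)\<^sup>2 / 2)" if Z: "Z \<in> G" for Z a
 proof -
  have [measurable]: "Z \<in> borel_measurable M" using Z by measurable
  have "integrable M (%w. cos (Z w))" "integrable M (%w. sin (Z w))" by (auto intro!: bi)
  thus ?thesis unfolding cos_add using gaussian_expectation_cos_sin[OF gaussian_G[OF Z]] by simp
 qed
 have cA: "expectation (%w. (cos (b + t * \<zeta> w) - expectation (%w. cos (b + t * \<zeta> w))) * indicator A w) = 0" for b t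
 proof (rule weighted_char_zero_family[OF _ em _ A])
  define z where "z w = t * \<zeta> w" for w
  have tz: "z \<in> G" unfolding z_def using zeta by (rule G_cmult)
  show "integrable M (%w. cos (b + t * \<zeta> w) - expectation (%w. cos (b + t * \<zeta> w)))"
   by (auto intro!: bi Bochner_Integration.integrable_diff)
  fix S c a assume S: "finite S" "S \<subseteq> {..<k}"
  define L where "L w = (\<Sum>i\<in>S. c i * \<eta> i w)" for w
  have LG: "L \<in> G" unfolding L_def using S eta by (intro G_sum G_cmult) auto
  have [measurable]: "L \<in> borel_measurable M" "z \<in> borel_measurable M" using LG tz by measurable
  have "ip z L = expectation (%w. \<Sum>i\<in>S. t * c i * (\<eta> i w * \<zeta> w))"
   unfolding L_def z_def by (rule bochner_cong) (auto simp: sum_distrib_left ac_simps)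
  also have "\<dots> = (\<Sum>i\<in>S. expectation (%w. t * c i * (\<eta> i w * \<zeta> w)))"
   by (rule bochner_sum) (use S eta zeta sqint_G in \<open>auto intro!: sqint_mult integrable_mult_right\<close>)
  also have "\<dots> = 0" using unc S by (auto intro!: sum.neutral)
  finally have r: "ip z L = 0" .
  have sq: "sqint M z" "sqint M L" using tz LG sqint_G by auto
  have var: "(l2 M (%w. z w + L w))^2 = (l2 M z)^2 + (l2 M L)^2" "(l2 M (%w. z w - L w))^2 = (l2 M z)^2 + (l2 M L)^2"
   unfolding l2_squared power2_sum power2_diff
   using sqint_square[OF sq(1)] sqint_square[OF sq(2)] sqint_mult[OF sq] r by (simp_all add: mult.assoc)
  have i: "integrable M (%w. cos (x + (z w - L w)))" "integrable M (%w. cos (x + (z w + L w)))" "integrable M (%w. cos (a + L w))" for x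
   by (auto intro!: bi)
  have pw: "cos (b + z w) * cos (a + L w) = (cos ((b - a) + (z w - L w)) + cos ((b + a) + (z w + L w))) / 2" for w
   unfolding cos_times_cos by (simp add: algebra_simps)
  have "expectation (%w. cos (b + z w) * cos (a + L w)) = (cos (b - a) + cos (b + a)) / 2 * exp (- ((l2 M z)^2 + (l2 M L)^2) / 2)"
   unfolding pw using i by (simp add: shift[OF G_diff[OF tz LG]] shift[OF G_add[OF tz LG]] var distrib_right)
  also have "\<dots> = expectation (%w. cos (b + z w)) * expectation (%w. cos (a + L w))"
   unfolding shift[OF tz] shift[OF LG] cos_times_cos[symmetric] by (simp add: exp_add[symmetric] add_divide_distrib diff_divide_distrib)
  finally have "expectation (%w. (cos (b + z w) - expectation (%w. cos (b + z w))) * cos (a + L w)) = 0"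
   using i(3) by (simp add: left_diff_distrib ib)
  thus "expectation (%w. (cos (b + t * \<zeta> w) - expectation (%w. cos (b + t * \<zeta> w))) * cos (a + (\<Sum>i\<in>S. c i * \<eta> i w))) = 0"
   by (simp only: z_def L_def)
 qed
 define p where "p = expectation (indicat_real A)"
 have split: "expectation (%w. (indicat_real A w - p) * g w) = expectation (%w. indicat_real A w * g w) - p * expectation g"
  if "g \<in> borel_measurable M" "!!x. \<bar>g x\<bar> <= 1" for g
  using ib[OF _ that(1) _ that(2), of "indicat_real A"] bi[OF that] by (simp add: left_diff_distrib)
 have "expectation (%w. (indicat_real A w - p) * indicat_real B (\<zeta> w)) = 0"
 proof (rule weighted_char_zero)
  show "integrable M (%w. indicat_real A w - p)" by (auto intro!: bi Bochner_Integration.integrable_diff)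
  fix b t
  have "integrable M (%w. cos (b + t * \<zeta> w) * indicat_real A w)" "integrable M (indicat_real A)"
   by (rule ib bi; auto)+
  hence "expectation (%w. cos (b + t * \<zeta> w) * indicat_real A w) = expectation (%w. cos (b + t * \<zeta> w)) * p"
   using cA[of b t] by (simp add: left_diff_distrib p_def)
  thus "expectation (%w. (indicat_real A w - p) * cos (b + t * \<zeta> w)) = 0"
   by (subst split) (simp_all add: mult.commute)
 qed auto
 thus ?thesis by (subst (asm) split) (auto simp: p_def indicator_def)
qed

end

section \<open>Gaussian integration by parts\<close>

lemma polynomial_growth_integrable_std_normal:
 fixes g :: "real => real"
 assumes [measurable]: "g \<in> borel_measurable borel" and b: "!!x. \<bar>g x\<bar> <= C * (1 + \<bar>x\<bar>) ^ m"
 shows "integrable std_gauss g"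
proof (rule bochner_integrable_bound)
 show "integrable std_gauss (%x. C * (2 ^ m * (1 + \<bar>x ^ m\<bar>)))"
 proof -
  interpret N: real_distribution std_gauss by (rule real_dist_normal_dist)
  show ?thesis using integrable_std_normal_distribution_moment[of m] by auto
 qed
 have C: "C \<ge> 0" using b[of 0] by simp
 have "(1 + \<bar>x\<bar>) ^ m <= 2 ^ m * (1 + \<bar>x ^ m\<bar>)" for x :: real
 proof -
  have "(1 + \<bar>x\<bar>) ^ m <= (2 * max 1 \<bar>x\<bar>) ^ m" by (rule power_mono) auto
  also have "\<dots> = 2 ^ m * (max 1 \<bar>x\<bar>) ^ m" by (simp add: power_mult_distrib)
  also have "\<dots> <= 2 ^ m * (1 + \<bar>x ^ m\<bar>)" by (intro mult_left_mono) (auto simp: max_def power_abs)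
  finally show ?thesis .
 qed
 hence "\<bar>g x\<bar> <= C * (2 ^ m * (1 + \<bar>x ^ m\<bar>))" for x
  using b[of x] C by (meson mult_left_mono order_trans)
 thus "AE x in std_gauss. norm (g x) <= norm (C * (2 ^ m * (1 + \<bar>x ^ m\<bar>)))"
  by (intro always_eventually allI) (metis abs_ge_self order_trans real_norm_def)
qed simp

lemma std_normal_polynomial_tail:
 assumes F: "filterlim (%x::real. \<bar>x\<bar>) at_top F"
 shows "((%x. (1 + \<bar>x\<bar>) ^ m * std_normal_density x) \<longlongrightarrow> 0) F"
\<comment> \<open>The factor comes from \<open>- x\<^sup>2 / 2 <= 3/2 - (1 + \<bar>x\<bar>)\<close>.\<close>
proof (rule tendsto_0_le[where K="exp (3/2)"])
 have "filterlim (%x::real. 1 + \<bar>x\<bar>) at_top F"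
  using filterlim_tendsto_add_at_top[OF tendsto_const F] by simp
 from filterlim_compose[OF tendsto_power_div_exp_0 this]
 show "((%x. (1 + \<bar>x\<bar>) ^ m / exp (1 + \<bar>x\<bar>)) \<longlongrightarrow> 0) F" .
 show "\<forall>\<^sub>F x in F. norm ((1 + \<bar>x\<bar>) ^ m * std_normal_density x) <= norm ((1 + \<bar>x\<bar>) ^ m / exp (1 + \<bar>x\<bar>)) * exp (3/2)"
 proof (rule always_eventually, rule allI)
  fix x :: real
  have "0 <= (\<bar>x\<bar> - 1)^2" by simp
  hence "- x\<^sup>2 / 2 <= 3/2 - (1 + \<bar>x\<bar>)" by (simp add: power2_diff)
  hence "exp (- x\<^sup>2 / 2) <= exp (3/2 - (1 + \<bar>x\<bar>))" by simp
  moreover have "1 / sqrt (2 * pi) <= 1" using pi_gt3 by (simp add: real_le_rsqrt)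
  ultimately have "std_normal_density x <= 1 * exp (3/2 - (1 + \<bar>x\<bar>))"
   unfolding std_normal_density_def by (intro mult_mono) auto
  hence "(1 + \<bar>x\<bar>) ^ m * std_normal_density x <= (1 + \<bar>x\<bar>) ^ m * exp (3/2 - (1 + \<bar>x\<bar>))"
   by (intro mult_left_mono) auto
  thus "norm ((1 + \<bar>x\<bar>) ^ m * std_normal_density x) <= norm ((1 + \<bar>x\<bar>) ^ m / exp (1 + \<bar>x\<bar>)) * exp (3/2)"
   unfolding exp_diff by (simp add: abs_mult)
 qed
qed

text \<open>The integrand \<open>(g'(x) - x g(x)) \<rho>(x)\<close>, with \<open>\<rho>\<close> the standard normal density, is the derivative
 of \<open>g \<rho>\<close>, which vanishes at infinity.\<close>

lemma stein_identity:
 fixes g :: "real => real"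
 assumes d: "!!x. (g has_real_derivative g' x) (at x)" and c: "continuous_on UNIV g'"
  and b: "!!x. \<bar>g x\<bar> <= C * (1 + \<bar>x\<bar>) ^ m" and b': "!!x. \<bar>g' x\<bar> <= C' * (1 + \<bar>x\<bar>) ^ m'"
 shows "(\<integral>x. g x * x \<partial>std_gauss) = (\<integral>x. g' x \<partial>std_gauss)"
proof -
 have cg: "continuous_on UNIV g" using d by (meson DERIV_continuous_on has_field_derivative_at_within)
 have [measurable]: "g \<in> borel_measurable borel" "g' \<in> borel_measurable borel"
  using c cg by (auto intro: borel_measurable_continuous_onI)
 have C: "C \<ge> 0" using b[of 0] by simp
 have bx: "\<bar>g x * x\<bar> <= C * (1 + \<bar>x\<bar>) ^ Suc m" for x
 proof -
  have "\<bar>g x * x\<bar> <= (C * (1 + \<bar>x\<bar>) ^ m) * (1 + \<bar>x\<bar>)" unfolding abs_mult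
   using b[of x] C by (intro mult_mono) auto
  thus ?thesis by (simp add: ac_simps)
 qed
 have i1: "integrable std_gauss g'" "integrable std_gauss (%x. g x * x)"
  by (rule polynomial_growth_integrable_std_normal[OF _ b'], simp)
   (rule polynomial_growth_integrable_std_normal[OF _ bx], simp)
 have i: "integrable lborel (%x. std_normal_density x * g' x)" "integrable lborel (%x. std_normal_density x * (g x * x))"
  using i1 by (simp_all add: integrable_density)
 define f where "f x = std_normal_density x * g' x - std_normal_density x * (g x * x)" for x
 define F where "F x = std_normal_density x * g x" for x
 have "(LBINT x=-\<infinity>..\<infinity>. f x) = 0 - 0"
 proof (rule interval_integral_FTC_integrable)
  fix x
  have "((%x. c * exp (- x\<^sup>2 / 2)) has_real_derivative - x * (c * exp (- x\<^sup>2 / 2))) (at x)" for c :: real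
   by (auto intro!: derivative_eq_intros)
  hence "(std_normal_density has_real_derivative - x * std_normal_density x) (at x)"
   unfolding std_normal_density_def[abs_def] .
  hence "(F has_real_derivative f x) (at x)"
   unfolding F_def[abs_def] f_def using d[of x] by (auto intro!: derivative_eq_intros simp: algebra_simps)
  thus "(F has_vector_derivative f x) (at x)" by (simp add: real_vector_derivative)
  have "continuous_on UNIV f" unfolding f_def std_normal_density_def using c cg by (intro continuous_intros) auto
  thus "isCont f x" by (simp add: continuous_on_eq_continuous_at)
 next
  show "set_integrable lborel (einterval (-\<infinity>) \<infinity>) f"
   using i by (simp add: set_integrable_def f_def[abs_def])
  have lim: "(F \<longlongrightarrow> 0) Fl" if "filterlim (%x::real. \<bar>x\<bar>) at_top Fl" for Fl
  proof (rule tendsto_0_le[OF std_normal_polynomial_tail[OF that, of m], where K=C], rule always_eventually, rule allI)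
   fix x
   have "norm (F x) = std_normal_density x * \<bar>g x\<bar>" by (simp add: F_def abs_mult)
   also have "\<dots> <= std_normal_density x * (C * (1 + \<bar>x\<bar>) ^ m)" by (intro mult_left_mono b) auto
   finally show "norm (F x) <= norm ((1 + \<bar>x\<bar>) ^ m * std_normal_density x) * C" by (simp add: abs_mult ac_simps)
  qed
  show "((F \<circ> real_of_ereal) \<longlongrightarrow> 0) (at_right (-\<infinity>))" unfolding ereal_tendsto_simps1
   by (rule lim) (rule filterlim_at_bot_mirror[THEN iffD2], simp add: filterlim_abs_real)
  show "((F \<circ> real_of_ereal) \<longlongrightarrow> 0) (at_left \<infinity>)" unfolding ereal_tendsto_simps1
   by (rule lim) (rule filterlim_abs_real)
 qed simp
 hence "(\<integral>x. f x \<partial>lborel) = 0"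
  by (simp add: interval_lebesgue_integral_def set_lebesgue_integral_def)
 hence "(\<integral>x. std_normal_density x * g' x \<partial>lborel) = (\<integral>x. std_normal_density x * (g x * x) \<partial>lborel)"
  unfolding f_def using i by simp
 thus ?thesis by (simp add: integral_density)
qed

subsection \<open>Functions of finitely many variables with continuous partial derivatives\<close>

text \<open>Only first derivatives enter the integration by parts formula; asking for no more keeps products with
 a further variable easy to handle.\<close>

definition C1_growth :: "nat => ((nat => real) => real) => bool" where
 "C1_growth k f \<longleftrightarrow> (\<forall>x y. (\<forall>i<k. x i = y i) \<longrightarrow> f x = f y) \<and> continuous_on UNIV f \<and>
  (\<forall>i<k. continuous_on UNIV (partial_deriv i f) \<and> (\<forall>x. (%y. f (x(i := y))) differentiable at (x i))) \<and>
  (\<exists>C m. \<forall>x. \<bar>f x\<bar> <= C * (1 + (\<Sum>i<k. \<bar>x i\<bar>)) ^ m) \<and>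
  (\<forall>i<k. \<exists>C m. \<forall>x. \<bar>partial_deriv i f x\<bar> <= C * (1 + (\<Sum>i<k. \<bar>x i\<bar>)) ^ m)"

lemma partial_deriv_cong:
 assumes f: "!!x y. (\<forall>i<k. x i = y i) ==> f x = f y" and xy: "\<forall>i<k. x i = y i" and i: "i < k"
 shows "partial_deriv i f x = partial_deriv i f y"
proof -
 have "(%u. f (x(i := u))) = (%u. f (y(i := u)))" by (rule ext, rule f) (use xy in auto)
 thus ?thesis using xy i by (simp add: partial_deriv_def)
qed

text \<open>Moving from \<open>y + c z\<close> to \<open>y + c (z + h)\<close> one coordinate at a time turns the increment into a sum of
 one-dimensional increments, to which the mean value theorem and the continuity of the partial
 derivatives apply.\<close>

lemma C1_growth_chain_rule:
 assumes f: "C1_growth k f"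
 shows "((%z. f (%i. y i + c i * z)) has_real_derivative (\<Sum>j<k. c j * partial_deriv j f (%i. y i + c i * z))) (at z)"
proof -
 have dep: "!!x y. (\<forall>i<k. x i = y i) ==> f x = f y" using f unfolding C1_growth_def by blast
 have cont: "!!i. i < k ==> continuous_on UNIV (partial_deriv i f)"
  and diff: "!!i x. i < k ==> (%y. f (x(i := y))) differentiable at (x i)" using f unfolding C1_growth_def by blast+
 define p where "p h j = (%i. y i + c i * (z + (if i < j then h else 0)))" for h :: real and j :: nat
 have step: "\<exists>s. (\<forall>i. s i \<in> {0..1}) \<and> f (p h (Suc j)) - f (p h j) = h * (c j * partial_deriv j f (%i. y i + c i * (z + h * s i)))"
  if j: "j < k" for h j
 proof -
  define \<psi> where "\<psi> u = f ((p h j)(j := y j + c j * u))" for u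
  have der: "(\<psi> has_real_derivative c j * partial_deriv j f ((p h j)(j := y j + c j * u))) (at u)" for u
  proof -
   let ?x = "(p h j)(j := y j + c j * u)"
   have "((%v. f (?x(j := v))) has_real_derivative partial_deriv j f ?x) (at (?x j))"
    unfolding partial_deriv_def using diff[OF j, of ?x] by (simp add: DERIV_deriv_iff_real_differentiable)
   hence "((%v. f ((p h j)(j := v))) has_real_derivative partial_deriv j f ?x) (at (y j + c j * u))" by simp
   moreover have "((%u. y j + c j * u) has_real_derivative c j) (at u)" by (auto intro!: derivative_eq_intros)
   ultimately have "((%v. f ((p h j)(j := v))) \<circ> (%u. y j + c j * u) has_real_derivative partial_deriv j f ?x * c j) (at u)"
    by (rule DERIV_chain)
   thus ?thesis by (simp add: \<psi>_def[abs_def] o_def mult.commute)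
  qed
  have e1: "\<psi> (z + h) = f (p h (Suc j))" unfolding \<psi>_def p_def by (rule arg_cong[of _ _ f]) auto
  have e0: "\<psi> z = f (p h j)" unfolding \<psi>_def p_def by (rule arg_cong[of _ _ f]) auto
  have "\<exists>t\<in>{0..1}. \<psi> (z + h) - \<psi> z = h * (c j * partial_deriv j f ((p h j)(j := y j + c j * (z + h * t))))"
  proof (cases "h = 0")
   case True thus ?thesis by (auto intro: bexI[of _ 0])
  next
   case False
   define w where "w t = \<psi> (z + h * t)" for t
   have "(w has_real_derivative (c j * partial_deriv j f ((p h j)(j := y j + c j * (z + h * t)))) * h) (at t)" for t
   proof -
    have "((%t. z + h * t) has_real_derivative h) (at t)" by (auto intro!: derivative_eq_intros)
    from DERIV_chain[OF der this] show ?thesis by (simp add: w_def[abs_def] o_def)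
   qed
   from MVT2[of 0 1 w, OF _ this] obtain t where "0 < t" "t < 1"
    "w 1 - w 0 = (1 - 0) * ((c j * partial_deriv j f ((p h j)(j := y j + c j * (z + h * t)))) * h)" by auto
   thus ?thesis by (intro bexI[of _ t]) (auto simp: w_def)
  qed
  then obtain t where t: "t \<in> {0..1}" "\<psi> (z + h) - \<psi> z = h * (c j * partial_deriv j f ((p h j)(j := y j + c j * (z + h * t))))" by blast
  define s where "s i = (if i = j then t else if i < j then 1 else 0)" for i
  have "(p h j)(j := y j + c j * (z + h * t)) = (%i. y i + c i * (z + h * s i))"
   by (auto simp: p_def s_def)
  thus ?thesis using t e0 e1 by (intro exI[of _ s]) (auto simp: s_def)
 qed
 define s where "s h j = (SOME s. (\<forall>i. s i \<in> {0..1}) \<and> f (p h (Suc j)) - f (p h j) = h * (c j * partial_deriv j f (%i. y i + c i * (z + h * s i))))" for h j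
 have s: "s h j i \<in> {0..1}" and sd: "f (p h (Suc j)) - f (p h j) = h * (c j * partial_deriv j f (%i. y i + c i * (z + h * s h j i)))"
  if "j < k" for h j i
  using someI_ex[OF step[OF that, of h], folded s_def] by auto
 define q where "q h j = (%i. y i + c i * (z + h * s h j i))" for h j
 have quot: "(f (%i. y i + c i * (z + h)) - f (%i. y i + c i * z)) / h = (\<Sum>j<k. c j * partial_deriv j f (q h j))" if "h \<noteq> 0" for h
 proof -
  have "f (%i. y i + c i * (z + h)) = f (p h k)" by (rule dep) (auto simp: p_def)
  moreover have "f (%i. y i + c i * z) = f (p h 0)" by (rule dep) (auto simp: p_def)
  moreover have "(\<Sum>j<k. f (p h (Suc j)) - f (p h j)) = f (p h k) - f (p h 0)" by (rule sum_lessThan_telescope)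
  moreover have "(\<Sum>j<k. f (p h (Suc j)) - f (p h j)) = (\<Sum>j<k. h * (c j * partial_deriv j f (q h j)))"
   by (rule sum.cong) (auto simp: sd q_def)
  ultimately have "f (%i. y i + c i * (z + h)) - f (%i. y i + c i * z) = h * (\<Sum>j<k. c j * partial_deriv j f (q h j))"
   by (simp add: sum_distrib_left)
  thus ?thesis using that by simp
 qed
 have "((%h. \<Sum>j<k. c j * partial_deriv j f (q h j)) \<longlongrightarrow> (\<Sum>j<k. c j * partial_deriv j f (%i. y i + c i * z))) (at 0)"
 proof (intro tendsto_sum tendsto_mult tendsto_const)
  fix j assume "j \<in> {..<k}"
  hence j: "j < k" by simp
  have "((%h. q h j) \<longlongrightarrow> (%i. y i + c i * z)) (at 0)"
  proof -
   have "limitin (product_topology (%i::nat. euclidean :: real topology) UNIV) (%h. q h j) (%i. y i + c i * z) (at 0)"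
    unfolding limitin_componentwise
   proof (intro conjI ballI)
    fix i
    have hs: "((%h. h * s h j i) \<longlongrightarrow> 0) (at 0)"
     by (rule tendsto_0_le[OF tendsto_ident_at, where K=1])
      (use s[OF j] in \<open>auto intro!: always_eventually simp: abs_mult mult_left_le\<close>)
    have "((%h. q h j i) \<longlongrightarrow> y i + c i * (z + 0)) (at 0)"
     unfolding q_def by (intro tendsto_intros hs)
    thus "limitin euclidean (%h. q h j i) (y i + c i * z) (at 0)" by simp
   qed auto
   thus ?thesis by (simp add: euclidean_product_topology)
  qed
  moreover have "isCont (partial_deriv j f) (%i. y i + c i * z)"
   using cont[OF j] by (simp add: continuous_on_eq_continuous_at)
  ultimately show "((%h. partial_deriv j f (q h j)) \<longlongrightarrow> partial_deriv j f (%i. y i + c i * z)) (at 0)"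
   by (rule isCont_tendsto_compose[rotated])
 qed
 hence "((%h. (f (%i. y i + c i * (z + h)) - f (%i. y i + c i * z)) / h) \<longlongrightarrow> (\<Sum>j<k. c j * partial_deriv j f (%i. y i + c i * z))) (at 0)"
  by (rule Lim_transform_eventually) (auto simp: eventually_at_filter quot)
 thus ?thesis by (simp add: DERIV_def)
qed

lemma growth_along_line:
 fixes f :: "(nat => real) => real"
 assumes b: "!!x. \<bar>f x\<bar> <= C * (1 + (\<Sum>i<k. \<bar>x i\<bar>)) ^ m"
 shows "\<bar>f (%i. y i + c i * z)\<bar> <= C * (1 + (\<Sum>i<k. \<bar>y i\<bar> + \<bar>c i\<bar>)) ^ m * (1 + \<bar>z\<bar>) ^ m"
proof -
 have C: "C \<ge> 0" using b[of "%_. 0"] by simp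
 define A where "A = (\<Sum>i<k. \<bar>y i\<bar> + \<bar>c i\<bar>)"
 have A: "A \<ge> 0" unfolding A_def by (intro sum_nonneg) auto
 have "(\<Sum>i<k. \<bar>y i + c i * z\<bar>) <= (\<Sum>i<k. (\<bar>y i\<bar> + \<bar>c i\<bar>) * (1 + \<bar>z\<bar>))"
 proof (rule sum_mono)
  fix i
  have "\<bar>y i + c i * z\<bar> <= \<bar>y i\<bar> + \<bar>c i\<bar> * \<bar>z\<bar>" by (simp add: abs_mult[symmetric])
  also have "\<dots> <= (\<bar>y i\<bar> + \<bar>c i\<bar>) * (1 + \<bar>z\<bar>)" by (simp add: algebra_simps)
  finally show "\<bar>y i + c i * z\<bar> <= (\<bar>y i\<bar> + \<bar>c i\<bar>) * (1 + \<bar>z\<bar>)" .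
 qed
 hence "(\<Sum>i<k. \<bar>y i + c i * z\<bar>) <= A * (1 + \<bar>z\<bar>)"
  by (simp only: A_def sum_distrib_right)
 hence "1 + (\<Sum>i<k. \<bar>y i + c i * z\<bar>) <= (1 + A) * (1 + \<bar>z\<bar>)"
  by (simp add: distrib_right)
 hence "(1 + (\<Sum>i<k. \<bar>y i + c i * z\<bar>)) ^ m <= ((1 + A) * (1 + \<bar>z\<bar>)) ^ m"
  by (intro power_mono) (auto intro!: add_nonneg_nonneg sum_nonneg)
 hence "C * (1 + (\<Sum>i<k. \<bar>y i + c i * z\<bar>)) ^ m <= C * ((1 + A) * (1 + \<bar>z\<bar>)) ^ m"
  using C by (rule mult_left_mono)
 thus ?thesis using b[of "%i. y i + c i * z"] by (simp add: A_def power_mult_distrib mult.assoc)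
qed

context prob_space begin

lemma all_moments_growth:
 fixes f :: "(nat => real) => real"
 assumes b: "!!x. \<bar>f x\<bar> <= C * (1 + (\<Sum>i<k. \<bar>x i\<bar>)) ^ m" and c: "continuous_on UNIV f"
  and dep: "!!x y. (\<forall>i<k. x i = y i) ==> f x = f y"
  and xi: "!!i. i < k ==> all_moments (\<xi> i)"
 shows "all_moments (%w. f (%i. \<xi> i w))"
proof (rule all_moments_bound)
 show "all_moments (%w. C * (1 + (\<Sum>i<k. \<bar>\<xi> i w\<bar>)) ^ m)"
  by (intro all_moments_mult all_moments_const all_moments_power all_moments_add all_moments_sum all_moments_abs xi) auto
 have [measurable]: "f \<in> borel_measurable borel" by (rule borel_measurable_continuous_onI[OF c])
 have "(%w. if i < k then \<xi> i w else 0) \<in> borel_measurable M" for i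
  using all_moments_measurable[OF xi, of i] by (cases "i < k") auto
 hence "(%w i. if i < k then \<xi> i w else 0) \<in> borel_measurable M"
  by (rule measurable_coordinatewise_then_product)
 hence "(%w. f (%i. if i < k then \<xi> i w else 0)) \<in> borel_measurable M" by measurable
 also have "(%w. f (%i. if i < k then \<xi> i w else 0)) = (%w. f (%i. \<xi> i w))"
  by (intro ext dep) auto
 finally show "(%w. f (%i. \<xi> i w)) \<in> borel_measurable M" .
 show "\<bar>f (%i. \<xi> i w)\<bar> <= \<bar>C * (1 + (\<Sum>i<k. \<bar>\<xi> i w\<bar>)) ^ m\<bar>" for w
  using b[of "%i. \<xi> i w"] by linarith
qed

end

lemma C1_growth_dep: "C1_growth k f ==> (\<forall>i<k. x i = y i) ==> f x = f y"
 unfolding C1_growth_def by blast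

lemma C1_growth_partial_dep:
 "C1_growth k f ==> (\<forall>i<k. x i = y i) ==> j < k ==> partial_deriv j f x = partial_deriv j f y"
 using partial_deriv_cong[of k f x y j] unfolding C1_growth_def by blast

context gaussian_space begin

lemma all_moments_C1_growth:
 assumes f: "C1_growth k f" and xi: "!!i. i < k ==> \<xi> i \<in> G"
 shows "all_moments (%w. f (%i. \<xi> i w))"
  and "j < k ==> all_moments (%w. partial_deriv j f (%i. \<xi> i w))"
proof -
 obtain C m where b: "!!x. \<bar>f x\<bar> <= C * (1 + (\<Sum>i<k. \<bar>x i\<bar>)) ^ m" using f unfolding C1_growth_def by blast
 show "all_moments (%w. f (%i. \<xi> i w))"
  by (rule all_moments_growth[OF b]) (use f xi all_moments_G in \<open>auto simp: C1_growth_def\<close>)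
 assume j: "j < k"
 obtain C m where b: "!!x. \<bar>partial_deriv j f x\<bar> <= C * (1 + (\<Sum>i<k. \<bar>x i\<bar>)) ^ m"
  using f j unfolding C1_growth_def by blast
 show "all_moments (%w. partial_deriv j f (%i. \<xi> i w))"
  by (rule all_moments_growth[OF b _ C1_growth_partial_dep[OF f _ j]])
   (use f xi j all_moments_G in \<open>auto simp: C1_growth_def\<close>)
qed

text \<open>Fubini's theorem for the joint law of \<open>\<eta>\<close> and \<open>\<zeta>\<close>, which is a product because they are independent.
 Coordinates beyond \<open>k\<close> are set to zero to obtain one random element of the space of sequences.\<close>

lemma expectation_independent_pair:
 fixes \<Phi> :: "(nat => real) => real => real"
 assumes zeta: "\<zeta> \<in> G" and eta: "!!i. i < k ==> \<eta> i \<in> G"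
  and unc: "!!i. i < k ==> ip (\<eta> i) \<zeta> = 0"
  and Phi[measurable]: "case_prod \<Phi> \<in> borel_measurable (borel \<Otimes>\<^sub>M borel)"
  and int: "integrable M (%w. \<Phi> (%i. if i < k then \<eta> i w else 0) (\<zeta> w))"
 shows "expectation (%w. \<Phi> (%i. if i < k then \<eta> i w else 0) (\<zeta> w))
  = (\<integral>h. (\<integral>x. \<Phi> h (l2 M \<zeta> * x) \<partial>std_gauss) \<partial>distr M borel (%w i. if i < k then \<eta> i w else 0))"
  and "integrable (distr M borel (%w i. if i < k then \<eta> i w else 0)) (%h. \<integral>x. \<Phi> h (l2 M \<zeta> * x) \<partial>std_gauss)"
proof -
 define H where "H w = (%i. if i < k then \<eta> i w else 0)" for w
 have zm[measurable]: "\<zeta> \<in> borel_measurable M" using zeta by measurable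
 have em: "\<eta> i \<in> borel_measurable M" if "i < k" for i using eta that measurable_G by auto
 have "(%w. if i < k then \<eta> i w else 0) \<in> borel_measurable M" for i
  using em[of i] by (cases "i < k") auto
 hence Hm[measurable]: "H \<in> borel_measurable M" unfolding H_def
  by (rule measurable_coordinatewise_then_product)
 define \<S> where "\<S> = sigma (space M) {\<eta> i -` B \<inter> space M | i B. i \<in> {..<k} \<and> B \<in> sets borel}"
 have ss: "{\<eta> i -` B \<inter> space M | i B. i \<in> {..<k} \<and> B \<in> sets borel} \<subseteq> Pow (space M)" by auto
 have HS: "H \<in> borel_measurable \<S>" unfolding H_def
 proof (rule measurable_coordinatewise_then_product)
  fix i
  show "(%w. if i < k then \<eta> i w else 0) \<in> borel_measurable \<S>"
  proof (cases "i < k")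
   case True
   have "\<eta> i \<in> borel_measurable \<S>"
    unfolding \<S>_def by (rule measurableI) (use True ss in \<open>auto simp: sets_measure_of space_measure_of intro!: sigma_sets.Basic\<close>)
   thus ?thesis using True by simp
  qed simp
 qed
 interpret HD: prob_space "distr M borel H" by (rule prob_space_distr) simp
 interpret ZD: prob_space "distr M borel \<zeta>" by (rule prob_space_distr) simp
 have law: "distr M borel H \<Otimes>\<^sub>M distr M borel \<zeta> = distr M (borel \<Otimes>\<^sub>M borel) (%w. (H w, \<zeta> w))"
 proof (rule pair_measure_eqI)
  show "sigma_finite_measure (distr M borel H)" "sigma_finite_measure (distr M borel \<zeta>)" by unfold_locales
  show "sets (distr M borel H \<Otimes>\<^sub>M distr M borel \<zeta>) = sets (distr M (borel \<Otimes>\<^sub>M borel) (%w. (H w, \<zeta> w)))"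
   by (simp cong: sets_pair_measure_cong)
  fix A B assume "A \<in> sets (distr M borel H)" "B \<in> sets (distr M borel \<zeta>)"
  hence [measurable]: "A \<in> sets borel" "B \<in> sets borel" by auto
  define A' where "A' = H -` A \<inter> space M"
  have A': "A' \<in> sigma_sets (space M) {\<eta> i -` B \<inter> space M | i B. i \<in> {..<k} \<and> B \<in> sets borel}"
   using measurable_sets[OF HS, of A] ss unfolding A'_def \<S>_def by (simp add: sets_measure_of space_measure_of)
  have [measurable]: "A' \<in> sets M" unfolding A'_def by measurable
  have "prob (A' \<inter> (\<zeta> -` B \<inter> space M)) = prob A' * prob (\<zeta> -` B \<inter> space M)"
  proof -
   have "prob (A' \<inter> (\<zeta> -` B \<inter> space M)) = expectation (%w. indicat_real A' w * indicat_real B (\<zeta> w))"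
   proof -
    have "prob (A' \<inter> (\<zeta> -` B \<inter> space M)) = expectation (indicat_real (A' \<inter> (\<zeta> -` B \<inter> space M)))"
     by (simp add: Int_assoc)
    also have "\<dots> = expectation (%w. indicat_real A' w * indicat_real B (\<zeta> w))"
     by (rule bochner_cong) (auto simp: indicator_def)
    finally show ?thesis .
   qed
   also have "\<dots> = expectation (indicat_real A') * expectation (%w. indicat_real B (\<zeta> w))"
    by (rule uncorrelated_product_law[OF zeta eta unc A']) auto
   also have "expectation (%w. indicat_real B (\<zeta> w)) = prob (\<zeta> -` B \<inter> space M)"
   proof -
    have "prob (\<zeta> -` B \<inter> space M) = expectation (indicat_real (\<zeta> -` B \<inter> space M))"
     by (simp add: Int_assoc)
    also have "\<dots> = expectation (%w. indicat_real B (\<zeta> w))"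
     by (rule bochner_cong) (auto simp: indicator_def)
    finally show ?thesis by simp
   qed
   also have "expectation (indicat_real A') = prob A'" by simp
   finally show ?thesis .
  qed
  hence "emeasure M (A' \<inter> (\<zeta> -` B \<inter> space M)) = emeasure M A' * emeasure M (\<zeta> -` B \<inter> space M)"
   by (simp add: emeasure_eq_measure ennreal_mult)
  moreover have "(%w. (H w, \<zeta> w)) -` (A \<times> B) \<inter> space M = A' \<inter> (\<zeta> -` B \<inter> space M)" by (auto simp: A'_def)
  ultimately show "emeasure (distr M borel H) A * emeasure (distr M borel \<zeta>) B = emeasure (distr M (borel \<Otimes>\<^sub>M borel) (%w. (H w, \<zeta> w))) (A \<times> B)"
   by (simp add: emeasure_distr A'_def)
 qed
 have Phi2[measurable]: "(%x. \<Phi> (fst x) (snd x)) \<in> borel_measurable (borel \<Otimes>\<^sub>M borel)"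
  using Phi by (simp add: case_prod_unfold)
 interpret P: pair_sigma_finite "distr M borel H" "distr M borel \<zeta>" ..
 have i: "integrable (distr M borel H \<Otimes>\<^sub>M distr M borel \<zeta>) (%x. \<Phi> (fst x) (snd x))"
 proof -
  have "integrable M (%w. \<Phi> (H w) (\<zeta> w))" using int by (simp add: H_def)
  thus ?thesis unfolding law by (subst integrable_distr_eq) auto
 qed
 have inner: "(\<integral>z. \<Phi> h z \<partial>distr M borel \<zeta>) = (\<integral>x. \<Phi> h (l2 M \<zeta> * x) \<partial>std_gauss)" for h
 proof -
  have [measurable]: "\<Phi> h \<in> borel_measurable borel"
   using measurable_compose[OF measurable_Pair1' Phi, of h] by simp
  have "distr M borel \<zeta> = distr std_gauss borel (%x. l2 M \<zeta> * x)"
   using gaussian_G[OF zeta] by (simp add: gaussian_def)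
  thus ?thesis
   using integral_distr[of "%x. l2 M \<zeta> * x" std_gauss borel "\<Phi> h"] by simp
 qed
 have "expectation (%w. \<Phi> (H w) (\<zeta> w)) = (\<integral>x. \<Phi> (fst x) (snd x) \<partial>(distr M borel H \<Otimes>\<^sub>M distr M borel \<zeta>))"
  unfolding law by (subst integral_distr) auto
 also have "\<dots> = (\<integral>h. (\<integral>z. \<Phi> h z \<partial>distr M borel \<zeta>) \<partial>distr M borel H)"
  using P.integral_fst'[OF i] by simp
 finally show "expectation (%w. \<Phi> (%i. if i < k then \<eta> i w else 0) (\<zeta> w))
  = (\<integral>h. (\<integral>x. \<Phi> h (l2 M \<zeta> * x) \<partial>std_gauss) \<partial>distr M borel (%w i. if i < k then \<eta> i w else 0))"
  unfolding inner H_def[abs_def] .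
 show "integrable (distr M borel (%w i. if i < k then \<eta> i w else 0)) (%h. \<integral>x. \<Phi> h (l2 M \<zeta> * x) \<partial>std_gauss)"
  using P.integrable_fst'[OF i] unfolding inner H_def[abs_def] by (simp add: inner)
qed

text \<open>Removing from each \<open>\<xi>\<^sub>i\<close> its projection on \<open>\<zeta>\<close> leaves variables independent of \<open>\<zeta>\<close>; given
 these, the expectation is a one-dimensional Gaussian integral along a line, to which Stein's
 identity and the chain rule apply.\<close>

theorem gaussian_integration_by_parts:
 assumes f: "C1_growth k f" and xi: "!!i. i < k ==> \<xi> i \<in> G" and zeta: "\<zeta> \<in> G"
 shows "expectation (%w. f (%i. \<xi> i w) * \<zeta> w)
  = (\<Sum>j<k. expectation (%w. partial_deriv j f (%i. \<xi> i w)) * ip (\<xi> j) \<zeta>)"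
proof (cases "l2 M \<zeta> = 0")
 case True
 have "AE w in M. \<zeta> w = 0" by (rule l2_eq_0_AE[OF sqint_G[OF zeta] True])
 hence "AE w in M. f (%i. \<xi> i w) * \<zeta> w = 0" "AE w in M. \<xi> j w * \<zeta> w = 0" for j by auto
 thus ?thesis by (simp add: integral_eq_zero_AE)
next
 case False
 define \<sigma> where "\<sigma> = l2 M \<zeta>"
 have s: "\<sigma> > 0" using False l2_nonneg[of M \<zeta>] unfolding \<sigma>_def by linarith
 have s2: "\<sigma>^2 = ip \<zeta> \<zeta>" unfolding \<sigma>_def l2_squared by (simp add: power2_eq_square)
 define a where "a i = ip (\<xi> i) \<zeta> / \<sigma>^2" for i
 define \<eta> where "\<eta> i w = \<xi> i w - a i * \<zeta> w" for i w
 have eta: "\<eta> i \<in> G" if "i < k" for i unfolding \<eta>_def using that xi zeta by (intro G_diff G_cmult) auto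
 have unc: "ip (\<eta> i) \<zeta> = 0" if "i < k" for i
 proof -
  have "ip (\<eta> i) \<zeta> = expectation (%w. \<xi> i w * \<zeta> w - a i * (\<zeta> w * \<zeta> w))"
   by (rule bochner_cong) (auto simp: \<eta>_def algebra_simps)
  also have "\<dots> = ip (\<xi> i) \<zeta> - a i * \<sigma>^2"
   unfolding s2 using sqint_mult[OF sqint_G[OF xi[OF that]] sqint_G[OF zeta]] sqint_mult[OF sqint_G[OF zeta] sqint_G[OF zeta]]
   by simp
  finally show ?thesis using s by (simp add: a_def)
 qed
 have fm[measurable]: "f \<in> borel_measurable borel" using f by (auto simp: C1_growth_def intro: borel_measurable_continuous_onI)
 have pm: "partial_deriv j f \<in> borel_measurable borel" if "j < k" for j
  using f that by (auto simp: C1_growth_def intro: borel_measurable_continuous_onI)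
 have line[measurable]: "(%x. (%i. fst x i + a i * snd x)) \<in> (borel \<Otimes>\<^sub>M borel :: ((nat => real) \<times> real) measure) \<rightarrow>\<^sub>M borel"
 proof (rule measurable_coordinatewise_then_product)
  fix i
  have "(%x. fst x) \<in> (borel \<Otimes>\<^sub>M borel :: ((nat => real) \<times> real) measure) \<rightarrow>\<^sub>M borel" by (rule measurable_fst)
  from measurable_product_then_coordinatewise[OF this, of i]
  show "(%x. fst x i + a i * snd x) \<in> borel_measurable (borel \<Otimes>\<^sub>M borel :: ((nat => real) \<times> real) measure)"
   by (intro borel_measurable_add borel_measurable_times borel_measurable_const measurable_snd)
 qed
 have argf: "f (%i. (if i < k then \<eta> i w else 0) + a i * \<zeta> w) = f (%i. \<xi> i w)" for w
  by (rule C1_growth_dep[OF f]) (auto simp: \<eta>_def)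
 have argp: "partial_deriv j f (%i. (if i < k then \<eta> i w else 0) + a i * \<zeta> w) = partial_deriv j f (%i. \<xi> i w)" if "j < k" for j w
  by (rule C1_growth_partial_dep[OF f _ that]) (auto simp: \<eta>_def)
 define \<nu> where "\<nu> = distr M borel (%w i. if i < k then \<eta> i w else 0)"
 have part: "expectation (%w. partial_deriv j f (%i. \<xi> i w))
   = (\<integral>h. (\<integral>x. partial_deriv j f (%i. h i + a i * (\<sigma> * x)) \<partial>std_gauss) \<partial>\<nu>)"
  "integrable \<nu> (%h. \<integral>x. partial_deriv j f (%i. h i + a i * (\<sigma> * x)) \<partial>std_gauss)"
  if j: "j < k" for j
 proof -
  have 1: "(%(h, z). partial_deriv j f (%i. h i + a i * z)) \<in> borel_measurable (borel \<Otimes>\<^sub>M borel)"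
   unfolding case_prod_unfold by (rule measurable_compose[OF line pm[OF j]])
  have 2: "integrable M (%w. partial_deriv j f (%i. (if i < k then \<eta> i w else 0) + a i * \<zeta> w))"
   unfolding argp[OF j]
   by (intro all_moments_integrable all_moments_C1_growth(2)[OF f xi j]) auto
  show "expectation (%w. partial_deriv j f (%i. \<xi> i w))
   = (\<integral>h. (\<integral>x. partial_deriv j f (%i. h i + a i * (\<sigma> * x)) \<partial>std_gauss) \<partial>\<nu>)"
   using expectation_independent_pair(1)[OF zeta eta unc 1 2] unfolding \<nu>_def \<sigma>_def argp[OF j] by simp
  show "integrable \<nu> (%h. \<integral>x. partial_deriv j f (%i. h i + a i * (\<sigma> * x)) \<partial>std_gauss)"
   using expectation_independent_pair(2)[OF zeta eta unc 1 2] unfolding \<nu>_def \<sigma>_def by simp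
 qed
 have "expectation (%w. f (%i. \<xi> i w) * \<zeta> w)
   = expectation (%w. f (%i. (if i < k then \<eta> i w else 0) + a i * \<zeta> w) * \<zeta> w)" by (simp only: argf)
 also have "\<dots> = (\<integral>h. (\<integral>x. f (%i. h i + a i * (\<sigma> * x)) * (\<sigma> * x) \<partial>std_gauss) \<partial>\<nu>)"
  unfolding \<nu>_def \<sigma>_def
 proof (rule expectation_independent_pair(1)[OF zeta eta unc])
  show "(%(h, z). f (%i. h i + a i * z) * z) \<in> borel_measurable (borel \<Otimes>\<^sub>M borel)"
   unfolding case_prod_unfold by (intro borel_measurable_times measurable_compose[OF line fm]) auto
  show "integrable M (%w. f (%i. (if i < k then \<eta> i w else 0) + a i * \<zeta> w) * \<zeta> w)"
   unfolding argf
   by (intro all_moments_integrable all_moments_mult all_moments_C1_growth[OF f xi] all_moments_G[OF zeta]) auto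
 qed auto
 also have "\<dots> = (\<integral>h. (\<Sum>j<k. a j * \<sigma>^2 * (\<integral>x. partial_deriv j f (%i. h i + a i * (\<sigma> * x)) \<partial>std_gauss)) \<partial>\<nu>)"
 proof (rule bochner_cong[OF refl])
  fix h
  define g where "g x = f (%i. h i + (a i * \<sigma>) * x)" for x
  define g' where "g' x = (\<Sum>j<k. (a j * \<sigma>) * partial_deriv j f (%i. h i + (a i * \<sigma>) * x))" for x
  have cl: "continuous_on UNIV (%x::real. (%i. h i + (a i * \<sigma>) * x))" by (intro continuous_intros)
  obtain C m where b: "!!x. \<bar>f x\<bar> <= C * (1 + (\<Sum>i<k. \<bar>x i\<bar>)) ^ m" using f unfolding C1_growth_def by blast
  have "\<forall>j. \<exists>D l. j < k \<longrightarrow> (\<forall>x. \<bar>partial_deriv j f x\<bar> <= D * (1 + (\<Sum>i<k. \<bar>x i\<bar>)) ^ l)"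
   using f unfolding C1_growth_def by blast
  then obtain D l where bp: "!!j x. j < k ==> \<bar>partial_deriv j f x\<bar> <= D j * (1 + (\<Sum>i<k. \<bar>x i\<bar>)) ^ l j"
   by metis
  define E where "E j = D j * (1 + (\<Sum>i<k. \<bar>h i\<bar> + \<bar>a i * \<sigma>\<bar>)) ^ l j" for j
  have bl: "\<bar>partial_deriv j f (%i. h i + (a i * \<sigma>) * x)\<bar> <= E j * (1 + \<bar>x\<bar>) ^ l j" if "j < k" for j x
   unfolding E_def by (rule growth_along_line[OF bp[OF that]])
  have E0: "E j \<ge> 0" if "j < k" for j using bl[OF that, of 0] by simp
  have cp: "continuous_on UNIV (%x. partial_deriv j f (%i. h i + (a i * \<sigma>) * x))" if "j < k" for j
   by (rule continuous_on_compose2[OF _ cl]) (use f that in \<open>auto simp: C1_growth_def\<close>)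
  define L where "L = (\<Sum>j<k. l j)"
  have "(\<integral>x. g x * x \<partial>std_gauss) = (\<integral>x. g' x \<partial>std_gauss)"
  proof (rule stein_identity)
   show "(g has_real_derivative g' x) (at x)" for x
    unfolding g_def g'_def by (rule C1_growth_chain_rule[OF f])
   show "continuous_on UNIV g'" unfolding g'_def by (intro continuous_intros cp) auto
   show "\<bar>g x\<bar> <= C * (1 + (\<Sum>i<k. \<bar>h i\<bar> + \<bar>a i * \<sigma>\<bar>)) ^ m * (1 + \<bar>x\<bar>) ^ m" for x
    unfolding g_def by (rule growth_along_line[OF b])
   show "\<bar>g' x\<bar> <= (\<Sum>j<k. \<bar>a j * \<sigma>\<bar> * E j) * (1 + \<bar>x\<bar>) ^ L" for x
   proof -
    have "\<bar>g' x\<bar> <= (\<Sum>j<k. \<bar>(a j * \<sigma>) * partial_deriv j f (%i. h i + (a i * \<sigma>) * x)\<bar>)"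
     unfolding g'_def by (rule sum_abs)
    also have "\<dots> <= (\<Sum>j<k. \<bar>a j * \<sigma>\<bar> * E j * (1 + \<bar>x\<bar>) ^ L)"
    proof (rule sum_mono)
     fix j assume "j \<in> {..<k}" hence j: "j < k" by simp
     have "l j <= L" unfolding L_def by (rule member_le_sum) (use j in auto)
     hence "(1 + \<bar>x\<bar>) ^ l j <= (1 + \<bar>x\<bar>) ^ L" by (rule power_increasing) auto
     hence "E j * (1 + \<bar>x\<bar>) ^ l j <= E j * (1 + \<bar>x\<bar>) ^ L" using E0[OF j] by (rule mult_left_mono)
     hence "\<bar>partial_deriv j f (%i. h i + (a i * \<sigma>) * x)\<bar> <= E j * (1 + \<bar>x\<bar>) ^ L" using bl[OF j, of x] by linarith
     thus "\<bar>(a j * \<sigma>) * partial_deriv j f (%i. h i + (a i * \<sigma>) * x)\<bar> <= \<bar>a j * \<sigma>\<bar> * E j * (1 + \<bar>x\<bar>) ^ L"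
      unfolding abs_mult[of "a j * \<sigma>"] mult.assoc[of "\<bar>a j * \<sigma>\<bar>"] by (rule mult_left_mono) simp
    qed
    finally show ?thesis by (simp add: sum_distrib_right)
   qed
  qed
  hence "(\<integral>x. f (%i. h i + a i * (\<sigma> * x)) * (\<sigma> * x) \<partial>std_gauss) = \<sigma> * (\<integral>x. g' x \<partial>std_gauss)"
   by (simp add: g_def mult.assoc mult.left_commute[of _ \<sigma>])
  also have "(\<integral>x. g' x \<partial>std_gauss) = (\<Sum>j<k. (a j * \<sigma>) * (\<integral>x. partial_deriv j f (%i. h i + (a i * \<sigma>) * x) \<partial>std_gauss))"
   unfolding g'_def
  proof (subst bochner_sum)
   fix j assume "j \<in> {..<k}"
   hence j: "j < k" by simp
   have "(%x. partial_deriv j f (%i. h i + (a i * \<sigma>) * x)) \<in> borel_measurable borel"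
    by (rule borel_measurable_continuous_onI[OF cp[OF j]])
   from polynomial_growth_integrable_std_normal[OF this bl[OF j]]
   show "integrable std_gauss (%x. (a j * \<sigma>) * partial_deriv j f (%i. h i + (a i * \<sigma>) * x))" by simp
  qed simp
  finally show "(\<integral>x. f (%i. h i + a i * (\<sigma> * x)) * (\<sigma> * x) \<partial>std_gauss)
   = (\<Sum>j<k. a j * \<sigma>^2 * (\<integral>x. partial_deriv j f (%i. h i + a i * (\<sigma> * x)) \<partial>std_gauss))"
   by (simp add: sum_distrib_left power2_eq_square mult.assoc mult.left_commute)
 qed
 also have "\<dots> = (\<Sum>j<k. a j * \<sigma>^2 * (\<integral>h. (\<integral>x. partial_deriv j f (%i. h i + a i * (\<sigma> * x)) \<partial>std_gauss) \<partial>\<nu>))"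
  using part(2) by (subst bochner_sum) auto
 also have "\<dots> = (\<Sum>j<k. a j * \<sigma>^2 * expectation (%w. partial_deriv j f (%i. \<xi> i w)))"
  using part(1) by (intro sum.cong) auto
 also have "\<dots> = (\<Sum>j<k. expectation (%w. partial_deriv j f (%i. \<xi> i w)) * ip (\<xi> j) \<zeta>)"
  using s by (intro sum.cong) (auto simp: a_def)
 finally show ?thesis .
qed

end

section \<open>The covariance functions\<close>

locale hurst =
 fixes H :: real
 assumes H_half: "1/2 < H" and H_less_1: "H < 1"
begin

text \<open>\<open>\<gamma>\<close> is the covariance function of the stationary process \<open>U\<^sub>t = e\<^sup>-\<^sup>t B\<^bsub>a(t)\<^esub>\<close> and \<open>r\<close> the density of
 the covariance of the increments of \<open>Y\<close>. They are related by \<open>r = \<gamma> - \<gamma>''\<close>; \<open>\<gamma>1\<close> is the derivative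
 of \<open>\<gamma>\<close> and \<open>q\<close> the primitive of \<open>r\<close>.\<close>

definition \<gamma> :: "real => real" where
 "\<gamma> x = 1/2 * H powr (2 * H) * (exp (- x) + exp x * (1 - (1 - exp (- x / H)) powr (2 * H)))"

definition r :: "real => real" where
 "r x = H powr (2 * H) / H * (2 * H - 1) * exp x * exp (- x / H) * (1 - exp (- x / H)) powr (2 * H - 2)"

definition \<gamma>1 :: "real => real" where
 "\<gamma>1 x = 1/2 * H powr (2 * H) * (exp x - exp (- x) - exp x * (1 - exp (- x / H)) powr (2 * H - 1) * (1 + exp (- x / H)))"

definition q :: "real => real" where
 "q x = integral {0..x} \<gamma> - \<gamma>1 x"

definition lam :: real where "lam = 1 / H - 1"

definition K\<gamma> :: real where "K\<gamma> = 3/2 * H powr (2 * H)"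

definition Kq :: real where "Kq = H powr (2 * H) + K\<gamma> / lam"

lemma H_pos[simp]: "0 < H" "0 <= H" "H \<noteq> 0" using H_half by auto

lemma lam_pos: "0 < lam" and lam_less_1: "lam < 1"
 using H_half H_less_1 by (auto simp: lam_def field_simps)

lemma K\<gamma>_pos: "0 < K\<gamma>" by (simp add: K\<gamma>_def)

lemma y_bounds: assumes "0 <= x" shows "0 < exp (- x / H)" "exp (- x / H) <= 1" "0 < x ==> exp (- x / H) < 1"
 using assms by (auto simp: divide_nonpos_pos)

lemma exp_y: "exp x * exp (- x / H) = exp (- lam * x)"
 by (simp add: exp_add[symmetric] lam_def algebra_simps)

lemma powr_ge_square: assumes "0 <= w" "w <= 1" shows "w^2 <= w powr (2 * H)"
proof (cases "w = 0")
 case False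
 hence "w^2 = w powr 2" using assms by (simp add: powr_numeral)
 also have "\<dots> <= w powr (2 * H)" using assms H_less_1 by (intro powr_mono') auto
 finally show ?thesis .
qed simp

lemma \<gamma>_nonneg: assumes "0 <= x" shows "0 <= \<gamma> x"
proof -
 have "(1 - exp (- x / H)) powr (2 * H) <= 1" using y_bounds[OF assms] by (intro powr_le1) auto
 thus ?thesis unfolding \<gamma>_def by (intro mult_nonneg_nonneg add_nonneg_nonneg) auto
qed

lemma \<gamma>_0: "\<gamma> 0 = H powr (2 * H)"
 by (simp add: \<gamma>_def)

text \<open>As \<open>2 H <= 2\<close>, \<open>1 - (1 - y)\<^bsup>2H\<^esup> <= 1 - (1 - y)^2 <= 2 y\<close> for \<open>y = e\<^bsup>-x/H\<^esup>\<close>, and \<open>e\<^sup>x y\<close> decays because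
 \<open>H < 1\<close>.\<close>

lemma \<gamma>_decay: assumes x: "0 <= x" shows "\<gamma> x <= K\<gamma> * exp (- lam * x)"
proof -
 define y where "y = exp (- x / H)"
 have y: "0 < y" "y <= 1" using y_bounds[OF x] by (auto simp: y_def)
 have "(1 - y)^2 <= (1 - y) powr (2 * H)" using y by (intro powr_ge_square) auto
 hence "1 - (1 - y) powr (2 * H) <= 2 * y" using y by (simp add: power2_diff) (smt (verit) zero_le_power2)
 hence "exp x * (1 - (1 - y) powr (2 * H)) <= exp x * (2 * y)" by (intro mult_left_mono) auto
 also have "\<dots> = 2 * exp (- lam * x)" using exp_y[of x] by (simp add: y_def)
 finally have 1: "exp x * (1 - (1 - y) powr (2 * H)) <= 2 * exp (- lam * x)" .
 have 2: "exp (- x) <= exp (- lam * x)" using x lam_less_1 by (simp add: mult_left_le_one_le lam_pos less_imp_le)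
 have "\<gamma> x <= 1/2 * H powr (2 * H) * (3 * exp (- lam * x))"
  unfolding \<gamma>_def y_def[symmetric] proof (rule mult_left_mono)
  show "exp (- x) + exp x * (1 - (1 - y) powr (2 * H)) <= 3 * exp (- lam * x)" using 1 2 by linarith
 qed simp
 thus ?thesis by (simp add: K\<gamma>_def)
qed

text \<open>The exponent \<open>2 H > 1\<close> of the mean square increments of \<open>U\<close> is what makes its quadratic variation vanish.\<close>

lemma \<gamma>_holder: assumes x: "0 <= x" "x <= 1" shows "\<gamma> 0 - \<gamma> x <= 2 * x powr (2 * H)"
proof -
 define y where "y = exp (- x / H)"
 have y: "0 < y" "y <= 1" using y_bounds[OF x(1)] by (auto simp: y_def)
 have "1 - y <= x / H" using exp_ge_add_one_self[of "- x / H"] by (simp add: y_def)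
 hence "(1 - y) powr (2 * H) <= (x / H) powr (2 * H)" using y H_half by (intro powr_mono2) auto
 also have "\<dots> = x powr (2 * H) / H powr (2 * H)" using x by (simp add: powr_divide)
 finally have "exp x * (1 - y) powr (2 * H) <= exp 1 * (x powr (2 * H) / H powr (2 * H))"
  using x by (intro mult_mono) auto
 also have "\<dots> <= 3 * (x powr (2 * H) / H powr (2 * H))" using exp_le by (intro mult_right_mono) auto
 finally have 1: "exp x * (1 - y) powr (2 * H) <= 3 * (x powr (2 * H) / H powr (2 * H))" .
 have "0 <= (exp (x/2) - exp (- (x/2)))^2" by simp
 also have "\<dots> = exp x + exp (- x) - 2"
  unfolding power2_diff by (simp add: exp_double[symmetric] exp_add[symmetric] power2_eq_square)
 finally have 2: "2 - exp x - exp (- x) <= 0" by simp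
 have "\<gamma> 0 - \<gamma> x = 1/2 * H powr (2 * H) * (2 - exp x - exp (- x) + exp x * (1 - y) powr (2 * H))"
  by (simp add: \<gamma>_0 \<gamma>_def y_def algebra_simps)
 also have "\<dots> <= 1/2 * H powr (2 * H) * (3 * (x powr (2 * H) / H powr (2 * H)))"
  using 1 2 by (intro mult_left_mono) auto
 also have "\<dots> = 3/2 * x powr (2 * H)" by simp
 also have "\<dots> <= 2 * x powr (2 * H)" by (rule mult_right_mono) auto
 finally show ?thesis .
qed

lemma continuous_on_powr_y: assumes "0 < p" shows "continuous_on {0..} (%x. (1 - exp (- x / H)) powr p)"
proof (rule continuous_on_powr')
 show "continuous_on {0..} (%x. 1 - exp (- x / H))" by (intro continuous_intros) auto
 show "\<forall>x\<in>{0..}. 0 <= 1 - exp (- x / H) \<and> (1 - exp (- x / H) = 0 \<longrightarrow> 0 < p)"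
  using y_bounds assms by auto
qed simp

lemma continuous_on_\<gamma>: "continuous_on {0..} \<gamma>"
 unfolding \<gamma>_def[abs_def] by (intro continuous_intros continuous_on_powr_y) auto

lemma continuous_on_\<gamma>1: "continuous_on {0..} \<gamma>1"
 unfolding \<gamma>1_def[abs_def] by (intro continuous_intros continuous_on_powr_y) (use H_half in auto)

lemma y_has_derivative: "((%x. exp (- x / H)) has_real_derivative - (exp (- x / H) / H)) (at x)"
 by (auto intro!: derivative_eq_intros)

lemma powr_y_has_derivative:
 assumes "0 < x"
 shows "((%x. (1 - exp (- x / H)) powr p) has_real_derivative p * (1 - exp (- x / H)) powr (p - 1) * (exp (- x / H) / H)) (at x)"
proof -
 have "((%x. 1 - exp (- x / H)) has_real_derivative exp (- x / H) / H) (at x)"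
  using DERIV_diff[OF DERIV_const y_has_derivative, of 1 x] by simp
 from DERIV_fun_powr[OF this, of p] show ?thesis using y_bounds[of x] assms by simp
qed

lemma \<gamma>_has_derivative: assumes x: "0 < x" shows "(\<gamma> has_real_derivative \<gamma>1 x) (at x)"
proof -
 define y where "y = exp (- x / H)"
 have y: "0 < y" "y < 1" using y_bounds[of x] x by (auto simp: y_def)
 have w: "1 - exp (- x / H) > 0" using y by (simp add: y_def)
 have p: "(1 - y) powr (2 * H) = (1 - y) powr (2 * H - 1) * (1 - y)"
  using y powr_add[of "1 - y" "2 * H - 1" 1] by simp
 define f where "f x = (1 - exp (- x / H)) powr (2 * H)" for x
 have d: "(f has_real_derivative 2 * H * (1 - y) powr (2 * H - 1) * (y / H)) (at x)"
  unfolding y_def f_def by (rule powr_y_has_derivative[OF x])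
 have fx: "f x = (1 - y) powr (2 * H)" by (simp add: f_def y_def)
 have "((%x. 1/2 * H powr (2 * H) * (exp (- x) + exp x * (1 - f x))) has_real_derivative 1/2 * H powr (2 * H) * (- exp (- x) + (exp x * (1 - (1 - y) powr (2 * H)) + exp x * (- (2 * H * (1 - y) powr (2 * H - 1) * (y / H)))))) (at x)"
  by (rule derivative_eq_intros d refl)+ (simp add: fx)
 hence "(\<gamma> has_real_derivative 1/2 * H powr (2 * H) * (- exp (- x) + (exp x * (1 - (1 - y) powr (2 * H)) + exp x * (- (2 * H * (1 - y) powr (2 * H - 1) * (y / H)))))) (at x)"
  unfolding \<gamma>_def[abs_def] f_def .
 also have "1/2 * H powr (2 * H) * (- exp (- x) + (exp x * (1 - (1 - y) powr (2 * H)) + exp x * (- (2 * H * (1 - y) powr (2 * H - 1) * (y / H))))) = \<gamma>1 x"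
  unfolding \<gamma>1_def y_def[symmetric] p by (simp add: field_simps)
 finally show ?thesis .
qed

lemma \<gamma>1_has_derivative: assumes x: "0 < x" shows "(\<gamma>1 has_real_derivative \<gamma> x - r x) (at x)"
proof -
 define y where "y = exp (- x / H)"
 have y: "0 < y" "y < 1" using y_bounds[of x] x by (auto simp: y_def)
 have w: "1 - exp (- x / H) > 0" using y by (simp add: y_def)
 define P where "P = (1 - y) powr (2 * H - 2)"
 have p1: "(1 - y) powr (2 * H - 1) = P * (1 - y)"
  unfolding P_def using y powr_add[of "1 - y" "2 * H - 2" 1] by simp
 have p2: "(1 - y) powr (2 * H) = P * (1 - y)^2"
  unfolding P_def using y powr_add[of "1 - y" "2 * H - 2" 2] by (simp add: powr_numeral)
 define f where "f x = (1 - exp (- x / H)) powr (2 * H - 1)" for x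
 define g where "g x = exp (- x / H)" for x
 have d: "(f has_real_derivative (2 * H - 1) * P * (y / H)) (at x)"
  using powr_y_has_derivative[OF x, of "2 * H - 1"] unfolding y_def f_def P_def by simp
 have dg: "(g has_real_derivative - (y / H)) (at x)" unfolding g_def y_def by (rule y_has_derivative)
 have fx: "f x = P * (1 - y)" "g x = y" by (simp_all add: f_def g_def p1[symmetric]) (simp_all add: y_def)
 define k where "k = 1/2 * H powr (2 * H)"
 have "((%x. k * (exp x - exp (- x) - exp x * f x * (1 + g x))) has_real_derivative k * (exp x + exp (- x) -
   ((exp x * (P * (1 - y)) + exp x * ((2 * H - 1) * P * (y / H))) * (1 + y) + exp x * (P * (1 - y)) * (- (y / H))))) (at x)"
  by (rule derivative_eq_intros d dg refl)+ (simp add: fx algebra_simps)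
 hence "(\<gamma>1 has_real_derivative k * (exp x + exp (- x) -
   ((exp x * (P * (1 - y)) + exp x * ((2 * H - 1) * P * (y / H))) * (1 + y) + exp x * (P * (1 - y)) * (- (y / H))))) (at x)"
  unfolding \<gamma>1_def[abs_def] f_def g_def k_def .
 also have "k * (exp x + exp (- x) -
   ((exp x * (P * (1 - y)) + exp x * ((2 * H - 1) * P * (y / H))) * (1 + y) + exp x * (P * (1 - y)) * (- (y / H)))) = \<gamma> x - r x"
 proof -
  define h where "h = inverse H"
  have h: "H * h = 1" by (simp add: h_def)
  have "\<gamma> x = k * (exp (- x) + exp x * (1 - (1 - y) powr (2 * H)))"
   unfolding \<gamma>_def k_def y_def by (rule refl)
  hence "\<gamma> x = k * (exp (- x) + exp x * (1 - P * (1 - y)^2))" unfolding p2 .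
  moreover have "r x = 2 * k * ((2 * H - 1) * h) * (exp x * y * P)"
   unfolding r_def k_def P_def h_def y_def divide_inverse by (simp only: mult_ac) simp
  moreover have e: "(2 * H - 1) * h = 2 - h" using h by (simp add: left_diff_distrib)
  moreover have "(2 * H - 1) * P * (y * h) = ((2 * H - 1) * h) * (P * y)" by (simp only: mult_ac)
  ultimately show ?thesis unfolding divide_inverse h_def[symmetric]
   by (simp only: e) (simp add: power2_eq_square algebra_simps)
 qed
 finally show ?thesis .
qed

lemma r_nonneg: "0 <= r x"
 unfolding r_def using H_half by (intro mult_nonneg_nonneg) auto

lemma r_measurable[measurable]: "r \<in> borel_measurable borel"
 unfolding r_def[abs_def] by measurable

lemma \<gamma>_integrable: "0 <= a ==> \<gamma> integrable_on {a..b}"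
 by (rule integrable_continuous_interval) (rule continuous_on_subset[OF continuous_on_\<gamma>], auto)

lemma integral_\<gamma>_has_derivative:
 assumes x: "0 < x" shows "((%x. integral {0..x} \<gamma>) has_real_derivative \<gamma> x) (at x)"
proof -
 have "((%u. integral {0..u} \<gamma>) has_real_derivative \<gamma> x) (at x within {0..x+1})"
  by (rule integral_has_real_derivative) (use x continuous_on_subset[OF continuous_on_\<gamma>] in auto)
 moreover have "at x within {0..x+1} = at x" by (rule at_within_interior) (use x in auto)
 ultimately show ?thesis by simp
qed

lemma continuous_on_integral_\<gamma>: "continuous_on {0..} (%x. integral {0..x} \<gamma>)"
proof -
 have "continuous_on {0..b} (%x. integral {0..x} \<gamma>)" for b
  by (rule indefinite_integral_continuous_1) (rule \<gamma>_integrable, simp)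
 hence c: "continuous (at x within {0..x+1}) (%x. integral {0..x} \<gamma>)" if "0 <= x" for x
  using that by (auto simp: continuous_on_eq_continuous_within)
 have "at x within {0..} = at x within {0..x+1}" if "0 <= x" for x :: real
  by (rule at_within_nhd[of x "{..<x+1}"]) auto
 with c show ?thesis by (auto simp: continuous_on_eq_continuous_within)
qed

lemma continuous_on_q: "continuous_on {0..} q"
 unfolding q_def[abs_def] by (intro continuous_intros continuous_on_integral_\<gamma> continuous_on_\<gamma>1)

lemma q_has_derivative: assumes x: "0 < x" shows "(q has_real_derivative r x) (at x)"
 unfolding q_def[abs_def]
 using DERIV_diff[OF integral_\<gamma>_has_derivative[OF x] \<gamma>1_has_derivative[OF x]] by simp

lemma q_mono: assumes "0 <= x" "x <= y" shows "q x <= q y"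
proof (rule DERIV_nonneg_imp_increasing_open[OF assms(2)])
 show "\<exists>z. (q has_real_derivative z) (at u) \<and> 0 <= z" if "x < u" "u < y" for u
  using q_has_derivative[of u] r_nonneg[of u] that assms by auto
 show "continuous_on {x..y} q" by (rule continuous_on_subset[OF continuous_on_q]) (use assms in auto)
qed

lemma integral_\<gamma>_le: assumes x: "0 <= x" shows "integral {0..x} \<gamma> <= K\<gamma> / lam"
proof -
 have "((%u. K\<gamma> * exp (- lam * u)) has_integral (- K\<gamma> / lam * exp (- lam * x)) - (- K\<gamma> / lam * exp (- lam * 0))) {0..x}"
  by (rule fundamental_theorem_of_calculus[OF x])
   (use lam_pos in \<open>auto intro!: derivative_eq_intros simp: real_vector_derivative[symmetric]\<close>)
 hence "integral {0..x} (%u. K\<gamma> * exp (- lam * u)) = K\<gamma> / lam * (1 - exp (- lam * x))"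
  and i: "(%u. K\<gamma> * exp (- lam * u)) integrable_on {0..x}"
  by (auto simp: has_integral_iff algebra_simps)
 moreover have "integral {0..x} \<gamma> <= integral {0..x} (%u. K\<gamma> * exp (- lam * u))"
  by (rule integral_le[OF \<gamma>_integrable i]) (use \<gamma>_decay in auto)
 moreover have "K\<gamma> / lam * (1 - exp (- lam * x)) <= K\<gamma> / lam"
  using K\<gamma>_pos lam_pos by (intro mult_left_le) auto
 ultimately show ?thesis by simp
qed

text \<open>In the upper bound for \<open>- \<gamma>1\<close> the terms \<open>e\<^sup>x\<close> cancel up to a bounded remainder, and the integral of \<open>\<gamma>\<close>
 is finite.\<close>

lemma q_le: assumes x: "0 <= x" shows "q x <= Kq"
proof -
 define y where "y = exp (- x / H)"
 have y: "0 < y" "y <= 1" using y_bounds[OF x] by (auto simp: y_def)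
 have "(1 - y) powr (2 * H - 1) <= 1" using y H_half by (intro powr_le1) auto
 hence "(1 - y) powr (2 * H - 1) * (1 + y) <= 1 * (1 + y)" using y by (intro mult_right_mono) auto
 hence "exp x * ((1 - y) powr (2 * H - 1) * (1 + y)) <= exp x * (1 + y)" by simp
 also have "\<dots> = exp x + exp (- lam * x)" using exp_y[of x] by (simp add: y_def distrib_left)
 finally have "exp (- x) - exp x + exp x * (1 - y) powr (2 * H - 1) * (1 + y) <= exp (- x) + exp (- lam * x)"
  by (simp add: mult.assoc)
 also have "\<dots> <= 2" using x lam_pos by (smt (verit) exp_le_one_iff mult_minus_left mult_nonneg_nonneg)
 finally have "1/2 * H powr (2 * H) * (exp (- x) - exp x + exp x * (1 - y) powr (2 * H - 1) * (1 + y)) <= 1/2 * H powr (2 * H) * 2"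
  by (intro mult_left_mono) auto
 moreover have "- \<gamma>1 x = 1/2 * H powr (2 * H) * (exp (- x) - exp x + exp x * (1 - y) powr (2 * H - 1) * (1 + y))"
  unfolding \<gamma>1_def y_def by (simp add: algebra_simps)
 ultimately have "- \<gamma>1 x <= H powr (2 * H)" by linarith
 thus ?thesis using integral_\<gamma>_le[OF x] by (simp add: q_def Kq_def)
qed

lemma Kq_pos: "0 < Kq"
 unfolding Kq_def using K\<gamma>_pos lam_pos by (intro add_pos_pos divide_pos_pos) auto

end

section \<open>The driving noise along a path\<close>

text \<open>Integration by parts: the error of one tagged interval is an integral of the oscillation of the
 integrator against \<open>e\<^sup>-\<^sup>s ds\<close>.\<close>

lemma exp_rs_increment_bound:
 fixes g :: "real => real"
 assumes uxv: "0 <= u" "u <= x" "x <= v" and g: "continuous_on {u..v} g"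
  and osc: "!!s s'. s \<in> {u..v} ==> s' \<in> {u..v} ==> \<bar>g s - g s'\<bar> <= e"
 shows "\<bar>exp (- x) * (g v - g u) - (exp (- v) * g v - exp (- u) * g u + integral {u..v} (%s. exp (- s) * g s))\<bar> <= e * (v - u)"
proof -
 have part: "\<bar>(exp (- a) - exp (- b)) * k - integral {a..b} (%s. exp (- s) * g s)\<bar> <= e * (b - a)"
  if ab: "a <= b" "u <= a" "b <= v" and k: "!!s. s \<in> {a..b} ==> \<bar>k - g s\<bar> <= e" for a b k
 proof -
  have cg: "continuous_on {a..b} g" using g by (rule continuous_on_subset) (use ab in auto)
  have "((%s. exp (- s)) has_integral (- exp (- b)) - (- exp (- a))) {a..b}"
   by (rule fundamental_theorem_of_calculus[OF ab(1)])
    (auto intro!: derivative_eq_intros simp: real_vector_derivative[symmetric])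
  hence "((%s. exp (- s)) has_integral (exp (- a) - exp (- b))) {a..b}" by simp
  hence "((%s. exp (- s) * k) has_integral (exp (- a) - exp (- b)) * k) {a..b}"
   by (rule has_integral_mult_left)
  moreover have "((%s. exp (- s) * g s) has_integral integral {a..b} (%s. exp (- s) * g s)) {a..b}"
   by (intro integrable_integral integrable_continuous_interval continuous_intros cg)
  ultimately have hi: "((%s. exp (- s) * k - exp (- s) * g s) has_integral (exp (- a) - exp (- b)) * k - integral {a..b} (%s. exp (- s) * g s)) {a..b}"
   by (rule has_integral_diff)
  have e: "0 <= e" using k[of a] ab by (auto intro: order_trans[OF abs_ge_zero])
  have "norm (exp (- s) * k - exp (- s) * g s) <= e" if "s \<in> {a..b} - {}" for s
  proof -
   have "norm (exp (- s) * k - exp (- s) * g s) = exp (- s) * \<bar>k - g s\<bar>"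
    by (simp add: right_diff_distrib[symmetric] abs_mult)
   also have "\<dots> <= 1 * e" using k[of s] that ab uxv by (intro mult_mono) auto
   finally show ?thesis by simp
  qed
  hence "norm ((exp (- a) - exp (- b)) * k - integral {a..b} (%s. exp (- s) * g s)) <= e * measure lborel {a..b}"
   using has_integral_bound_real[OF e finite.emptyI hi] by blast
  thus ?thesis using ab by simp
 qed
 have "integral {u..x} (%s. exp (- s) * g s) + integral {x..v} (%s. exp (- s) * g s) = integral {u..v} (%s. exp (- s) * g s)"
  by (intro hk_combine uxv integrable_continuous_interval continuous_intros g)
 moreover have "\<bar>(exp (- u) - exp (- x)) * g u - integral {u..x} (%s. exp (- s) * g s)\<bar> <= e * (x - u)"
  by (rule part) (use uxv osc in auto)
 moreover have "\<bar>(exp (- x) - exp (- v)) * g v - integral {x..v} (%s. exp (- s) * g s)\<bar> <= e * (v - x)"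
  by (rule part) (use uxv osc in auto)
 ultimately show ?thesis by (simp add: algebra_simps)
qed

text \<open>Summing the errors over a tagged division gives at most the oscillation of the integrator on the mesh
 scale times the length of the interval.\<close>

lemma has_rs_integral_exp:
 fixes g :: "real => real"
 assumes t: "0 <= t" and g: "continuous_on {0..t} g"
 shows "has_rs_integral (%s. exp (- s)) g 0 t (exp (- t) * g t - g 0 + integral {0..t} (%s. exp (- s) * g s))"
 unfolding has_rs_integral_def
proof (intro allI impI)
 fix e :: real assume e: "e > 0"
 define e' where "e' = e / (t + 1)"
 have e': "e' > 0" "e' * t < e" using e t by (auto simp: e'_def field_simps)
 have "uniformly_continuous_on {0..t} g" by (rule compact_uniformly_continuous[OF g]) simp
 then obtain d where d: "d > 0" "!!s s'. s \<in> {0..t} ==> s' \<in> {0..t} ==> \<bar>s - s'\<bar> < d ==> \<bar>g s - g s'\<bar> < e'"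
  unfolding uniformly_continuous_on_def dist_real_def using e' by (metis abs_minus_commute)
 define F where "F s = exp (- s) * g s + integral {0..s} (%u. exp (- u) * g u)" for s
 show "\<exists>d>0. \<forall>\<D>. \<D> tagged_division_of {0..t} \<and> (\<forall>(x, K)\<in>\<D>. Sup K - Inf K < d) \<longrightarrow>
   \<bar>(\<Sum>(x, K)\<in>\<D>. exp (- x) * (g (Sup K) - g (Inf K))) - (exp (- t) * g t - g 0 + integral {0..t} (%s. exp (- s) * g s))\<bar> < e"
 proof (intro exI[of _ d] conjI d(1) allI impI)
  fix \<D> assume D: "\<D> tagged_division_of {0..t} \<and> (\<forall>(x, K)\<in>\<D>. Sup K - Inf K < d)"
  have bound: "\<bar>exp (- x) * (g (Sup K) - g (Inf K)) - (F (Sup K) - F (Inf K))\<bar> <= e' * (Sup K - Inf K)" if xK: "(x, K) \<in> \<D>" for x K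
  proof -
   obtain u v where K: "K = cbox u v" using D xK by (meson tagged_division_ofD(4))
   have xin: "x \<in> K" "K \<subseteq> {0..t}" using D xK by (meson tagged_division_ofD(2,3))+
   have uv: "0 <= u" "u <= x" "x <= v" "v <= t" using xin K by (auto simp: subset_iff)
   have SI: "Sup K = v" "Inf K = u" using K uv by auto
   have vu: "v - u < d" using D xK SI by auto
   have sub: "{u..v} \<subseteq> {0..t}" using uv by auto
   have "integral {0..u} (%s. exp (- s) * g s) + integral {u..v} (%s. exp (- s) * g s) = integral {0..v} (%s. exp (- s) * g s)"
    by (intro hk_combine integrable_continuous_interval continuous_intros continuous_on_subset[OF g]) (use uv in auto)
   hence FF: "F v - F u = exp (- v) * g v - exp (- u) * g u + integral {u..v} (%s. exp (- s) * g s)"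
    by (simp add: F_def)
   have "\<bar>exp (- x) * (g v - g u) - (F v - F u)\<bar> <= e' * (v - u)"
    unfolding FF
   proof (rule exp_rs_increment_bound[OF uv(1-3) continuous_on_subset[OF g sub]])
    fix s s' assume "s \<in> {u..v}" "s' \<in> {u..v}"
    thus "\<bar>g s - g s'\<bar> <= e'" using d(2)[of s s'] sub vu by force
   qed
   thus ?thesis by (simp add: SI)
  qed
  have fin: "finite \<D>" using D by blast
  have "(\<Sum>(x, K)\<in>\<D>. F (Sup K) - F (Inf K)) = F t - F 0" and len: "(\<Sum>(x, K)\<in>\<D>. Sup K - Inf K) = t - 0"
   using D additive_tagged_division_1[OF t, of \<D> F] additive_tagged_division_1[OF t, of \<D> "%x. x"] by auto
  hence "(\<Sum>(x, K)\<in>\<D>. exp (- x) * (g (Sup K) - g (Inf K))) - (F t - F 0)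
   = (\<Sum>(x, K)\<in>\<D>. exp (- x) * (g (Sup K) - g (Inf K)) - (F (Sup K) - F (Inf K)))"
   by (simp add: sum_subtractf case_prod_unfold)
  also have "\<bar>\<dots>\<bar> <= (\<Sum>(x, K)\<in>\<D>. e' * (Sup K - Inf K))"
   by (rule order_trans[OF sum_abs sum_mono]) (use bound in auto)
  also have "\<dots> = e' * t" using len by (simp add: sum_distrib_left[symmetric] case_prod_unfold)
  also have "\<dots> < e" by fact
  finally show "\<bar>(\<Sum>(x, K)\<in>\<D>. exp (- x) * (g (Sup K) - g (Inf K))) - (exp (- t) * g t - g 0 + integral {0..t} (%s. exp (- s) * g s))\<bar> < e"
   by (simp add: F_def algebra_simps)
 qed
qed

lemma has_rs_integral_unique:
 assumes ab: "a <= b" and I: "has_rs_integral f g a b I" and J: "has_rs_integral f g a b J"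
 shows "I = J"
proof (rule ccontr)
 assume "I \<noteq> J"
 define e where "e = \<bar>I - J\<bar> / 2"
 have e: "e > 0" using \<open>I \<noteq> J\<close> by (simp add: e_def)
 define S where "S \<D> = (\<Sum>(x, K)\<in>\<D>. f x * (g (Sup K) - g (Inf K)))" for \<D>
 obtain d1 where d1: "d1 > 0" "!!\<D>. \<D> tagged_division_of {a..b} ==> (\<forall>(x, K)\<in>\<D>. Sup K - Inf K < d1) ==> \<bar>S \<D> - I\<bar> < e"
  using I e unfolding has_rs_integral_def S_def by meson
 obtain d2 where d2: "d2 > 0" "!!\<D>. \<D> tagged_division_of {a..b} ==> (\<forall>(x, K)\<in>\<D>. Sup K - Inf K < d2) ==> \<bar>S \<D> - J\<bar> < e"
  using J e unfolding has_rs_integral_def S_def by meson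
 define d where "d = min d1 d2 / 3"
 have d: "d > 0" using d1 d2 by (simp add: d_def)
 have "gauge (%x. ball x d)" using d by (simp add: gauge_ball)
 then obtain \<D> where D: "\<D> tagged_division_of {a..b}" "(%x. ball x d) fine \<D>"
  using fine_division_exists_real by blast
 have mesh: "Sup K - Inf K < min d1 d2" if xK: "(x, K) \<in> \<D>" for x K
 proof -
  obtain u v where K: "K = cbox u v" using D xK by (meson tagged_division_ofD(4))
  have xin: "x \<in> K" using D xK by (meson tagged_division_ofD(2))
  have uv: "u <= x" "x <= v" using xin K by auto
  have sub: "K \<subseteq> ball x d" using D xK by (auto simp: fine_def)
  have "u \<in> K" "v \<in> K" using K uv by auto
  hence "u \<in> ball x d" "v \<in> ball x d" using sub by blast+
  hence "v - u < 2 * d" by (auto simp: dist_real_def)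
  moreover have "Sup K = v" "Inf K = u" using K uv by auto
  moreover have "min d1 d2 > 0" using d1 d2 by simp
  ultimately show ?thesis unfolding d_def by linarith
 qed
 have b: "\<bar>S \<D> - I\<bar> < e" "\<bar>S \<D> - J\<bar> < e" using d1(2)[OF D(1)] d2(2)[OF D(1)] mesh by force+
 have "\<bar>I - J\<bar> <= \<bar>S \<D> - I\<bar> + \<bar>S \<D> - J\<bar>" by linarith
 also have "\<dots> < e + e" by (rule add_strict_mono[OF b])
 finally show False by (simp add: e_def)
qed

lemma rs_integral_exp:
 fixes g :: "real => real"
 assumes t: "0 <= t" and g: "continuous_on {0..t} g"
 shows "rs_integral (%s. exp (- s)) g 0 t = exp (- t) * g t - g 0 + integral {0..t} (%s. exp (- s) * g s)"
 unfolding rs_integral_def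
proof (rule the_equality)
 show "has_rs_integral (%s. exp (- s)) g 0 t (exp (- t) * g t - g 0 + integral {0..t} (%s. exp (- s) * g s))"
  by (rule has_rs_integral_exp[OF assms])
 fix I assume "has_rs_integral (%s. exp (- s)) g 0 t I"
 thus "I = exp (- t) * g t - g 0 + integral {0..t} (%s. exp (- s) * g s)"
  by (rule has_rs_integral_unique[OF t _ has_rs_integral_exp[OF assms]])
qed

subsection \<open>The linear equation \<open>f' = g - \<alpha> f\<close>\<close>

lemma linear_ode_solution:
 fixes g :: "real => real" and c \<alpha> t :: real
 assumes g: "continuous_on {0..} g" and t: "0 <= t"
 defines "f \<equiv> %t. exp (- \<alpha> * t) * (c + integral {0..t} (%s. exp (\<alpha> * s) * g s))"
 shows "((%s. g s - \<alpha> * f s) has_integral (f t - c)) {0..t}" and "continuous_on {0..t} f"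
proof -
 have cg: "continuous_on {0..t} (%s. exp (\<alpha> * s) * g s)"
  by (intro continuous_intros continuous_on_subset[OF g]) auto
 have d: "(f has_real_derivative g s - \<alpha> * f s) (at s within {0..t})" if s: "s \<in> {0..t}" for s
 proof -
  have d1: "((%s. integral {0..s} (%s. exp (\<alpha> * s) * g s)) has_real_derivative exp (\<alpha> * s) * g s) (at s within {0..t})"
   by (rule integral_has_real_derivative[OF cg s])
  define I where "I s = integral {0..s} (%s. exp (\<alpha> * s) * g s)" for s
  have "((%s. exp (- \<alpha> * s) * (c + I s)) has_real_derivative (- \<alpha> * exp (- \<alpha> * s)) * (c + I s) + (exp (\<alpha> * s) * g s) * exp (- \<alpha> * s)) (at s within {0..t})"
   by (rule derivative_eq_intros d1[folded I_def] refl | simp)+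
  moreover have gE: "(exp (\<alpha> * s) * g s) * exp (- \<alpha> * s) = g s"
  proof -
   have "(exp (\<alpha> * s) * g s) * exp (- \<alpha> * s) = (exp (\<alpha> * s) * exp (- \<alpha> * s)) * g s" by (simp only: mult_ac)
   also have "exp (\<alpha> * s) * exp (- \<alpha> * s) = 1" by (simp add: exp_minus)
   finally show ?thesis by simp
  qed
  moreover have "(- \<alpha> * exp (- \<alpha> * s)) * (c + I s) + (exp (\<alpha> * s) * g s) * exp (- \<alpha> * s) = g s - \<alpha> * (exp (- \<alpha> * s) * (c + I s))"
   unfolding gE by (simp add: algebra_simps)
  moreover have "f = (%s. exp (- \<alpha> * s) * (c + I s))" by (simp add: f_def I_def)
  ultimately show ?thesis by (simp only:)
 qed
 show "continuous_on {0..t} f" using d by (rule DERIV_continuous_on)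
 have "((%s. g s - \<alpha> * f s) has_integral (f t - f 0)) {0..t}"
  by (rule fundamental_theorem_of_calculus[OF t]) (use d in \<open>simp add: real_vector_derivative\<close>)
 thus "((%s. g s - \<alpha> * f s) has_integral (f t - c)) {0..t}" by (simp add: f_def)
qed

lemma linear_ode_zero:
 fixes f :: "real => real"
 assumes f: "continuous_on {0..T} f" and T: "0 <= T"
  and eq: "!!t. t \<in> {0..T} ==> f t = - \<alpha> * integral {0..t} f"
 shows "f T = 0"
proof -
 have d: "(f has_real_derivative - \<alpha> * f s) (at s within {0..T})" if s: "s \<in> {0..T}" for s
 proof -
  have "((%t. - \<alpha> * integral {0..t} f) has_real_derivative - \<alpha> * f s) (at s within {0..T})"
   using integral_has_real_derivative[OF f s] by (rule DERIV_cmult)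
  thus ?thesis by (rule has_field_derivative_transform_within[OF _ zero_less_one s]) (use eq in auto)
 qed
 have "((%s. exp (\<alpha> * s) * f s) has_real_derivative 0) (at s within {0..T})" if s: "s \<in> {0..T}" for s
  by (rule derivative_eq_intros d[OF s] refl | simp add: algebra_simps)+
 hence "\<exists>c. \<forall>s\<in>{0..T}. exp (\<alpha> * s) * f s = c"
  by (intro has_field_derivative_zero_constant) auto
 then obtain c where "!!s. s \<in> {0..T} ==> exp (\<alpha> * s) * f s = c" by blast
 from this[of 0] this[of T] eq[of 0] T show ?thesis by auto
qed

section \<open>The Gaussian space of fractional Brownian motion\<close>

text \<open>The process is the pointwise limit of its discretisations \<open>(t, w) \<mapsto> f (\<lfloor>n t\<rfloor> / n) w\<close>.\<close>

lemma continuous_process_jointly_measurable: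
 fixes f :: "real => 'a => real"
 assumes c: "!!w. w \<in> space M ==> continuous_on UNIV (%t. f t w)" and m: "!!t. f t \<in> borel_measurable M"
 shows "case_prod f \<in> borel_measurable (borel \<Otimes>\<^sub>M M)"
proof (rule borel_measurable_LIMSEQ_real)
 fix n :: nat
 have [measurable]: "f t \<in> borel_measurable M" for t by (rule m)
 have "(%x. (%i::int. %x. f (real_of_int i / real (Suc n)) (snd x)) (floor (real (Suc n) * fst x)) x) \<in> borel_measurable (borel \<Otimes>\<^sub>M M)"
  by (rule measurable_compose_countable) measurable
 thus "(%x. f (real_of_int (floor (real (Suc n) * fst x)) / real (Suc n)) (snd x)) \<in> borel_measurable (borel \<Otimes>\<^sub>M M)" by simp
next
 fix x :: "real \<times> 'a" assume x: "x \<in> space (borel \<Otimes>\<^sub>M M)"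
 obtain t w where tw: "x = (t, w)" by fastforce
 have w: "w \<in> space M" using x tw by (auto simp: space_pair_measure)
 have "(%n. real_of_int (floor (real (Suc n) * t)) / real (Suc n)) \<longlonglongrightarrow> t"
 proof (rule LIM_zero_cancel, rule tendsto_0_le[OF LIMSEQ_inverse_real_of_nat, where K=1], rule always_eventually, rule allI)
  fix n
  have "\<bar>real_of_int (floor (real (Suc n) * t)) - real (Suc n) * t\<bar> <= 1" by linarith
  hence "\<bar>real_of_int (floor (real (Suc n) * t)) - real (Suc n) * t\<bar> / real (Suc n) <= 1 / real (Suc n)" by (intro divide_right_mono) auto
  moreover have "real_of_int (floor (real (Suc n) * t)) / real (Suc n) - t = (real_of_int (floor (real (Suc n) * t)) - real (Suc n) * t) / real (Suc n)"
   by (simp add: field_simps)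
  ultimately show "norm (real_of_int (floor (real (Suc n) * t)) / real (Suc n) - t) <= norm (inverse (real (Suc n))) * 1"
   by (simp add: abs_divide inverse_eq_divide)
 qed
 hence "(%n. f (real_of_int (floor (real (Suc n) * t)) / real (Suc n)) w) \<longlonglongrightarrow> f t w"
  using c[OF w] by (intro continuous_on_tendsto_compose[of UNIV "%t. f t w"]) auto
 thus "(%n. f (real_of_int (floor (real (Suc n) * fst x)) / real (Suc n)) (snd x)) \<longlonglongrightarrow> case_prod f x" by (simp add: tw)
qed

context gaussian_space begin

text \<open>A minimising sequence for the distance to \<open>G\<close> is Cauchy by the parallelogram identity, and its limit
 lies in \<open>G\<close> by closedness.\<close>

lemma orthogonal_projection:
 assumes Z: "sqint M Z"
 obtains P where "P \<in> G" "!!W. W \<in> G ==> ip (%w. Z w - P w) W = 0"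
proof -
 define D where "D W = (dl2 M W Z)^2" for W
 define d where "d = Inf (D ` G)"
 note sq = sqint_diff[OF sqint_G Z]
 have bb: "bdd_below (D ` G)" by (rule bdd_belowI[of _ 0]) (auto simp: D_def)
 have lb: "d <= D W" if "W \<in> G" for W unfolding d_def using that by (intro cInf_lower bb) auto
 have "\<exists>W\<in>G. D W < d + 1 / real (Suc n)" for n
  using cInf_lessD[of "D ` G" "d + 1 / real (Suc n)"] G_zero by (auto simp: d_def)
 then obtain W where W: "!!n. W n \<in> G" "!!n. D (W n) < d + 1 / real (Suc n)" by metis
 have par: "(dl2 M (W j) (W k))^2 < 2 / real (Suc j) + 2 / real (Suc k)" for j k
 proof -
  define V where "V w = 1/2 * (W j w + W k w)" for w
  have V: "V \<in> G" unfolding V_def by (intro G_cmult G_add W)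
  note i = sqint_square[OF sq[OF W(1)]] sqint_square[OF sq[OF V]]
  have "(W j w - W k w)^2 = 2 * (W j w - Z w)^2 + 2 * (W k w - Z w)^2 - 4 * (V w - Z w)^2" for w
   by (simp add: V_def power2_eq_square field_simps)
  hence "(dl2 M (W j) (W k))^2 = 2 * D (W j) + 2 * D (W k) - 4 * D V" unfolding D_def l2_squared using i by simp
  thus ?thesis using W(2)[of j] W(2)[of k] lb[OF V] by simp
 qed
 have "\<exists>N. \<forall>j\<ge>N. \<forall>k\<ge>N. dl2 M (W j) (W k) < e" if e: "e > 0" for e
 proof -
  obtain N where N: "1 / real (Suc N) < e^2 / 4" using nat_approx_posE[of "e^2 / 4"] e by auto
  have "dl2 M (W j) (W k) < e" if "N <= j" "N <= k" for j k
  proof -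
   have "2 / real (Suc j) <= 2 / real (Suc N)" "2 / real (Suc k) <= 2 / real (Suc N)" using that by (auto intro!: divide_left_mono)
   hence "(dl2 M (W j) (W k))^2 < e^2" using par[of j k] N by simp
   thus ?thesis using e by (simp add: power_less_imp_less_base)
  qed
  thus ?thesis by blast
 qed
 then obtain P where P: "sqint M P" "(%k. dl2 M (W k) P) \<longlonglongrightarrow> 0" using l2_complete[of W] sqint_G[OF W(1)] by blast
 have PG: "P \<in> G" by (rule G_limit[OF W(1) P])
 have "(%k. dl2 M (W k) Z) \<longlonglongrightarrow> dl2 M P Z"
  by (rule l2_tendsto_norm) (use P(2) sq[OF W(1)] sq[OF PG] in auto)
 hence "(%k. D (W k)) \<longlonglongrightarrow> D P" unfolding D_def by (intro tendsto_intros)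
 moreover have "(%n. d + 1 / real (Suc n)) \<longlonglongrightarrow> d + 0" by (intro tendsto_intros LIMSEQ_Suc[OF lim_1_over_n])
 ultimately have Pd: "D P <= d" using W(2) less_imp_le by (intro LIMSEQ_le) auto
 have "ip (%w. Z w - P w) V = 0" if V: "V \<in> G" for V
 proof -
  define b c where "b = ip (%w. Z w - P w) V" and "c = (l2 M V)^2"
  note s = sqint_diff[OF Z P(1)] sqint_G[OF V]
  have "(P w + t * V w - Z w)^2 = (P w - Z w)^2 - 2 * t * ((Z w - P w) * V w) + t^2 * (V w)^2" for t w
   by (simp add: power2_eq_square algebra_simps)
  hence "D (%w. P w + t * V w) = D P - 2 * t * b + t^2 * c" for t
   unfolding D_def l2_squared b_def c_def using sqint_square[OF sq[OF PG]] sqint_mult[OF s] sqint_square[OF s(2)] by simp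
  hence q: "0 <= - 2 * t * b + t^2 * c" for t using lb[OF G_add[OF PG G_cmult[OF V, of t]]] Pd by simp
  have c: "0 <= c" by (simp add: c_def)
  define u where "u = b / (c + 1)"
  have b: "b = u * (c + 1)" using c by (simp add: u_def)
  have "u^2 * (c + 2) <= 0" using q[of u] unfolding b by (simp add: power2_eq_square algebra_simps)
  hence "u^2 <= 0" using c by (simp add: mult_le_0_iff)
  thus ?thesis using b by (simp add: b_def)
 qed
 thus thesis using that PG by blast
qed

text \<open>The difference of the integral and its projection to \<open>G\<close> is orthogonal to every \<open>Q t\<close>, hence, exchanging
 expectation and integral, to the integral itself, so it vanishes.\<close>

lemma process_integral_in_G:
 fixes Q :: "real => 'a => real"
 assumes Qm: "case_prod Q \<in> borel_measurable (borel \<Otimes>\<^sub>M M)" and ab: "a <= b"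
  and Q: "!!t. t \<in> {a..b} ==> Q t \<in> G \<and> l2 M (Q t) <= K"
 shows "(%w. LBINT t:{a..b}. Q t w) \<in> G"
proof -
 define I where "I w = (LBINT t:{a..b}. Q t w)" for w
 have Qb: "sqint M (Q t) \<and> l2 M (Q t) <= K" if "t \<in> {a..b}" for t using Q[OF that] sqint_G by blast
 have I: "sqint M I" unfolding I_def by (rule process_integral_sqint[OF Qm ab Qb])
 obtain P where P: "P \<in> G" "!!W. W \<in> G ==> ip (%w. I w - P w) W = 0" using orthogonal_projection[OF I] by blast
 define R where "R w = I w - P w" for w
 have R: "sqint M R" unfolding R_def by (rule sqint_diff[OF I sqint_G[OF P(1)]])
 have "ip R I = (LBINT t:{a..b}. ip R (Q t))" unfolding I_def using process_integral_inner[OF Qm ab Qb R] by blast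
 also have "\<dots> = (LBINT t:{a..b}. 0)" by (rule set_lebesgue_integral_cong) (use P(2) Q in \<open>auto simp: R_def\<close>)
 finally have "ip R I = 0" by simp
 moreover have "ip R P = 0" using P by (simp add: R_def)
 moreover have "R w * R w = R w * I w - R w * P w" for w unfolding right_diff_distrib[symmetric] R_def ..
 hence "ip R R = ip R I - ip R P" using sqint_mult[OF R I] sqint_mult[OF R sqint_G[OF P(1)]] by simp
 ultimately have "l2 M R = 0" unfolding l2_def power2_eq_square by simp
 from l2_eq_0_AE[OF R this] have "AE w in M. P w = I w" by eventually_elim (simp add: R_def)
 from G_cong_AE[OF P(1) sqint_measurable[OF I] this] show ?thesis unfolding I_def[abs_def] .
qed

end

locale fbm = prob_space M + hurst H for M :: "'a measure" and H :: real +
 fixes B :: "real => 'a => real"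
 assumes fbm: "fractional_brownian_motion M H B"
begin

definition Lin :: "('a => real) set" where
 "Lin = {%w. \<Sum>t\<in>S. c t * B t w | S c. finite S \<and> S \<subseteq> {0..}}"

definition G :: "('a => real) set" where
 "G = {Z. sqint M Z \<and> (\<forall>e>0. \<exists>W\<in>Lin. dl2 M W Z < e)}"

lemma B_measurable: "0 <= t ==> B t \<in> borel_measurable M"
 using fbm by (auto simp: fractional_brownian_motion_def centered_gaussian_process_def)

lemma B_continuous: "w \<in> space M ==> continuous_on {0..} (%t. B t w)"
 using fbm by (auto simp: fractional_brownian_motion_def)

lemma B_covariance: "0 <= s ==> 0 <= t ==>
  ip (B s) (B t) = 1/2 * (t powr (2*H) + s powr (2*H) - \<bar>t - s\<bar> powr (2*H))"
 using fbm by (auto simp: fractional_brownian_motion_def)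

lemma gaussian_Lin: assumes "W \<in> Lin" shows "gaussian W"
proof -
 obtain S c where W: "W = (%w. \<Sum>t\<in>S. c t * B t w)" "finite S" "S \<subseteq> {0..}" using assms by (auto simp: Lin_def)
 have m: "W \<in> borel_measurable M" unfolding W(1) using W B_measurable by (intro borel_measurable_sum borel_measurable_times) auto
 have "(AE w in M. W w = 0) \<or> (\<exists>\<sigma>>0. distributed M lborel W (normal_density 0 \<sigma>))"
  unfolding W(1) using fbm W(2,3) unfolding fractional_brownian_motion_def centered_gaussian_process_def by blast
 thus ?thesis using gaussian_null[OF m] gaussian_distributed by blast
qed

lemma Lin_add: assumes "V \<in> Lin" "W \<in> Lin" shows "(%w. V w + W w) \<in> Lin"
proof -
 obtain S c where V: "V = (%w. \<Sum>t\<in>S. c t * B t w)" "finite S" "S \<subseteq> {0..}" using assms by (auto simp: Lin_def)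
 obtain R d where W: "W = (%w. \<Sum>t\<in>R. d t * B t w)" "finite R" "R \<subseteq> {0..}" using assms by (auto simp: Lin_def)
 define e where "e t = (if t \<in> S then c t else 0) + (if t \<in> R then d t else 0)" for t
 have "V w + W w = (\<Sum>t\<in>S \<union> R. e t * B t w)" for w
 proof -
  have "V w = (\<Sum>t\<in>S \<union> R. (if t \<in> S then c t else 0) * B t w)"
   unfolding V(1) using V W by (intro sum.mono_neutral_cong_left) auto
  moreover have "W w = (\<Sum>t\<in>S \<union> R. (if t \<in> R then d t else 0) * B t w)"
   unfolding W(1) using V W by (intro sum.mono_neutral_cong_left) auto
  ultimately show ?thesis by (simp add: e_def distrib_right sum.distrib)
 qed
 hence "(%w. V w + W w) = (%w. \<Sum>t\<in>S \<union> R. e t * B t w)" by blast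
 thus ?thesis unfolding Lin_def using V W by blast
qed

lemma Lin_cmult: assumes "W \<in> Lin" shows "(%w. k * W w) \<in> Lin"
proof -
 obtain S c where W: "W = (%w. \<Sum>t\<in>S. c t * B t w)" "finite S" "S \<subseteq> {0..}" using assms by (auto simp: Lin_def)
 have "(%w. k * W w) = (%w. \<Sum>t\<in>S. (k * c t) * B t w)" unfolding W(1) by (simp add: sum_distrib_left mult.assoc)
 moreover have "(%w. \<Sum>t\<in>S. (%t. k * c t) t * B t w) \<in> Lin"
  unfolding Lin_def using W by (intro CollectI exI[of _ S] exI[of _ "%t. k * c t"]) auto
 ultimately show ?thesis by simp
qed

lemma Lin_zero: "(%w. 0) \<in> Lin"
proof -
 have "(%w. \<Sum>t\<in>{}. 0 * B t w) \<in> Lin"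
  unfolding Lin_def by (intro CollectI exI[of _ "{}"] exI[of _ "%_. 0"]) auto
 thus ?thesis by simp
qed

lemma Lin_sqint: "W \<in> Lin ==> sqint M W" using gaussian_Lin gaussian_sqint by blast

lemma Lin_subset_G: "Lin \<subseteq> G"
 unfolding G_def using Lin_sqint by (auto intro!: bexI)

sublocale gaussian_space M G
proof
 show "gaussian Z" if Z: "Z \<in> G" for Z
 proof -
  have "\<exists>W\<in>Lin. dl2 M W Z < 1 / real (Suc n)" for n using Z by (auto simp: G_def)
  then obtain W where W: "!!n. W n \<in> Lin" "!!n. dl2 M (W n) Z < 1 / real (Suc n)" by metis
  have "(%n. dl2 M (W n) Z) \<longlonglongrightarrow> 0"
   by (rule tendsto_0_le[OF LIMSEQ_inverse_real_of_nat, where K=1], rule always_eventually)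
    (use W(2) in \<open>auto simp: inverse_eq_divide less_imp_le\<close>)
  thus ?thesis using gaussian_l2_limit[of W Z] gaussian_Lin W Z by (auto simp: G_def)
 qed
 show "(%w. 0) \<in> G" using Lin_zero Lin_subset_G by blast
 show "(%w. Z w + W w) \<in> G" if Z: "Z \<in> G" and W: "W \<in> G" for Z W
  unfolding G_def
 proof (intro CollectI conjI allI impI)
  have sq: "sqint M Z" "sqint M W" using Z W by (auto simp: G_def)
  show "sqint M (%w. Z w + W w)" using sq by (rule sqint_add)
  fix e :: real assume "e > 0"
  hence "e/2 > 0" by simp
  then obtain Z' W' where zw: "Z' \<in> Lin" "dl2 M Z' Z < e/2" "W' \<in> Lin" "dl2 M W' W < e/2"
   using Z W unfolding G_def by blast
  have "l2 M (%w. (Z' w + W' w) - (Z w + W w)) = l2 M (%w. (Z' w - Z w) + (W' w - W w))" by (simp add: algebra_simps)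
  also have "\<dots> <= dl2 M Z' Z + dl2 M W' W"
   by (intro l2_triangle sqint_diff sq Lin_sqint zw)
  finally show "\<exists>V\<in>Lin. l2 M (%w. V w - (Z w + W w)) < e"
   using zw by (intro bexI[OF _ Lin_add[OF zw(1,3)]]) auto
 qed
 show "(%w. c * Z w) \<in> G" if Z: "Z \<in> G" for Z c
  unfolding G_def
 proof (intro CollectI conjI allI impI)
  have sq: "sqint M Z" using Z by (auto simp: G_def)
  show "sqint M (%w. c * Z w)" using sq by (rule sqint_cmult)
  fix e :: real assume e: "e > 0"
  hence "e / (\<bar>c\<bar> + 1) > 0" by (simp add: divide_pos_pos add_nonneg_pos)
  then obtain Z' where z: "Z' \<in> Lin" "dl2 M Z' Z < e / (\<bar>c\<bar> + 1)"
   using Z unfolding G_def by blast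
  have "l2 M (%w. c * Z' w - c * Z w) = \<bar>c\<bar> * dl2 M Z' Z" by (simp add: right_diff_distrib[symmetric] l2_cmult)
  also have "\<dots> <= (\<bar>c\<bar> + 1) * dl2 M Z' Z" by (intro mult_right_mono) auto
  also have "\<dots> < e" using z(2) by (simp add: pos_less_divide_eq add_nonneg_pos mult.commute)
  finally show "\<exists>V\<in>Lin. l2 M (%w. V w - c * Z w) < e" by (rule bexI[OF _ Lin_cmult[OF z(1)]])
 qed
 show "Z \<in> G" if sq: "sqint M Z" and cl: "!!e. e > 0 ==> \<exists>W\<in>G. dl2 M W Z < e" for Z
  unfolding G_def
 proof (intro CollectI conjI allI impI sq)
  fix e :: real assume "e > 0"
  then obtain W where W: "W \<in> G" "dl2 M W Z < e/2" using cl[of "e/2"] by auto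
  then obtain V where V: "V \<in> Lin" "dl2 M V W < e/2" unfolding G_def using \<open>e > 0\<close> by (auto dest: spec[of _ "e/2"])
  have "dl2 M V Z <= dl2 M V W + dl2 M W Z"
   by (rule l2_triangle3) (use V W sq Lin_sqint in \<open>auto simp: G_def\<close>)
  thus "\<exists>V\<in>Lin. dl2 M V Z < e" using V W by (intro bexI[OF _ V(1)]) auto
 qed
qed

definition clock :: "real => real" where "clock t = H * exp (t / H)"

text \<open>The Lamperti transform of \<open>B\<close>; self-similarity makes it stationary.\<close>

definition U :: "real => 'a => real" where "U t w = exp (- t) * B (clock t) w"

lemma clock_pos: "0 < clock t" by (simp add: clock_def)

lemma U_in_G: "U t \<in> G"
proof -
 have "(%w. \<Sum>s\<in>{clock t}. exp (- t) * B s w) \<in> Lin" unfolding Lin_def using clock_pos[of t] by (auto intro!: exI[of _ "{clock t}"] exI[of _ "%_. exp (- t)"])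
 thus ?thesis using Lin_subset_G by (auto simp: U_def[abs_def])
qed

lemma U_measurable[measurable]: "U t \<in> borel_measurable M" using U_in_G measurable_G by blast

lemma U_continuous: assumes "w \<in> space M" shows "continuous_on A (%t. U t w)"
proof -
 have "continuous_on UNIV (%t. U t w)"
  unfolding U_def clock_def by (intro continuous_intros continuous_on_compose2[OF B_continuous[OF assms]]) auto
 thus ?thesis by (rule continuous_on_subset) auto
qed

lemma U_jointly_measurable[measurable]: "case_prod U \<in> borel_measurable (borel \<Otimes>\<^sub>M M)"
 by (rule continuous_process_jointly_measurable) (auto intro: U_continuous)

lemma U_covariance_le: assumes st: "s <= t" shows "ip (U s) (U t) = \<gamma> (t - s)"
proof -
 define y where "y = exp (- (t - s) / H)"
 have y: "0 < y" "y <= 1" using y_bounds[of "t - s"] st by (auto simp: y_def)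
 have p: "clock u powr (2 * H) = H powr (2 * H) * exp (2 * u)" for u
  unfolding clock_def by (simp add: powr_mult exp_powr_real)
 have "clock s = clock t * y" unfolding clock_def y_def by (simp add: exp_add[symmetric] diff_divide_distrib)
 hence "\<bar>clock t - clock s\<bar> = clock t * (1 - y)" using y clock_pos[of t] by (simp add: right_diff_distrib abs_of_nonneg mult_left_le)
 hence d: "\<bar>clock t - clock s\<bar> powr (2 * H) = H powr (2 * H) * exp (2 * t) * (1 - y) powr (2 * H)"
  using y clock_pos[of t] p[of t] by (simp add: powr_mult)
 have "ip (U s) (U t) = expectation (%w. (exp (- s) * exp (- t)) * (B (clock s) w * B (clock t) w))"
  by (rule bochner_cong) (auto simp: U_def)
 also have "\<dots> = exp (- s) * exp (- t) * (1/2 * (clock t powr (2*H) + clock s powr (2*H) - \<bar>clock t - clock s\<bar> powr (2*H)))"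
  using B_covariance[of "clock s" "clock t"] clock_pos[of s] clock_pos[of t] by simp
 also have "\<dots> = 1/2 * H powr (2 * H) * ((exp (- s) * exp (- t) * exp (2 * s)) + (exp (- s) * exp (- t) * exp (2 * t)) * (1 - (1 - y) powr (2 * H)))"
  unfolding d p by (simp add: algebra_simps)
 also have "exp (- s) * exp (- t) * exp (2 * s) = exp (- (t - s))" by (simp add: exp_add[symmetric])
 also have "exp (- s) * exp (- t) * exp (2 * t) = exp (t - s)" by (simp add: exp_add[symmetric])
 finally show ?thesis by (simp add: \<gamma>_def y_def)
qed

lemma U_covariance: "ip (U s) (U t) = \<gamma> \<bar>t - s\<bar>"
proof (cases "s <= t")
 case True thus ?thesis using U_covariance_le by simp
next
 case False
 hence "ip (U t) (U s) = \<gamma> (s - t)" by (intro U_covariance_le) auto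
 thus ?thesis using False by (simp add: mult.commute)
qed

lemma U_l2: "(l2 M (U t))^2 = \<gamma> 0"
 using U_covariance[of t t] by (simp add: l2_squared) (simp add: power2_eq_square)

lemma U_sqint: "sqint M (U t)" using U_in_G sqint_G by blast

lemma U_increment: "(dl2 M (U t) (U s))^2 = 2 * (\<gamma> 0 - \<gamma> \<bar>t - s\<bar>)"
proof -
 have "(dl2 M (U t) (U s))^2 = expectation (%w. U t w * U t w + U s w * U s w - 2 * (U s w * U t w))"
  unfolding l2_squared by (rule bochner_cong) (auto simp: power2_eq_square algebra_simps)
 also have "\<dots> = \<gamma> 0 + \<gamma> 0 - 2 * \<gamma> \<bar>t - s\<bar>"
  using sqint_mult[OF U_sqint U_sqint, of t t] sqint_mult[OF U_sqint U_sqint, of s s] sqint_mult[OF U_sqint U_sqint, of s t]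
  by (simp add: U_covariance)
 finally show ?thesis by simp
qed

lemma U_increment_le: assumes "\<bar>t - s\<bar> <= 1" shows "dl2 M (U t) (U s) <= 2 * \<bar>t - s\<bar> powr H"
proof (rule power2_le_imp_le)
 have "(dl2 M (U t) (U s))^2 <= 2 * (2 * \<bar>t - s\<bar> powr (2 * H))"
  unfolding U_increment using \<gamma>_holder[of "\<bar>t - s\<bar>"] assms by auto
 also have "\<dots> = (2 * \<bar>t - s\<bar> powr H)^2" by (simp add: power2_eq_square powr_add[symmetric])
 finally show "(dl2 M (U t) (U s))^2 <= (2 * \<bar>t - s\<bar> powr H)^2" .
qed simp

text \<open>The pathwise integral in the definition of the noise is the integration by parts formula for \<open>e\<^sup>-\<^sup>s\<close>
 against \<open>B \<circ> clock\<close>.\<close>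

lemma Y1_eq:
 assumes w: "w \<in> space M" and t: "0 <= t"
 shows "Y1 H B t w = U t w - U 0 w + integral {0..t} (%s. U s w)"
proof -
 have "continuous_on {0..t} (%s. B (H * exp (s / H)) w)"
  by (intro continuous_intros continuous_on_compose2[OF B_continuous[OF w]]) auto
 from rs_integral_exp[OF t this] show ?thesis by (simp add: Y1_def U_def clock_def)
qed

end

section \<open>Covariance of the noise\<close>

lemma integral_shift_origin: "integral {s..t} (%u::real. h (u - s)) = integral {0..t - s} (h :: real => real)"
 using integral_shift_real_ivl[of 0 "- s" "t - s" h] by simp

lemma integral_reflect_origin: "integral {s..t} (%u::real. h (t - u)) = integral {0..t - s} (h :: real => real)"
proof -
 have "integral {s..t} (%u. h (t - u)) = integral {- t..- s} (%u. h (u + t))"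
  using Henstock_Kurzweil_Integration.integral_reflect_real[of "- s" "- t" "%u. h (u + t)"] by simp
 also have "\<dots> = integral {0..t - s} h" using integral_shift_real_ivl[of 0 t "t - s" h] by simp
 finally show ?thesis .
qed

lemma lborel_set_integral_continuous:
 fixes f :: "real => real"
 assumes "continuous_on {a..b} f"
 shows "(LBINT u:{a..b}. f u) = integral {a..b} f"
 by (rule set_borel_integral_eq_integral(2)[OF borel_integrable_atLeastAtMost'[OF assms]])

lemma partition_mono:
 fixes t :: "nat => real"
 assumes t: "!!i. i < n ==> t i <= t (Suc i)" and "i <= j" "j <= n"
 shows "t i <= t j"
 using assms(2,3)
proof (induction j rule: dec_induct)
 case (step k)
 thus ?case using t[of k] by simp
qed simp

context hurst begin

definition Qi :: "real => real" where "Qi x = integral {0..x} q"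

lemma Qi_increment: assumes "0 <= x" "x <= y"
 shows "Qi y - Qi x = integral {x..y} q" and "Qi y - Qi x <= Kq * (y - x)"
proof -
 have i: "q integrable_on {a..b}" if "0 <= a" for a b
  by (rule integrable_continuous_interval) (rule continuous_on_subset[OF continuous_on_q], use that in auto)
 show e: "Qi y - Qi x = integral {x..y} q"
  unfolding Qi_def using hk_combine[OF assms i] by simp
 have "integral {x..y} q <= integral {x..y} (%_. Kq)"
  by (rule integral_le[OF i integrable_const_ivl]) (use assms q_le in auto)
 thus "Qi y - Qi x <= Kq * (y - x)" unfolding e using assms by (simp add: mult.commute)
qed

text \<open>Positivity of the density \<open>r\<close> enters here: \<open>q\<close> increases, so \<open>Qi\<close> is convex, and convexity is
 positive correlation of disjoint increments of \<open>Y\<close>.\<close>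

lemma Qi_convex: assumes "0 <= x" "0 <= h" "0 <= k" shows "Qi (x + h) - Qi x <= Qi (x + k + h) - Qi (x + k)"
proof -
 have i: "(%u. q (y + u)) integrable_on {0..h}" if "0 <= y" for y
  by (intro integrable_continuous_interval continuous_on_compose2[OF continuous_on_q] continuous_intros) (use that in auto)
 have e: "Qi (y + h) - Qi y = integral {0..h} (%u. q (y + u))" if "0 <= y" for y
  using Qi_increment(1)[of y "y + h"] integral_shift_origin[of y "y + h" "%u. q (y + u)"] that assms by simp
 have "integral {0..h} (%u. q (x + u)) <= integral {0..h} (%u. q (x + k + u))"
  by (rule integral_le[OF i i]) (use assms in \<open>auto intro!: q_mono\<close>)
 thus ?thesis using e[of x] e[of "x + k"] assms by simp
qed

end

context fbm begin

abbreviation Y :: "real => 'a => real" where "Y \<equiv> Y1 H B"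

definition IU :: "real => real => 'a => real" where "IU s t w = (LBINT u:{s..t}. U u w)"

lemma IU_eq: "w \<in> space M ==> IU s t w = integral {s..t} (%u. U u w)"
 unfolding IU_def by (rule lborel_set_integral_continuous[OF U_continuous])

lemma l2_U: "l2 M (U t) = sqrt (\<gamma> 0)"
 using U_l2[of t] by (metis l2_nonneg real_sqrt_unique)

lemma IU_in_G: assumes "s <= t" shows "IU s t \<in> G"
 unfolding IU_def[abs_def]
 by (rule process_integral_in_G[OF U_jointly_measurable assms, where K="sqrt (\<gamma> 0)"]) (simp add: U_in_G l2_U)

lemma IU_inner:
 assumes st: "s <= t" and xi: "sqint M \<xi>"
 shows "ip \<xi> (IU s t) = (LBINT u:{s..t}. ip \<xi> (U u))"
 unfolding IU_def
 using process_integral_inner[OF U_jointly_measurable st _ xi, of "sqrt (\<gamma> 0)"] U_sqint l2_U by auto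

lemma Y_eq: "w \<in> space M ==> 0 <= t ==> Y t w = U t w - U 0 w + IU 0 t w"
 using Y1_eq[of w t] by (simp add: IU_eq)

lemma Y_increment_eq: assumes w: "w \<in> space M" and st: "0 <= s" "s <= t"
 shows "Y t w - Y s w = U t w - U s w + IU s t w"
proof -
 have "integral {0..s} (%u. U u w) + integral {s..t} (%u. U u w) = integral {0..t} (%u. U u w)"
  by (intro hk_combine st integrable_continuous_interval U_continuous w)
 thus ?thesis using st by (simp add: Y_eq[OF w] IU_eq[OF w])
qed

lemma Y_0: "w \<in> space M ==> Y 0 w = 0"
 by (simp add: Y_eq IU_eq)

lemma Y_in_G: assumes "0 <= t" shows "Y t \<in> G"
proof (rule G_cong_AE)
 show V: "(%w. U t w - U 0 w + IU 0 t w) \<in> G" by (intro G_add G_diff U_in_G IU_in_G assms)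
 hence [measurable]: "(%w. U t w - U 0 w + IU 0 t w) \<in> borel_measurable M" by measurable
 show "Y t \<in> borel_measurable M"
  by (subst measurable_cong[of _ _ "%w. U t w - U 0 w + IU 0 t w"]) (auto simp: Y_eq assms)
 show "AE w in M. U t w - U 0 w + IU 0 t w = Y t w" by (rule AE_I2) (simp add: Y_eq assms)
qed

lemma \<gamma>_abs_integral:
 assumes v: "s <= v" "v <= t"
 shows "integral {s..t} (%u. \<gamma> \<bar>u - v\<bar>) = integral {0..v - s} \<gamma> + integral {0..t - v} \<gamma>"
proof -
 have "continuous_on {s..t} (%u. \<gamma> \<bar>u - v\<bar>)"
  by (intro continuous_intros continuous_on_compose2[OF continuous_on_\<gamma>]) auto
 hence "integral {s..t} (%u. \<gamma> \<bar>u - v\<bar>) = integral {s..v} (%u. \<gamma> \<bar>u - v\<bar>) + integral {v..t} (%u. \<gamma> \<bar>u - v\<bar>)"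
  by (intro hk_combine[symmetric] v integrable_continuous_interval)
 also have "integral {s..v} (%u. \<gamma> \<bar>u - v\<bar>) = integral {s..v} (%u. \<gamma> (v - u))"
  by (rule hk_cong) (simp add: abs_minus_commute)
 also have "\<dots> = integral {0..v - s} \<gamma>" by (rule integral_reflect_origin)
 also have "integral {v..t} (%u. \<gamma> \<bar>u - v\<bar>) = integral {v..t} (%u. \<gamma> (u - v))"
  by (rule hk_cong) simp
 also have "\<dots> = integral {0..t - v} \<gamma>" by (rule integral_shift_origin)
 finally show ?thesis .
qed

lemma continuous_on_\<gamma>_abs: "continuous_on A (%u. \<gamma> \<bar>u - v\<bar>)"
 by (intro continuous_intros continuous_on_compose2[OF continuous_on_\<gamma>]) auto

lemma integral_q_eq: assumes x: "0 <= x"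
 shows "integral {0..x} q = integral {0..x} (%x. integral {0..x} \<gamma>) - (\<gamma> x - \<gamma> 0)"
proof -
 have "(\<gamma>1 has_integral \<gamma> x - \<gamma> 0) {0..x}"
 proof (rule fundamental_theorem_of_calculus_interior[OF x])
  show "continuous_on {0..x} \<gamma>" by (rule continuous_on_subset[OF continuous_on_\<gamma>]) auto
  show "(\<gamma> has_vector_derivative \<gamma>1 u) (at u)" if "u \<in> {0<..<x}" for u
   using \<gamma>_has_derivative[of u] that by (simp add: real_vector_derivative)
 qed
 moreover have "((%x. integral {0..x} \<gamma>) has_integral integral {0..x} (%x. integral {0..x} \<gamma>)) {0..x}"
  by (intro integrable_integral integrable_continuous_interval continuous_on_subset[OF continuous_on_integral_\<gamma>]) auto
 ultimately have "((%x. integral {0..x} \<gamma> - \<gamma>1 x) has_integral integral {0..x} (%x. integral {0..x} \<gamma>) - (\<gamma> x - \<gamma> 0)) {0..x}"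
  by (intro has_integral_diff)
 thus ?thesis by (simp add: q_def[abs_def] integral_unique)
qed

text \<open>Expanding the square of \<open>U\<^sub>t - U\<^sub>s + \<integral>\<^sub>s\<^sup>t U\<close>: the mixed term vanishes by symmetry, and the remaining two are
 the two parts of \<open>q\<close>.\<close>

lemma Y_increment_variance:
 assumes st: "0 <= s" "s <= t"
 shows "(dl2 M (Y t) (Y s))^2 = 2 * integral {0..t - s} q"
proof -
 define A D where "A w = U t w - U s w" and "D = IU s t" for w
 have AG: "A \<in> G" unfolding A_def[abs_def] by (intro G_diff U_in_G)
 have DG: "D \<in> G" unfolding D_def by (rule IU_in_G[OF st(2)])
 note sq = sqint_G[OF AG] sqint_G[OF DG]
 have UD: "ip (U v) D = integral {0..v - s} \<gamma> + integral {0..t - v} \<gamma>" if v: "s <= v" "v <= t" for v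
  unfolding D_def IU_inner[OF st(2) U_sqint] U_covariance
  by (subst lborel_set_integral_continuous[OF continuous_on_\<gamma>_abs]) (rule \<gamma>_abs_integral[OF v])
 have AD: "ip A D = 0"
 proof -
  have "ip A D = expectation (%w. U t w * D w - U s w * D w)"
   by (simp add: A_def left_diff_distrib)
  also have "\<dots> = ip (U t) D - ip (U s) D"
   by (intro bochner_diff sqint_mult U_sqint sq)
  also have "\<dots> = 0" using UD[of t] UD[of s] st by simp
  finally show ?thesis .
 qed
 have DD: "ip D D = 2 * integral {0..t - s} (%x. integral {0..x} \<gamma>)"
 proof -
  have c: "continuous_on {s..t} (%v. integral {0..v - s} \<gamma>)" "continuous_on {s..t} (%v. integral {0..t - v} \<gamma>)"
   by (intro continuous_intros continuous_on_compose2[OF continuous_on_integral_\<gamma>]; auto)+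
  have "ip D D = (LBINT v:{s..t}. ip D (U v))"
   unfolding D_def by (rule IU_inner[OF st(2) sqint_G[OF IU_in_G[OF st(2)]]])
  also have "\<dots> = (LBINT v:{s..t}. integral {0..v - s} \<gamma> + integral {0..t - v} \<gamma>)"
  proof (rule set_lebesgue_integral_cong, simp, intro allI impI)
   fix v assume "v \<in> {s..t}"
   thus "ip D (U v) = integral {0..v - s} \<gamma> + integral {0..t - v} \<gamma>"
    using UD[of v] by (simp add: mult.commute)
  qed
  also have "\<dots> = integral {s..t} (%v. integral {0..v - s} \<gamma> + integral {0..t - v} \<gamma>)"
   by (rule lborel_set_integral_continuous) (intro continuous_intros c)
  also have "\<dots> = integral {s..t} (%v. integral {0..v - s} \<gamma>) + integral {s..t} (%v. integral {0..t - v} \<gamma>)"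
   by (intro hk_add integrable_continuous_interval c)
  also have "integral {s..t} (%v. integral {0..v - s} \<gamma>) = integral {0..t - s} (%x. integral {0..x} \<gamma>)"
   by (rule integral_shift_origin)
  also have "integral {s..t} (%v. integral {0..t - v} \<gamma>) = integral {0..t - s} (%x. integral {0..x} \<gamma>)"
   by (rule integral_reflect_origin)
  finally show ?thesis by simp
 qed
 have "(dl2 M (Y t) (Y s))^2 = expectation (%w. (A w)^2 + 2 * (A w * D w) + D w * D w)"
  unfolding l2_squared
 proof (rule bochner_cong[OF refl])
  fix w assume "w \<in> space M"
  hence eq: "Y t w - Y s w = A w + D w" using Y_increment_eq[OF _ st] by (simp add: A_def D_def)
  show "(Y t w - Y s w)^2 = (A w)^2 + 2 * (A w * D w) + D w * D w"
   unfolding eq by (simp add: power2_eq_square algebra_simps)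
 qed
 also have "\<dots> = expectation (%w. (A w)^2) + 2 * ip A D + ip D D"
  using sqint_square[OF sq(1)] sqint_mult[OF sq] sqint_mult[OF sq(2) sq(2)] by simp
 also have "expectation (%w. (A w)^2) = 2 * (\<gamma> 0 - \<gamma> (t - s))"
  using U_increment[of t s] st by (simp add: A_def l2_squared)
 finally show ?thesis using AD DD st by (simp add: integral_q_eq)
qed

lemma Y_sqint: "0 <= t ==> sqint M (Y t)" using Y_in_G sqint_G by blast

lemma Y_variance: assumes t: "0 <= t" shows "ip (Y t) (Y t) = 2 * integral {0..t} q"
proof -
 have "(dl2 M (Y t) (Y 0))^2 = ip (Y t) (Y t)"
  unfolding l2_squared by (rule bochner_cong) (auto simp: Y_0 power2_eq_square)
 thus ?thesis using Y_increment_variance[of 0 t] t by simp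
qed

lemma Y_covariance: assumes st: "0 <= s" "s <= t" shows "ip (Y s) (Y t) = Qi s + Qi t - Qi (t - s)"
proof -
 have t: "0 <= t" using st by simp
 note i = sqint_mult[OF Y_sqint[OF st(1)] Y_sqint[OF st(1)]] sqint_mult[OF Y_sqint[OF t] Y_sqint[OF t]] sqint_mult[OF Y_sqint[OF st(1)] Y_sqint[OF t]]
 have "(dl2 M (Y t) (Y s))^2 = expectation (%w. Y t w * Y t w + Y s w * Y s w - 2 * (Y s w * Y t w))"
  unfolding l2_squared by (rule bochner_cong) (auto simp: power2_eq_square algebra_simps)
 also have "\<dots> = ip (Y t) (Y t) + ip (Y s) (Y s) - 2 * ip (Y s) (Y t)"
  using i by simp
 finally show ?thesis
  using Y_increment_variance[OF st] Y_variance[OF st(1)] Y_variance[OF t] by (simp add: Qi_def)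
qed

lemma Y_increment_covariance:
 assumes ab: "0 <= a" "a <= b"
 shows "b <= c ==> c <= d ==> 0 <= ip (%w. Y b w - Y a w) (%w. Y d w - Y c w)"
  and "b <= d ==> ip (%w. Y b w - Y a w) (Y d) <= 2 * Kq * (b - a)"
proof -
 have b: "0 <= b" using ab by simp
 have e: "ip (%w. Y b w - Y a w) (Y d) = Qi b - Qi a + (Qi (d - a) - Qi (d - b))" if "b <= d" for d
  using Y_covariance[of b d] Y_covariance[of a d] that ab b sqint_mult[OF Y_sqint Y_sqint, of b d] sqint_mult[OF Y_sqint Y_sqint, of a d]
  by (simp add: left_diff_distrib)
 show "ip (%w. Y b w - Y a w) (Y d) <= 2 * Kq * (b - a)" if "b <= d"
  unfolding e[OF that] using Qi_increment(2)[OF ab] Qi_increment(2)[of "d - b" "d - a"] ab that by (simp add: algebra_simps)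
 assume cd: "b <= c" "c <= d"
 have "ip (%w. Y b w - Y a w) (%w. Y d w - Y c w) = ip (%w. Y b w - Y a w) (Y d) - ip (%w. Y b w - Y a w) (Y c)"
  using sqint_mult[OF sqint_diff[OF Y_sqint[OF b] Y_sqint[OF ab(1)]] Y_sqint[of d]] sqint_mult[OF sqint_diff[OF Y_sqint[OF b] Y_sqint[OF ab(1)]] Y_sqint[of c]] cd b
  by (simp add: right_diff_distrib)
 moreover have "c - b + (b - a) = c - a" "c - b + (d - c) + (b - a) = d - a" "c - b + (d - c) = d - b" by simp_all
 ultimately show "0 <= ip (%w. Y b w - Y a w) (%w. Y d w - Y c w)"
  using Qi_convex[of "c - b" "b - a" "d - c"] e[of c] e[of d] ab cd by simp
qed

text \<open>The increments of \<open>Y\<close> are positively correlated, so the row sums of their covariance matrix are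
 covariances with \<open>Y\<close> itself, and Schur's test applies.\<close>

lemma increments_l2_le:
 fixes t f :: "nat => real"
 assumes t0: "t 0 = 0" and t: "!!i. i < n ==> t i <= t (Suc i)"
 shows "(l2 M (%w. \<Sum>i<n. f i * (Y (t (Suc i)) w - Y (t i) w)))^2 <= 2 * Kq * (\<Sum>i<n. (f i)^2 * (t (Suc i) - t i))"
proof -
 note mono = partition_mono[of n t, OF t]
 have t_nonneg: "0 <= t i" if "i <= n" for i using mono[of 0 i] t0 that by simp
 define \<xi> where "\<xi> i w = Y (t (Suc i)) w - Y (t i) w" for i w
 have xi: "sqint M (\<xi> i)" if "i < n" for i unfolding \<xi>_def using that by (intro sqint_diff Y_sqint t_nonneg) auto
 define c where "c i j = ip (\<xi> i) (\<xi> j)" for i j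
 have csym: "c i j = c j i" for i j by (simp add: c_def mult.commute)
 have c_le: "0 <= c i j" if "i < j" "j < n" for i j
  unfolding c_def \<xi>_def using that by (intro Y_increment_covariance mono t_nonneg) auto
 have c0: "0 <= c i j" if "i < n" "j < n" for i j
  using c_le[of i j] c_le[of j i] csym[of i j] that by (cases i j rule: linorder_cases) (auto simp: c_def)
 have row: "(\<Sum>j<n. c i j) <= 2 * Kq * (t (Suc i) - t i)" if i: "i < n" for i
 proof -
  have "(\<Sum>j<n. c i j) = expectation (%w. \<Sum>j<n. \<xi> i w * \<xi> j w)"
   unfolding c_def by (rule bochner_sum[symmetric]) (use xi i in \<open>auto intro: sqint_mult\<close>)
  also have "\<dots> = ip (\<xi> i) (Y (t n))"
  proof (rule bochner_cong[OF refl])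
   fix w assume "w \<in> space M"
   hence "(\<Sum>j<n. \<xi> j w) = Y (t n) w" using sum_lessThan_telescope[of "%j. Y (t j) w" n] by (simp add: \<xi>_def t0 Y_0)
   thus "(\<Sum>j<n. \<xi> i w * \<xi> j w) = \<xi> i w * Y (t n) w" by (simp add: sum_distrib_left[symmetric])
  qed
  also have "\<dots> <= 2 * Kq * (t (Suc i) - t i)"
   unfolding \<xi>_def using i by (intro Y_increment_covariance mono t_nonneg) auto
  finally show ?thesis .
 qed
 have "(l2 M (%w. \<Sum>i<n. f i * \<xi> i w))^2 = expectation (%w. \<Sum>i<n. \<Sum>j<n. f i * f j * (\<xi> i w * \<xi> j w))"
  unfolding l2_squared by (simp add: power2_eq_square sum_product mult_ac)
 also have "\<dots> = (\<Sum>i<n. \<Sum>j<n. f i * f j * c i j)"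
 proof -
  have i: "integrable M (%w. f i * f j * (\<xi> i w * \<xi> j w))" if "i < n" "j < n" for i j
   using that by (intro integrable_mult_right sqint_mult xi)
  have "expectation (%w. \<Sum>j<n. f k * f j * (\<xi> k w * \<xi> j w)) = (\<Sum>j<n. f k * f j * c k j)" if "k < n" for k
   unfolding c_def by (subst bochner_sum, rule i[OF that]) simp_all
  thus ?thesis by (subst bochner_sum) (auto intro!: i Bochner_Integration.integrable_sum)
 qed
 also have "\<dots> <= (\<Sum>i<n. \<Sum>j<n. (f i)^2 / 2 * c i j + (f j)^2 / 2 * c i j)"
 proof (intro sum_mono)
  fix i j assume "i \<in> {..<n}" "j \<in> {..<n}"
  hence c: "0 <= c i j" by (simp add: c0)
  have "f i * f j <= (f i)^2 / 2 + (f j)^2 / 2" using sum_squares_bound[of "f i" "f j"] by simp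
  from mult_right_mono[OF this c] show "f i * f j * c i j <= (f i)^2 / 2 * c i j + (f j)^2 / 2 * c i j" by (simp add: distrib_right)
 qed
 also have "\<dots> = (\<Sum>i<n. \<Sum>j<n. (f i)^2 / 2 * c i j) + (\<Sum>i<n. \<Sum>j<n. (f j)^2 / 2 * c i j)" by (simp add: sum.distrib)
 also have "(\<Sum>i<n. \<Sum>j<n. (f j)^2 / 2 * c i j) = (\<Sum>i<n. \<Sum>j<n. (f i)^2 / 2 * c i j)"
  by (subst sum.swap) (intro sum.cong refl, simp add: c_def mult.commute)
 also have "(\<Sum>i<n. \<Sum>j<n. (f i)^2 / 2 * c i j) + (\<Sum>i<n. \<Sum>j<n. (f i)^2 / 2 * c i j) = (\<Sum>i<n. (f i)^2 * (\<Sum>j<n. c i j))"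
  by (simp add: sum_distrib_left sum_distrib_right sum.distrib[symmetric] mult.commute)
 also have "\<dots> <= (\<Sum>i<n. (f i)^2 * (2 * Kq * (t (Suc i) - t i)))" by (intro sum_mono mult_left_mono row) auto
 also have "\<dots> = 2 * Kq * (\<Sum>i<n. (f i)^2 * (t (Suc i) - t i))" unfolding sum_distrib_left by (rule sum.cong) (simp_all add: algebra_simps)
 finally show ?thesis by (simp add: \<xi>_def)
qed

end

section \<open>Step functions and Wiener integrals\<close>

definition step_apply :: "step => (real => real) => real" where
 "step_apply c L = (\<Sum>t\<in>Poly_Mapping.keys c. Poly_Mapping.lookup c t * L t)"

abbreviation step_error :: "real => step => (real => real) => real" where
 "step_error T c f \<equiv> integral {0..T} (%s. (step_fun c s - f s)^2)"

lemma step_fun_eq: "step_fun c s = step_apply c (%t. indicator {0..t} s)"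
 by (simp add: step_fun_def step_apply_def)

lemma step_integral_eq: "step_integral Y c w = step_apply c (%t. Y t w)"
 by (simp add: step_integral_def step_apply_def)

lemma step_apply_superset:
 assumes "finite S" "Poly_Mapping.keys c \<subseteq> S" shows "step_apply c L = (\<Sum>t\<in>S. Poly_Mapping.lookup c t * L t)"
 unfolding step_apply_def by (rule sum.mono_neutral_left) (use assms in \<open>auto simp: in_keys_iff\<close>)

lemma step_apply_diff: "step_apply (c - d) L = step_apply c L - step_apply d L"
proof -
 let ?S = "Poly_Mapping.keys c \<union> Poly_Mapping.keys d"
 have "step_apply (c - d) L = (\<Sum>t\<in>?S. Poly_Mapping.lookup (c - d) t * L t)"
  by (rule step_apply_superset) (use keys_diff[of c d] in auto)
 also have "\<dots> = (\<Sum>t\<in>?S. Poly_Mapping.lookup c t * L t) - (\<Sum>t\<in>?S. Poly_Mapping.lookup d t * L t)"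
  by (simp add: lookup_minus left_diff_distrib sum_subtractf)
 finally show ?thesis using step_apply_superset[of ?S c L] step_apply_superset[of ?S d L] by simp
qed

lemma step_apply_add: "step_apply (c + d) L = step_apply c L + step_apply d L"
proof -
 let ?S = "Poly_Mapping.keys c \<union> Poly_Mapping.keys d"
 have "step_apply (c + d) L = (\<Sum>t\<in>?S. Poly_Mapping.lookup (c + d) t * L t)"
  by (rule step_apply_superset) (use Poly_Mapping.keys_add[of c d] in auto)
 also have "\<dots> = (\<Sum>t\<in>?S. Poly_Mapping.lookup c t * L t) + (\<Sum>t\<in>?S. Poly_Mapping.lookup d t * L t)"
  by (simp add: lookup_add distrib_right sum.distrib)
 finally show ?thesis using step_apply_superset[of ?S c L] step_apply_superset[of ?S d L] by simp
qed

lemma step_apply_zero: "step_apply 0 L = 0" by (simp add: step_apply_def)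

lemma step_apply_single: "step_apply (Poly_Mapping.single t v) L = v * L t"
 by (simp add: step_apply_def)

lemma step_apply_sum: "step_apply (\<Sum>i\<in>I. f i) L = (\<Sum>i\<in>I. step_apply (f i) L)"
 by (induction I rule: infinite_finite_induct) (auto simp: step_apply_add step_apply_zero)

definition riemann_step :: "(real => real) => real => nat => step" where
 "riemann_step x T N = (\<Sum>j<N. Poly_Mapping.single (T * real (Suc j) / real N) (x (T * real j / real N))
   - Poly_Mapping.single (T * real j / real N) (x (T * real j / real N)))"

lemma step_apply_riemann: "step_apply (riemann_step x T N) L
 = (\<Sum>j<N. x (T * real j / real N) * (L (T * real (Suc j) / real N) - L (T * real j / real N)))"
 by (simp add: riemann_step_def step_apply_sum step_apply_diff step_apply_single right_diff_distrib)

lemma grid_in: "0 <= T ==> j <= N ==> T * real j / real N \<in> {0..T}"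
 by (cases "N = 0") (auto simp: field_simps mult_left_mono)

lemma keys_riemann: assumes T: "0 <= T" shows "Poly_Mapping.keys (riemann_step x T N) \<subseteq> {0..T}"
proof -
 have "Poly_Mapping.keys (riemann_step x T N) \<subseteq> (\<Union>j\<in>{..<N}. Poly_Mapping.keys (Poly_Mapping.single (T * real (Suc j) / real N) (x (T * real j / real N))
   - Poly_Mapping.single (T * real j / real N) (x (T * real j / real N))))"
  unfolding riemann_step_def by (rule keys_sum)
 also have "\<dots> \<subseteq> {0..T}"
 proof (rule UN_least)
  fix j assume "j \<in> {..<N}"
  hence "T * real (Suc j) / real N \<in> {0..T}" "T * real j / real N \<in> {0..T}"
   by (intro grid_in[OF T]; simp)+
  thus "Poly_Mapping.keys (Poly_Mapping.single (T * real (Suc j) / real N) (x (T * real j / real N))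
   - Poly_Mapping.single (T * real j / real N) (x (T * real j / real N))) \<subseteq> {0..T}"
   using keys_diff[of "Poly_Mapping.single (T * real (Suc j) / real N) (x (T * real j / real N))" "Poly_Mapping.single (T * real j / real N) (x (T * real j / real N))"]
   by (auto split: if_splits)
 qed
 finally show ?thesis .
qed

text \<open>Index of the cell of the grid \<open>T j / n\<close> that contains \<open>s\<close>.\<close>

definition grid_point :: "real => nat => real => nat" where
 "grid_point T N s = nat (\<lceil>s * real N / T\<rceil> - 1)"

lemma grid_cell:
 assumes s: "0 < s" "s <= T" and N: "N > 0" and j: "j = grid_point T N s"
 shows "j < N" "T * real j / real N < s" "s <= T * real (Suc j) / real N"
proof -
 define c where "c = \<lceil>s * real N / T\<rceil>"
 have T: "T > 0" using s by simp
 have "s * real N / T > 0" using s N T by simp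
 hence c1: "c \<ge> 1" unfolding c_def by linarith
 have rj: "real j = real_of_int c - 1" using c1 by (simp add: j grid_point_def c_def)
 have le: "real_of_int c - 1 < s * real N / T" "s * real N / T <= real_of_int c" unfolding c_def by linarith+
 have "s * real N / T <= real N" using s T N by (simp add: field_simps)
 hence "c <= int N" unfolding c_def by (simp add: ceiling_le_iff)
 thus "j < N" using rj c1 by linarith
 show "T * real j / real N < s" using le(1) T N by (simp add: rj field_simps)
 show "s <= T * real (Suc j) / real N" using le(2) T N rj by (simp add: field_simps)
qed

lemma step_fun_riemann:
 assumes s: "0 < s" "s <= T" and N: "N > 0"
 shows "step_fun (riemann_step x T N) s = x (T * real (grid_point T N s) / real N)"
proof -
 define j where "j = grid_point T N s"
 have T: "T > 0" using s by simp
 note j = grid_cell[OF s N j_def]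
 have mono: "T * real a / real N <= T * real b / real N" if "a <= b" for a b
  using that T N by (intro divide_right_mono mult_left_mono) auto
 have "indicat_real {0..T * real (Suc i) / real N} s - indicat_real {0..T * real i / real N} s = (if i = j then 1 else 0)" for i
 proof -
  consider "i < j" | "i = j" | "i > j" by linarith
  thus ?thesis
  proof cases
   case 1
   hence "T * real (Suc i) / real N <= T * real j / real N" "T * real i / real N <= T * real j / real N" by (intro mono; simp)+
   thus ?thesis using 1 j s by (auto simp: indicator_def)
  next
   case 2 thus ?thesis using j s by (auto simp: indicator_def)
  next
   case 3
   hence "T * real (Suc j) / real N <= T * real i / real N" "T * real (Suc j) / real N <= T * real (Suc i) / real N" by (intro mono; simp)+
   thus ?thesis using 3 j s by (auto simp: indicator_def)
  qed
 qed
 hence "step_fun (riemann_step x T N) s = (\<Sum>i<N. if i = j then x (T * real i / real N) else 0)"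
  unfolding step_fun_eq step_apply_riemann by (intro sum.cong) auto
 thus ?thesis using j by (simp add: j_def)
qed

lemma borel_measurable_step_fun[measurable]: "step_fun c \<in> borel_measurable borel"
 unfolding step_fun_def[abs_def] by measurable

lemma step_fun_bounded: "\<exists>K\<ge>0. \<forall>s. \<bar>step_fun c s\<bar> <= K"
proof (intro exI[of _ "\<Sum>t\<in>Poly_Mapping.keys c. \<bar>Poly_Mapping.lookup c t\<bar>"] conjI allI)
 fix s
 have "\<bar>step_fun c s\<bar> <= (\<Sum>t\<in>Poly_Mapping.keys c. \<bar>Poly_Mapping.lookup c t * indicator {0..t} s\<bar>)"
  unfolding step_fun_def by (rule sum_abs)
 also have "\<dots> <= (\<Sum>t\<in>Poly_Mapping.keys c. \<bar>Poly_Mapping.lookup c t\<bar>)" by (rule sum_mono) (auto simp: indicator_def)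
 finally show "\<bar>step_fun c s\<bar> <= (\<Sum>t\<in>Poly_Mapping.keys c. \<bar>Poly_Mapping.lookup c t\<bar>)" .
qed (auto intro: sum_nonneg)

lemma bounded_measurable_integrable_on:
 fixes f :: "real => real"
 assumes f: "f \<in> borel_measurable lebesgue" and b: "!!x. x \<in> {a..b} ==> \<bar>f x\<bar> <= K"
 shows "f integrable_on {a..b}"
proof (rule measurable_bounded_by_integrable_imp_integrable)
 show "f \<in> borel_measurable (lebesgue_on {a..b})" using f by (rule measurable_restrict_space1)
 show "(%x. K) integrable_on {a..b}" by (rule integrable_const_ivl)
qed (use b in auto)

lemma borel_imp_lebesgue_measurable: "f \<in> borel_measurable borel ==> f \<in> borel_measurable lebesgue"
 by (intro measurable_completion) simp

lemma abs_le_imp_square_le: "\<bar>a\<bar> <= b ==> a\<^sup>2 <= b^2" for a b :: real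
 using abs_le_square_iff[of a b] by linarith

lemma step_minus_square_integrable:
 assumes f: "f \<in> borel_measurable lebesgue" and b: "!!x. x \<in> {0..T} ==> \<bar>f x\<bar> <= C"
 shows "(%s. (step_fun c s - f s)^2) integrable_on {0..T}"
proof -
 obtain K where K: "K \<ge> 0" "!!s. \<bar>step_fun c s\<bar> <= K" using step_fun_bounded by blast
 have sm: "step_fun c \<in> borel_measurable lebesgue" by (intro borel_imp_lebesgue_measurable) measurable
 show ?thesis
 proof (rule bounded_measurable_integrable_on[where K="(K + C)^2"])
  show "(%s. (step_fun c s - f s)^2) \<in> borel_measurable lebesgue" using sm f by measurable
  fix x assume "x \<in> {0..T}"
  hence "\<bar>step_fun c x - f x\<bar> <= K + C" using K(2)[of x] b[of x] by linarith
  thus "\<bar>(step_fun c x - f x)\<^sup>2\<bar> <= (K + C)^2" by (simp add: abs_le_square_iff[symmetric])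
 qed
qed

lemma continuous_square_integrable:
 fixes x :: "real => real"
 assumes c: "continuous_on {0..T} x" shows "(%s. (step_fun d s - x s)^2) integrable_on {0..T}"
proof -
 define x' where "x' s = (if s \<in> {0..T} then x s else 0)" for s
 have "bounded (x ` {0..T})" by (rule compact_imp_bounded[OF compact_continuous_image[OF c]]) simp
 then obtain K where K: "\<forall>y\<in>x ` {0..T}. norm y <= K" unfolding bounded_iff by blast
 have "(%s. indicator {0..T} s *\<^sub>R x s) \<in> borel_measurable borel"
  by (rule borel_measurable_continuous_on_indicator[OF _ c]) simp
 also have "(%s. indicator {0..T} s *\<^sub>R x s) = x'" by (auto simp: x'_def indicator_def)
 finally have m: "x' \<in> borel_measurable lebesgue" by (rule borel_imp_lebesgue_measurable)
 have "(%s. (step_fun d s - x' s)^2) integrable_on {0..T}"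
  by (rule step_minus_square_integrable[OF m, of T K]) (use K in \<open>auto simp: x'_def\<close>)
 thus ?thesis by (rule integrable_eq) (simp add: x'_def)
qed

lemma riemann_step_tendsto:
 fixes x :: "real => real"
 assumes T: "0 <= T" and c: "continuous_on {0..T} x"
 shows "(%N. step_error T (riemann_step x T N) x) \<longlonglongrightarrow> 0"
proof (cases "T = 0")
 case True thus ?thesis by simp
next
 case False
 hence T0: "T > 0" using T by simp
 show ?thesis
 proof (rule LIMSEQ_I)
  fix e :: real assume e: "e > 0"
  define e' where "e' = sqrt (e / (2 * T))"
  have e': "e' > 0" using e T0 by (simp add: e'_def)
  have "uniformly_continuous_on {0..T} x" by (rule compact_uniformly_continuous[OF c]) simp
  then obtain d where d: "d > 0" "!!s s'. s \<in> {0..T} ==> s' \<in> {0..T} ==> \<bar>s' - s\<bar> < d ==> \<bar>x s' - x s\<bar> < e'"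
   unfolding uniformly_continuous_on_def dist_real_def using e' by metis
  obtain N0 :: nat where N0: "T / d < real N0" using reals_Archimedean2 by blast
  show "\<exists>no. \<forall>N\<ge>no. norm (step_error T (riemann_step x T N) x - 0) < e"
  proof (intro exI[of _ "Suc N0"] allI impI)
   fix N assume N: "N \<ge> Suc N0"
   hence Np: "N > 0" by simp
   have "T / d < real N" using N0 N by linarith
   hence TN: "T / real N < d" using d T0 Np by (simp add: field_simps)
   have bnd: "(step_fun (riemann_step x T N) s - x s)^2 <= e'^2" if s: "s \<in> {0..T} - {0}" for s
   proof -
    have s': "0 < s" "s <= T" using s by auto
    define j where "j = grid_point T N s"
    note j = grid_cell[OF s' Np j_def]
    have "T * real j / real N \<in> {0..T}" using j by (intro grid_in[OF T]) auto
    moreover have "\<bar>T * real j / real N - s\<bar> < d"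
    proof -
     have "s - T * real j / real N <= T / real N" using j(3) by (simp add: distrib_left add_divide_distrib)
     thus ?thesis using j(2) TN by linarith
    qed
    ultimately have "\<bar>step_fun (riemann_step x T N) s - x s\<bar> <= e'"
     unfolding step_fun_riemann[OF s' Np] j_def[symmetric] using d(2)[of s "T * real j / real N"] s by auto
    thus ?thesis using e' by (simp add: abs_le_square_iff[symmetric])
   qed
   define h where "h s = (if s = 0 then 0 else (step_fun (riemann_step x T N) s - x s)\<^sup>2)" for s
   have eq: "step_error T (riemann_step x T N) x = integral {0..T} h"
    by (rule integral_spike[of "{0}"]) (auto simp: h_def)
   have "h integrable_on {0..T}"
    by (rule integrable_spike[OF continuous_square_integrable[OF c, of "riemann_step x T N"] negligible_sing[of 0]]) (auto simp: h_def)
   hence "norm (integral {0..T} h) <= integral {0..T} (%s. e'^2)"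
    by (rule integral_norm_bound_integral) (use bnd in \<open>auto simp: h_def\<close>)
   also have "\<dots> = e'^2 * T" using T by simp
   also have "\<dots> = e / 2" using e T0 by (simp add: e'_def)
   also have "\<dots> < e" using e by simp
   finally show "norm (step_error T (riemann_step x T N) x - 0) < e" using eq by simp
  qed
 qed
qed

lemma square_diff_le: "(a - b)^2 <= 2 * (a - c)^2 + 2 * (b - c)^2" for a b c :: real
proof -
 have "0 <= (a + b - 2 * c)^2" by simp
 thus ?thesis by (simp add: power2_eq_square algebra_simps)
qed

text \<open>Bounded measurable functions are limits almost everywhere of uniformly bounded continuous functions,
 and for these the Riemann step functions converge in mean square.\<close>

lemma step_functions_dense:
 fixes f :: "real => real"
 assumes T: "0 <= T" and f: "f \<in> borel_measurable lebesgue" and b: "!!x. \<bar>f x\<bar> <= C" and e: "e > 0"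
 shows "\<exists>c. Poly_Mapping.keys c \<subseteq> {0..T} \<and> step_error T c f < e"
proof -
 have C: "C \<ge> 0" using b[of 0] by linarith
 have "f measurable_on UNIV" by (rule lebesgue_measurable_imp_measurable_on_real[OF f]) simp
 then obtain Z g where Z: "negligible Z" and gc: "!!n::nat. continuous_on UNIV (g n)" and lim: "!!x. x \<notin> Z ==> (%n. g n x) \<longlonglongrightarrow> f x"
  unfolding measurable_on_def by auto
 define h where "h n x = max (- C) (min C (g n x))" for n x
 have hc: "continuous_on UNIV (h n)" for n unfolding h_def by (intro continuous_intros gc)
 have hb: "\<bar>h n x\<bar> <= C" for n x unfolding h_def using C by auto
 have hl: "(%n. h n x) \<longlonglongrightarrow> f x" if "x \<notin> Z" for x
 proof -
  have "(%n. h n x) \<longlonglongrightarrow> max (- C) (min C (f x))" unfolding h_def by (intro tendsto_intros lim that)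
  moreover have "max (- C) (min C (f x)) = f x" using b[of x] by (auto simp: max_def min_def)
  ultimately show ?thesis by simp
 qed
 have hm: "h n \<in> borel_measurable lebesgue" for n by (intro borel_imp_lebesgue_measurable borel_measurable_continuous_onI hc)
 have sq_int: "(%s. (h n s - f s)^2) integrable_on {0..T}" for n
 proof (rule bounded_measurable_integrable_on[where K="(C + C)^2"])
  show "(%s. (h n s - f s)^2) \<in> borel_measurable lebesgue" using hm f by measurable
  fix x
  have "\<bar>h n x - f x\<bar> <= C + C" using hb[of n x] b[of x] by linarith
  thus "\<bar>(h n x - f x)\<^sup>2\<bar> <= (C + C)^2" unfolding abs_power2 by (rule abs_le_imp_square_le)
 qed
 define k where "k n s = (if s \<in> Z then 0 else (h n s - f s)\<^sup>2)" for n s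
 have "(%n. integral {0..T} (k n)) \<longlonglongrightarrow> integral {0..T} (%_. 0)"
 proof (rule dominated_convergence(2))
  show "k n integrable_on {0..T}" for n by (rule integrable_spike[OF sq_int[of n] Z]) (auto simp: k_def)
  show "(%_. (C + C)^2) integrable_on {0..T}" by (rule integrable_const_ivl)
  show "norm (k n s) <= (C + C)^2" for n s
  proof -
   have "\<bar>h n s - f s\<bar> <= C + C" using hb[of n s] b[of s] by linarith
   hence "(h n s - f s)^2 <= (C + C)^2" by (rule abs_le_imp_square_le)
   thus ?thesis by (simp add: k_def)
  qed
  show "(%n. k n s) \<longlonglongrightarrow> 0" for s
  proof (cases "s \<in> Z")
   case False
   have "(%n. (h n s - f s)^2) \<longlonglongrightarrow> (f s - f s)\<^sup>2" by (intro tendsto_intros hl False)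
   thus ?thesis using False by (simp add: k_def)
  qed (simp add: k_def)
 qed
 hence "(%n. integral {0..T} (k n)) \<longlonglongrightarrow> 0" by simp
 hence "\<forall>\<^sub>F n in sequentially. integral {0..T} (k n) < e / 4" using e by (intro order_tendstoD) auto
 then obtain n where n: "integral {0..T} (k n) < e / 4" by (auto simp: eventually_sequentially)
 have kn: "integral {0..T} (k n) = integral {0..T} (%s. (h n s - f s)^2)"
  by (rule integral_spike[OF Z]) (auto simp: k_def)
 have "(%N. step_error T (riemann_step (h n) T N) (h n)) \<longlonglongrightarrow> 0"
  by (rule riemann_step_tendsto[OF T]) (rule continuous_on_subset[OF hc], simp)
 hence "\<forall>\<^sub>F N in sequentially. step_error T (riemann_step (h n) T N) (h n) < e / 4" using e by (intro order_tendstoD) auto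
 then obtain N where N: "step_error T (riemann_step (h n) T N) (h n) < e / 4" by (auto simp: eventually_sequentially)
 define c where "c = riemann_step (h n) T N"
 have i1: "(%s. (step_fun c s - f s)^2) integrable_on {0..T}" by (rule step_minus_square_integrable[OF f b])
 have i2: "(%s. (step_fun c s - h n s)^2) integrable_on {0..T}" by (rule step_minus_square_integrable[OF hm hb])
 have "step_error T c f <= integral {0..T} (%s. 2 * (step_fun c s - h n s)^2 + 2 * (h n s - f s)^2)"
 proof (rule integral_le[OF i1])
  show "(%s. 2 * (step_fun c s - h n s)^2 + 2 * (h n s - f s)^2) integrable_on {0..T}"
   using integrable_add[OF integrable_cmul[OF i2, of 2] integrable_cmul[OF sq_int[of n], of 2]] by simp
  show "(step_fun c s - f s)^2 <= 2 * (step_fun c s - h n s)^2 + 2 * (h n s - f s)^2" for s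
   using square_diff_le[of "step_fun c s" "f s" "h n s"] by (simp add: power2_commute)
 qed
 also have "\<dots> = 2 * step_error T c (h n) + 2 * integral {0..T} (%s. (h n s - f s)^2)"
  using hk_add[OF integrable_cmul[OF i2, of 2] integrable_cmul[OF sq_int[of n], of 2]] by simp
 also have "\<dots> < e" using n N kn by (simp add: c_def)
 finally show ?thesis using keys_riemann[OF T] c_def by blast
qed

context fbm begin

lemma step_integral_in_G: assumes "Poly_Mapping.keys c \<subseteq> {0..T}" shows "step_integral Y c \<in> G"
 unfolding step_integral_def[abs_def] using assms by (intro G_sum G_cmult Y_in_G) auto

lemma step_inner_eq:
 assumes c: "Poly_Mapping.keys c \<subseteq> {0..T}" and d: "Poly_Mapping.keys d \<subseteq> {0..T}"
 shows "step_inner M Y c d = ip (step_integral Y c) (step_integral Y d)"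
proof -
 have i: "integrable M (%w. Poly_Mapping.lookup c t * Poly_Mapping.lookup d s * (Y t w * Y s w))"
  if "t \<in> Poly_Mapping.keys c" "s \<in> Poly_Mapping.keys d" for s t
  using that c d by (intro integrable_mult_right sqint_mult Y_sqint) auto
 have "ip (step_integral Y c) (step_integral Y d)
  = expectation (%w. \<Sum>t\<in>Poly_Mapping.keys c. \<Sum>s\<in>Poly_Mapping.keys d. Poly_Mapping.lookup c t * Poly_Mapping.lookup d s * (Y t w * Y s w))"
  by (rule bochner_cong) (auto simp: step_integral_def sum_product mult_ac)
 also have "\<dots> = (\<Sum>t\<in>Poly_Mapping.keys c. \<Sum>s\<in>Poly_Mapping.keys d. expectation (%w. Poly_Mapping.lookup c t * Poly_Mapping.lookup d s * (Y t w * Y s w)))"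
  using i by (subst bochner_sum) (auto intro!: sum.cong bochner_sum)
 finally show ?thesis by (simp add: step_inner_def)
qed

lemma step_inner_self: assumes "Poly_Mapping.keys c \<subseteq> {0..T}" shows "step_inner M Y c c = (l2 M (step_integral Y c))^2"
 unfolding step_inner_eq[OF assms assms] l2_squared by (simp add: power2_eq_square)

text \<open>A step function encoded by indicators of \<open>[0,s]\<close> is rewritten with disjoint cells by summation by parts,
 adding the points of the support in increasing order. The formula holds for all functionals \<open>L\<close> at
 once, so that the same cells and coefficients serve for the integral against \<open>Y\<close> and for the function.\<close>

lemma step_sum_as_increments:
 fixes c :: "real => real"
 assumes "finite S" "S \<subseteq> {0..}"
 shows "\<exists>n t f. t 0 = 0 \<and> (\<forall>i<n. t i <= t (Suc i)) \<and> t n \<in> insert 0 S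
  \<and> (\<forall>L. L 0 = (0::real) \<longrightarrow> (\<Sum>s\<in>S. c s * L s) = (\<Sum>i<n. f i * (L (t (Suc i)) - L (t i))))
  \<and> (\<forall>u>0. (\<Sum>s\<in>S. c s * indicator {0..s} u)\<^sup>2 = (\<Sum>i<n. (f i)^2 * (indicator {0..t (Suc i)} u - indicat_real {0..t i} u)))"
 using assms
proof (induction S rule: finite_linorder_max_induct)
 case empty
 show ?case by (intro exI[of _ 0] exI[of _ "%_. 0"]) auto
next
 case (insert b S)
 then obtain n t f where t: "t 0 = 0" "!!i. i < n ==> t i <= t (Suc i)" "t n \<in> insert 0 S"
  and L: "!!L. L 0 = (0::real) ==> (\<Sum>s\<in>S. c s * L s) = (\<Sum>i<n. f i * (L (t (Suc i)) - L (t i)))"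
  and sq: "!!u. u > 0 ==> (\<Sum>s\<in>S. c s * indicator {0..s} u)\<^sup>2 = (\<Sum>i<n. (f i)^2 * (indicator {0..t (Suc i)} u - indicat_real {0..t i} u))"
  by auto
 have b: "b \<notin> S" "0 <= b" using insert by auto
 define t' f' where "t' = t(Suc n := b)" and "f' i = (if i < n then f i else 0) + c b" for i
 have sum': "(\<Sum>i<Suc n. g (f' i) * (L (t' (Suc i)) - L (t' i))) = (\<Sum>i<n. g (f i + c b) * (L (t (Suc i)) - L (t i))) + g (c b) * (L b - L (t n))"
  for g L :: "real => real"
  by (simp add: t'_def f'_def)
 have L': "(\<Sum>s\<in>insert b S. c s * L s) = (\<Sum>i<Suc n. f' i * (L (t' (Suc i)) - L (t' i)))" if L0: "L 0 = 0" for L :: "real => real"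
 proof -
  have "(\<Sum>i<n. (f i + c b) * (L (t (Suc i)) - L (t i))) = (\<Sum>s\<in>S. c s * L s) + c b * (\<Sum>i<n. L (t (Suc i)) - L (t i))"
   unfolding L[of L, OF L0] distrib_right sum.distrib sum_distrib_left ..
  thus ?thesis using sum'[of "%x. x" L] insert b L0 t(1) sum_lessThan_telescope[of "%i. L (t i)" n] by (simp add: algebra_simps)
 qed
 have sq': "(\<Sum>s\<in>insert b S. c s * indicator {0..s} u)^2 = (\<Sum>i<Suc n. (f' i)^2 * (indicator {0..t' (Suc i)} u - indicat_real {0..t' i} u))"
  if u: "0 < u" for u
 proof -
  define L where "L s = indicat_real {0..s} u" for s
  define F where "F = (\<Sum>s\<in>S. c s * L s)"
  have L0: "L 0 = 0" using u by (simp add: L_def)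
  have FL: "F * L b = F" "L b * L b = L b"
  proof -
   show "L b * L b = L b" by (simp add: L_def indicator_def)
   show "F * L b = F"
   proof (cases "u <= b")
    case False
    hence "F = 0" unfolding F_def L_def using insert by (intro sum.neutral) (auto simp: indicator_def)
    thus ?thesis by simp
   qed (use u in \<open>simp add: L_def\<close>)
  qed
  have "(\<Sum>i<n. (f i + c b)^2 * (L (t (Suc i)) - L (t i)))
   = (\<Sum>i<n. (f i)^2 * (L (t (Suc i)) - L (t i)) + 2 * c b * (f i * (L (t (Suc i)) - L (t i))) + (c b)^2 * (L (t (Suc i)) - L (t i)))"
   by (rule sum.cong) (simp_all add: power2_eq_square algebra_simps)
  also have "\<dots> = F^2 + 2 * c b * F + (c b)^2 * L (t n)"
   unfolding sum.distrib sum_distrib_left[symmetric] sum_lessThan_telescope[of "%i. L (t i)" n]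
   using sq[OF u] L[of L, OF L0] by (simp add: F_def L_def[symmetric] t(1) L0)
  finally have "(\<Sum>i<Suc n. (f' i)^2 * (L (t' (Suc i)) - L (t' i))) = F^2 + 2 * c b * F + (c b)^2 * L b"
   using sum'[of "%x. x^2" L] by (simp add: algebra_simps)
  also have "\<dots> = (c b * L b + F)^2"
  proof -
   have "(c b * L b + F)^2 = (c b)^2 * (L b * L b) + 2 * c b * (F * L b) + F^2" by (simp add: power2_eq_square algebra_simps)
   thus ?thesis unfolding FL by simp
  qed
  also have "c b * L b + F = (\<Sum>s\<in>insert b S. c s * L s)" using insert b by (simp add: F_def)
  finally show ?thesis by (simp add: L_def)
 qed
 have "t' i <= t' (Suc i)" if "i < Suc n" for i
  using that t insert b by (cases "i = n") (auto simp: t'_def less_imp_le)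
 moreover have "t' 0 = 0" "t' (Suc n) \<in> insert 0 (insert b S)" using t by (auto simp: t'_def)
 ultimately show ?case by (intro exI[of _ "Suc n"] exI[of _ t'] exI[of _ f'] conjI allI impI L' sq')
qed

text \<open>The bound that extends the integral from step functions to bounded measurable functions; on disjoint
 cells it is \<open>increments_l2_le\<close>.\<close>

lemma step_integral_l2_le:
 assumes c: "Poly_Mapping.keys c \<subseteq> {0..T}"
 shows "(l2 M (step_integral Y c))^2 <= 2 * Kq * integral {0..T} (%s. (step_fun c s)^2)"
proof -
 have "finite (Poly_Mapping.keys c)" "Poly_Mapping.keys c \<subseteq> {0..}" using c by auto
 from step_sum_as_increments[OF this, of "Poly_Mapping.lookup c"] obtain n t f
  where t: "t 0 = 0" "!!i. i < n ==> t i <= t (Suc i)" "t n \<in> insert 0 (Poly_Mapping.keys c)"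
  and L: "!!L. L 0 = (0::real) ==> step_apply c L = (\<Sum>i<n. f i * (L (t (Suc i)) - L (t i)))"
  and sq: "!!u. u > 0 ==> (step_fun c u)\<^sup>2 = (\<Sum>i<n. (f i)^2 * (indicator {0..t (Suc i)} u - indicat_real {0..t i} u))"
  unfolding step_apply_def step_fun_def by blast
 note mono = partition_mono[of n t, OF t(2)]
 have t0: "0 <= t i" if "i <= n" for i using mono[of 0 i] t(1) that by simp
 show ?thesis
 proof (cases "0 <= T")
  case False
  hence "Poly_Mapping.keys c = {}" using c by auto
  thus ?thesis by (simp add: step_integral_def[abs_def] step_fun_def)
 next
  case True
  hence tT: "t i <= T" if "i <= n" for i
  proof -
   have "t n <= T" using t(3) c True by auto
   thus ?thesis using mono[of i n] that by simp
  qed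
  have ind: "((%u. indicat_real {0..x} u) has_integral x) {0..T}" if "0 <= x" "x <= T" for x
  proof -
   have "((%u. if u \<in> {0..x} then 1 else 0 :: real) has_integral x) {0..T}"
    by (subst has_integral_restrict) (use that has_integral_const_real[of "1::real" 0 x] in auto)
   thus ?thesis by (simp add: indicator_def of_bool_def)
  qed
  have "((%u. \<Sum>i<n. (f i)^2 * (indicator {0..t (Suc i)} u - indicat_real {0..t i} u)) has_integral (\<Sum>i<n. (f i)^2 * (t (Suc i) - t i))) {0..T}"
   by (intro has_integral_sum has_integral_mult_right has_integral_diff ind t0 tT) auto
  hence "((%u. (step_fun c u)^2) has_integral (\<Sum>i<n. (f i)^2 * (t (Suc i) - t i))) {0..T}"
   by (rule has_integral_spike[of "{0}", rotated 2]) (auto simp: sq)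
  hence "integral {0..T} (%u. (step_fun c u)^2) = (\<Sum>i<n. (f i)^2 * (t (Suc i) - t i))" by (rule integral_unique)
  moreover have "l2 M (step_integral Y c) = l2 M (%w. \<Sum>i<n. f i * (Y (t (Suc i)) w - Y (t i) w))"
   unfolding l2_def by (intro arg_cong[of _ _ sqrt] bochner_cong) (auto simp: step_integral_eq L Y_0)
  ultimately show ?thesis using increments_l2_le[of t n f, OF t(1,2)] by simp
 qed
qed

lemma step_integral_diff: "step_integral Y (c - d) w = step_integral Y c w - step_integral Y d w"
 by (simp add: step_integral_eq step_apply_diff)

lemma step_fun_diff: "step_fun (c - d) s = step_fun c s - step_fun d s"
 by (simp add: step_fun_eq step_apply_diff)

lemma keys_diff_subset: "Poly_Mapping.keys c \<subseteq> {0..T} ==> Poly_Mapping.keys d \<subseteq> {0..T} ==> Poly_Mapping.keys (c - d) \<subseteq> {0..T::real}"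
 using keys_diff[of c d] by blast

lemma step_integral_diff_l2_le:
 assumes c: "Poly_Mapping.keys c \<subseteq> {0..T}" and d: "Poly_Mapping.keys d \<subseteq> {0..T}"
  and ic: "(%s. (step_fun c s - f s)^2) integrable_on {0..T}" and id: "(%s. (step_fun d s - f s)^2) integrable_on {0..T}"
 shows "(dl2 M (step_integral Y c) (step_integral Y d))^2
  <= 4 * Kq * (step_error T c f + step_error T d f)"
proof -
 have "(dl2 M (step_integral Y c) (step_integral Y d))^2 <= 2 * Kq * integral {0..T} (%s. (step_fun c s - step_fun d s)^2)"
  using step_integral_l2_le[OF keys_diff_subset[OF c d]] by (simp add: step_integral_diff[abs_def] step_fun_diff)
 also have "\<dots> <= 2 * Kq * integral {0..T} (%s. 2 * (step_fun c s - f s)^2 + 2 * (step_fun d s - f s)^2)"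
 proof (rule mult_left_mono)
  show "integral {0..T} (%s. (step_fun c s - step_fun d s)^2) <= integral {0..T} (%s. 2 * (step_fun c s - f s)^2 + 2 * (step_fun d s - f s)^2)"
  proof (rule integral_le)
   obtain K where K: "!!s. \<bar>step_fun d s\<bar> <= K" using step_fun_bounded[of d] by blast
   show "(%s. (step_fun c s - step_fun d s)^2) integrable_on {0..T}"
    by (rule step_minus_square_integrable[OF borel_imp_lebesgue_measurable K]) measurable
   show "(%s. 2 * (step_fun c s - f s)^2 + 2 * (step_fun d s - f s)^2) integrable_on {0..T}"
    using integrable_add[OF integrable_cmul[OF ic, of 2] integrable_cmul[OF id, of 2]] by simp
  qed (rule square_diff_le)
  show "0 <= 2 * Kq" using Kq_pos by simp
 qed
 also have "integral {0..T} (%s. 2 * (step_fun c s - f s)^2 + 2 * (step_fun d s - f s)^2)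
  = 2 * step_error T c f + 2 * step_error T d f"
  using hk_add[OF integrable_cmul[OF ic, of 2] integrable_cmul[OF id, of 2]] by simp
 finally show ?thesis by (simp add: algebra_simps)
qed

lemma hilb_keys: "h \<in> hilb M Y T ==> Poly_Mapping.keys (h k) \<subseteq> {0..T}"
 by (simp add: hilb_def)

lemma iso_properties:
 assumes h: "h \<in> hilb M Y T"
 shows "iso M Y h \<in> G" and "(%k. dl2 M (step_integral Y (h k)) (iso M Y h)) \<longlonglongrightarrow> 0"
proof -
 have sG: "step_integral Y (h k) \<in> G" for k by (rule step_integral_in_G[OF hilb_keys[OF h]])
 have cauchy: "\<exists>N. \<forall>j\<ge>N. \<forall>k\<ge>N. dl2 M (step_integral Y (h j)) (step_integral Y (h k)) < e" if e: "e > 0" for e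
 proof -
  have "e^2 > 0" using e by simp
  then obtain N where N: "!!j k. j \<ge> N ==> k \<ge> N ==> step_inner M Y (h j - h k) (h j - h k) < e^2"
   using h unfolding hilb_def by blast
  have "dl2 M (step_integral Y (h j)) (step_integral Y (h k)) < e" if "j \<ge> N" "k \<ge> N" for j k
  proof (rule power2_less_imp_less)
   show "(dl2 M (step_integral Y (h j)) (step_integral Y (h k)))^2 < e^2"
    using N[OF that] step_inner_self[OF keys_diff_subset[OF hilb_keys[OF h] hilb_keys[OF h]], of j k]
    by (simp add: step_integral_diff[abs_def])
  qed (use e in simp)
  thus ?thesis by blast
 qed
 obtain Z where Z: "sqint M Z" "(%k. dl2 M (step_integral Y (h k)) Z) \<longlonglongrightarrow> 0"
  using l2_complete[of "%k. step_integral Y (h k)", OF sqint_G[OF sG] cauchy] by blast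
 have conv: "(%k. \<integral>w. (Z w - step_integral Y (h k) w)^2 \<partial>M) \<longlonglongrightarrow> 0 \<longleftrightarrow> (%k. dl2 M (step_integral Y (h k)) Z) \<longlonglongrightarrow> 0" for Z
 proof -
  have eq: "(\<integral>w. (Z w - step_integral Y (h k) w)^2 \<partial>M) = (dl2 M (step_integral Y (h k)) Z)^2" for k
   unfolding l2_squared by (simp add: power2_commute)
  show ?thesis unfolding eq by (simp add: power_tendsto_0_iff)
 qed
 have "iso M Y h \<in> borel_measurable M \<and> integrable M (%w. (iso M Y h w)^2) \<and>
  (%k. \<integral>w. (iso M Y h w - step_integral Y (h k) w)^2 \<partial>M) \<longlonglongrightarrow> 0"
  unfolding iso_def by (rule someI[of _ Z]) (use Z conv in \<open>auto simp: sqint_def\<close>)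
 hence *: "sqint M (iso M Y h)" "(%k. dl2 M (step_integral Y (h k)) (iso M Y h)) \<longlonglongrightarrow> 0"
  unfolding conv by (auto simp: sqint_def)
 show "(%k. dl2 M (step_integral Y (h k)) (iso M Y h)) \<longlonglongrightarrow> 0" by (rule *)
 show "iso M Y h \<in> G" by (rule G_limit[OF sG *])
qed

lemma hinner_eq:
 assumes g: "g \<in> hilb M Y T" and h: "h \<in> hilb M Y T"
 shows "hinner M Y g h = ip (iso M Y g) (iso M Y h)"
proof -
 have "(%k. step_inner M Y (g k) (h k)) = (%k. ip (step_integral Y (g k)) (step_integral Y (h k)))"
  by (rule ext) (rule step_inner_eq[OF hilb_keys[OF g] hilb_keys[OF h]])
 moreover have "(%k. ip (step_integral Y (g k)) (step_integral Y (h k))) \<longlonglongrightarrow> ip (iso M Y g) (iso M Y h)"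
  by (rule l2_tendsto_inner[OF _ _ iso_properties(2)[OF g] _ _ iso_properties(2)[OF h]])
   (auto intro: sqint_G step_integral_in_G[OF hilb_keys[OF g]] step_integral_in_G[OF hilb_keys[OF h]] iso_properties(1)[OF g] iso_properties(1)[OF h])
 ultimately show ?thesis unfolding hinner_def by (simp add: limI)
qed

text \<open>An integral against \<open>Y\<close> depends only on the represented function, and can be computed along any step
 functions that approximate this function in \<open>L^2([0,T])\<close>.\<close>

lemma iso_approximation:
 assumes h: "represents M Y T h f" and c: "Poly_Mapping.keys c \<subseteq> {0..T}"
  and ic: "(%s. (step_fun c s - f s)^2) integrable_on {0..T}"
 shows "(dl2 M (step_integral Y c) (iso M Y h))^2 <= 4 * Kq * step_error T c f"
proof (rule LIMSEQ_le)
 have hh: "h \<in> hilb M Y T" and ih: "!!k. (%s. (step_fun (h k) s - f s)^2) integrable_on {0..T}"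
  and lh: "(%k. step_error T (h k) f) \<longlonglongrightarrow> 0" using h by (auto simp: represents_def)
 have sG: "step_integral Y (h k) \<in> G" for k by (rule step_integral_in_G[OF hilb_keys[OF hh]])
 have cG: "step_integral Y c \<in> G" by (rule step_integral_in_G[OF c])
 note iG = iso_properties(1)[OF hh]
 have "(%k. dl2 M (step_integral Y c) (step_integral Y (h k))) \<longlonglongrightarrow> dl2 M (step_integral Y c) (iso M Y h)"
 proof (rule l2_tendsto_norm)
  show "(%k. l2 M (%w. step_integral Y c w - step_integral Y (h k) w - (step_integral Y c w - iso M Y h w))) \<longlonglongrightarrow> 0"
  proof -
   have "l2 M (%w. step_integral Y c w - step_integral Y (h k) w - (step_integral Y c w - iso M Y h w)) = dl2 M (step_integral Y (h k)) (iso M Y h)" for k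
    by (subst l2_minus_commute) simp
   thus ?thesis using iso_properties(2)[OF hh] by simp
  qed
 qed (intro sqint_diff sqint_G[OF sG] sqint_G[OF cG] sqint_G[OF iG])+
 thus "(%k. (dl2 M (step_integral Y c) (step_integral Y (h k)))^2) \<longlonglongrightarrow> (dl2 M (step_integral Y c) (iso M Y h))\<^sup>2"
  by (intro tendsto_intros)
 have "(%k. 4 * Kq * (step_error T c f + step_error T (h k) f))
  \<longlonglongrightarrow> 4 * Kq * (step_error T c f + 0)"
  by (intro tendsto_intros lh)
 thus "(%k. 4 * Kq * (step_error T c f + step_error T (h k) f))
  \<longlonglongrightarrow> 4 * Kq * step_error T c f" by simp
 show "\<exists>N. \<forall>k\<ge>N. (dl2 M (step_integral Y c) (step_integral Y (h k)))\<^sup>2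
  <= 4 * Kq * (step_error T c f + step_error T (h k) f)"
  using step_integral_diff_l2_le[OF c hilb_keys[OF hh] ic ih] by blast
qed

lemma represents_ex:
 assumes k: "!!k. Poly_Mapping.keys (h k) \<subseteq> {0..T}" and i: "!!k. (%s. (step_fun (h k) s - f s)^2) integrable_on {0..T}"
  and l: "(%k. step_error T (h k) f) \<longlonglongrightarrow> 0"
 shows "represents M Y T h f"
 unfolding represents_def hilb_def
proof (intro conjI CollectI allI impI k i l)
 fix e :: real assume e: "e > 0"
 hence "e / (8 * Kq) > 0" using Kq_pos by simp
 from order_tendstoD(2)[OF l this] obtain N where N: "!!k. k \<ge> N ==> step_error T (h k) f < e / (8 * Kq)"
  by (auto simp: eventually_sequentially)
 show "\<exists>N. \<forall>j\<ge>N. \<forall>k\<ge>N. step_inner M Y (h j - h k) (h j - h k) < e"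
 proof (intro exI[of _ N] allI impI)
  fix j l assume jl: "N <= j" "N <= l"
  have "step_inner M Y (h j - h l) (h j - h l) = (dl2 M (step_integral Y (h j)) (step_integral Y (h l)))^2"
   using step_inner_self[OF keys_diff_subset[OF k k]] by (simp add: step_integral_diff[abs_def])
  also have "\<dots> <= 4 * Kq * (step_error T (h j) f + step_error T (h l) f)"
   by (rule step_integral_diff_l2_le[OF k k i i])
  also have "\<dots> < 4 * Kq * (e / (8 * Kq) + e / (8 * Kq))"
   using N[OF jl(1)] N[OF jl(2)] Kq_pos by (intro mult_strict_left_mono add_strict_mono) auto
  also have "\<dots> = e" using Kq_pos by simp
  finally show "step_inner M Y (h j - h l) (h j - h l) < e" .
 qed
qed

lemma represents_bounded_measurable:
 assumes T: "0 <= T" and f: "f \<in> borel_measurable lebesgue" and b: "!!x. \<bar>f x\<bar> <= C"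
 shows "represents M Y T (hilb_of M Y T f) f"
proof -
 have "\<exists>c. Poly_Mapping.keys c \<subseteq> {0..T} \<and> step_error T c f < 1 / real (Suc n)" for n
  by (rule step_functions_dense[OF T f b]) simp
 then obtain h where h: "!!n. Poly_Mapping.keys (h n) \<subseteq> {0..T}" "!!n. step_error T (h n) f < 1 / real (Suc n)"
  by metis
 have i: "(%s. (step_fun (h k) s - f s)^2) integrable_on {0..T}" for k by (rule step_minus_square_integrable[OF f b])
 have l: "(%k. step_error T (h k) f) \<longlonglongrightarrow> 0"
 proof (rule tendsto_0_le[OF LIMSEQ_inverse_real_of_nat, where K=1], rule always_eventually, rule allI)
  fix k
  have "0 <= step_error T (h k) f" by (rule hk_nonneg[OF i]) simp
  thus "norm (step_error T (h k) f) <= norm (inverse (real (Suc k))) * 1"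
   using h(2)[of k] by (simp add: inverse_eq_divide)
 qed
 show ?thesis unfolding hilb_of_def by (rule someI[of _ h]) (rule represents_ex[OF h(1) i l])
qed

lemma represents_continuous:
 fixes x :: "real => real"
 assumes T: "0 <= T" and c: "continuous_on {0..T} x"
 shows "represents M Y T (hilb_of M Y T x) x"
 unfolding hilb_of_def
 by (rule someI[of _ "riemann_step x T"])
  (rule represents_ex[OF keys_riemann[OF T] continuous_square_integrable[OF c] riemann_step_tendsto[OF T c]])

lemma wiener_integral_properties:
 assumes T: "0 <= T" and f: "f \<in> borel_measurable lebesgue" and b: "!!x. \<bar>f x\<bar> <= C"
 shows "wiener_integral M Y T f \<in> G" and "(l2 M (wiener_integral M Y T f))^2 <= 4 * Kq * C^2 * T"
proof -
 note r = represents_bounded_measurable[OF T f b]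
 hence h: "hilb_of M Y T f \<in> hilb M Y T" by (simp add: represents_def)
 show "wiener_integral M Y T f \<in> G" unfolding wiener_integral_def by (rule iso_properties(1)[OF h])
 have i: "(%s. (step_fun 0 s - f s)^2) integrable_on {0..T}" by (rule step_minus_square_integrable[OF f b])
 have "(dl2 M (step_integral Y 0) (wiener_integral M Y T f))^2 <= 4 * Kq * step_error T 0 f"
  unfolding wiener_integral_def by (rule iso_approximation[OF r _ i]) simp
 also have "\<dots> <= 4 * Kq * integral {0..T} (%s. C^2)"
 proof (intro mult_left_mono integral_le i integrable_const_ivl)
  show "(step_fun 0 s - f s)^2 <= C^2" for s
   using b[of s] by (simp add: step_fun_eq step_apply_zero abs_le_square_iff[symmetric])
 qed (use Kq_pos in auto)
 also have "\<dots> = 4 * Kq * C^2 * T" using T by simp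
 finally show "(l2 M (wiener_integral M Y T f))^2 <= 4 * Kq * C^2 * T"
  by (simp add: step_integral_eq step_apply_zero l2_uminus)
qed

end

section \<open>The Ornstein--Uhlenbeck process\<close>

lemma linear_ode_variation:
 fixes g :: "real => real" and \<alpha> c t :: real
 assumes g: "continuous_on {0..} g" and t: "0 <= t"
 defines "f \<equiv> %t. exp (- \<alpha> * t) * (c + integral {0..t} (%s. exp (\<alpha> * s) * g s))"
 shows "f t = c + integral {0..t} g - \<alpha> * integral {0..t} f"
proof -
 have sol: "((%s. g s - \<alpha> * f s) has_integral (f t - c)) {0..t}" "continuous_on {0..t} f"
  unfolding f_def by (rule linear_ode_solution[OF g t])+
 have i: "g integrable_on {0..t}" "f integrable_on {0..t}"
  using sol(2) by (auto intro!: integrable_continuous_interval continuous_on_subset[OF g])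
 have "integral {0..t} (%s. g s - \<alpha> * f s) = f t - c" using sol(1) by (rule integral_unique)
 moreover have "integral {0..t} (%s. g s - \<alpha> * f s) = integral {0..t} g - integral {0..t} (%s. \<alpha> * f s)"
  using integrable_cmul[OF i(2), of \<alpha>] by (intro hk_diff i) simp
 ultimately show ?thesis by simp
qed

text \<open>The kernel \<open>e\<^bsup>-\<alpha>(t-r)\<^esup>\<close> preserves every rate of exponential decay smaller than \<open>\<alpha>\<close>.\<close>

lemma weighted_exp_integral_bound:
 fixes c :: "real => real" and \<alpha> \<kappa> :: real
 assumes st: "s <= t" and k: "\<kappa> < \<alpha>" and K: "0 <= K"
  and i: "set_integrable lborel {s..t} (%r. exp (- \<alpha> * \<bar>t - r\<bar>) * c r)"
  and b: "!!r. r \<in> {s..t} ==> \<bar>c r\<bar> <= K * exp (- \<kappa> * (r - s))"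
 shows "\<bar>LBINT r:{s..t}. exp (- \<alpha> * \<bar>t - r\<bar>) * c r\<bar> <= K * exp (- \<kappa> * (t - s)) / (\<alpha> - \<kappa>)"
proof -
 define k where "k r = K * exp (- \<kappa> * (t - s)) * exp (- (\<alpha> - \<kappa>) * (t - r))" for r
 have ck: "continuous_on {s..t} k" unfolding k_def by (intro continuous_intros)
 have ik: "set_integrable lborel {s..t} k" by (rule borel_integrable_atLeastAtMost'[OF ck])
 have le: "\<bar>exp (- \<alpha> * \<bar>t - r\<bar>) * c r\<bar> <= k r" if r: "r \<in> {s..t}" for r
 proof -
  have "\<bar>exp (- \<alpha> * \<bar>t - r\<bar>) * c r\<bar> = exp (- \<alpha> * (t - r)) * \<bar>c r\<bar>" using r by (simp add: abs_mult)
  also have "\<dots> <= exp (- \<alpha> * (t - r)) * (K * exp (- \<kappa> * (r - s)))" by (intro mult_left_mono b r) simp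
  also have "\<dots> = K * (exp (- \<alpha> * (t - r)) * exp (- \<kappa> * (r - s)))" by simp
  also have "exp (- \<alpha> * (t - r)) * exp (- \<kappa> * (r - s)) = exp (- \<kappa> * (t - s)) * exp (- (\<alpha> - \<kappa>) * (t - r))"
   by (simp add: exp_add[symmetric] algebra_simps)
  finally show ?thesis by (simp add: k_def mult.assoc)
 qed
 have "(LBINT r:{s..t}. exp (- \<alpha> * \<bar>t - r\<bar>) * c r) <= (LBINT r:{s..t}. k r)"
  by (rule set_integral_mono[OF i ik]) (use le in \<open>auto simp: abs_le_iff\<close>)
 moreover have "- (LBINT r:{s..t}. k r) <= (LBINT r:{s..t}. exp (- \<alpha> * \<bar>t - r\<bar>) * c r)"
 proof -
  have "set_integrable lborel {s..t} (%r. - k r)"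
   by (rule borel_integrable_atLeastAtMost') (intro continuous_intros ck)
  hence "(LBINT r:{s..t}. - k r) <= (LBINT r:{s..t}. exp (- \<alpha> * \<bar>t - r\<bar>) * c r)"
   by (rule set_integral_mono[OF _ i]) (use le in \<open>auto simp: abs_le_iff minus_le_iff\<close>)
  thus ?thesis by (simp add: set_integral_uminus ik)
 qed
 moreover have "(LBINT r:{s..t}. k r) <= K * exp (- \<kappa> * (t - s)) / (\<alpha> - \<kappa>)"
 proof -
  have "(k has_integral (K * exp (- \<kappa> * (t - s)) * exp (- (\<alpha> - \<kappa>) * (t - t)) / (\<alpha> - \<kappa>) - K * exp (- \<kappa> * (t - s)) * exp (- (\<alpha> - \<kappa>) * (t - s)) / (\<alpha> - \<kappa>))) {s..t}"
  proof (rule fundamental_theorem_of_calculus[OF st])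
   fix r
   have "((%r. K * exp (- \<kappa> * (t - s)) * exp (- (\<alpha> - \<kappa>) * (t - r)) / (\<alpha> - \<kappa>)) has_real_derivative k r) (at r within {s..t})"
    unfolding k_def using k by (auto intro!: derivative_eq_intros)
   thus "((%r. K * exp (- \<kappa> * (t - s)) * exp (- (\<alpha> - \<kappa>) * (t - r)) / (\<alpha> - \<kappa>)) has_vector_derivative k r) (at r within {s..t})"
    by (simp add: real_vector_derivative)
  qed
  hence "(LBINT r:{s..t}. k r) = K * exp (- \<kappa> * (t - s)) / (\<alpha> - \<kappa>) - K * exp (- \<kappa> * (t - s)) * exp (- (\<alpha> - \<kappa>) * (t - s)) / (\<alpha> - \<kappa>)"
   unfolding lborel_set_integral_continuous[OF ck] by (simp add: integral_unique)
  also have "\<dots> <= K * exp (- \<kappa> * (t - s)) / (\<alpha> - \<kappa>)" using K k by simp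
  finally show ?thesis .
 qed
 ultimately show ?thesis by linarith
qed

text \<open>Truncating the time at zero makes a function on the half line a function on the whole line.\<close>

lemma continuous_on_max_0: "continuous_on {0..} (f :: real => real) ==> continuous_on A (%t. f (max 0 t))"
 by (rule continuous_on_compose2[of "{0..}" f]) (auto intro!: continuous_intros)

lemma continuous_on_atLeast_0:
 fixes f :: "real => real"
 assumes "!!T. T \<ge> 0 ==> continuous_on {0..T} f" shows "continuous_on {0..} f"
 unfolding continuous_on_eq_continuous_within
proof
 fix x :: real assume "x \<in> {0..}"
 hence x: "0 <= x" by simp
 have "at x within {0..} = at x within {0..x+1}" by (rule at_within_nhd[of x "{..<x+1}"]) auto
 moreover have "continuous (at x within {0..x+1}) f"
  using assms[of "x + 1"] x by (auto simp: continuous_on_eq_continuous_within)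
 ultimately show "continuous (at x within {0..}) f" by simp
qed

text \<open>The solution \<open>f\<close> of \<open>f = y - \<alpha> \<integral> f\<close>, for a merely continuous \<open>y\<close>: variation of constants,
 integrated by parts so that \<open>y\<close> is not differentiated.\<close>

definition volterra :: "real => (real => real) => real => real" where
 "volterra \<alpha> y t = y t + exp (- \<alpha> * t) * (0 + integral {0..t} (%s. exp (\<alpha> * s) * (- \<alpha> * y s)))"

lemma volterra_continuous: assumes y: "continuous_on {0..} y" shows "continuous_on {0..} (volterra \<alpha> y)"
proof (rule continuous_on_atLeast_0)
 fix T :: real assume T: "0 <= T"
 have "continuous_on {0..} (%s. - \<alpha> * y s)" by (intro continuous_intros y)
 from linear_ode_solution(2)[OF this T, where c=0 and \<alpha>=\<alpha>]
 show "continuous_on {0..T} (volterra \<alpha> y)"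
  unfolding volterra_def[abs_def] using continuous_on_subset[OF y, of "{0..T}"] by (intro continuous_on_add) auto
qed

lemma volterra_equation: assumes y: "continuous_on {0..} y" and t: "0 <= t"
 shows "volterra \<alpha> y t = y t - \<alpha> * integral {0..t} (volterra \<alpha> y)"
proof -
 define f where "f t = exp (- \<alpha> * t) * (0 + integral {0..t} (%s. exp (\<alpha> * s) * (- \<alpha> * y s)))" for t
 have cy: "continuous_on {0..} (%s. - \<alpha> * y s)" by (intro continuous_intros y)
 have "f t = 0 + integral {0..t} (%s. - \<alpha> * y s) - \<alpha> * integral {0..t} f"
  unfolding f_def by (rule linear_ode_variation[OF cy t])
 also have "integral {0..t} (%s. - \<alpha> * y s) = - \<alpha> * integral {0..t} y" by (rule integral_mult_right)
 also have "0 + - \<alpha> * integral {0..t} y - \<alpha> * integral {0..t} f = - \<alpha> * (integral {0..t} y + integral {0..t} f)" by (simp add: algebra_simps)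
 also have "integral {0..t} y + integral {0..t} f = integral {0..t} (%s. y s + f s)"
 proof (rule hk_add[symmetric])
  show "y integrable_on {0..t}" by (rule integrable_continuous_interval) (rule continuous_on_subset[OF y], auto)
  show "f integrable_on {0..t}" unfolding f_def
   by (rule integrable_continuous_interval[OF linear_ode_solution(2)[OF cy t]])
 qed
 also have "(%s. y s + f s) = volterra \<alpha> y" by (simp add: volterra_def[abs_def] f_def)
 finally have "f t = - \<alpha> * integral {0..t} (volterra \<alpha> y)" .
 moreover have "volterra \<alpha> y t = y t + f t" by (simp only: volterra_def f_def)
 ultimately show ?thesis by simp
qed

lemma volterra_unique:
 assumes y: "continuous_on {0..} y" and f: "continuous_on {0..} f" and t: "0 <= t"
  and eq: "!!s. 0 <= s ==> f s = y s - \<alpha> * integral {0..s} f"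
 shows "f t = volterra \<alpha> y t"
proof -
 define D where "D s = f s - volterra \<alpha> y s" for s
 note c = f volterra_continuous[OF y, of \<alpha>]
 have eqD: "D s = - \<alpha> * integral {0..s} D" if s: "0 <= s" for s
 proof -
  have i: "f integrable_on {0..s}" "volterra \<alpha> y integrable_on {0..s}"
   by (rule integrable_continuous_interval, rule continuous_on_subset, rule c, simp)+
  have "integral {0..s} D = integral {0..s} f - integral {0..s} (volterra \<alpha> y)"
   unfolding D_def by (rule hk_diff[OF i])
  hence "\<alpha> * integral {0..s} D = \<alpha> * integral {0..s} f - \<alpha> * integral {0..s} (volterra \<alpha> y)" by (simp only: right_diff_distrib)
  thus ?thesis using eq[OF s] volterra_equation[OF y s, of \<alpha>] D_def[of s] by linarith
 qed
 have "D t = 0"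
 proof (rule linear_ode_zero[OF _ t])
  show "continuous_on {0..t} D" unfolding D_def by (intro continuous_on_diff continuous_on_subset[OF c(1)] continuous_on_subset[OF c(2)]) auto
 qed (use eqD in auto)
 thus ?thesis by (simp add: D_def)
qed

locale ou = fbm M H B for M :: "'a measure" and H :: real and B :: "real => 'a => real" +
 fixes \<phi> :: "'p::finite => real => real" and \<mu> :: "real ^ 'p" and \<alpha> C :: real and X :: "real => 'a => real"
 assumes \<phi>_measurable: "!!i. \<phi> i \<in> borel_measurable lebesgue"
  and C_pos: "C > 0" and \<phi>_bound: "!!i t. \<bar>\<phi> i t\<bar> <= C"
  and \<alpha>_pos: "\<alpha> > 0"
  and X_solution: "ou_solution M (Y1 H B) \<phi> \<mu> \<alpha> X"
begin

abbreviation decay :: "real => real" where "decay u \<equiv> exp (- \<alpha> * u)"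

definition L :: "real => real" where "L t = (\<Sum>i\<in>UNIV. \<mu> $ i * \<phi> i t)"

definition CL :: real where "CL = (\<Sum>i\<in>UNIV. \<bar>\<mu> $ i\<bar> * C)"

lemma L_bound: "\<bar>L t\<bar> <= CL"
proof -
 have "\<bar>L t\<bar> <= (\<Sum>i\<in>UNIV. \<bar>\<mu> $ i * \<phi> i t\<bar>)" unfolding L_def by (rule sum_abs)
 also have "\<dots> <= CL" unfolding CL_def by (rule sum_mono) (simp add: abs_mult \<phi>_bound mult_left_mono)
 finally show ?thesis .
qed

lemma CL_nonneg: "0 <= CL" using L_bound[of 0] by linarith

lemma L_measurable: "L \<in> borel_measurable lebesgue"
 unfolding L_def[abs_def] using \<phi>_measurable by (intro borel_measurable_sum borel_measurable_times) auto

lemma L_integrable: "L integrable_on {a..b}"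
 by (rule bounded_measurable_integrable_on[OF L_measurable]) (rule L_bound)

definition N :: "real => real" where "N t = integral {0..t} L"

lemma N_increment: assumes "0 <= s" "s <= t" shows "\<bar>N t - N s\<bar> <= CL * (t - s)"
proof -
 have "N t - N s = integral {s..t} L"
  unfolding N_def using hk_combine[OF assms L_integrable] by simp
 moreover have "norm (integral {s..t} L) <= integral {s..t} (%_. CL)"
  by (rule integral_norm_bound_integral[OF L_integrable integrable_const_ivl]) (simp add: L_bound)
 ultimately show ?thesis using assms by (simp add: mult.commute)
qed

lemma N_continuous: "continuous_on {0..} N"
 unfolding N_def[abs_def] by (rule continuous_on_atLeast_0) (rule indefinite_integral_continuous_1[OF L_integrable])

text \<open>The mean of the solution, in a form that does not differentiate the merely measurable drift.\<close>

definition mean :: "real => real" where "mean = volterra \<alpha> N"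

lemma mean_continuous: "continuous_on {0..} mean"
 unfolding mean_def by (rule volterra_continuous[OF N_continuous])

lemma mean_integrable: "0 <= a ==> mean integrable_on {a..b}"
 by (rule integrable_continuous_interval) (rule continuous_on_subset[OF mean_continuous], auto)

lemma mean_equation: assumes t: "0 <= t" shows "mean t = N t - \<alpha> * integral {0..t} mean"
 unfolding mean_def by (rule volterra_equation[OF N_continuous t])

text \<open>The mean at \<open>t\<close> is an average of the increments \<open>N\<^sub>t - N\<^sub>s\<close> with \<open>s\<close> in \<open>[0,t]\<close>, where \<open>s\<close> has density \<open>\<alpha> e\<^bsup>-\<alpha>(t-s)\<^esup>\<close> and
 the remaining mass \<open>e\<^bsup>-\<alpha>t\<^esup>\<close> at \<open>0\<close>, so that \<open>t - s\<close> has mean at most \<open>1/\<alpha>\<close>; and \<open>N\<close> is Lipschitz.\<close>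

lemma mean_bound: assumes t: "0 <= t" shows "\<bar>mean t\<bar> <= CL / \<alpha>"
proof -
 have cN: "continuous_on {0..t} N" by (rule continuous_on_subset[OF N_continuous]) auto
 have e0: "((%s. \<alpha> * decay (t - s)) has_integral (decay (t - t) - decay (t - 0))) {0..t}"
  by (rule fundamental_theorem_of_calculus[OF t])
   (auto intro!: derivative_eq_intros simp: real_vector_derivative[symmetric])
 have e1: "((%s. \<alpha> * decay (t - s) * N t) has_integral (1 - decay t) * N t) {0..t}"
  using has_integral_mult_left[OF e0, of "N t"] by simp
 have "((%s. \<alpha> * decay (t - s) * N s) has_integral integral {0..t} (%s. \<alpha> * decay (t - s) * N s)) {0..t}"
  by (intro integrable_integral integrable_continuous_interval continuous_intros cN)
 moreover have "integral {0..t} (%s. \<alpha> * decay (t - s) * N s) = N t - mean t"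
 proof -
  have "integral {0..t} (%s. \<alpha> * decay (t - s) * N s) = integral {0..t} (%s. - decay t * (exp (\<alpha> * s) * (- \<alpha> * N s)))"
   by (rule hk_cong) (simp add: right_diff_distrib exp_diff exp_minus divide_simps)
  also have "\<dots> = - decay t * integral {0..t} (%s. exp (\<alpha> * s) * (- \<alpha> * N s))" by (rule integral_mult_right)
  finally show ?thesis by (simp add: mean_def volterra_def)
 qed
 ultimately have e2: "((%s. \<alpha> * decay (t - s) * N s) has_integral N t - mean t) {0..t}" by simp
 have e3: "((%s. \<alpha> * decay (t - s) * (N t - N s)) has_integral mean t - decay t * N t) {0..t}"
  using has_integral_diff[OF e1 e2] by (simp add: algebra_simps)
 have d1: "((%s. decay (t - s) * ((t - s) + 1 / \<alpha>)) has_real_derivative \<alpha> * decay (t - s) * (t - s)) (at s within {0..t})" for s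
  using \<alpha>_pos by (auto intro!: derivative_eq_intros simp: field_simps)
 have e40: "((%s. \<alpha> * decay (t - s) * (t - s)) has_integral
   (decay (t - t) * ((t - t) + 1 / \<alpha>) - decay (t - 0) * ((t - 0) + 1 / \<alpha>))) {0..t}"
  by (rule fundamental_theorem_of_calculus[OF t]) (use d1 in \<open>simp add: real_vector_derivative\<close>)
 have e4: "((%s. CL * (\<alpha> * decay (t - s) * (t - s))) has_integral CL * (1 / \<alpha> - decay t * (t + 1 / \<alpha>))) {0..t}"
  using has_integral_mult_right[OF e40, of CL] by simp
 have "norm (integral {0..t} (%s. \<alpha> * decay (t - s) * (N t - N s))) <= integral {0..t} (%s. CL * (\<alpha> * decay (t - s) * (t - s)))"
 proof (rule integral_norm_bound_integral)
  fix s assume s: "s \<in> {0..t}"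
  have "norm (\<alpha> * decay (t - s) * (N t - N s)) = \<alpha> * decay (t - s) * \<bar>N t - N s\<bar>"
   using \<alpha>_pos by (simp add: abs_mult)
  also have "\<dots> <= \<alpha> * decay (t - s) * (CL * (t - s))"
   by (intro mult_left_mono N_increment) (use s \<alpha>_pos in auto)
  finally show "norm (\<alpha> * decay (t - s) * (N t - N s)) <= CL * (\<alpha> * decay (t - s) * (t - s))" by (simp add: mult_ac)
 qed (use e3 e4 in auto)
 hence "\<bar>mean t - decay t * N t\<bar> <= CL * (1 / \<alpha> - decay t * (t + 1 / \<alpha>))"
  unfolding integral_unique[OF e3] integral_unique[OF e4] real_norm_def .
 moreover have "\<bar>decay t * N t\<bar> <= decay t * (CL * t)"
  using N_increment[of 0 t] t by (simp add: abs_mult N_def mult_left_mono)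
 moreover have "CL * (1 / \<alpha> - decay t * (t + 1 / \<alpha>)) + decay t * (CL * t) = CL / \<alpha> - CL * decay t / \<alpha>"
  by (simp add: algebra_simps)
 moreover have "0 <= CL * decay t / \<alpha>" using CL_nonneg \<alpha>_pos by simp
 ultimately show ?thesis by linarith
qed

lemma mean_increment: assumes st: "0 <= s" "s <= t" shows "\<bar>mean t - mean s\<bar> <= 2 * CL * (t - s)"
proof -
 have t: "0 <= t" using st by simp
 have "integral {0..s} mean + integral {s..t} mean = integral {0..t} mean"
  by (rule hk_combine[OF st mean_integrable]) simp
 hence "\<alpha> * integral {0..t} mean = \<alpha> * integral {0..s} mean + \<alpha> * integral {s..t} mean" by (metis distrib_left)
 hence "mean t - mean s = (N t - N s) - \<alpha> * integral {s..t} mean"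
  using mean_equation[OF t] mean_equation[OF st(1)] by linarith
 moreover have "norm (integral {s..t} mean) <= integral {s..t} (%_. CL / \<alpha>)"
  by (rule integral_norm_bound_integral[OF mean_integrable integrable_const_ivl]) (use mean_bound st in auto)
 hence "\<bar>integral {s..t} mean\<bar> <= CL / \<alpha> * (t - s)" using st by (simp add: mult.commute)
 hence "\<bar>\<alpha> * integral {s..t} mean\<bar> <= \<alpha> * (CL / \<alpha> * (t - s))"
  unfolding abs_mult using \<alpha>_pos by (simp only: abs_of_pos mult_left_mono less_imp_le)
 hence "\<bar>\<alpha> * integral {s..t} mean\<bar> <= CL * (t - s)" using \<alpha>_pos by simp
 ultimately show ?thesis using N_increment[OF st] by linarith
qed

definition m :: "real => real" where "m t = mean (max 0 t)"

lemma m_bound: "\<bar>m t\<bar> <= CL / \<alpha>" unfolding m_def by (rule mean_bound) simp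

lemma m_measurable[measurable]: "m \<in> borel_measurable borel"
 unfolding m_def[abs_def] by (intro borel_measurable_continuous_onI continuous_on_max_0 mean_continuous)

definition EI :: "real => real => 'a => real" where
 "EI s t w = (LBINT r:{s..t}. decay \<bar>t - r\<bar> * U r w)"

text \<open>Variation of constants for \<open>dZ = - \<alpha> Z dt + dY\<close>, with \<open>dY = dU + U dt\<close> and the integral against \<open>U\<close> taken by
 parts. Only ordinary integrals remain.\<close>

definition Z0 :: "real => 'a => real" where
 "Z0 t w = U t w - decay t * U 0 w + (1 - \<alpha>) * EI 0 t w"

definition Z :: "real => 'a => real" where "Z t = Z0 (max 0 t)"

lemma EI_integrand_continuous: "w \<in> space M ==> continuous_on A (%r. decay \<bar>t - r\<bar> * U r w)"
 by (intro continuous_intros U_continuous)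

lemma EI_eq: "w \<in> space M ==> EI s t w = integral {s..t} (%r. decay \<bar>t - r\<bar> * U r w)"
 unfolding EI_def by (rule lborel_set_integral_continuous[OF EI_integrand_continuous])

lemma exp_abs_bound: "\<bar>decay \<bar>t - v\<bar>\<bar> <= 1"
 using \<alpha>_pos by simp

lemma EI_bound: "l2 M (%w. decay \<bar>t - v\<bar> * U v w) <= sqrt (\<gamma> 0)"
proof -
 have "\<bar>decay \<bar>t - v\<bar>\<bar> * sqrt (\<gamma> 0) <= sqrt (\<gamma> 0)"
  using exp_abs_bound[of t v] \<gamma>_nonneg[of 0] by (intro mult_left_le_one_le) auto
 thus ?thesis by (simp add: l2_cmult l2_U)
qed

lemma EI_in_G: assumes "s <= t" shows "EI s t \<in> G"
 unfolding EI_def[abs_def]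
proof (rule process_integral_in_G[OF _ assms, where K="sqrt (\<gamma> 0)"])
 show "case_prod (%r w. decay \<bar>t - r\<bar> * U r w) \<in> borel_measurable (borel \<Otimes>\<^sub>M M)" by measurable
qed (intro conjI G_cmult U_in_G EI_bound)

lemma EI_inner:
 assumes st: "s <= t" and xi: "sqint M \<xi>"
 shows "ip \<xi> (EI s t) = (LBINT r:{s..t}. decay \<bar>t - r\<bar> * ip \<xi> (U r))"
  and "set_integrable lborel {s..t} (%r. decay \<bar>t - r\<bar> * ip \<xi> (U r))"
proof -
 have m: "case_prod (%r w. decay \<bar>t - r\<bar> * U r w) \<in> borel_measurable (borel \<Otimes>\<^sub>M M)" by measurable
 have b: "sqint M (%w. decay \<bar>t - r\<bar> * U r w) \<and> l2 M (%w. decay \<bar>t - r\<bar> * U r w) <= sqrt (\<gamma> 0)" for r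
  using sqint_cmult[OF U_sqint] EI_bound by blast
 have e: "expectation (%w. \<xi> w * (decay \<bar>t - r\<bar> * U r w)) = decay \<bar>t - r\<bar> * ip \<xi> (U r)" for r
  unfolding mult.left_commute[of _ "decay \<bar>t - r\<bar>"] by (rule integral_mult_right_zero)
 show "ip \<xi> (EI s t) = (LBINT r:{s..t}. decay \<bar>t - r\<bar> * ip \<xi> (U r))"
  and "set_integrable lborel {s..t} (%r. decay \<bar>t - r\<bar> * ip \<xi> (U r))"
  using process_integral_inner[OF m st b xi] unfolding EI_def e by auto
qed

lemma EI_split:
 assumes w: "w \<in> space M" and st: "0 <= s" "s <= t"
 shows "EI 0 t w = decay (t - s) * EI 0 s w + EI s t w"
proof -
 have "integral {0..s} (%r. decay \<bar>t - r\<bar> * U r w) + integral {s..t} (%r. decay \<bar>t - r\<bar> * U r w) = integral {0..t} (%r. decay \<bar>t - r\<bar> * U r w)"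
  by (intro hk_combine st integrable_continuous_interval EI_integrand_continuous w)
 moreover have "integral {0..s} (%r. decay \<bar>t - r\<bar> * U r w) = integral {0..s} (%r. decay (t - s) * (decay \<bar>s - r\<bar> * U r w))"
 proof (rule hk_cong)
  fix r assume "r \<in> {0..s}"
  hence "- \<alpha> * \<bar>t - r\<bar> = - \<alpha> * (t - s) + - \<alpha> * \<bar>s - r\<bar>" using st by (simp add: algebra_simps)
  thus "decay \<bar>t - r\<bar> * U r w = decay (t - s) * (decay \<bar>s - r\<bar> * U r w)"
   by (simp only: exp_add mult.assoc)
 qed
 moreover have "integral {0..s} (%r. decay (t - s) * (decay \<bar>s - r\<bar> * U r w))
   = decay (t - s) * integral {0..s} (%r. decay \<bar>s - r\<bar> * U r w)" by (rule integral_mult_right)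
 ultimately show ?thesis unfolding EI_eq[OF w] by linarith
qed

lemma Z_nonneg_time: "0 <= t ==> Z t w = U t w - decay t * U 0 w + (1 - \<alpha>) * EI 0 t w"
 by (simp add: Z_def Z0_def)

lemma Z_in_G: "Z t \<in> G"
 unfolding Z_def Z0_def[abs_def] by (intro G_add G_diff G_cmult U_in_G EI_in_G) simp

lemma Z_sqint: "sqint M (Z t)" using Z_in_G sqint_G by blast

lemma Z_measurable[measurable]: "Z t \<in> borel_measurable M" using Z_in_G measurable_G by blast

text \<open>The formula defining \<open>Z\<close> contains no integral against \<open>Y\<close>; that it solves the linear equation driven
 by \<open>Y\<close> follows from \<open>Y\<^sub>t = U\<^sub>t - U\<^sub>0 + \<integral>\<^sub>0\<^sup>t U\<close> and the fundamental theorem of calculus.\<close>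

lemma Z_path:
 assumes w: "w \<in> space M"
 shows "continuous_on {0..} (%t. Z t w)"
  and "0 <= t ==> Z t w = Y t w - \<alpha> * integral {0..t} (%s. Z s w)"
proof -
 define g where "g s = (1 - \<alpha>) * U s w" for s
 have cg: "continuous_on {0..} g" unfolding g_def by (intro continuous_intros U_continuous w)
 define f where "f t = decay t * (- U 0 w + integral {0..t} (%s. exp (\<alpha> * s) * g s))" for t
 have Zf: "Z t w = U t w + f t" if t: "0 <= t" for t
 proof -
  have "EI 0 t w = integral {0..t} (%r. decay t * (exp (\<alpha> * r) * U r w))"
   unfolding EI_eq[OF w]
  proof (rule hk_cong)
   fix r assume "r \<in> {0..t}"
   hence "- \<alpha> * \<bar>t - r\<bar> = - \<alpha> * t + \<alpha> * r" by (simp add: algebra_simps)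
   thus "decay \<bar>t - r\<bar> * U r w = decay t * (exp (\<alpha> * r) * U r w)"
    by (simp only: exp_add mult.assoc)
  qed
  also have "\<dots> = decay t * integral {0..t} (%r. exp (\<alpha> * r) * U r w)" by (rule integral_mult_right)
  finally have 1: "EI 0 t w = decay t * integral {0..t} (%r. exp (\<alpha> * r) * U r w)" .
  have "integral {0..t} (%s. exp (\<alpha> * s) * g s) = integral {0..t} (%s. (1 - \<alpha>) * (exp (\<alpha> * s) * U s w))"
   unfolding g_def by (simp only: mult.left_commute)
  also have "\<dots> = (1 - \<alpha>) * integral {0..t} (%r. exp (\<alpha> * r) * U r w)" by (rule integral_mult_right)
  finally have "f t = decay t * (- U 0 w + (1 - \<alpha>) * integral {0..t} (%r. exp (\<alpha> * r) * U r w))" by (simp only: f_def)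
  moreover have "Z t w = U t w - decay t * U 0 w + (1 - \<alpha>) * (decay t * integral {0..t} (%r. exp (\<alpha> * r) * U r w))"
   unfolding Z_nonneg_time[OF t] 1 ..
  moreover have "a - e * b + c * (e * d) = a + e * (- b + c * d)" for a b c d e :: real by (simp add: algebra_simps)
  ultimately show ?thesis by (simp only:)
 qed
 have cf: "continuous_on {0..T} f" if "0 <= T" for T
  unfolding f_def using linear_ode_solution(2)[OF cg that] .
 have "continuous_on {0..} (%t. U t w + f t)"
  by (intro continuous_intros U_continuous w continuous_on_atLeast_0 cf)
 thus cZ: "continuous_on {0..} (%t. Z t w)" by (rule continuous_on_eq) (simp add: Zf)
 assume t: "0 <= t"
 have iU: "(%s. U s w) integrable_on {0..t}" by (intro integrable_continuous_interval U_continuous w)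
 have iff: "f integrable_on {0..t}" by (intro integrable_continuous_interval cf t)
 have "f t = - U 0 w + integral {0..t} g - \<alpha> * integral {0..t} f"
  unfolding f_def by (rule linear_ode_variation[OF cg t])
 moreover have "integral {0..t} g = (1 - \<alpha>) * integral {0..t} (%s. U s w)"
  unfolding g_def by (rule integral_mult_right)
 moreover have "integral {0..t} (%s. Z s w) = integral {0..t} (%s. U s w) + integral {0..t} f"
 proof -
  have "integral {0..t} (%s. Z s w) = integral {0..t} (%s. U s w + f s)"
   by (rule hk_cong) (simp add: Zf)
  also have "\<dots> = integral {0..t} (%s. U s w) + integral {0..t} f" by (rule hk_add[OF iU iff])
  finally show ?thesis .
 qed
 moreover have "Y t w = U t w - U 0 w + integral {0..t} (%s. U s w)" using t w by (simp add: Y_eq IU_eq)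
 moreover have "(1 - \<alpha>) * a = a - \<alpha> * a" "\<alpha> * (a + b) = \<alpha> * a + \<alpha> * b" for a b by (simp_all add: algebra_simps)
 ultimately show "Z t w = Y t w - \<alpha> * integral {0..t} (%s. Z s w)"
  using Zf[OF t] by simp
qed

lemma Z_continuous: assumes "w \<in> space M" shows "continuous_on A (%t. Z t w)"
proof -
 have "continuous_on A (%t. Z (max 0 t) w)" by (rule continuous_on_max_0[OF Z_path(1)[OF assms]])
 thus ?thesis by (simp add: Z_def)
qed

lemma Z_jointly_measurable[measurable]: "case_prod Z \<in> borel_measurable (borel \<Otimes>\<^sub>M M)"
 by (rule continuous_process_jointly_measurable) (auto intro: Z_continuous)

lemma X_drift_integral: assumes w: "w \<in> space M" and t: "0 <= t"
 shows "((%s. L s - \<alpha> * X s w) has_integral (X t w - Y t w)) {0..t}"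
 using X_solution w t by (auto simp: ou_solution_def drift_def L_def)

lemma Y_continuous: assumes w: "w \<in> space M" shows "continuous_on {0..} (%t. Y t w)"
proof -
 have "continuous_on {0..} (%t. U t w - U 0 w + integral {0..t} (%u. U u w))"
  by (intro continuous_intros U_continuous w continuous_on_atLeast_0 indefinite_integral_continuous_1 integrable_continuous_interval)
 thus ?thesis by (rule continuous_on_eq) (simp add: Y_eq w IU_eq)
qed

text \<open>Both sides solve the same linear integral equation, so their difference solves the homogeneous one.\<close>

lemma X_eq_mean_Z: assumes w: "w \<in> space M" and t: "0 <= t" shows "X t w = m t + Z t w"
proof -
 have cX: "continuous_on {0..T} (%t. X t w)" if T: "0 <= T" for T
 proof -
  have "(%s. L s - \<alpha> * X s w) integrable_on {0..T}" using X_drift_integral[OF w T] by blast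
  hence "continuous_on {0..T} (%t. integral {0..t} (%s. L s - \<alpha> * X s w))" by (rule indefinite_integral_continuous_1)
  hence "continuous_on {0..T} (%t. integral {0..t} (%s. L s - \<alpha> * X s w) + Y t w)"
   by (intro continuous_on_add continuous_on_subset[OF Y_continuous[OF w]]) auto
  moreover have "integral {0..t} (%s. L s - \<alpha> * X s w) + Y t w = X t w" if "t \<in> {0..T}" for t
   using integral_unique[OF X_drift_integral[OF w, of t]] that by simp
  ultimately show ?thesis by (rule continuous_on_eq)
 qed
 define D where "D t = X t w - mean t - Z t w" for t
 have iX: "(%t. X t w) integrable_on {0..T}" if "0 <= T" for T by (intro integrable_continuous_interval cX that)
 have iZ: "(%t. Z t w) integrable_on {0..T}" for T by (intro integrable_continuous_interval Z_continuous w)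
 have eqD: "D s = - \<alpha> * integral {0..s} D" if s: "0 <= s" for s
 proof -
  have "X s w - Y s w = integral {0..s} (%s. L s - \<alpha> * X s w)" using X_drift_integral[OF w s] by (simp add: integral_unique)
  also have "\<dots> = N s - \<alpha> * integral {0..s} (%s. X s w)"
   unfolding N_def using integrable_cmul[OF iX[OF s], of \<alpha>] by (subst hk_diff[OF L_integrable]) auto
  finally have x: "X s w = Y s w + N s - \<alpha> * integral {0..s} (%s. X s w)" by simp
  have "integral {0..s} D = integral {0..s} (%s. X s w) - integral {0..s} mean - integral {0..s} (%s. Z s w)"
   unfolding D_def by (simp add: hk_diff iX s mean_integrable iZ integrable_diff)
  hence "\<alpha> * integral {0..s} D = \<alpha> * integral {0..s} (%s. X s w) - \<alpha> * integral {0..s} mean - \<alpha> * integral {0..s} (%s. Z s w)"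
   by (simp only: right_diff_distrib)
  thus ?thesis using x mean_equation[OF s] Z_path(2)[OF w s] D_def[of s] by linarith
 qed
 have "D t = 0"
 proof (rule linear_ode_zero[OF _ t])
  show "continuous_on {0..t} D" unfolding D_def
   by (intro continuous_on_diff cX t continuous_on_subset[OF mean_continuous] Z_continuous w) auto
 qed (use eqD in auto)
 thus ?thesis using t by (simp add: D_def m_def)
qed

lemma m_continuous: "continuous_on A m"
 unfolding m_def[abs_def] by (rule continuous_on_max_0[OF mean_continuous])

lemma X_continuous: assumes w: "w \<in> space M" shows "continuous_on {0..T} (%t. X t w)"
proof -
 have "continuous_on {0..T} (%t. m t + Z t w)" by (intro continuous_on_add m_continuous Z_continuous w)
 thus ?thesis by (rule continuous_on_eq) (simp add: X_eq_mean_Z w)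
qed

subsection \<open>Decay of correlations\<close>

text \<open>A rate of decay shared by \<open>\<gamma>\<close> and by the kernel \<open>e\<^bsup>-\<alpha>t\<^esup>\<close>; it is strictly smaller than \<open>\<alpha>\<close>, so that
 \<open>1 / (\<alpha> - \<kappa>)\<close> makes sense.\<close>

definition \<kappa> :: real where "\<kappa> = min lam (\<alpha> / 2)"

lemma \<kappa>: "0 < \<kappa>" "\<kappa> < \<alpha>" "\<kappa> <= lam" using lam_pos \<alpha>_pos by (auto simp: \<kappa>_def)

lemma \<gamma>_decay_\<kappa>: assumes "0 <= x" shows "\<gamma> x <= K\<gamma> * exp (- \<kappa> * x)"
proof -
 have "\<kappa> * x <= lam * x" using \<kappa>(3) assms by (rule mult_right_mono)
 hence "exp (- lam * x) <= exp (- \<kappa> * x)" by simp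
 thus ?thesis using \<gamma>_decay[OF assms] K\<gamma>_pos by (smt (verit) mult_left_mono)
qed

definition Ku :: real where "Ku = 2 + \<bar>1 - \<alpha>\<bar> / \<alpha>"

lemma Ku_pos: "0 < Ku" using \<alpha>_pos by (simp add: Ku_def add_pos_nonneg)

lemma Z_inner:
 assumes s: "0 <= s" and xi: "sqint M \<xi>"
 shows "ip \<xi> (Z s) = ip \<xi> (U s) - decay s * ip \<xi> (U 0)
  + (1 - \<alpha>) * ip \<xi> (EI 0 s)"
proof -
 have e: "ip \<xi> (Z s) = expectation (%w. \<xi> w * U s w - decay s * (\<xi> w * U 0 w) + (1 - \<alpha>) * (\<xi> w * EI 0 s w))"
  by (rule bochner_cong) (auto simp: Z_nonneg_time[OF s] algebra_simps)
 show ?thesis unfolding e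
  using sqint_mult[OF xi U_sqint] sqint_mult[OF xi sqint_G[OF EI_in_G[OF s]]] by simp
qed

text \<open>Bounds on correlations with \<open>U\<close> pass to correlations with \<open>Z\<close>, with a constant that does not depend on
 the time.\<close>

lemma Z_inner_bound:
 assumes s: "0 <= s" and xi: "sqint M \<xi>" and b: "!!v. v \<in> {0..s} ==> \<bar>ip \<xi> (U v)\<bar> <= K"
 shows "\<bar>ip \<xi> (Z s)\<bar> <= Ku * K"
proof -
 have K: "0 <= K" using b[of 0] s by (auto intro: order_trans[OF abs_ge_zero])
 have "\<bar>ip \<xi> (EI 0 s)\<bar> <= K * exp (- 0 * (s - 0)) / (\<alpha> - 0)"
  unfolding EI_inner(1)[OF s xi]
  by (rule weighted_exp_integral_bound[OF s \<alpha>_pos K EI_inner(2)[OF s xi]]) (use b in auto)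
 hence e: "\<bar>ip \<xi> (EI 0 s)\<bar> <= K / \<alpha>" by simp
 have "decay s <= 1" using s \<alpha>_pos by simp
 hence "\<bar>decay s * ip \<xi> (U 0)\<bar> <= 1 * K"
  unfolding abs_mult using b[of 0] s by (intro mult_mono) auto
 moreover have "\<bar>(1 - \<alpha>) * ip \<xi> (EI 0 s)\<bar> <= \<bar>1 - \<alpha>\<bar> * (K / \<alpha>)"
  unfolding abs_mult by (rule mult_left_mono[OF e]) simp
 moreover have "\<bar>ip \<xi> (U s)\<bar> <= K" using b[of s] s by simp
 moreover have "Ku * K = 2 * K + \<bar>1 - \<alpha>\<bar> * (K / \<alpha>)" by (simp add: Ku_def algebra_simps)
 ultimately show ?thesis unfolding Z_inner[OF s xi] by linarith
qed

definition KZ :: real where "KZ = Ku * sqrt (\<gamma> 0)"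

lemma KZ_nonneg: "0 <= KZ" using Ku_pos \<gamma>_nonneg[of 0] by (simp add: KZ_def)

lemma Z_l2: "l2 M (Z s) <= KZ"
proof -
 have *: "l2 M (Z s) <= KZ" if s: "0 <= s" for s
 proof (cases "l2 M (Z s) = 0")
  case False
  hence p: "l2 M (Z s) > 0" using l2_nonneg[of M "Z s"] by linarith
  have "\<bar>ip (Z s) (Z s)\<bar> <= Ku * (l2 M (Z s) * sqrt (\<gamma> 0))"
   by (rule Z_inner_bound[OF s Z_sqint]) (use cauchy_schwarz[OF Z_sqint U_sqint] in \<open>simp add: l2_U\<close>)
  moreover have "ip (Z s) (Z s) = l2 M (Z s) * l2 M (Z s)"
   using l2_squared[of M "Z s"] by (simp add: power2_eq_square)
  ultimately have "l2 M (Z s) * l2 M (Z s) <= KZ * l2 M (Z s)" by (simp add: KZ_def mult_ac)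
  thus ?thesis using p by simp
 qed (use KZ_nonneg in simp)
 have "Z s = Z (max 0 s)" by (simp add: Z_def)
 thus ?thesis using *[of "max 0 s"] by simp
qed

definition K\<rho> :: real where "K\<rho> = KZ^2 + Ku * K\<gamma> * (2 + \<bar>1 - \<alpha>\<bar> / (\<alpha> - \<kappa>))"

lemma K\<rho>_pos: "0 < K\<rho>"
 unfolding K\<rho>_def using Ku_pos K\<gamma>_pos \<kappa> by (intro add_nonneg_pos mult_pos_pos add_pos_nonneg) auto

lemma Z_U_correlation:
 assumes sr: "0 <= s" "s <= t" shows "\<bar>ip (U t) (Z s)\<bar> <= Ku * K\<gamma> * exp (- \<kappa> * (t - s))"
proof -
 have "\<bar>ip (U t) (Z s)\<bar> <= Ku * (K\<gamma> * exp (- \<kappa> * (t - s)))"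
 proof (rule Z_inner_bound[OF sr(1) U_sqint])
  fix v assume v: "v \<in> {0..s}"
  have "\<bar>ip (U t) (U v)\<bar> = \<gamma> (t - v)" unfolding U_covariance using v sr \<gamma>_nonneg[of "t - v"] by simp
  also have "\<dots> <= K\<gamma> * exp (- \<kappa> * (t - v))" by (rule \<gamma>_decay_\<kappa>) (use v sr in auto)
  also have "\<dots> <= K\<gamma> * exp (- \<kappa> * (t - s))" using v \<kappa>(1) K\<gamma>_pos by (intro mult_left_mono) auto
  finally show "\<bar>ip (U t) (U v)\<bar> <= K\<gamma> * exp (- \<kappa> * (t - s))" .
 qed
 thus ?thesis by (simp add: mult.assoc)
qed

text \<open>For \<open>s <= t\<close>, \<open>Z\<^sub>t\<close> is \<open>e\<^bsup>-\<alpha>(t-s)\<^esup> Z\<^sub>s\<close> plus a functional of \<open>U\<close> on \<open>[s,t]\<close>. The first part decays by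
 itself, the second one through the correlations of \<open>Z\<^sub>s\<close> with the later values of \<open>U\<close>.\<close>

lemma Z_correlation_le:
 assumes st: "0 <= s" "s <= t" shows "\<bar>ip (Z s) (Z t)\<bar> <= K\<rho> * exp (- \<kappa> * (t - s))"
proof -
 define E where "E = decay (t - s)"
 define k where "k = exp (- \<kappa> * (t - s))"
 have Ek: "0 < E" "E <= k" unfolding E_def k_def using \<kappa>(2) st by (auto intro: mult_right_mono)
 have t: "0 <= t" using st by simp
 have Zt: "Z t w = E * Z s w + U t w - E * U s w + (1 - \<alpha>) * EI s t w" if w: "w \<in> space M" for w
 proof -
  have 1: "decay t = E * decay s" unfolding E_def by (simp add: exp_add[symmetric] algebra_simps)
  have 2: "EI 0 t w = E * EI 0 s w + EI s t w" unfolding E_def by (rule EI_split[OF w st])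
  show ?thesis unfolding Z_nonneg_time[OF t] Z_nonneg_time[OF st(1)] 1 2 by (simp only: algebra_simps)
 qed
 have "ip (Z s) (Z t) = expectation (%w. E * (Z s w * Z s w) + Z s w * U t w - E * (Z s w * U s w) + (1 - \<alpha>) * (Z s w * EI s t w))"
  by (rule bochner_cong) (auto simp: Zt algebra_simps)
 also have "\<dots> = E * ip (Z s) (Z s) + ip (Z s) (U t) - E * ip (Z s) (U s)
  + (1 - \<alpha>) * ip (Z s) (EI s t)"
  using sqint_mult[OF Z_sqint Z_sqint] sqint_mult[OF Z_sqint U_sqint] sqint_mult[OF Z_sqint sqint_G[OF EI_in_G[OF st(2)]]] by simp
 finally have eq: "ip (Z s) (Z t) = E * ip (Z s) (Z s) + ip (Z s) (U t) - E * ip (Z s) (U s)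
  + (1 - \<alpha>) * ip (Z s) (EI s t)" .
 define c where "c = Ku * K\<gamma>"
 have c: "0 <= c" using Ku_pos K\<gamma>_pos by (simp add: c_def)
 have ZU: "\<bar>ip (Z s) (U r)\<bar> <= c * exp (- \<kappa> * (r - s))" if "s <= r" for r
  using Z_U_correlation[OF st(1) that] by (simp add: c_def mult.commute)
 have 1: "\<bar>E * ip (Z s) (Z s)\<bar> <= k * KZ^2"
 proof -
  have "\<bar>ip (Z s) (Z s)\<bar> <= KZ^2"
   using power_mono[OF Z_l2[of s] l2_nonneg, of 2] unfolding l2_squared by (simp add: power2_eq_square)
  thus ?thesis unfolding abs_mult using Ek by (intro mult_mono) auto
 qed
 have 2: "\<bar>ip (Z s) (U t)\<bar> <= k * c" using ZU[of t] st by (simp add: k_def mult.commute)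
 have 3: "\<bar>E * ip (Z s) (U s)\<bar> <= k * c"
  unfolding abs_mult using ZU[of s] Ek c by (intro mult_mono) auto
 have "\<bar>ip (Z s) (EI s t)\<bar> <= c * exp (- \<kappa> * (t - s)) / (\<alpha> - \<kappa>)"
  unfolding EI_inner(1)[OF st(2) Z_sqint]
  by (rule weighted_exp_integral_bound[OF st(2) \<kappa>(2) c EI_inner(2)[OF st(2) Z_sqint]]) (use ZU in auto)
 hence "\<bar>(1 - \<alpha>) * ip (Z s) (EI s t)\<bar> <= \<bar>1 - \<alpha>\<bar> * (c * k / (\<alpha> - \<kappa>))"
  unfolding abs_mult k_def by (rule mult_left_mono) simp
 hence 4: "\<bar>(1 - \<alpha>) * ip (Z s) (EI s t)\<bar> <= k * (c * (\<bar>1 - \<alpha>\<bar> / (\<alpha> - \<kappa>)))" by (simp add: mult_ac)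
 have "K\<rho> * k = k * KZ^2 + k * c + k * c + k * (c * (\<bar>1 - \<alpha>\<bar> / (\<alpha> - \<kappa>)))" by (simp add: K\<rho>_def c_def algebra_simps)
 thus ?thesis using 1 2 3 4 unfolding eq k_def[symmetric] by linarith
qed

lemma Z_correlation:
 assumes "0 <= s" "0 <= t" shows "\<bar>ip (Z s) (Z t)\<bar> <= K\<rho> * exp (- \<kappa> * \<bar>t - s\<bar>)"
proof (cases "s <= t")
 case True thus ?thesis using Z_correlation_le assms by simp
next
 case False
 hence "\<bar>ip (Z t) (Z s)\<bar> <= K\<rho> * exp (- \<kappa> * (s - t))" using assms by (intro Z_correlation_le) auto
 thus ?thesis using False by (simp add: mult.commute)
qed

text \<open>By the Cauchy-Schwarz inequality, \<open>(E[Z\<^sub>t U\<^sub>t])^2 / \<gamma> 0\<close> is a lower bound for the variance of \<open>Z\<^sub>t\<close>. From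
 \<open>0 <= \<gamma> <= \<gamma> 0\<close> and \<open>t \<ge> 1\<close>, \<open>E[Z\<^sub>t U\<^sub>t]\<close> is at least \<open>\<gamma> 0 (1 - e\<^bsup>-\<alpha>\<^esup>)\<close> if \<open>\<alpha> <= 1\<close>, and \<open>1/\<alpha>\<close> times this otherwise.\<close>

definition c\<sigma> :: real where "c\<sigma> = \<gamma> 0 * ((1 - exp (- \<alpha>)) * min 1 (1 / \<alpha>))^2"

lemma c\<sigma>_pos: "0 < c\<sigma>"
proof -
 have "0 < 1 - exp (- \<alpha>)" "0 < min 1 (1 / \<alpha>)" using \<alpha>_pos by auto
 thus ?thesis unfolding c\<sigma>_def by (intro mult_pos_pos zero_less_power) (auto simp: \<gamma>_0)
qed

lemma \<gamma>_le_0: assumes "0 <= x" shows "\<gamma> x <= \<gamma> 0"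
 using U_increment[of x 0] assms zero_le_power2[of "dl2 M (U x) (U 0)"] by simp

lemma Z_variance_lower: assumes t: "1 <= t" shows "c\<sigma> <= (l2 M (Z t))^2"
proof -
 have t0: "0 <= t" using t by simp
 define E where "E = decay t"
 have E: "0 < E" "E <= exp (- \<alpha>)" unfolding E_def using t \<alpha>_pos by auto
 have E1: "exp (- \<alpha>) < 1" using \<alpha>_pos by simp
 have g0: "0 < \<gamma> 0" by (simp add: \<gamma>_0)
 have EL1: "E <= 1" using E(2) E1 by linarith
 define I where "I = ip (U t) (EI 0 t)"
 have I: "I = (LBINT r:{0..t}. decay \<bar>t - r\<bar> * \<gamma> \<bar>r - t\<bar>)"
  unfolding I_def EI_inner(1)[OF t0 U_sqint] U_covariance ..
 have si: "set_integrable lborel {0..t} (%r. decay \<bar>t - r\<bar> * \<gamma> \<bar>r - t\<bar>)"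
  using EI_inner(2)[OF t0 U_sqint, of t] unfolding U_covariance .
 have "0 <= I" unfolding I set_lebesgue_integral_def by (rule integral_nonneg_AE) (auto simp: indicator_def \<gamma>_nonneg)
 have "I <= (LBINT r:{0..t}. \<gamma> 0 * decay (t - r))"
  unfolding I
 proof (rule set_integral_mono[OF si])
  show "set_integrable lborel {0..t} (%r. \<gamma> 0 * decay (t - r))" by (intro borel_integrable_atLeastAtMost' continuous_intros)
  fix r assume "r \<in> {0..t}"
  thus "decay \<bar>t - r\<bar> * \<gamma> \<bar>r - t\<bar> <= \<gamma> 0 * decay (t - r)"
   using \<gamma>_le_0[of "\<bar>r - t\<bar>"] by (simp add: mult.commute)
 qed
 also have "\<dots> = \<gamma> 0 * (1 - E) / \<alpha>"
 proof -
  have d: "((%r. \<gamma> 0 * decay (t - r) / \<alpha>) has_real_derivative \<gamma> 0 * decay (t - r)) (at r within {0..t})" for r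
   using \<alpha>_pos by (auto intro!: derivative_eq_intros)
  have "((%r. \<gamma> 0 * decay (t - r)) has_integral (\<gamma> 0 * decay (t - t) / \<alpha> - \<gamma> 0 * decay (t - 0) / \<alpha>)) {0..t}"
   by (rule fundamental_theorem_of_calculus[OF t0]) (use d in \<open>simp add: real_vector_derivative\<close>)
  hence "integral {0..t} (%r. \<gamma> 0 * decay (t - r)) = \<gamma> 0 * decay (t - t) / \<alpha> - \<gamma> 0 * decay (t - 0) / \<alpha>"
   by (rule integral_unique)
  hence "integral {0..t} (%r. \<gamma> 0 * decay (t - r)) = \<gamma> 0 * (1 - E) / \<alpha>"
   unfolding E_def diff_self diff_zero mult_zero_right exp_zero diff_divide_distrib[symmetric] right_diff_distrib[symmetric] .
  moreover have "(LBINT r:{0..t}. \<gamma> 0 * decay (t - r)) = integral {0..t} (%r. \<gamma> 0 * decay (t - r))"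
   by (rule lborel_set_integral_continuous) (intro continuous_intros)
  ultimately show ?thesis by simp
 qed
 finally have Iu: "I <= \<gamma> 0 * (1 - E) / \<alpha>" .
 have ZU: "ip (U t) (Z t) = \<gamma> 0 - E * \<gamma> t + (1 - \<alpha>) * I"
  unfolding Z_inner[OF t0 U_sqint] I_def E_def using t0 by (simp add: U_covariance)
 have Eg: "E * \<gamma> t <= E * \<gamma> 0" using \<gamma>_le_0[OF t0] E by simp
 have "\<gamma> 0 * ((1 - E) * min 1 (1 / \<alpha>)) <= ip (U t) (Z t)"
 proof (cases "\<alpha> <= 1")
  case True
  have "(1 - E) * min 1 (1 / \<alpha>) <= (1 - E) * 1" using EL1 by (intro mult_left_mono) auto
  hence "\<gamma> 0 * ((1 - E) * min 1 (1 / \<alpha>)) <= \<gamma> 0 * (1 - E)" using g0 by simp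
  moreover have "0 <= (1 - \<alpha>) * I" using True \<open>0 <= I\<close> by simp
  ultimately show ?thesis unfolding ZU using Eg by (simp add: algebra_simps)
 next
  case False
  hence m1: "min 1 (1 / \<alpha>) = 1 / \<alpha>" using \<alpha>_pos by (simp add: min_def)
  have "(\<alpha> - 1) * I <= (\<alpha> - 1) * (\<gamma> 0 * (1 - E) / \<alpha>)" using Iu False by (intro mult_left_mono) auto
  also have "\<dots> = \<gamma> 0 * (1 - E) - \<gamma> 0 * ((1 - E) * (1 / \<alpha>))" using \<alpha>_pos by (simp add: field_simps)
  finally show ?thesis unfolding ZU m1 using Eg by (simp add: algebra_simps)
 qed
 moreover have "ip (U t) (Z t) <= sqrt (\<gamma> 0) * l2 M (Z t)"
  using cauchy_schwarz[OF U_sqint Z_sqint, of t t] by (simp add: l2_U)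
 ultimately have "\<gamma> 0 * ((1 - E) * min 1 (1 / \<alpha>)) <= sqrt (\<gamma> 0) * l2 M (Z t)" by linarith
 moreover have "\<gamma> 0 * a = sqrt (\<gamma> 0) * (sqrt (\<gamma> 0) * a)" for a using g0 by (simp add: mult.assoc[symmetric])
 ultimately have "sqrt (\<gamma> 0) * (sqrt (\<gamma> 0) * ((1 - E) * min 1 (1 / \<alpha>))) <= sqrt (\<gamma> 0) * l2 M (Z t)" by simp
 hence "sqrt (\<gamma> 0) * ((1 - E) * min 1 (1 / \<alpha>)) <= l2 M (Z t)" using g0 by (simp only: mult_le_cancel_left_pos[OF real_sqrt_gt_zero])
 moreover have "sqrt (\<gamma> 0) * ((1 - exp (- \<alpha>)) * min 1 (1 / \<alpha>)) <= sqrt (\<gamma> 0) * ((1 - E) * min 1 (1 / \<alpha>))"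
  using E g0 \<alpha>_pos by (intro mult_left_mono mult_right_mono) auto
 ultimately have "sqrt (\<gamma> 0) * ((1 - exp (- \<alpha>)) * min 1 (1 / \<alpha>)) <= l2 M (Z t)" by linarith
 hence "(sqrt (\<gamma> 0) * ((1 - exp (- \<alpha>)) * min 1 (1 / \<alpha>)))^2 <= (l2 M (Z t))^2"
  by (rule power_mono) (use g0 E1 \<alpha>_pos in \<open>intro mult_nonneg_nonneg, auto\<close>)
 thus ?thesis using g0 by (simp add: c\<sigma>_def power_mult_distrib)
qed

lemma Z_increment_eq:
 assumes w: "w \<in> space M" and st: "0 <= s" "s <= t"
 shows "Z t w - Z s w = U t w - U s w + (LBINT u:{s..t}. U u w - \<alpha> * Z u w)"
proof -
 have "integral {0..s} (%s. Z s w) + integral {s..t} (%s. Z s w) = integral {0..t} (%s. Z s w)"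
  by (intro hk_combine st integrable_continuous_interval Z_continuous w)
 hence "\<alpha> * integral {0..t} (%s. Z s w) = \<alpha> * integral {0..s} (%s. Z s w) + \<alpha> * integral {s..t} (%s. Z s w)" by (metis distrib_left)
 hence "Z t w - Z s w = (Y t w - Y s w) - \<alpha> * integral {s..t} (%s. Z s w)"
  using Z_path(2)[OF w, of t] Z_path(2)[OF w, of s] st by linarith
 moreover have "(LBINT u:{s..t}. U u w - \<alpha> * Z u w) = integral {s..t} (%u. U u w - \<alpha> * Z u w)"
  by (rule lborel_set_integral_continuous) (intro continuous_intros U_continuous Z_continuous w)
 moreover have "\<dots> = integral {s..t} (%u. U u w) - integral {s..t} (%u. \<alpha> * Z u w)"
  by (intro hk_diff integrable_continuous_interval continuous_intros U_continuous Z_continuous w)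
 moreover have "integral {s..t} (%u. \<alpha> * Z u w) = \<alpha> * integral {s..t} (%u. Z u w)" by (rule integral_mult_right)
 ultimately show ?thesis using Y_increment_eq[OF w st] by (simp add: IU_eq[OF w])
qed

definition KD :: real where "KD = 2 + sqrt (\<gamma> 0) + \<alpha> * KZ"

lemma KD_nonneg: "0 <= KD" using \<alpha>_pos KZ_nonneg \<gamma>_nonneg[of 0] by (simp add: KD_def)

text \<open>The increment is the one of \<open>U\<close>, of order \<open>H\<close>, plus integrals over \<open>[s,t]\<close> of bounded processes.\<close>

lemma Z_increment_l2_le:
 assumes st: "0 <= s" "s <= t" "t - s <= 1" shows "dl2 M (Z t) (Z s) <= KD * (t - s) powr H"
proof -
 have qm: "case_prod (%u w. U u w - \<alpha> * Z u w) \<in> borel_measurable (borel \<Otimes>\<^sub>M M)" by measurable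
 have qb: "sqint M (%w. U u w - \<alpha> * Z u w) \<and> l2 M (%w. U u w - \<alpha> * Z u w) <= sqrt (\<gamma> 0) + \<alpha> * KZ" for u
 proof
  show "sqint M (%w. U u w - \<alpha> * Z u w)" by (intro sqint_diff sqint_cmult U_sqint Z_sqint)
  have "l2 M (%w. U u w - \<alpha> * Z u w) <= l2 M (U u) + l2 M (%w. \<alpha> * Z u w)"
   by (intro l2_triangle_diff sqint_cmult U_sqint Z_sqint)
  also have "\<dots> <= sqrt (\<gamma> 0) + \<alpha> * KZ" using Z_l2[of u] \<alpha>_pos by (simp add: l2_U l2_cmult)
  finally show "l2 M (%w. U u w - \<alpha> * Z u w) <= sqrt (\<gamma> 0) + \<alpha> * KZ" .
 qed
 define R where "R w = (LBINT u:{s..t}. U u w - \<alpha> * Z u w)" for w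
 have R: "sqint M R" "l2 M R <= (t - s) * (sqrt (\<gamma> 0) + \<alpha> * KZ)"
  unfolding R_def using process_integral_sqint[OF qm st(2) qb] process_integral_l2[OF qm st(2) qb] by auto
 have "dl2 M (Z t) (Z s) = l2 M (%w. (U t w - U s w) + R w)"
 proof (rule l2_cong_AE)
  show "AE w in M. Z t w - Z s w = (U t w - U s w) + R w"
   unfolding R_def by (intro AE_I2) (rule Z_increment_eq[OF _ st(1,2)])
  have "R \<in> borel_measurable M" using R(1) by (simp add: sqint_def)
  thus "(%w. (U t w - U s w) + R w) \<in> borel_measurable M" by measurable
 qed measurable
 also have "\<dots> <= dl2 M (U t) (U s) + l2 M R" by (intro l2_triangle sqint_diff U_sqint R)
 also have "\<dots> <= 2 * (t - s) powr H + (t - s) powr H * (sqrt (\<gamma> 0) + \<alpha> * KZ)"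
 proof (rule add_mono)
  show "dl2 M (U t) (U s) <= 2 * (t - s) powr H" using U_increment_le[of t s] st by simp
  have "t - s <= (t - s) powr H" using st H_less_1 powr_mono'[of H 1 "t - s"] by (cases "t = s") auto
  hence "(t - s) * (sqrt (\<gamma> 0) + \<alpha> * KZ) <= (t - s) powr H * (sqrt (\<gamma> 0) + \<alpha> * KZ)"
   using \<alpha>_pos KZ_nonneg \<gamma>_nonneg[of 0] by (intro mult_right_mono) auto
  thus "l2 M R <= (t - s) powr H * (sqrt (\<gamma> 0) + \<alpha> * KZ)" using R(2) by linarith
 qed
 also have "\<dots> = KD * (t - s) powr H" by (simp add: KD_def algebra_simps)
 finally show ?thesis .
qed

end

section \<open>Laws of large numbers\<close>

lemma bounded_borel_set_integrable:
 fixes f :: "real => real"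
 assumes f[measurable]: "f \<in> borel_measurable borel" and b: "!!x. x \<in> {a..b} ==> \<bar>f x\<bar> <= K"
 shows "set_integrable lborel {a..b} f"
 unfolding set_integrable_def
 by (rule integrableI_bounded_set[where A="{a..b}" and B=K]) (use b in \<open>auto simp: indicator_def emeasure_lborel_Icc_eq\<close>)

lemma exp_abs_integral_le:
 fixes \<kappa> t T :: real
 assumes k: "0 < \<kappa>" and t: "t \<in> {0..T}"
 shows "(LBINT s:{0..T}. exp (- \<kappa> * \<bar>s - t\<bar>)) <= 2 / \<kappa>"
proof -
 have c: "continuous_on A (%s. exp (- \<kappa> * \<bar>s - t\<bar>))" for A by (intro continuous_intros)
 have "integral {0..t} (%s. exp (- \<kappa> * \<bar>s - t\<bar>)) = integral {0..t} (%s. exp (\<kappa> * (s - t)))"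
  by (rule hk_cong) (simp add: algebra_simps)
 also have "((%s. exp (\<kappa> * (s - t))) has_integral (exp (\<kappa> * (t - t)) / \<kappa> - exp (\<kappa> * (0 - t)) / \<kappa>)) {0..t}"
  by (rule fundamental_theorem_of_calculus)
   (use k t in \<open>auto intro!: derivative_eq_intros simp: real_vector_derivative[symmetric]\<close>)
 hence "integral {0..t} (%s. exp (\<kappa> * (s - t))) = exp (\<kappa> * (t - t)) / \<kappa> - exp (\<kappa> * (0 - t)) / \<kappa>" by (rule integral_unique)
 also have "\<dots> <= 1 / \<kappa>" using k by simp
 finally have 1: "integral {0..t} (%s. exp (- \<kappa> * \<bar>s - t\<bar>)) <= 1 / \<kappa>" .
 have "integral {t..T} (%s. exp (- \<kappa> * \<bar>s - t\<bar>)) = integral {t..T} (%s. exp (- \<kappa> * (s - t)))"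
  by (rule hk_cong) simp
 also have "((%s. exp (- \<kappa> * (s - t))) has_integral (- exp (- \<kappa> * (T - t)) / \<kappa> - (- exp (- \<kappa> * (t - t)) / \<kappa>))) {t..T}"
  by (rule fundamental_theorem_of_calculus)
   (use k t in \<open>auto intro!: derivative_eq_intros simp: real_vector_derivative[symmetric]\<close>)
 hence "integral {t..T} (%s. exp (- \<kappa> * (s - t))) = - exp (- \<kappa> * (T - t)) / \<kappa> - (- exp (- \<kappa> * (t - t)) / \<kappa>)" by (rule integral_unique)
 also have "\<dots> <= 1 / \<kappa>" using k by simp
 finally have 2: "integral {t..T} (%s. exp (- \<kappa> * \<bar>s - t\<bar>)) <= 1 / \<kappa>" .
 have "integral {0..t} (%s. exp (- \<kappa> * \<bar>s - t\<bar>)) + integral {t..T} (%s. exp (- \<kappa> * \<bar>s - t\<bar>)) = integral {0..T} (%s. exp (- \<kappa> * \<bar>s - t\<bar>))"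
  by (rule hk_combine) (use t integrable_continuous_interval[OF c] in auto)
 thus ?thesis using 1 2 unfolding lborel_set_integral_continuous[OF c] by simp
qed

context prob_space begin

text \<open>The sum of the variables has finite expectation, so it is finite almost surely and its terms tend
 to zero.\<close>

lemma summable_expectation_AE_tendsto_0:
 fixes f :: "nat => 'a => real"
 assumes f: "!!n. integrable M (f n)" and nn: "!!n w. 0 <= f n w" and s: "summable (%n. expectation (f n))"
 shows "AE w in M. (%n. f n w) \<longlonglongrightarrow> 0"
proof -
 have [measurable]: "f n \<in> borel_measurable M" for n using f by auto
 have "(\<integral>\<^sup>+w. suminf (%n. ennreal (f n w)) \<partial>M) = suminf (%n. \<integral>\<^sup>+w. ennreal (f n w) \<partial>M)"
  by (rule nn_integral_suminf) measurable
 also have "\<dots> = suminf (%n. ennreal (expectation (f n)))"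
  using f nn by (simp add: nn_integral_eq_integral)
 also have "\<dots> = ennreal (suminf (%n. expectation (f n)))"
  by (rule suminf_ennreal2[OF _ s]) (simp add: nn Bochner_Integration.integral_nonneg)
 finally have "(\<integral>\<^sup>+w. suminf (%n. ennreal (f n w)) \<partial>M) \<noteq> \<infinity>" by simp
 hence "AE w in M. suminf (%n. ennreal (f n w)) \<noteq> \<infinity>" by (intro nn_integral_noteq_infinite) measurable
 thus ?thesis
 proof eventually_elim
  case (elim w)
  have "summable (%n. f n w)" by (rule summable_suminf_not_top) (use nn elim in auto)
  thus ?case by (rule summable_LIMSEQ_zero)
 qed
qed

lemma l2_decay_AE_tendsto_0:
 assumes W: "!!n. sqint M (W n)" and b: "!!n. (l2 M (W n))\<^sup>2 <= K / (real n)^2"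
 shows "AE w in M. (%n. W n w) \<longlonglongrightarrow> 0"
proof -
 have s: "summable (%n. K * inverse (real n ^ 2))" by (intro summable_mult inverse_power_summable) simp
 have "AE w in M. (%n. (W n w)^2) \<longlonglongrightarrow> 0"
 proof (rule summable_expectation_AE_tendsto_0)
  show "summable (%n. expectation (%w. (W n w)^2))"
   by (rule summable_comparison_test'[OF s, of 0]) (use b in \<open>simp add: l2_squared[symmetric] divide_inverse\<close>)
 qed (use W in \<open>auto simp: sqint_def\<close>)
 thus ?thesis by simp
qed

text \<open>The variance is the double integral of the covariance over the square, and each line contributes at
 most \<open>2 K / \<kappa>\<close>.\<close>

lemma process_integral_variance:
 fixes Q :: "real => 'a => real"
 assumes Qm: "case_prod Q \<in> borel_measurable (borel \<Otimes>\<^sub>M M)" and T: "0 <= T"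
  and b: "!!t. t \<in> {0..T} ==> sqint M (Q t) \<and> l2 M (Q t) <= K'"
  and c: "!!s t. s \<in> {0..T} ==> t \<in> {0..T} ==> \<bar>ip (Q t) (Q s)\<bar> <= K * exp (- \<kappa> * \<bar>s - t\<bar>)"
  and k: "0 < \<kappa>" and K: "0 <= K"
 shows "(l2 M (%w. LBINT t:{0..T}. Q t w))^2 <= 2 * K / \<kappa> * T"
proof -
 define I where "I w = (LBINT t:{0..T}. Q t w)" for w
 have I: "sqint M I" unfolding I_def by (rule process_integral_sqint[OF Qm T b])
 have inner: "ip I (Q t) <= 2 * K / \<kappa>" if t: "t \<in> {0..T}" for t
 proof -
  have tq: "sqint M (Q t)" using b t by blast
  have "ip I (Q t) = expectation (%w. Q t w * (LBINT s:{0..T}. Q s w))"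
   by (simp add: I_def mult.commute)
  also have "\<dots> = (LBINT s:{0..T}. ip (Q t) (Q s))"
   using process_integral_inner[OF Qm T b tq] by blast
  also have "\<dots> <= (LBINT s:{0..T}. K * exp (- \<kappa> * \<bar>s - t\<bar>))"
  proof (rule set_integral_mono)
   show "set_integrable lborel {0..T} (%s. ip (Q t) (Q s))"
    using process_integral_inner[OF Qm T b tq] by blast
   show "set_integrable lborel {0..T} (%s. K * exp (- \<kappa> * \<bar>s - t\<bar>))"
    by (intro borel_integrable_atLeastAtMost' continuous_intros)
  qed (use c t in \<open>auto intro: order_trans[OF abs_ge_self]\<close>)
  also have "\<dots> = K * (LBINT s:{0..T}. exp (- \<kappa> * \<bar>s - t\<bar>))" by (rule set_integral_mult_right)
  also have "\<dots> <= K * (2 / \<kappa>)" by (rule mult_left_mono[OF exp_abs_integral_le[OF k t] K])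
  finally show ?thesis by (simp add: mult.commute)
 qed
 have "(l2 M I)^2 = expectation (%w. I w * (LBINT t:{0..T}. Q t w))"
  unfolding l2_squared I_def[symmetric] by (simp only: power2_eq_square)
 also have "\<dots> = (LBINT t:{0..T}. ip I (Q t))"
  using process_integral_inner[OF Qm T b I] by blast
 also have "\<dots> <= (LBINT t:{0..T}. 2 * K / \<kappa>)"
 proof (rule set_integral_mono)
  show "set_integrable lborel {0..T} (%t. ip I (Q t))"
   using process_integral_inner[OF Qm T b I] by blast
  show "set_integrable lborel {0..T} (%t. 2 * K / \<kappa>)" by (intro borel_integrable_atLeastAtMost' continuous_intros)
 qed (rule inner)
 also have "\<dots> = 2 * K / \<kappa> * T" using T by (simp add: set_lebesgue_integral_def)
 finally show ?thesis by (simp add: I_def[abs_def])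
qed

end

context gaussian_space begin

lemma gaussian_square_l2: assumes Z: "Z \<in> G" shows "sqint M (%w. (Z w)^2)" "(l2 M (%w. (Z w)^2))^2 = 3 * l2 M Z ^ 4"
proof -
 show "sqint M (%w. (Z w)^2)" by (intro all_moments_sqint all_moments_power all_moments_G Z)
 have "((Z w)^2)^2 = Z w ^ 4" for w by (simp add: power_mult[symmetric])
 thus "(l2 M (%w. (Z w)^2))^2 = 3 * l2 M Z ^ 4"
  using gaussian_fourth_moment[OF gaussian_G[OF Z]] by (simp add: l2_squared)
qed

lemma gaussian_square_over_n_AE_tendsto_0:
 assumes W: "!!n. W n \<in> G" and b: "!!n. l2 M (W n) <= K"
 shows "AE w in M. (%n. (W n w)^2 / real n) \<longlonglongrightarrow> 0"
proof -
 have "AE w in M. (%n. 1 / real n * (W n w)^2) \<longlonglongrightarrow> 0"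
 proof (rule l2_decay_AE_tendsto_0)
  fix n
  show "sqint M (%w. 1 / real n * (W n w)^2)" by (intro sqint_cmult gaussian_square_l2 W)
  have "l2 M (W n) ^ 4 <= K ^ 4" using b[of n] by (intro power_mono) auto
  hence "(1 / real n)^2 * (3 * l2 M (W n) ^ 4) <= (1 / real n)^2 * (3 * K ^ 4)" by (intro mult_left_mono) auto
  thus "(l2 M (%w. 1 / real n * (W n w)^2))^2 <= 3 * K ^ 4 / (real n)^2"
   unfolding l2_cmult power_mult_distrib gaussian_square_l2(2)[OF W] by (simp add: power_divide)
 qed
 thus ?thesis by simp
qed

text \<open>The second moments of \<open>W\<^sub>n / n\<close> are only of order \<open>1/n\<close>, which is not summable; the fourth ones are of order
 \<open>1/n^2\<close>.\<close>

lemma gaussian_over_n_AE_tendsto_0: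
 assumes W: "!!n. W n \<in> G" and b: "!!n. (l2 M (W n))\<^sup>2 <= K * real n"
 shows "AE w in M. (%n. W n w / real n) \<longlonglongrightarrow> 0"
proof -
 have V: "(%w. 1 / real n * W n w) \<in> G" for n by (rule G_cmult[OF W])
 have "AE w in M. (%n. (1 / real n * W n w)^2) \<longlonglongrightarrow> 0"
 proof (rule l2_decay_AE_tendsto_0)
  fix n
  show "sqint M (%w. (1 / real n * W n w)^2)" by (rule gaussian_square_l2(1)[OF V])
  have "((l2 M (W n))^2)^2 <= (K * real n)^2" using b[of n] by (intro power_mono) auto
  hence "l2 M (W n) ^ 4 <= K^2 * (real n)^2" by (simp add: power_mult_distrib power_mult[symmetric])
  hence "3 * ((1 / real n) ^ 4 * l2 M (W n) ^ 4) <= 3 * ((1 / real n) ^ 4 * (K^2 * (real n)^2))"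
   by (intro mult_left_mono) auto
  also have "\<dots> = 3 * K^2 / (real n)^2" by (cases "n = 0") (simp_all add: field_simps power_divide power2_eq_square power4_eq_xxxx)
  finally show "(l2 M (%w. (1 / real n * W n w)^2))^2 <= 3 * K^2 / (real n)^2"
   unfolding gaussian_square_l2(2)[OF V] l2_cmult by (simp add: power_mult_distrib[symmetric])
 qed
 thus ?thesis by simp
qed

end

text \<open>Between two consecutive squares both sequences are enclosed by their values at the end points, and \<open>a\<close>
 varies there by \<open>O(k) = o(k^2)\<close>.\<close>

lemma square_subsequence_suffices:
 fixes S a :: "nat => real"
 assumes S: "mono S" and a: "mono a" and K: "!!k. a ((Suc k)^2) - a (k^2) <= K * real (2 * k + 1)"
  and sq: "(%k. (S (k^2) - a (k^2)) / real (k^2)) \<longlonglongrightarrow> 0"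
 shows "(%n. (S n - a n) / real n) \<longlonglongrightarrow> 0"
proof -
 define D where "D k = (S (k^2) - a (k^2)) / real (k^2)" for k
 define k where "k n = nat \<lfloor>sqrt (real n)\<rfloor>" for n
 have K0: "0 <= K" using K[of 0] monoD[OF a, of "0^2" "(Suc 0)^2"] by simp
 have lim_k: "filterlim k sequentially sequentially"
  unfolding k_def by (intro filterlim_compose[OF filterlim_nat_sequentially] filterlim_compose[OF filterlim_floor_sequentially]
    filterlim_compose[OF sqrt_at_top] filterlim_real_sequentially)
 have D0: "D \<longlonglongrightarrow> 0" using sq by (simp add: D_def[abs_def])
 have "(%j. 4 * \<bar>D (Suc j)\<bar> + \<bar>D j\<bar> + 3 * K * (1 / real j)) \<longlonglongrightarrow> 4 * \<bar>0\<bar> + \<bar>0\<bar> + 3 * K * 0"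
  by (intro tendsto_intros D0 LIMSEQ_Suc[OF D0] lim_1_over_n)
 hence "(%j. 4 * \<bar>D (Suc j)\<bar> + \<bar>D j\<bar> + 3 * K * (1 / real j)) \<longlonglongrightarrow> 0" by simp
 from filterlim_compose[OF this lim_k]
 have lim: "(%n. 4 * \<bar>D (Suc (k n))\<bar> + \<bar>D (k n)\<bar> + 3 * K * (1 / real (k n))) \<longlonglongrightarrow> 0" .
 \<comment> \<open>For \<open>x = k n \<ge> 1\<close>, the factors come from \<open>(x + 1)^2 <= 4 x\<^sup>2\<close> and \<open>2 x + 1 <= 3 x\<close>.\<close>
 have bound: "\<bar>(S n - a n) / real n\<bar> <= 4 * \<bar>D (Suc (k n))\<bar> + \<bar>D (k n)\<bar> + 3 * K * (1 / real (k n))" if n: "1 <= n" for n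
 proof -
  have kf: "real (k n) <= sqrt (real n)" "sqrt (real n) < real (k n) + 1" unfolding k_def by (auto simp: of_nat_nat)
  have k1: "1 <= k n" using n unfolding k_def by (simp add: le_nat_iff le_floor_iff)
  have "(real (k n))^2 <= real n" using power_mono[OF kf(1), of 2] by simp
  hence l: "(k n)^2 <= n" by (simp only: of_nat_power[symmetric] of_nat_le_iff)
  have "real n <= (real (Suc (k n)))^2" using power_mono[of "sqrt (real n)" "real (Suc (k n))" 2] kf(2) by simp
  hence u: "n <= (Suc (k n))^2" by (simp only: of_nat_power[symmetric] of_nat_le_iff)
  define x where "x = real (k n)"
  have x: "1 <= x" "x^2 <= real n" using k1 \<open>(real (k n))^2 <= real n\<close> by (simp_all add: x_def)
  have e1: "S ((k n)^2) - a ((k n)^2) = D (k n) * x^2" using k1 by (simp add: D_def x_def)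
  have e2: "S ((Suc (k n))^2) - a ((Suc (k n))^2) = D (Suc (k n)) * (x + 1)^2"
  proof -
   have "real ((Suc (k n))^2) = (x + 1)^2" by (simp add: x_def add.commute)
   moreover have "(x + 1)^2 \<noteq> 0" using x by simp
   ultimately show ?thesis unfolding D_def by simp
  qed
  have m: "S ((k n)^2) <= S n" "S n <= S ((Suc (k n))^2)" "a ((k n)^2) <= a n" "a n <= a ((Suc (k n))^2)"
   using monoD[OF S] monoD[OF a] l u by auto
  have Kk: "a ((Suc (k n))^2) - a ((k n)^2) <= K * (2 * x + 1)" using K[of "k n"] by (simp add: x_def add.commute)
  have "S n - a n <= D (Suc (k n)) * (x + 1)^2 + K * (2 * x + 1)" using m Kk e2 by linarith
  also have "\<dots> <= \<bar>D (Suc (k n))\<bar> * (x + 1)^2 + \<bar>D (k n)\<bar> * x^2 + K * (2 * x + 1)"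
  proof -
   have "D (Suc (k n)) * (x + 1)^2 <= \<bar>D (Suc (k n))\<bar> * (x + 1)^2" by (intro mult_right_mono) auto
   moreover have "0 <= \<bar>D (k n)\<bar> * x^2" by simp
   ultimately show ?thesis by linarith
  qed
  finally have up: "S n - a n <= \<bar>D (Suc (k n))\<bar> * (x + 1)^2 + \<bar>D (k n)\<bar> * x^2 + K * (2 * x + 1)" .
  have "- (S n - a n) <= - D (k n) * x^2 + K * (2 * x + 1)" using m Kk e1 by linarith
  also have "- D (k n) * x^2 <= \<bar>D (k n)\<bar> * x^2" by (intro mult_right_mono) auto
  also have "\<bar>D (k n)\<bar> * x^2 <= \<bar>D (Suc (k n))\<bar> * (x + 1)^2 + \<bar>D (k n)\<bar> * x^2" by simp
  finally have "\<bar>S n - a n\<bar> <= \<bar>D (Suc (k n))\<bar> * (x + 1)^2 + \<bar>D (k n)\<bar> * x^2 + K * (2 * x + 1)"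
   using up by (simp add: abs_le_iff)
  also have "\<dots> <= \<bar>D (Suc (k n))\<bar> * (4 * x^2) + \<bar>D (k n)\<bar> * x^2 + K * (3 * x)"
  proof (intro add_mono mult_left_mono)
   have "(x + 1)^2 <= (2 * x)^2" using x by (intro power_mono) auto
   thus "(x + 1)^2 <= 4 * x^2" by (simp add: power_mult_distrib)
  qed (use x K0 in auto)
  also have "\<dots> = x^2 * (4 * \<bar>D (Suc (k n))\<bar> + \<bar>D (k n)\<bar> + 3 * K * (1 / x))"
   using x by (simp add: field_simps power2_eq_square)
  also have "\<dots> <= real n * (4 * \<bar>D (Suc (k n))\<bar> + \<bar>D (k n)\<bar> + 3 * K * (1 / x))"
   using x K0 by (intro mult_right_mono) auto
  finally show ?thesis using n by (simp add: x_def abs_divide field_simps)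
 qed
 show ?thesis
  by (rule Lim_null_comparison[OF _ lim]) (use bound in \<open>auto simp: eventually_sequentially intro!: exI[of _ 1]\<close>)
qed

context ou begin

text \<open>Joint measurability of \<open>\<phi>\<^sub>i(t) Z\<^sub>t\<close> requires Borel functions of \<open>t\<close>; changing \<open>\<phi>\<^sub>i\<close> on a null set affects no
 integral, and clipping keeps the bound for all \<open>t\<close>.\<close>

lemma \<phi>_borel_version: "\<exists>g. g \<in> borel_measurable borel \<and> (\<forall>t. \<bar>g t\<bar> <= C) \<and> (AE t in lborel. \<phi> i t = g t)"
proof -
 obtain g where g[measurable]: "g \<in> borel_measurable lborel" and ae: "AE t in lborel. \<phi> i t = g t"
  using completion_ex_borel_measurable_real[OF \<phi>_measurable[of i]] by blast
 have "(%t. max (- C) (min C (g t))) \<in> borel_measurable borel" by measurable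
 moreover have "\<bar>max (- C) (min C (g t))\<bar> <= C" for t using C_pos by auto
 moreover have "AE t in lborel. \<phi> i t = max (- C) (min C (g t))"
  using ae
 proof eventually_elim
  case (elim t)
  thus ?case using \<phi>_bound[of i t] by (auto simp: abs_le_iff)
 qed
 ultimately show ?thesis by blast
qed

definition \<phi>b :: "'p => real => real" where
 "\<phi>b i = (SOME g. g \<in> borel_measurable borel \<and> (\<forall>t. \<bar>g t\<bar> <= C) \<and> (AE t in lborel. \<phi> i t = g t))"

lemma \<phi>b: shows \<phi>b_measurable[measurable]: "\<phi>b i \<in> borel_measurable borel" and \<phi>b_bound: "\<bar>\<phi>b i t\<bar> <= C"
  and \<phi>b_AE: "AE t in lborel. \<phi> i t = \<phi>b i t"
 using someI_ex[OF \<phi>_borel_version[of i]] unfolding \<phi>b_def[symmetric] by auto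

definition Lb :: "real => real" where "Lb t = (\<Sum>i\<in>UNIV. \<mu> $ i * \<phi>b i t)"

lemma Lb_measurable[measurable]: "Lb \<in> borel_measurable borel" unfolding Lb_def[abs_def] by measurable

lemma Lb_bound: "\<bar>Lb t\<bar> <= CL"
proof -
 have "\<bar>Lb t\<bar> <= (\<Sum>i\<in>UNIV. \<bar>\<mu> $ i * \<phi>b i t\<bar>)" unfolding Lb_def by (rule sum_abs)
 also have "\<dots> <= CL" unfolding CL_def by (rule sum_mono) (simp add: abs_mult \<phi>b_bound mult_left_mono)
 finally show ?thesis .
qed

lemma Lb_AE: "AE t in lborel. L t = Lb t"
proof -
 have "AE t in lborel. \<forall>i\<in>UNIV. \<phi> i t = \<phi>b i t" by (rule AE_finite_allI) (auto intro: \<phi>b_AE)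
 thus ?thesis by eventually_elim (simp add: L_def Lb_def)
qed

lemma bounded_times_continuous_set_integrable:
 fixes f g :: "real => real"
 assumes g[measurable]: "g \<in> borel_measurable borel" and b: "!!t. \<bar>g t\<bar> <= K" and f: "continuous_on UNIV f"
 shows "set_integrable lborel {s..t} (%u. g u * f u)"
proof -
 have [measurable]: "f \<in> borel_measurable borel" by (rule borel_measurable_continuous_onI[OF f])
 have "compact (f ` {s..t})" by (intro compact_continuous_image continuous_on_subset[OF f]) auto
 then obtain R where R: "!!u. u \<in> {s..t} ==> \<bar>f u\<bar> <= R" using compact_imp_bounded[of "f ` {s..t}"] by (fastforce simp: bounded_iff)
 show ?thesis
 proof (rule bounded_borel_set_integrable)
  fix u assume u: "u \<in> {s..t}"
  show "\<bar>g u * f u\<bar> <= \<bar>K\<bar> * \<bar>R\<bar>" unfolding abs_mult using b[of u] R[OF u] by (intro mult_mono) auto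
 qed measurable
qed

lemma integral_borel_version:
 fixes f g g' :: "real => real"
 assumes g[measurable]: "g \<in> borel_measurable borel" and b: "!!t. \<bar>g t\<bar> <= K" and ae: "AE t in lborel. g' t = g t" and f: "continuous_on UNIV f"
 shows "((%u. g' u * f u) has_integral (LBINT u:{s..t}. g u * f u)) {s..t}"
proof -
 have "((%u. g u * f u) has_integral (LBINT u:{s..t}. g u * f u)) {s..t}"
  using set_borel_integral_eq_integral[OF bounded_times_continuous_set_integrable[OF g b f, of s t]] by (simp add: has_integral_integral)
 moreover have "AE u in lborel. u \<in> {s..t} \<longrightarrow> g u * f u = g' u * f u" using ae by eventually_elim simp
 ultimately show ?thesis by (subst has_integral_AE[symmetric])
qed

lemma Z_mult_bound:
 assumes b: "!!t. \<bar>g t\<bar> <= K" shows "(%w. g t * Z t w) \<in> G \<and> l2 M (%w. g t * Z t w) <= K * KZ"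
 using b[of t] Z_l2[of t] order_trans[OF abs_ge_zero b] by (auto simp: l2_cmult intro!: G_cmult Z_in_G mult_mono)

lemma Z_mult_integral_in_G:
 assumes g[measurable]: "g \<in> borel_measurable borel" and b: "!!t. \<bar>g t\<bar> <= K" and T: "0 <= T"
 shows "(%w. LBINT t:{0..T}. g t * Z t w) \<in> G"
proof (rule process_integral_in_G[OF _ T Z_mult_bound[OF b]])
 show "case_prod (%t w. g t * Z t w) \<in> borel_measurable (borel \<Otimes>\<^sub>M M)" by measurable
qed

lemma Z_mult_integral_variance:
 assumes g[measurable]: "g \<in> borel_measurable borel" and b: "!!t. \<bar>g t\<bar> <= K" and T: "0 <= T"
 shows "(l2 M (%w. LBINT t:{0..T}. g t * Z t w))^2 <= 2 * (K^2 * K\<rho>) / \<kappa> * T"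
proof (rule process_integral_variance[where K'="K * KZ"])
 have K: "0 <= K" using b[of 0] by linarith
 show "case_prod (%t w. g t * Z t w) \<in> borel_measurable (borel \<Otimes>\<^sub>M M)" by measurable
 show "sqint M (%w. g t * Z t w) \<and> l2 M (%w. g t * Z t w) <= K * KZ" for t
  using Z_mult_bound[where g=g, OF b] sqint_G by blast
 fix s t assume st: "s \<in> {0..T}" "t \<in> {0..T}"
 have "expectation (%w. g t * Z t w * (g s * Z s w)) = expectation (%w. (g s * g t) * (Z s w * Z t w))"
  by (rule bochner_cong) (simp_all add: mult_ac)
 also have "\<dots> = (g s * g t) * ip (Z s) (Z t)" by (rule integral_mult_right_zero)
 finally have e: "expectation (%w. g t * Z t w * (g s * Z s w)) = (g s * g t) * ip (Z s) (Z t)" .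
 have "\<bar>g s * g t\<bar> <= K * K" unfolding abs_mult using b K by (intro mult_mono) auto
 moreover have "\<bar>ip (Z s) (Z t)\<bar> <= K\<rho> * exp (- \<kappa> * \<bar>t - s\<bar>)" using st by (intro Z_correlation) auto
 ultimately have "\<bar>g s * g t\<bar> * \<bar>ip (Z s) (Z t)\<bar> <= (K * K) * (K\<rho> * exp (- \<kappa> * \<bar>t - s\<bar>))"
  using K by (intro mult_mono) auto
 thus "\<bar>expectation (%w. g t * Z t w * (g s * Z s w))\<bar> <= K^2 * K\<rho> * exp (- \<kappa> * \<bar>s - t\<bar>)"
  unfolding e abs_mult by (simp add: power2_eq_square abs_minus_commute mult.assoc)
qed (use T \<kappa> K\<rho>_pos in auto)

lemma Z_mult_integral_LLN:
 assumes g[measurable]: "g \<in> borel_measurable borel" and b: "!!t. \<bar>g t\<bar> <= K"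
 shows "AE w in M. (%n. (LBINT t:{0..real n}. g t * Z t w) / real n) \<longlonglongrightarrow> 0"
 by (rule gaussian_over_n_AE_tendsto_0[OF Z_mult_integral_in_G[OF g b] Z_mult_integral_variance[OF g b]]) auto

definition varZ :: "real => real" where "varZ t = (l2 M (Z t))^2"

lemma varZ_measurable[measurable]: "varZ \<in> borel_measurable borel"
 unfolding varZ_def[abs_def] l2_squared by measurable

lemma varZ_bounds: "0 <= varZ t" "varZ t <= KZ^2"
 unfolding varZ_def using power_mono[OF Z_l2[of t] l2_nonneg, of 2] by auto

lemma varZ_set_integrable: "set_integrable lborel {a..b} varZ"
 by (rule bounded_borel_set_integrable[where K="KZ^2"]) (use varZ_bounds in auto)

definition AZ :: "real => real" where "AZ T = (LBINT t:{0..T}. varZ t)"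

lemma AZ_eq: "AZ T = integral {0..T} varZ" and varZ_integrable: "varZ integrable_on {a..b}"
 using set_borel_integral_eq_integral[OF varZ_set_integrable] by (auto simp: AZ_def)

lemma AZ_increment: assumes "0 <= s" "s <= t" shows "0 <= AZ t - AZ s" "AZ t - AZ s <= KZ^2 * (t - s)"
proof -
 have e: "AZ t - AZ s = integral {s..t} varZ"
  unfolding AZ_eq using hk_combine[OF assms varZ_integrable] by simp
 show "0 <= AZ t - AZ s" unfolding e by (rule hk_nonneg[OF varZ_integrable]) (simp add: varZ_bounds)
 have "integral {s..t} varZ <= integral {s..t} (%_. KZ^2)"
  by (rule integral_le[OF varZ_integrable integrable_const_ivl]) (simp add: varZ_bounds)
 thus "AZ t - AZ s <= KZ^2 * (t - s)" unfolding e using assms by (simp add: mult.commute)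
qed

lemma AZ_lower: assumes "1 <= T" shows "c\<sigma> * (T - 1) <= AZ T"
proof -
 have "AZ T - AZ 1 = integral {1..T} varZ"
  unfolding AZ_eq using hk_combine[of 0 1 T varZ, OF _ assms varZ_integrable] by simp
 moreover have "integral {1..T} (%_. c\<sigma>) <= integral {1..T} varZ"
  by (rule integral_le[OF integrable_const_ivl varZ_integrable]) (simp add: varZ_def Z_variance_lower)
 moreover have "0 <= AZ 1" using AZ_increment(1)[of 0 1] by (simp add: AZ_eq)
 ultimately show ?thesis using assms by (simp add: mult.commute)
qed

definition SZ :: "real => 'a => real" where "SZ T w = (LBINT t:{0..T}. (Z t w)\<^sup>2)"

lemma Z_square_continuous: "w \<in> space M ==> continuous_on A (%t. (Z t w)^2)"
 by (intro continuous_intros Z_continuous)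

lemma SZ_eq: "w \<in> space M ==> SZ T w = integral {0..T} (%t. (Z t w)^2)"
 unfolding SZ_def by (rule lborel_set_integral_continuous[OF Z_square_continuous])

definition qZ :: "real => 'a => real" where "qZ t w = (Z t w)^2 - varZ t"

lemma qZ_measurable[measurable]: "case_prod qZ \<in> borel_measurable (borel \<Otimes>\<^sub>M M)"
 unfolding qZ_def[abs_def] by measurable

lemma qZ_covariance: "ip (qZ t) (qZ s) = 2 * (ip (Z t) (Z s))^2"
 unfolding qZ_def varZ_def by (rule gaussian_square_covariance[OF Z_in_G Z_in_G])

lemma qZ_l2: "sqint M (qZ t) \<and> l2 M (qZ t) <= 2 * KZ^2"
proof
 show "sqint M (qZ t)" unfolding qZ_def[abs_def] by (intro sqint_diff gaussian_square_l2 Z_in_G sqint_const)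
 have "ip (Z t) (Z t) = varZ t" unfolding varZ_def l2_squared by (simp only: power2_eq_square)
 hence "(l2 M (qZ t))^2 = 2 * (varZ t)^2" using qZ_covariance[of t t] unfolding l2_squared by (simp only: power2_eq_square)
 also have "\<dots> <= 2 * (KZ^2)^2" using varZ_bounds[of t] by (intro mult_left_mono power_mono) auto
 also have "\<dots> <= (2 * KZ^2)^2" by (simp add: power_mult_distrib)
 finally show "l2 M (qZ t) <= 2 * KZ^2" by (rule power2_le_imp_le) simp
qed

lemma SZ_minus_AZ: "w \<in> space M ==> SZ T w - AZ T = (LBINT t:{0..T}. qZ t w)"
 unfolding SZ_def AZ_def qZ_def
 by (rule set_integral_diff(2)[symmetric, OF borel_integrable_atLeastAtMost'[OF Z_square_continuous] varZ_set_integrable])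

lemma SZ_variance: assumes T: "0 <= T"
 shows "(l2 M (%w. LBINT t:{0..T}. qZ t w))^2 <= 2 * (2 * K\<rho>\<^sup>2) / \<kappa> * T"
proof (rule process_integral_variance[OF qZ_measurable T qZ_l2])
 fix s t assume st: "s \<in> {0..T}" "t \<in> {0..T}"
 have "\<bar>ip (Z t) (Z s)\<bar> <= K\<rho> * exp (- \<kappa> * \<bar>s - t\<bar>)" using st by (intro Z_correlation) auto
 hence "(ip (Z t) (Z s))^2 <= (K\<rho> * exp (- \<kappa> * \<bar>s - t\<bar>))^2" by (rule abs_le_imp_square_le)
 also have "\<dots> = K\<rho>\<^sup>2 * exp (- \<kappa> * \<bar>s - t\<bar>) * exp (- \<kappa> * \<bar>s - t\<bar>)" by (simp add: power_mult_distrib power2_eq_square)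
 also have "\<dots> <= K\<rho>\<^sup>2 * exp (- \<kappa> * \<bar>s - t\<bar>) * 1" using \<kappa>(1) by (intro mult_left_mono) auto
 finally show "\<bar>ip (qZ t) (qZ s)\<bar> <= 2 * K\<rho>\<^sup>2 * exp (- \<kappa> * \<bar>s - t\<bar>)"
  unfolding qZ_covariance by simp
qed (use \<kappa> in auto)

text \<open>The covariance of \<open>Z\<^sub>s\<^sup>2\<close> and \<open>Z\<^sub>t\<^sup>2\<close> is twice the squared covariance of \<open>Z\<^sub>s\<close> and \<open>Z\<^sub>t\<close>. The variance of the average is
 therefore only \<open>O(1/n)\<close>, which is summable along the squares.\<close>

lemma SZ_LLN: "AE w in M. (%n. (SZ (real n) w - AZ (real n)) / real n) \<longlonglongrightarrow> 0"
proof -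
 define V where "V k w = 1 / real (k^2) * (LBINT t:{0..real (k^2)}. qZ t w)" for k :: nat and w
 have "AE w in M. (%k. V k w) \<longlonglongrightarrow> 0"
 proof (rule l2_decay_AE_tendsto_0)
  fix k :: nat
  show "sqint M (V k)" unfolding V_def by (intro sqint_cmult process_integral_sqint[OF qZ_measurable _ qZ_l2]) simp
  have "(l2 M (V k))^2 = (1 / real (k^2))^2 * (l2 M (%w. LBINT t:{0..real (k^2)}. qZ t w))^2"
   unfolding V_def l2_cmult power_mult_distrib by simp
  also have "\<dots> <= (1 / real (k^2))^2 * (2 * (2 * K\<rho>\<^sup>2) / \<kappa> * real (k^2))"
   by (rule mult_left_mono[OF SZ_variance]) auto
  also have "\<dots> = 2 * (2 * K\<rho>\<^sup>2) / \<kappa> / (real k)^2"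
   by (cases "k = 0") (simp_all add: field_simps power2_eq_square)
  finally show "(l2 M (V k))^2 <= 2 * (2 * K\<rho>\<^sup>2) / \<kappa> / (real k)^2" .
 qed
 thus ?thesis
  using AE_space
 proof eventually_elim
  case (elim w)
  show ?case
  proof (rule square_subsequence_suffices[where K="KZ^2" and S="%n. SZ (real n) w" and a="%n. AZ (real n)"])
   show "mono (%n. SZ (real n) w)"
    by (intro monoI, unfold SZ_eq[OF elim(2)], rule integral_subset_le)
     (auto intro!: integrable_continuous_interval Z_square_continuous elim)
   show "mono (%n. AZ (real n))" using AZ_increment(1) by (intro monoI) (simp add: le_diff_eq)
   fix k :: nat
   have "AZ (real ((Suc k)^2)) - AZ (real (k^2)) <= KZ^2 * (real ((Suc k)^2) - real (k^2))"
    by (rule AZ_increment(2)) (simp_all add: power_mono)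
   also have "real ((Suc k)^2) - real (k^2) = real (2 * k + 1)" by (simp add: power2_eq_square algebra_simps)
   finally show "AZ (real ((Suc k)^2)) - AZ (real (k^2)) <= KZ^2 * real (2 * k + 1)" .
  next
   show "(%k. (SZ (real (k^2)) w - AZ (real (k^2))) / real (k^2)) \<longlonglongrightarrow> 0"
    using elim(1) unfolding V_def SZ_minus_AZ[OF elim(2)] by simp
  qed
 qed
qed

end

section \<open>Riemann sums of the solution against the noise\<close>

lemma polynomial_growth_Suc:
 assumes "\<exists>C m. \<forall>x. \<bar>h x\<bar> <= C * (1 + (\<Sum>i<k. \<bar>x i\<bar>)) ^ m"
 shows "\<exists>C m. \<forall>x::nat => real. \<bar>h x * (c + x k)\<bar> <= C * (1 + (\<Sum>i<Suc k. \<bar>x i\<bar>)) ^ m"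
  and "\<exists>C m. \<forall>x::nat => real. \<bar>h x\<bar> <= C * (1 + (\<Sum>i<Suc k. \<bar>x i\<bar>)) ^ m"
proof -
 obtain C m where b: "!!x. \<bar>h x\<bar> <= C * (1 + (\<Sum>i<k. \<bar>x i\<bar>)) ^ m" using assms by blast
 have C0: "0 <= C" using b[of "%_. 0"] abs_ge_zero[of "h (%_. 0)"] by simp
 have 1: "\<bar>h x\<bar> <= C * (1 + (\<Sum>i<Suc k. \<bar>x i\<bar>)) ^ m" for x
 proof -
  have "C * (1 + (\<Sum>i<k. \<bar>x i\<bar>)) ^ m <= C * (1 + (\<Sum>i<Suc k. \<bar>x i\<bar>)) ^ m"
   by (intro mult_left_mono power_mono C0) (auto intro: add_nonneg_nonneg sum_nonneg)
  thus ?thesis using b[of x] by linarith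
 qed
 thus "\<exists>C m. \<forall>x. \<bar>h x\<bar> <= C * (1 + (\<Sum>i<Suc k. \<bar>x i\<bar>)) ^ m" by blast
 have "\<bar>h x * (c + x k)\<bar> <= C * (\<bar>c\<bar> + 1) * (1 + (\<Sum>i<Suc k. \<bar>x i\<bar>)) ^ Suc m" for x
 proof -
  define S where "S = 1 + (\<Sum>i<Suc k. \<bar>x i\<bar>)"
  have S: "1 <= S" "\<bar>x k\<bar> <= S" unfolding S_def by (simp_all add: sum_nonneg add_increasing)
  have "\<bar>c\<bar> * 1 <= \<bar>c\<bar> * S" using S(1) by (rule mult_left_mono) simp
  hence "\<bar>c + x k\<bar> <= (\<bar>c\<bar> + 1) * S" using S(2) by (simp add: distrib_right)
  hence "\<bar>h x\<bar> * \<bar>c + x k\<bar> <= (C * S ^ m) * ((\<bar>c\<bar> + 1) * S)"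
   using 1[of x] S C0 by (intro mult_mono) (auto simp: S_def)
  thus ?thesis by (simp add: abs_mult S_def mult_ac)
 qed
 thus "\<exists>C m. \<forall>x. \<bar>h x * (c + x k)\<bar> <= C * (1 + (\<Sum>i<Suc k. \<bar>x i\<bar>)) ^ m" by blast
qed

text \<open>Multiplication by an affine function of one more variable brings products \<open>f(\<xi>) (c + \<eta>)\<close> into the
 scope of Gaussian integration by parts.\<close>

lemma C1_growth_mult_new_variable:
 assumes f: "C1_growth k f"
 shows "C1_growth (Suc k) (%x. f x * (c + x k))"
  and "i < k ==> partial_deriv i (%x. f x * (c + x k)) = (%x. partial_deriv i f x * (c + x k))"
  and "partial_deriv k (%x. f x * (c + x k)) = f"
proof -
 have upd: "f (x(k := y)) = f x" for x y by (rule C1_growth_dep[OF f]) simp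
 have gx: "((%y. f (x(i := y)) * (c + (x(i := y)) k)) has_real_derivative partial_deriv i f x * (c + x k)) (at (x i))" if i: "i < k" for i x
 proof -
  have "(%y. f (x(i := y))) differentiable at (x i)" using f i by (simp add: C1_growth_def)
  then obtain d where d: "((%y. f (x(i := y))) has_real_derivative d) (at (x i))" using real_differentiable_def by blast
  have "partial_deriv i f x = d" unfolding partial_deriv_def by (rule DERIV_imp_deriv[OF d])
  thus ?thesis using DERIV_cmult_right[OF d, of "c + x k"] i by (simp add: fun_upd_other)
 qed
 have gk: "((%y. f (x(k := y)) * (c + (x(k := y)) k)) has_real_derivative f x) (at (x k))" for x
  unfolding upd by (auto intro!: derivative_eq_intros)
 show pd: "partial_deriv i (%x. f x * (c + x k)) = (%x. partial_deriv i f x * (c + x k))" if "i < k" for i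
  unfolding partial_deriv_def[of i "%x. f x * (c + x k)"] by (rule ext, rule DERIV_imp_deriv, rule gx[OF that])
 show pk: "partial_deriv k (%x. f x * (c + x k)) = f"
  unfolding partial_deriv_def by (rule ext, rule DERIV_imp_deriv, rule gk)
 have ck: "continuous_on UNIV (%x::nat => real. c + x k)"
  by (intro continuous_on_add continuous_on_const continuous_on_product_coordinates)
 have cases: "continuous_on UNIV (partial_deriv i (%x. f x * (c + x k)))
   \<and> (\<forall>x. (%y. f (x(i := y)) * (c + (x(i := y)) k)) differentiable at (x i))
   \<and> (\<exists>C m. \<forall>x. \<bar>partial_deriv i (%x. f x * (c + x k)) x\<bar> <= C * (1 + (\<Sum>i<Suc k. \<bar>x i\<bar>)) ^ m)" if "i < Suc k" for i
 proof (cases "i < k")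
  case True
  thus ?thesis unfolding pd[OF True] real_differentiable_def using f gx[OF True]
   by (intro conjI polynomial_growth_Suc continuous_on_mult ck) (auto simp: C1_growth_def)
 next
  case False
  hence i: "i = k" using that by simp
  show ?thesis unfolding i pk real_differentiable_def using f gk
   by (intro conjI polynomial_growth_Suc(2)) (auto simp: C1_growth_def)
 qed
 show "C1_growth (Suc k) (%x. f x * (c + x k))"
  unfolding C1_growth_def
 proof (intro conjI allI impI)
  show "f x * (c + x k) = f y * (c + y k)" if "\<forall>i<Suc k. x i = y i" for x y using that C1_growth_dep[OF f, of x y] by simp
  show "continuous_on UNIV (%x. f x * (c + x k))" using f by (intro continuous_on_mult ck) (simp add: C1_growth_def)
  show "\<exists>C m. \<forall>x. \<bar>f x * (c + x k)\<bar> <= C * (1 + (\<Sum>i<Suc k. \<bar>x i\<bar>)) ^ m"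
   by (rule polynomial_growth_Suc) (use f in \<open>simp add: C1_growth_def\<close>)
 qed (use cases in blast)+
qed

context gaussian_space begin

text \<open>Integration by parts of \<open>f(\<xi>) (c + \<eta>)\<close> against \<open>\<zeta>\<close>. The derivative with respect to the new variable
 \<open>\<eta>\<close> produces exactly the product of expectations that is subtracted: this is the trace term by which
 the Skorohod integral differs from the pathwise one.\<close>

lemma gaussian_duality_term:
 assumes f: "C1_growth k f" and xi: "!!i. i < k ==> \<xi> i \<in> G" and eta: "\<eta> \<in> G" and zeta: "\<zeta> \<in> G"
 shows "expectation (%w. f (%i. \<xi> i w) * ((c + \<eta> w) * \<zeta> w)) - expectation (%w. f (%i. \<xi> i w)) * expectation (%w. (c + \<eta> w) * \<zeta> w)
  = (\<Sum>i<k. expectation (%w. partial_deriv i f (%i. \<xi> i w) * (c + \<eta> w)) * ip (\<xi> i) \<zeta>)"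
proof -
 define \<xi>' where "\<xi>' i = (if i < k then \<xi> i else \<eta>)" for i
 have xi': "\<xi>' i \<in> G" for i by (simp add: \<xi>'_def xi eta)
 have fe: "f (%i. \<xi>' i w) = f (%i. \<xi> i w)" for w by (rule C1_growth_dep[OF f]) (simp add: \<xi>'_def)
 have pe: "partial_deriv i f (%i. \<xi>' i w) = partial_deriv i f (%i. \<xi> i w)" if "i < k" for i w
  by (rule C1_growth_partial_dep[OF f _ that]) (simp add: \<xi>'_def)
 have k: "\<xi>' k = \<eta>" and lt: "!!i. i < k ==> \<xi>' i = \<xi> i" by (simp_all add: \<xi>'_def)
 have "expectation (%w. f (%i. \<xi>' i w) * (c + \<xi>' k w) * \<zeta> w)
  = (\<Sum>i<Suc k. expectation (%w. partial_deriv i (%x. f x * (c + x k)) (%i. \<xi>' i w)) * ip (\<xi>' i) \<zeta>)"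
  by (rule gaussian_integration_by_parts[OF C1_growth_mult_new_variable(1)[OF f] xi' zeta])
 also have "\<dots> = (\<Sum>i<k. expectation (%w. partial_deriv i f (%i. \<xi> i w) * (c + \<eta> w)) * ip (\<xi> i) \<zeta>)
  + expectation (%w. f (%i. \<xi> i w)) * ip \<eta> \<zeta>"
  by (simp add: C1_growth_mult_new_variable(2,3)[OF f] pe lt k fe)
 also have "ip \<eta> \<zeta> = expectation (%w. (c + \<eta> w) * \<zeta> w)"
  using gaussian_mean[OF gaussian_G[OF zeta]] sqint_integrable[OF sqint_G[OF zeta]] sqint_mult[OF sqint_G[OF eta] sqint_G[OF zeta]]
  by (simp add: distrib_right)
 finally show ?thesis by (simp add: fe k mult.assoc)
qed

lemma shifted_gaussian_sqint: "Z \<in> G ==> all_moments (%w. c + Z w)"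
 by (intro all_moments_add all_moments_const all_moments_G)

lemma shifted_gaussian_square_l2:
 assumes Z: "Z \<in> G" and b: "\<bar>c\<bar> <= x" "l2 M Z <= x"
 shows "l2 M (%w. (c + Z w)^2) <= 6 * x^2"
proof -
 have x: "0 <= x" using b(1) by linarith
 have p: "(a + b) ^ 4 <= 8 * a ^ 4 + 8 * b ^ 4" for a b :: real
 proof -
  have "(a + b)^2 <= 2 * a^2 + 2 * b^2" using sum_squares_ge_zero[of "a - b" 0] by (simp add: power2_eq_square algebra_simps)
  hence "((a + b)^2)^2 <= (2 * a^2 + 2 * b^2)^2" by (intro power_mono) auto
  also have "\<dots> <= 8 * (a^2)^2 + 8 * (b^2)^2" using sum_squares_ge_zero[of "a^2 - b^2" 0] by (simp add: power2_eq_square algebra_simps)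
  finally show ?thesis by (simp add: power_mult[symmetric])
 qed
 have "(l2 M (%w. (c + Z w)^2))^2 = expectation (%w. (c + Z w) ^ 4)" by (simp add: l2_squared power_mult[symmetric])
 also have "\<dots> <= expectation (%w. 8 * c ^ 4 + 8 * Z w ^ 4)"
  by (rule integral_mono[OF all_moments_integrable[OF all_moments_power[OF shifted_gaussian_sqint[OF Z]]]])
   (use gaussian_moments(1)[OF gaussian_G[OF Z], of 4] p in auto)
 also have "\<dots> = 8 * c ^ 4 + 8 * (3 * l2 M Z ^ 4)"
  using gaussian_fourth_moment[OF gaussian_G[OF Z]] gaussian_moments(1)[OF gaussian_G[OF Z], of 4] by (simp add: prob_space)
 also have "\<dots> <= 8 * x ^ 4 + 8 * (3 * x ^ 4)"
  using power_mono[OF b(1), of 4] power_mono[OF b(2), of 4] by (intro add_mono mult_left_mono) auto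
 also have "\<dots> <= (6 * x^2)^2" by (simp add: power_mult_distrib power_mult[symmetric])
 finally show ?thesis by (rule power2_le_imp_le) simp
qed

lemma shifted_gaussian_product:
 assumes Z: "Z \<in> G" and W: "W \<in> G" and b: "\<bar>c\<bar> <= x" "l2 M Z <= x" "\<bar>d\<bar> <= y" "l2 M W <= y"
 shows "sqint M (%w. (c + Z w) * (d + W w))" and "l2 M (%w. (c + Z w) * (d + W w)) <= 6 * x * y"
proof -
 note am = shifted_gaussian_sqint
 show "sqint M (%w. (c + Z w) * (d + W w))" by (intro all_moments_sqint all_moments_mult am Z W)
 have xy: "0 <= x" "0 <= y" using b by linarith+
 have "(l2 M (%w. (c + Z w) * (d + W w)))^2 = expectation (%w. (c + Z w)^2 * (d + W w)^2)" by (simp add: l2_squared power_mult_distrib)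
 also have "\<dots> <= l2 M (%w. (c + Z w)^2) * l2 M (%w. (d + W w)^2)"
  by (rule order_trans[OF abs_ge_self cauchy_schwarz]) (intro all_moments_sqint all_moments_power am Z W)+
 also have "\<dots> <= (6 * x^2) * (6 * y^2)"
  by (intro mult_mono shifted_gaussian_square_l2 Z W b) auto
 also have "\<dots> = (6 * x * y)^2" by (simp add: power_mult_distrib)
 finally show "l2 M (%w. (c + Z w) * (d + W w)) <= 6 * x * y" by (rule power2_le_imp_le) (use xy in simp)
qed

end

lemma set_integral_increment:
 fixes f :: "real => real"
 assumes st: "0 <= s" "s <= t" and f: "!!a b. set_integrable lborel {a..b} f"
 shows "(LBINT u:{0..t}. f u) - (LBINT u:{0..s}. f u) = (LBINT u:{s..t}. f u)"
 using hk_combine[OF st, of f] set_borel_integral_eq_integral[OF f] by simp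

context ou begin

lemma m_increment: assumes "0 <= s" "s <= t" shows "\<bar>m t - m s\<bar> <= 2 * CL * (t - s)"
 using mean_increment[OF assms] assms by (simp add: m_def)

definition Xc :: "real => 'a => real" where "Xc t w = m t + Z t w"

lemma X_eq_Xc: "w \<in> space M ==> 0 <= t ==> X t w = Xc t w" by (simp add: Xc_def X_eq_mean_Z)

lemma Xc_continuous: "w \<in> space M ==> continuous_on A (%t. Xc t w)"
 unfolding Xc_def by (intro continuous_on_add m_continuous Z_continuous)

lemma Xc_measurable[measurable]: "case_prod Xc \<in> borel_measurable (borel \<Otimes>\<^sub>M M)" "Xc t \<in> borel_measurable M"
 unfolding Xc_def[abs_def] by measurable

lemma Xc_all_moments: "all_moments (Xc t)"
 unfolding Xc_def[abs_def] by (rule shifted_gaussian_sqint[OF Z_in_G])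

lemma Xc_0: "w \<in> space M ==> Xc 0 w = 0"
 using X_solution X_eq_Xc[of w 0] by (auto simp: ou_solution_def)

definition Dc :: "real => 'a => real" where "Dc t w = Lb t - \<alpha> * Xc t w"

lemma Dc_eq: "Dc t w = (Lb t - \<alpha> * m t) + (- \<alpha>) * Z t w" by (simp add: Dc_def Xc_def algebra_simps)

lemma Dc_measurable[measurable]: "case_prod Dc \<in> borel_measurable (borel \<Otimes>\<^sub>M M)"
 unfolding Dc_def[abs_def] by measurable

lemma Dc_set_integrable: assumes w: "w \<in> space M" shows "set_integrable lborel {a..b} (%t. Dc t w)"
proof -
 have "set_integrable lborel {a..b} (%t. Lb t * 1 - \<alpha> * Xc t w)"
  by (intro set_integral_diff bounded_times_continuous_set_integrable[OF Lb_measurable Lb_bound]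
    borel_integrable_atLeastAtMost' continuous_intros Xc_continuous w)
 thus ?thesis by (simp add: Dc_def)
qed

lemma Xc_Dc_set_integrable: assumes w: "w \<in> space M" shows "set_integrable lborel {a..b} (%t. (Xc t w - c) * Dc t w)"
proof -
 have "set_integrable lborel {a..b} (%t. Lb t * (Xc t w - c) - \<alpha> * Xc t w * (Xc t w - c))"
  by (intro set_integral_diff bounded_times_continuous_set_integrable[OF Lb_measurable Lb_bound]
    borel_integrable_atLeastAtMost' continuous_intros Xc_continuous w)
 moreover have "Lb t * (Xc t w - c) - \<alpha> * Xc t w * (Xc t w - c) = (Xc t w - c) * Dc t w" for t
  by (simp add: Dc_def algebra_simps)
 ultimately show ?thesis by simp
qed

lemma Xc_increment: assumes w: "w \<in> space M" and st: "0 <= s" "s <= t"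
 shows "Xc t w - Xc s w = Y t w - Y s w + (LBINT u:{s..t}. Dc u w)"
proof -
 have e: "(LBINT u:{0..r}. Dc u w) = Xc r w - Y r w" if r: "0 <= r" for r
 proof -
  have "((%u. Dc u w) has_integral (LBINT u:{0..r}. Dc u w)) {0..r}"
   using set_borel_integral_eq_integral[OF Dc_set_integrable[OF w, of 0 r]] by (simp add: has_integral_integral)
  moreover have "AE u in lborel. u \<in> {0..r} \<longrightarrow> Dc u w = L u - \<alpha> * X u w"
   using Lb_AE by eventually_elim (simp add: Dc_def X_eq_Xc w)
  ultimately have "((%u. L u - \<alpha> * X u w) has_integral (LBINT u:{0..r}. Dc u w)) {0..r}"
   by (subst has_integral_AE[symmetric])
  from has_integral_unique[OF this X_drift_integral[OF w r]] show ?thesis using r w by (simp add: X_eq_Xc)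
 qed
 show ?thesis using set_integral_increment[OF st Dc_set_integrable[OF w]] e[of s] e[of t] st by simp
qed

text \<open>Subtracting from the pathwise primitive \<open>X\<^sub>T\<^sup>2/2\<close> the drift part leaves the candidate for
 the limit of the Riemann sums of \<open>X\<close> against \<open>Y\<close>.\<close>

definition Fx :: "real => 'a => real" where
 "Fx T w = (Xc T w)^2 / 2 - (LBINT u:{0..T}. Xc u w * Dc u w)"

lemma Fx_0: "w \<in> space M ==> Fx 0 w = 0"
 using set_borel_integral_eq_integral(2)[OF Xc_Dc_set_integrable[of w 0 0 0]] by (simp add: Fx_def Xc_0)

definition Rem :: "real => real => 'a => real" where
 "Rem s t w = Xc s w * (Y t w - Y s w) - (Fx t w - Fx s w)"

text \<open>The increment of \<open>Y\<close> is the one of \<open>X\<close> minus the drift, and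
 \<open>X\<^sub>s (X\<^sub>t - X\<^sub>s) = (X\<^sub>t\<^sup>2 - X\<^sub>s\<^sup>2) / 2 - (X\<^sub>t - X\<^sub>s)^2 / 2\<close>.\<close>

lemma Rem_eq: assumes w: "w \<in> space M" and st: "0 <= s" "s <= t"
 shows "Rem s t w = (LBINT u:{s..t}. (Xc u w - Xc s w) * Dc u w) - (Xc t w - Xc s w)^2 / 2"
proof -
 have iX: "set_integrable lborel {a..b} (%u. Xc u w * Dc u w)" for a b using Xc_Dc_set_integrable[OF w, of a b 0] by simp
 have "(LBINT u:{s..t}. (Xc u w - Xc s w) * Dc u w) = (LBINT u:{s..t}. Xc u w * Dc u w - Xc s w * Dc u w)"
  by (simp add: left_diff_distrib)
 also have "\<dots> = (LBINT u:{s..t}. Xc u w * Dc u w) - (LBINT u:{s..t}. Xc s w * Dc u w)"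
  by (intro set_integral_diff iX set_integrable_mult_right Dc_set_integrable w)
 also have "(LBINT u:{s..t}. Xc s w * Dc u w) = Xc s w * (LBINT u:{s..t}. Dc u w)" by (rule set_integral_mult_right)
 finally have i: "(LBINT u:{s..t}. (Xc u w - Xc s w) * Dc u w)
   = (LBINT u:{s..t}. Xc u w * Dc u w) - Xc s w * (LBINT u:{s..t}. Dc u w)" .
 define I where "I = (LBINT u:{s..t}. Xc u w * Dc u w)"
 have F: "Fx t w - Fx s w = (Xc t w)^2 / 2 - (Xc s w)^2 / 2 - I"
  using set_integral_increment[OF st iX] by (simp add: Fx_def I_def)
 define x y where "x = Xc s w" and "y = Xc t w"
 have D: "(LBINT u:{s..t}. Dc u w) = y - x - (Y t w - Y s w)" using Xc_increment[OF w st] by (simp add: x_def y_def)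
 show ?thesis unfolding Rem_def i F unfolding D I_def[symmetric] x_def[symmetric] y_def[symmetric]
  by (simp add: power2_eq_square field_simps)
qed

definition Kx :: real where "Kx = 2 * CL + KD"
definition Ky :: real where "Ky = 2 * CL + \<alpha> * KZ"
definition KR :: real where "KR = 6 * Kx * Ky + 3 * Kx^2"

lemma Kxy_nonneg: "0 <= Kx" "0 <= Ky" "0 <= KR"
 using CL_nonneg KD_nonneg KZ_nonneg \<alpha>_pos by (auto simp: Kx_def Ky_def KR_def)

lemma Xc_increment_bounds: assumes st: "0 <= s" "s <= t" "t - s <= 1"
 shows "\<bar>m t - m s\<bar> <= Kx * (t - s) powr H" and "dl2 M (Z t) (Z s) <= Kx * (t - s) powr H"
proof -
 have p: "t - s <= (t - s) powr H" using st H_less_1 powr_mono'[of H 1 "t - s"] by (cases "t = s") auto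
 have "\<bar>m t - m s\<bar> <= 2 * CL * (t - s)" by (rule m_increment[OF st(1,2)])
 also have "\<dots> <= 2 * CL * (t - s) powr H" using p CL_nonneg by (intro mult_left_mono) auto
 also have "\<dots> <= Kx * (t - s) powr H" using KD_nonneg by (intro mult_right_mono) (auto simp: Kx_def)
 finally show "\<bar>m t - m s\<bar> <= Kx * (t - s) powr H" .
 have "dl2 M (Z t) (Z s) <= KD * (t - s) powr H" by (rule Z_increment_l2_le[OF st])
 also have "\<dots> <= Kx * (t - s) powr H" using CL_nonneg by (intro mult_right_mono) (auto simp: Kx_def)
 finally show "dl2 M (Z t) (Z s) <= Kx * (t - s) powr H" .
qed

lemma Xc_diff: "Xc t w - Xc s w = (m t - m s) + (Z t w - Z s w)" by (simp add: Xc_def)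

lemma Xc_increment_square: assumes st: "0 <= s" "s <= t" "t - s <= 1"
 shows "sqint M (%w. (Xc t w - Xc s w)^2)" and "l2 M (%w. (Xc t w - Xc s w)^2) <= 6 * (Kx * (t - s) powr H)^2"
 unfolding Xc_diff
 by (intro all_moments_sqint all_moments_power shifted_gaussian_sqint G_diff Z_in_G)
  (rule shifted_gaussian_square_l2[OF G_diff[OF Z_in_G Z_in_G] Xc_increment_bounds[OF st]])

lemma Dc_bounds: "\<bar>Lb t - \<alpha> * m t\<bar> <= Ky" "l2 M (%w. (- \<alpha>) * Z t w) <= Ky"
proof -
 have "\<bar>\<alpha> * m t\<bar> <= \<alpha> * (CL / \<alpha>)" unfolding abs_mult using m_bound[of t] \<alpha>_pos by (intro mult_mono) auto
 hence "\<bar>\<alpha> * m t\<bar> <= CL" using \<alpha>_pos by simp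
 thus "\<bar>Lb t - \<alpha> * m t\<bar> <= Ky" using Lb_bound[of t] KZ_nonneg \<alpha>_pos by (simp add: Ky_def add_increasing2)
 have "l2 M (%w. (- \<alpha>) * Z t w) <= \<alpha> * KZ" unfolding l2_cmult using Z_l2[of t] \<alpha>_pos by simp
 thus "l2 M (%w. (- \<alpha>) * Z t w) <= Ky" using CL_nonneg by (simp add: Ky_def)
qed

text \<open>Squared increments are of order \<open>2 H\<close> in mean square, and the drift term of order \<open>1 + H \<ge> 2 H\<close>.\<close>

lemma Rem_l2: assumes st: "0 <= s" "s <= t" "t - s <= 1"
 shows "sqint M (Rem s t)" and "l2 M (Rem s t) <= KR * (t - s) powr (2 * H)"
proof -
 define d where "d = t - s"
 have d: "0 <= d" "d <= 1" using st by (simp_all add: d_def)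
 have qm: "case_prod (%u w. (Xc u w - Xc s w) * Dc u w) \<in> borel_measurable (borel \<Otimes>\<^sub>M M)" by measurable
 have qb: "sqint M (%w. (Xc u w - Xc s w) * Dc u w) \<and> l2 M (%w. (Xc u w - Xc s w) * Dc u w) <= 6 * (Kx * d powr H) * Ky"
  if u: "u \<in> {s..t}" for u
 proof -
  have us: "0 <= s" "s <= u" "u - s <= 1" using u st by auto
  have "(u - s) powr H <= d powr H" using u H_half by (intro powr_mono2) (auto simp: d_def)
  hence "Kx * (u - s) powr H <= Kx * d powr H" using Kxy_nonneg by (intro mult_left_mono) auto
  hence b: "\<bar>m u - m s\<bar> <= Kx * d powr H" "dl2 M (Z u) (Z s) <= Kx * d powr H"
   using Xc_increment_bounds[OF us] by linarith+
  show ?thesis unfolding Xc_diff Dc_eq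
   using shifted_gaussian_product[OF G_diff[OF Z_in_G Z_in_G] G_cmult[OF Z_in_G] b Dc_bounds] by blast
 qed
 define I where "I w = (LBINT u:{s..t}. (Xc u w - Xc s w) * Dc u w)" for w
 have I: "sqint M I" "l2 M I <= d * (6 * (Kx * d powr H) * Ky)"
  unfolding I_def d_def[symmetric] using process_integral_sqint[OF qm st(2) qb] process_integral_l2[OF qm st(2) qb] by (auto simp: d_def)
 have sq: "sqint M (%w. 1/2 * (Xc t w - Xc s w)^2)" by (intro sqint_cmult Xc_increment_square st)
 have R: "Rem s t w = I w - 1/2 * (Xc t w - Xc s w)^2" if "w \<in> space M" for w
  using Rem_eq[OF that st(1,2)] by (simp add: I_def)
 have s1: "sqint M (%w. I w - 1/2 * (Xc t w - Xc s w)^2)" by (rule sqint_diff[OF I(1) sq])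
 have meas: "Rem s t \<in> borel_measurable M" using s1 measurable_cong[of M "Rem s t" "%w. I w - 1/2 * (Xc t w - Xc s w)^2"] R by (simp add: sqint_def)
 show "sqint M (Rem s t)" using s1 meas R unfolding sqint_def
  by (auto intro: Bochner_Integration.integrable_cong[THEN iffD1, rotated 2])
 have "l2 M (Rem s t) = l2 M (%w. I w - 1/2 * (Xc t w - Xc s w)^2)"
  by (rule l2_cong_AE[OF meas]) (use s1 R in \<open>auto simp: sqint_def\<close>)
 also have "\<dots> <= l2 M I + l2 M (%w. 1/2 * (Xc t w - Xc s w)^2)" by (rule l2_triangle_diff[OF I(1) sq])
 also have "\<dots> <= d * (6 * (Kx * d powr H) * Ky) + 1/2 * (6 * (Kx * d powr H)^2)"
  unfolding l2_cmult using Xc_increment_square(2)[OF st] I(2) by (simp add: d_def)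
 also have "\<dots> = 6 * Kx * Ky * (d * d powr H) + 3 * Kx^2 * (d powr H)^2" by (simp add: power_mult_distrib)
 also have "(d powr H)^2 = d powr (2 * H)" by (simp add: power2_eq_square powr_add[symmetric])
 also have "6 * Kx * Ky * (d * d powr H) <= 6 * Kx * Ky * d powr (2 * H)"
 proof (rule mult_left_mono)
  have "d <= d powr H" using d H_less_1 powr_mono'[of H 1 d] by (cases "d = 0") auto
  hence "d * d powr H <= d powr H * d powr H" by (intro mult_right_mono) auto
  thus "d * d powr H <= d powr (2 * H)" by (simp add: powr_add[symmetric])
 qed (use Kxy_nonneg in auto)
 also have "6 * Kx * Ky * d powr (2 * H) + 3 * Kx^2 * d powr (2 * H) = KR * d powr (2 * H)" by (simp add: KR_def algebra_simps)
 finally show "l2 M (Rem s t) <= KR * (t - s) powr (2 * H)" by (simp add: d_def)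
qed

definition RS :: "real => nat => 'a => real" where
 "RS T n w = (\<Sum>j<n. Xc (T * real j / real n) w * (Y (T * real (Suc j) / real n) w - Y (T * real j / real n) w))"

lemma RS_minus_Fx: assumes w: "w \<in> space M" and n: "n > 0"
 shows "RS T n w - Fx T w = (\<Sum>j<n. Rem (T * real j / real n) (T * real (Suc j) / real n) w)"
proof -
 have "(\<Sum>j<n. Fx (T * real (Suc j) / real n) w - Fx (T * real j / real n) w) = Fx (T * real n / real n) w - Fx (T * real 0 / real n) w"
  by (rule sum_lessThan_telescope)
 also have "\<dots> = Fx T w" using n w by (simp add: Fx_0)
 finally show ?thesis unfolding RS_def Rem_def sum_subtractf by simp
qed

lemma grid_step: "n > 0 ==> T * real (Suc j) / real n - T * real j / real n = T / real n"
 by (simp add: field_simps)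

lemma eventually_fine_grid: assumes T: "0 < T" shows "\<forall>\<^sub>F n in sequentially. 0 < n \<and> T / real n <= 1"
proof -
 have "\<forall>\<^sub>F n in sequentially. nat \<lceil>T\<rceil> + 1 <= n" by (rule eventually_ge_at_top)
 thus ?thesis
 proof eventually_elim
  case (elim n)
  hence "T <= real n" by linarith
  thus ?case using elim T by simp
 qed
qed

text \<open>The \<open>n\<close> remainders of order \<open>(T/n)\<^bsup>2H\<^esup>\<close> sum up to order \<open>n\<^bsup>1-2H\<^esup>\<close>.\<close>

lemma RS_l2: assumes T: "0 < T" and n: "n > 0" "T / real n <= 1"
 shows "sqint M (%w. RS T n w - Fx T w)" and "dl2 M (RS T n) (Fx T) <= KR * T powr (2 * H) * real n powr (1 - 2 * H)"
proof -
 have R: "sqint M (Rem (T * real j / real n) (T * real (Suc j) / real n))"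
  "l2 M (Rem (T * real j / real n) (T * real (Suc j) / real n)) <= KR * (T / real n) powr (2 * H)" for j
 proof -
  have "0 <= T * real j / real n" "T * real j / real n <= T * real (Suc j) / real n" using T n by (auto intro!: divide_right_mono mult_left_mono)
  moreover have "T * real (Suc j) / real n - T * real j / real n <= 1" unfolding grid_step[OF n(1)] by (rule n(2))
  ultimately show "sqint M (Rem (T * real j / real n) (T * real (Suc j) / real n))"
   "l2 M (Rem (T * real j / real n) (T * real (Suc j) / real n)) <= KR * (T / real n) powr (2 * H)"
   using Rem_l2[of "T * real j / real n" "T * real (Suc j) / real n"] unfolding grid_step[OF n(1)] by blast+
 qed
 define S where "S w = (\<Sum>j<n. Rem (T * real j / real n) (T * real (Suc j) / real n) w)" for w
 have S: "sqint M S" unfolding S_def by (rule sqint_sum) (rule R)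
 have e: "RS T n w - Fx T w = S w" if "w \<in> space M" for w using RS_minus_Fx[OF that n(1)] by (simp add: S_def)
 have meas: "(%w. RS T n w - Fx T w) \<in> borel_measurable M" using S measurable_cong[of M "%w. RS T n w - Fx T w" S] e by (simp add: sqint_def)
 show "sqint M (%w. RS T n w - Fx T w)" using S meas e unfolding sqint_def
  by (auto intro: Bochner_Integration.integrable_cong[THEN iffD1, rotated 2])
 have "dl2 M (RS T n) (Fx T) = l2 M S" by (rule l2_cong_AE[OF meas]) (use S e in \<open>auto simp: sqint_def\<close>)
 also have "\<dots> <= (\<Sum>j<n. l2 M (Rem (T * real j / real n) (T * real (Suc j) / real n)))" unfolding S_def by (rule l2_sum) (rule R)
 also have "\<dots> <= (\<Sum>j<n. KR * (T / real n) powr (2 * H))" by (rule sum_mono) (rule R)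
 also have "\<dots> = KR * T powr (2 * H) * (real n * (1 / real n powr (2 * H)))" using T by (simp add: powr_divide)
 also have "real n * (1 / real n powr (2 * H)) = real n powr (1 - 2 * H)" using n by (simp add: powr_diff)
 finally show "dl2 M (RS T n) (Fx T) <= KR * T powr (2 * H) * real n powr (1 - 2 * H)" .
qed

lemma RS_tendsto: assumes T: "0 < T" shows "(%n. dl2 M (RS T n) (Fx T)) \<longlonglongrightarrow> 0"
proof (rule Lim_null_comparison)
 show "\<forall>\<^sub>F n in sequentially. norm (dl2 M (RS T n) (Fx T)) <= KR * T powr (2 * H) * real n powr (1 - 2 * H)"
  using eventually_fine_grid[OF T] by eventually_elim (use RS_l2[OF T] in auto)
 have "(%n. real n powr (1 - 2 * H)) \<longlonglongrightarrow> 0"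
  by (rule tendsto_neg_powr) (use H_half in \<open>auto simp: filterlim_real_sequentially\<close>)
 thus "(%n. KR * T powr (2 * H) * real n powr (1 - 2 * H)) \<longlonglongrightarrow> 0" by (rule tendsto_mult_right_zero)
qed

text \<open>\<open>Fx\<close> minus its expectation \<open>cF\<close>, expanded so that the law of large numbers applies to each term.\<close>

definition Sk :: "real => 'a => real" where
 "Sk T w = m T * Z T w + ((Z T w)^2 - varZ T) / 2 - (LBINT u:{0..T}. Lb u * Z u w)
  + \<alpha> * (2 * (LBINT u:{0..T}. m u * Z u w) + (SZ T w - AZ T))"

definition cF :: "real => real" where
 "cF T = ((m T)^2 + varZ T) / 2 - (LBINT u:{0..T}. Lb u * m u) + \<alpha> * ((LBINT u:{0..T}. (m u)\<^sup>2) + AZ T)"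

lemma Fx_eq_Sk: assumes w: "w \<in> space M" shows "Fx T w = Sk T w + cF T"
proof -
 have i: "set_integrable lborel {0..T} (%u. Lb u * m u)" "set_integrable lborel {0..T} (%u. Lb u * Z u w)"
  by (intro bounded_times_continuous_set_integrable[OF Lb_measurable Lb_bound] m_continuous Z_continuous w)+
 have j: "set_integrable lborel {0..T} (%u. (m u)^2)" "set_integrable lborel {0..T} (%u. m u * Z u w)" "set_integrable lborel {0..T} (%u. (Z u w)^2)"
  by (intro borel_integrable_atLeastAtMost' continuous_intros m_continuous Z_continuous w)+
 have "Xc u w * Dc u w = Lb u * m u + Lb u * Z u w - \<alpha> * ((m u)^2 + 2 * (m u * Z u w) + (Z u w)^2)" for u
  by (simp add: Xc_def Dc_def power2_eq_square algebra_simps)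
 hence "(LBINT u:{0..T}. Xc u w * Dc u w) = (LBINT u:{0..T}. Lb u * m u + Lb u * Z u w - \<alpha> * ((m u)^2 + 2 * (m u * Z u w) + (Z u w)^2))"
  by simp
 also have "\<dots> = (LBINT u:{0..T}. Lb u * m u) + (LBINT u:{0..T}. Lb u * Z u w)
  - \<alpha> * ((LBINT u:{0..T}. (m u)\<^sup>2) + 2 * (LBINT u:{0..T}. m u * Z u w) + (LBINT u:{0..T}. (Z u w)\<^sup>2))"
 proof -
  have a: "set_integrable lborel {0..T} (%u. (m u)^2 + 2 * (m u * Z u w))" by (intro set_integral_add set_integrable_mult_right j)
  have b: "set_integrable lborel {0..T} (%u. (m u)^2 + 2 * (m u * Z u w) + (Z u w)^2)" by (intro set_integral_add a j)
  show ?thesis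
   unfolding set_integral_diff(2)[OF set_integral_add(1)[OF i] set_integrable_mult_right[OF b]] set_integral_add(2)[OF i]
    set_integral_mult_right set_integral_add(2)[OF a j(3)] set_integral_add(2)[OF j(1) set_integrable_mult_right[OF j(2)]] ..
 qed
 finally have e: "(LBINT u:{0..T}. Xc u w * Dc u w) = (LBINT u:{0..T}. Lb u * m u) + (LBINT u:{0..T}. Lb u * Z u w)
  - \<alpha> * ((LBINT u:{0..T}. (m u)\<^sup>2) + 2 * (LBINT u:{0..T}. m u * Z u w) + SZ T w)" by (simp add: SZ_def)
 have "(Xc T w)^2 / 2 = (m T)^2 / 2 + m T * Z T w + (Z T w)^2 / 2" by (simp add: Xc_def power2_eq_square field_simps)
 thus ?thesis unfolding Fx_def Sk_def cF_def e by (simp add: algebra_simps add_divide_distrib diff_divide_distrib)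
qed

lemma Sk_moments: assumes T: "0 <= T" shows "sqint M (Sk T)" and "expectation (Sk T) = 0"
proof -
 define W where "W w = (LBINT u:{0..T}. qZ u w)" for w
 have W: "sqint M W" unfolding W_def by (rule process_integral_sqint[OF qZ_measurable T qZ_l2])
 have LZ: "(%w. LBINT u:{0..T}. Lb u * Z u w) \<in> G" by (rule Z_mult_integral_in_G[OF Lb_measurable Lb_bound T])
 have mZ: "(%w. LBINT u:{0..T}. m u * Z u w) \<in> G" by (rule Z_mult_integral_in_G[OF m_measurable m_bound T])
 define V where "V w = (m T * Z T w - (LBINT u:{0..T}. Lb u * Z u w)) + 2 * \<alpha> * (LBINT u:{0..T}. m u * Z u w)" for w
 have V: "V \<in> G" unfolding V_def by (intro G_add G_diff G_cmult Z_in_G LZ mZ)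
 have q: "expectation (qZ t) = 0" for t
 proof -
  have "expectation (qZ t) = expectation (%w. (Z t w)^2) - varZ t"
   unfolding qZ_def using sqint_square[OF Z_sqint] by (simp add: prob_space)
  thus ?thesis by (simp add: varZ_def l2_squared)
 qed
 have EW: "expectation W = 0"
  using process_integral_inner[OF qZ_measurable T qZ_l2 sqint_const[of 1]] q by (simp add: W_def[abs_def])
 have eq: "Sk T w = V w + 1/2 * qZ T w + \<alpha> * W w" if "w \<in> space M" for w
 proof -
  have 1: "SZ T w - AZ T = W w" using SZ_minus_AZ[OF that, of T] by (simp add: W_def)
  have 2: "((Z T w)^2 - varZ T) / 2 = 1/2 * qZ T w" by (simp add: qZ_def)
  show ?thesis unfolding Sk_def V_def 1 2 by (simp add: algebra_simps)
 qed
 have qT: "sqint M (qZ T)" using qZ_l2 by blast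
 have s: "sqint M (%w. V w + 1/2 * qZ T w + \<alpha> * W w)" by (intro sqint_add sqint_cmult qT W sqint_G V)
 have meas: "Sk T \<in> borel_measurable M" using s measurable_cong[of M "Sk T" "%w. V w + 1/2 * qZ T w + \<alpha> * W w"] eq by (simp add: sqint_def)
 show "sqint M (Sk T)" using s meas eq unfolding sqint_def
  by (auto intro: Bochner_Integration.integrable_cong[THEN iffD1, rotated 2])
 have "expectation (Sk T) = expectation (%w. V w + 1/2 * qZ T w + \<alpha> * W w)" by (rule bochner_cong) (auto simp: eq)
 also have "\<dots> = expectation V + 1/2 * expectation (qZ T) + \<alpha> * expectation W"
  using sqint_integrable[OF sqint_G[OF V]] sqint_integrable[OF qT] sqint_integrable[OF W] by simp
 finally show "expectation (Sk T) = 0" using gaussian_mean[OF gaussian_G[OF V]] q EW by simp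
qed

lemma RS_sqint: assumes T: "0 <= T" shows "all_moments (RS T n)"
 unfolding RS_def
proof (intro all_moments_sum all_moments_mult Xc_all_moments)
 fix j assume "j \<in> {..<n}"
 thus "all_moments (%w. Y (T * real (Suc j) / real n) w - Y (T * real j / real n) w)"
  using grid_in[OF T, of "Suc j" n] grid_in[OF T, of j n] by (intro all_moments_diff all_moments_G Y_in_G) auto
qed

lemma centred_RS_tendsto: assumes T: "0 < T"
 shows "(%n. l2 M (%w. (RS T n w - expectation (RS T n)) - Sk T w)) \<longlonglongrightarrow> 0"
proof (rule Lim_null_comparison)
 have T0: "0 <= T" using T by simp
 show "\<forall>\<^sub>F n in sequentially. norm (l2 M (%w. (RS T n w - expectation (RS T n)) - Sk T w)) <= 2 * dl2 M (RS T n) (Fx T)"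
  using eventually_fine_grid[OF T]
 proof eventually_elim
  case (elim n)
  define Df where "Df w = RS T n w - Fx T w" for w
  have Df: "sqint M Df" unfolding Df_def using RS_l2(1)[OF T] elim by blast
  have Dfe: "Df w = RS T n w - Sk T w - cF T" if "w \<in> space M" for w using Fx_eq_Sk[OF that, of T] by (simp add: Df_def)
  have RSi: "integrable M (RS T n)" by (intro all_moments_integrable RS_sqint T0)
  have "expectation Df = expectation (%w. RS T n w - Sk T w - cF T)" by (rule bochner_cong) (auto simp: Dfe)
  also have "\<dots> = expectation (RS T n) - cF T"
   using RSi sqint_integrable[OF Sk_moments(1)[OF T0]] Sk_moments(2)[OF T0] by (simp add: prob_space)
  finally have E: "expectation Df = expectation (RS T n) - cF T" .
  have [measurable]: "Sk T \<in> borel_measurable M" "RS T n \<in> borel_measurable M" "Df \<in> borel_measurable M"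
   using Sk_moments(1)[OF T0] RSi Df by (auto simp: sqint_def)
  have "l2 M (%w. (RS T n w - expectation (RS T n)) - Sk T w) = l2 M (%w. Df w - expectation Df)"
   by (rule l2_cong_AE) (auto simp: Dfe E)
  also have "\<dots> <= l2 M Df + l2 M (%w. expectation Df)" by (rule l2_triangle_diff[OF Df sqint_const])
  also have "\<dots> <= 2 * l2 M Df" using abs_expectation_le_l2[OF Df] by simp
  finally show ?case by (simp add: Df_def[abs_def])
 qed
 show "(%n. 2 * dl2 M (RS T n) (Fx T)) \<longlonglongrightarrow> 0" by (rule tendsto_mult_right_zero[OF RS_tendsto[OF T]])
qed

end

section \<open>The duality relation\<close>

lemma smooth_poly_growth_imp_C1_growth:
 assumes f: "smooth_poly_growth k f" shows "C1_growth k f"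
proof -
 have P: "continuous_on UNIV (partial_derivs js f) \<and>
    (\<forall>i<k. \<forall>x. (%y. partial_derivs js f (x(i := y))) differentiable at (x i)) \<and>
    (\<exists>C m. \<forall>x. \<bar>partial_derivs js f x\<bar> <= C * (1 + (\<Sum>i<k. \<bar>x i\<bar>)) ^ m)" if "set js \<subseteq> {..<k}" for js
  using f that unfolding smooth_poly_growth_def by blast
 have d: "\<forall>x y. (\<forall>i<k. x i = y i) \<longrightarrow> f x = f y" using f unfolding smooth_poly_growth_def by blast
 have 0: "partial_derivs [] f = f" and 1: "partial_derivs [i] f = partial_deriv i f" for i
  by (simp_all add: partial_derivs_def)
 have P0: "continuous_on UNIV f \<and> (\<forall>i<k. \<forall>x. (%y. f (x(i := y))) differentiable at (x i)) \<and>
    (\<exists>C m. \<forall>x. \<bar>f x\<bar> <= C * (1 + (\<Sum>i<k. \<bar>x i\<bar>)) ^ m)"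
  using P[of "[]"] unfolding 0 by simp
 have P1: "continuous_on UNIV (partial_deriv i f) \<and> (\<exists>C m. \<forall>x. \<bar>partial_deriv i f x\<bar> <= C * (1 + (\<Sum>i<k. \<bar>x i\<bar>)) ^ m)" if "i < k" for i
  using P[of "[i]"] that unfolding 1 by simp
 show ?thesis unfolding C1_growth_def using d P0 P1 by blast
qed

lemma represents_cong:
 assumes e: "!!t. t \<in> {0..T} ==> f t = g t"
 shows "represents M Y T h f \<longleftrightarrow> represents M Y T h g"
proof -
 have "step_error T (h k) f = integral {0..T} (%s. (step_fun (h k) s - g s)^2)" for k
  by (rule hk_cong) (simp add: e)
 moreover have "(%s. (step_fun (h k) s - f s)^2) integrable_on {0..T} \<longleftrightarrow> (%s. (step_fun (h k) s - g s)^2) integrable_on {0..T}" for k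
  by (rule Henstock_Kurzweil_Integration.integrable_cong) (simp add: e)
 ultimately show ?thesis unfolding represents_def by simp
qed

context ou begin

definition HX :: "real => 'a => nat => step" where "HX T w = hilb_of M Y T (%t. X t w)"

lemma HX_represents: assumes w: "w \<in> space M" and T: "0 <= T"
 shows "represents M Y T (HX T w) (%t. X t w)" "represents M Y T (HX T w) (%t. Xc t w)"
proof -
 show 1: "represents M Y T (HX T w) (%t. X t w)" unfolding HX_def by (rule represents_continuous[OF T X_continuous[OF w]])
 show "represents M Y T (HX T w) (%t. Xc t w)"
  by (rule represents_cong[THEN iffD1, OF _ 1]) (simp add: X_eq_Xc w)
qed

lemma HX_hilb: assumes "w \<in> space M" "0 <= T" shows "HX T w \<in> hilb M Y T"
 using HX_represents(1)[OF assms] by (simp add: represents_def)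

definition iX :: "real => 'a => 'a => real" where "iX T w = iso M Y (HX T w)"

lemma iX_sqint: "w \<in> space M ==> 0 <= T ==> sqint M (iX T w)"
 unfolding iX_def by (rule sqint_G[OF iso_properties(1)[OF HX_hilb]])

definition SE :: "real => nat => 'a => real" where
 "SE T n w = integral {0..T} (%s. (step_fun (riemann_step (%t. Xc t w) T n) s - Xc s w)^2)"

lemma SE_tendsto: "w \<in> space M ==> 0 <= T ==> (%n. SE T n w) \<longlonglongrightarrow> 0"
 unfolding SE_def by (intro riemann_step_tendsto Xc_continuous)

lemma iX_approximation: assumes w: "w \<in> space M" and T: "0 <= T"
 shows "(l2 M (%w'. step_integral Y (riemann_step (%t. Xc t w) T n) w' - iX T w w'))^2 <= 4 * Kq * SE T n w"
 unfolding iX_def SE_def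
 by (rule iso_approximation[OF HX_represents(2)[OF w T] keys_riemann[OF T] continuous_square_integrable[OF Xc_continuous[OF w]]])

definition YI :: "real => nat => nat => 'a => real" where
 "YI T n j w = Y (T * real (Suc j) / real n) w - Y (T * real j / real n) w"

lemma YI_in_G: assumes "0 <= T" "j < n" shows "YI T n j \<in> G"
 unfolding YI_def[abs_def] using grid_in[OF assms(1), of "Suc j" n] grid_in[OF assms(1), of j n] assms(2)
 by (intro G_diff Y_in_G) auto

text \<open>For a fixed path of \<open>X\<close>, taken at \<open>w\<close>, \<open>iX T w\<close> is the Wiener integral of this path as a random variable in a
 second argument, and \<open>AX\<close> is its inner product with \<open>\<xi>\<close>. The approximation \<open>AN\<close> replaces the path by its Riemann
 step function.\<close>

definition AX :: "real => ('a => real) => 'a => real" where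
 "AX T \<xi> w = expectation (%w'. \<xi> w' * iX T w w')"

definition AN :: "real => nat => ('a => real) => 'a => real" where
 "AN T n \<xi> w = (\<Sum>j<n. Xc (T * real j / real n) w * ip \<xi> (YI T n j))"

lemma riemann_step_integral:
 "step_integral Y (riemann_step (%t. Xc t w) T n) w' = (\<Sum>j<n. Xc (T * real j / real n) w * YI T n j w')"
 unfolding step_integral_eq step_apply_riemann YI_def ..

lemma expectation_riemann_step_integral:
 assumes xi: "sqint M \<xi>" and T: "0 <= T"
 shows "expectation (%w'. \<xi> w' * step_integral Y (riemann_step (%t. Xc t w) T n) w') = AN T n \<xi> w"
proof -
 have "expectation (%w'. \<xi> w' * step_integral Y (riemann_step (%t. Xc t w) T n) w')
  = expectation (%w'. \<Sum>j<n. Xc (T * real j / real n) w * (\<xi> w' * YI T n j w'))"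
  unfolding riemann_step_integral by (simp add: sum_distrib_left mult.left_commute)
 also have "\<dots> = (\<Sum>j<n. expectation (%w'. Xc (T * real j / real n) w * (\<xi> w' * YI T n j w')))"
  by (rule bochner_sum) (intro integrable_mult_right sqint_mult[OF xi sqint_G[OF YI_in_G[OF T]]], simp)
 finally show ?thesis by (simp add: AN_def)
qed

lemma AN_approximation: assumes w: "w \<in> space M" and T: "0 <= T" and xi: "sqint M \<xi>"
 shows "(AN T n \<xi> w - AX T \<xi> w)^2 <= (l2 M \<xi>)^2 * (4 * Kq) * SE T n w"
proof -
 define S where "S = step_integral Y (riemann_step (%t. Xc t w) T n)"
 have S: "sqint M S" unfolding S_def by (intro sqint_G step_integral_in_G[OF keys_riemann[OF T]])
 note i = iX_sqint[OF w T]
 have "AN T n \<xi> w - AX T \<xi> w = ip \<xi> S - expectation (%w'. \<xi> w' * iX T w w')"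
  unfolding S_def expectation_riemann_step_integral[OF xi T] AX_def ..
 also have "\<dots> = expectation (%w'. \<xi> w' * S w' - \<xi> w' * iX T w w')"
  by (rule bochner_diff[symmetric]) (intro sqint_mult xi S i)+
 also have "\<dots> = expectation (%w'. \<xi> w' * (S w' - iX T w w'))" by (simp add: right_diff_distrib)
 finally have "\<bar>AN T n \<xi> w - AX T \<xi> w\<bar> <= l2 M \<xi> * l2 M (%w'. S w' - iX T w w')"
  using cauchy_schwarz[OF xi sqint_diff[OF S i]] by simp
 hence "(AN T n \<xi> w - AX T \<xi> w)^2 <= (l2 M \<xi> * l2 M (%w'. S w' - iX T w w'))^2" by (rule abs_le_imp_square_le)
 also have "\<dots> = (l2 M \<xi>)^2 * (l2 M (%w'. S w' - iX T w w'))^2" by (rule power_mult_distrib)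
 also have "\<dots> <= (l2 M \<xi>)^2 * (4 * Kq * SE T n w)"
  unfolding S_def by (rule mult_left_mono[OF iX_approximation[OF w T]]) simp
 finally show ?thesis by (simp add: mult.assoc)
qed

lemma AN_tendsto: assumes w: "w \<in> space M" and T: "0 <= T" and xi: "sqint M \<xi>"
 shows "(%n. AN T n \<xi> w) \<longlonglongrightarrow> AX T \<xi> w"
proof -
 have "(%n. (l2 M \<xi>)^2 * (4 * Kq) * SE T n w) \<longlonglongrightarrow> 0" by (intro tendsto_mult_right_zero SE_tendsto w T)
 hence "(%n. (AN T n \<xi> w - AX T \<xi> w)^2) \<longlonglongrightarrow> 0"
  by (rule Lim_null_comparison[rotated]) (use AN_approximation[OF w T xi] in simp)
 hence "(%n. AN T n \<xi> w - AX T \<xi> w) \<longlonglongrightarrow> 0" by simp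
 thus ?thesis by (rule LIM_zero_cancel)
qed

lemma AN_all_moments: "all_moments (AN T n \<xi>)"
 unfolding AN_def[abs_def] by (intro all_moments_sum all_moments_mult Xc_all_moments all_moments_const)

lemma AX_measurable: assumes T: "0 <= T" and xi: "sqint M \<xi>" shows "AX T \<xi> \<in> borel_measurable M"
 by (rule borel_measurable_LIMSEQ_real[where u="%n. AN T n \<xi>"])
  (use AN_tendsto[OF _ T xi] all_moments_measurable[OF AN_all_moments] in auto)

text \<open>In terms of the jointly measurable process, the error is the time integral of \<open>(X\<^bsub>g(s)\<^esub> - X\<^sub>s)^2\<close>, where \<open>g(s)\<close> is the
 grid point to the left of \<open>s\<close>; this form makes its expectation accessible.\<close>

lemma SE_expectation:
 assumes T: "0 < T" and n: "0 < n" "T / real n <= 1"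
 obtains D where "integrable M D" "AE w in M. SE T n w = D w" "expectation D <= T * (6 * (Kx * (T / real n) powr H)^2)"
proof -
 define g where "g s = T * real (grid_point T n s) / real n" for s
 have [measurable]: "g \<in> borel_measurable borel" unfolding g_def grid_point_def by measurable
 have [measurable]: "(%x. Xc (g (fst x)) (snd x)) \<in> borel_measurable (borel \<Otimes>\<^sub>M M)"
  using measurable_compose[OF _ Xc_measurable(1), of "%x. (g (fst x), snd x)"] by simp
 have qm: "case_prod (%s w. (Xc (g s) w - Xc s w)^2) \<in> borel_measurable (borel \<Otimes>\<^sub>M M)"
  unfolding case_prod_beta' by measurable
 have gs: "0 <= g s" "g s <= s" "s - g s <= T / real n" if s: "s \<in> {0..T}" for s
 proof -
  show "0 <= g s" using T by (simp add: g_def)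
  have "g s <= s \<and> s - g s <= T / real n"
  proof (cases "s = 0")
   \<comment> \<open>At \<open>s = 0\<close> the index is \<open>nat (- 1) = 0\<close>.\<close>
   case True thus ?thesis using T by (simp add: g_def grid_point_def)
  next
   case False
   hence "0 < s" "s <= T" using s by auto
   from grid_cell[OF this n(1) refl] grid_step[OF n(1), of T "grid_point T n s"] show ?thesis by (auto simp: g_def)
  qed
  thus "g s <= s" "s - g s <= T / real n" by auto
 qed
 have qb: "sqint M (%w. (Xc (g s) w - Xc s w)^2) \<and> l2 M (%w. (Xc (g s) w - Xc s w)^2) <= 6 * (Kx * (T / real n) powr H)^2"
  if s: "s \<in> {0..T}" for s
 proof -
  have s1: "s - g s <= 1" using gs(3)[OF s] n(2) by linarith
  have "(s - g s) powr H <= (T / real n) powr H" using gs[OF s] H_half by (intro powr_mono2) auto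
  hence "(Kx * (s - g s) powr H)^2 <= (Kx * (T / real n) powr H)^2" using Kxy_nonneg by (intro power_mono mult_left_mono) auto
  thus ?thesis
   using Xc_increment_square[OF gs(1)[OF s] gs(2)[OF s] s1] by (simp add: power2_commute[of "Xc (g s) _"])
 qed
 define D where "D w = (LBINT s:{0..T}. (Xc (g s) w - Xc s w)\<^sup>2)" for w
 have T0: "0 <= T" using T by simp
 have D: "sqint M D" unfolding D_def by (rule process_integral_sqint[OF qm T0 qb])
 show thesis
 proof (rule that[of D])
  show "integrable M D" by (rule sqint_integrable[OF D])
  have "l2 M D <= (T - 0) * (6 * (Kx * (T / real n) powr H)^2)" unfolding D_def by (rule process_integral_l2[OF qm T0 qb])
  hence "l2 M D <= T * (6 * (Kx * (T / real n) powr H)^2)" by (simp only: diff_zero)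
  thus "expectation D <= T * (6 * (Kx * (T / real n) powr H)^2)" using abs_expectation_le_l2[OF D] by linarith
  have "AE w in M. set_integrable lborel {0..T} (%s. (Xc (g s) w - Xc s w)^2)" by (rule process_integrable_AE[OF qm T0 qb])
  thus "AE w in M. SE T n w = D w"
  proof eventually_elim
   case (elim w)
   have "SE T n w = integral {0..T} (%s. (Xc (g s) w - Xc s w)^2)"
    unfolding SE_def
   proof (rule integral_spike[of "{0}"])
    fix s assume "s \<in> {0..T} - {0}"
    hence s: "0 < s" "s <= T" by auto
    show "(Xc (g s) w - Xc s w)^2 = (step_fun (riemann_step (%t. Xc t w) T n) s - Xc s w)^2"
     unfolding step_fun_riemann[OF s n(1)] g_def ..
   qed simp
   also have "\<dots> = D w" unfolding D_def by (rule set_borel_integral_eq_integral(2)[OF elim, symmetric])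
   finally show ?case .
  qed
 qed
qed

text \<open>Pathwise, the error is controlled by the \<open>L^2\<close> distance of the path from its step function, and that
 distance has small expectation because \<open>X\<close> is Hoelder continuous in mean square.\<close>

lemma AX_mean_square:
 assumes T: "0 < T" and xi: "sqint M \<xi>"
 shows "sqint M (AX T \<xi>)" and "(%n. dl2 M (AN T n \<xi>) (AX T \<xi>)) \<longlonglongrightarrow> 0"
proof -
 have T0: "0 <= T" using T by simp
 define k where "k = (l2 M \<xi>)^2 * (4 * Kq)"
 have k: "0 <= k" using Kq_pos by (simp add: k_def)
 note [measurable] = AX_measurable[OF T0 xi] all_moments_measurable[OF AN_all_moments]
 have d: "sqint M (%w. AN T n \<xi> w - AX T \<xi> w) \<and> (dl2 M (AN T n \<xi>) (AX T \<xi>))\<^sup>2 <= k * (T * (6 * (Kx * (T / real n) powr H)^2))"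
  if n: "0 < n" "T / real n <= 1" for n
 proof -
  obtain D where D: "integrable M D" "AE w in M. SE T n w = D w" "expectation D <= T * (6 * (Kx * (T / real n) powr H)^2)"
   using SE_expectation[OF T n] .
  have ae: "AE w in M. (AN T n \<xi> w - AX T \<xi> w)\<^sup>2 <= k * D w"
   using D(2) AE_space
  proof eventually_elim
   case (elim w)
   show ?case using AN_approximation[OF elim(2) T0 xi, of n] unfolding elim(1) k_def .
  qed
  have i: "integrable M (%w. (AN T n \<xi> w - AX T \<xi> w)^2)"
  proof (rule bochner_integrable_bound[OF integrable_mult_right[OF D(1), of k]])
   show "AE w in M. norm ((AN T n \<xi> w - AX T \<xi> w)^2) <= norm (k * D w)" using ae by eventually_elim simp
  qed measurable
  have "(dl2 M (AN T n \<xi>) (AX T \<xi>))^2 <= expectation (%w. k * D w)"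
   unfolding l2_squared by (rule integral_mono_AE[OF i integrable_mult_right[OF D(1)] ae])
  also have "\<dots> <= k * (T * (6 * (Kx * (T / real n) powr H)^2))" using mult_left_mono[OF D(3) k] by simp
  finally show ?thesis using i by (simp add: sqint_def)
 qed
 show "sqint M (AX T \<xi>)"
 proof -
  obtain n where n: "0 < n" "T / real n <= 1" using eventually_happens[OF eventually_fine_grid[OF T]] by auto
  have "sqint M (%w. AN T n \<xi> w - (AN T n \<xi> w - AX T \<xi> w))"
   by (rule sqint_diff[OF all_moments_sqint[OF AN_all_moments]]) (use d[OF n] in blast)
  thus ?thesis by simp
 qed
 have "(%n. (dl2 M (AN T n \<xi>) (AX T \<xi>))^2) \<longlonglongrightarrow> 0"
 proof (rule Lim_null_comparison)
  show "\<forall>\<^sub>F n in sequentially. norm ((dl2 M (AN T n \<xi>) (AX T \<xi>))^2) <= k * (T * (6 * (Kx * (T / real n) powr H)^2))"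
   using eventually_fine_grid[OF T]
  proof eventually_elim
   case (elim n)
   show ?case using d[of n] elim by simp
  qed
  have "(%n. T / real n) \<longlonglongrightarrow> 0" by (rule lim_const_over_n)
  hence "(%n. (T / real n) powr H) \<longlonglongrightarrow> 0 powr H" using H_half T by (intro tendsto_powr2) (auto intro!: always_eventually)
  hence "(%n. k * (T * (6 * (Kx * (T / real n) powr H)^2))) \<longlonglongrightarrow> k * (T * (6 * (Kx * 0)^2))" by (intro tendsto_intros) simp
  thus "(%n. k * (T * (6 * (Kx * (T / real n) powr H)^2))) \<longlonglongrightarrow> 0" by simp
 qed
 thus "(%n. dl2 M (AN T n \<xi>) (AX T \<xi>)) \<longlonglongrightarrow> 0" by simp
qed

text \<open>Sum of \<open>gaussian_duality_term\<close> over the cells, with \<open>\<eta> = Z\<close> at the left end point and \<open>\<zeta>\<close> the increment of \<open>Y\<close>.\<close>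

lemma RS_duality:
 assumes T: "0 <= T" and f: "C1_growth k f" and xi: "!!i. i < k ==> \<xi> i \<in> G"
 shows "expectation (%w. f (%i. \<xi> i w) * RS T n w) - expectation (%w. f (%i. \<xi> i w)) * expectation (RS T n)
  = (\<Sum>i<k. expectation (%w. partial_deriv i f (%i. \<xi> i w) * AN T n (\<xi> i) w))"
proof -
 define t where "t j = T * real j / real n" for j
 have RSe: "RS T n w = (\<Sum>j<n. (m (t j) + Z (t j) w) * YI T n j w)" for w
  by (simp add: RS_def YI_def t_def Xc_def)
 have F: "all_moments (%w. f (%i. \<xi> i w))" by (rule all_moments_C1_growth(1)[OF f xi])
 have dF: "all_moments (%w. partial_deriv i f (%i. \<xi> i w))" if "i < k" for i by (rule all_moments_C1_growth(2)[OF f xi that])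
 have term_am: "all_moments (%w. (m (t j) + Z (t j) w) * YI T n j w)" if "j < n" for j
  by (intro all_moments_mult shifted_gaussian_sqint Z_in_G all_moments_G YI_in_G T that)
 have 1: "expectation (%w. f (%i. \<xi> i w) * RS T n w) = (\<Sum>j<n. expectation (%w. f (%i. \<xi> i w) * ((m (t j) + Z (t j) w) * YI T n j w)))"
  unfolding RSe sum_distrib_left
  by (rule bochner_sum) (intro all_moments_integrable all_moments_mult F term_am, simp)
 have 2: "expectation (RS T n) = (\<Sum>j<n. expectation (%w. (m (t j) + Z (t j) w) * YI T n j w))"
  unfolding RSe[abs_def]
  by (rule bochner_sum) (intro all_moments_integrable term_am, simp)
 have 3: "expectation (%w. partial_deriv i f (%i. \<xi> i w) * AN T n (\<xi> i) w)
   = (\<Sum>j<n. expectation (%w. partial_deriv i f (%i. \<xi> i w) * (m (t j) + Z (t j) w)) * ip (\<xi> i) (YI T n j))"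
  if i: "i < k" for i
 proof -
  have "expectation (%w. partial_deriv i f (%i. \<xi> i w) * AN T n (\<xi> i) w)
   = expectation (%w. \<Sum>j<n. partial_deriv i f (%i. \<xi> i w) * (m (t j) + Z (t j) w) * ip (\<xi> i) (YI T n j))"
   by (simp add: AN_def t_def Xc_def sum_distrib_left mult.assoc)
  also have "\<dots> = (\<Sum>j<n. expectation (%w. partial_deriv i f (%i. \<xi> i w) * (m (t j) + Z (t j) w) * ip (\<xi> i) (YI T n j)))"
   by (rule bochner_sum)
    (intro all_moments_integrable all_moments_mult dF[OF i] shifted_gaussian_sqint Z_in_G all_moments_const)
  finally show ?thesis by simp
 qed
 have "expectation (%w. f (%i. \<xi> i w) * RS T n w) - expectation (%w. f (%i. \<xi> i w)) * expectation (RS T n)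
  = (\<Sum>j<n. expectation (%w. f (%i. \<xi> i w) * ((m (t j) + Z (t j) w) * YI T n j w))
     - expectation (%w. f (%i. \<xi> i w)) * expectation (%w. (m (t j) + Z (t j) w) * YI T n j w))"
  unfolding 1 2 by (simp add: sum_subtractf sum_distrib_left)
 also have "\<dots> = (\<Sum>j<n. \<Sum>i<k. expectation (%w. partial_deriv i f (%i. \<xi> i w) * (m (t j) + Z (t j) w)) * ip (\<xi> i) (YI T n j))"
  by (intro sum.cong refl gaussian_duality_term f xi Z_in_G YI_in_G T) auto
 also have "\<dots> = (\<Sum>i<k. \<Sum>j<n. expectation (%w. partial_deriv i f (%i. \<xi> i w) * (m (t j) + Z (t j) w)) * ip (\<xi> i) (YI T n j))"
  by (rule sum.swap)
 also have "\<dots> = (\<Sum>i<k. expectation (%w. partial_deriv i f (%i. \<xi> i w) * AN T n (\<xi> i) w))"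
  by (intro sum.cong refl) (simp add: 3)
 finally show ?thesis .
qed

text \<open>Passage to the limit in \<open>RS_duality\<close>: the Riemann sums minus their expectations tend to \<open>Fx - E Fx = Sk\<close>.\<close>

lemma Sk_duality:
 assumes T: "0 < T" and f: "C1_growth k f" and xi: "!!i. i < k ==> \<xi> i \<in> G"
 shows "expectation (%w. f (%i. \<xi> i w) * Sk T w)
  = (\<Sum>i<k. expectation (%w. partial_deriv i f (%i. \<xi> i w) * AX T (\<xi> i) w))"
proof -
 have T0: "0 <= T" using T by simp
 define F where "F w = f (%i. \<xi> i w)" for w
 define dF where "dF i w = partial_deriv i f (%i. \<xi> i w)" for i w
 have F: "sqint M F" unfolding F_def by (intro all_moments_sqint all_moments_C1_growth(1)[OF f xi])
 have dF: "sqint M (dF i)" if "i < k" for i unfolding dF_def by (intro all_moments_sqint all_moments_C1_growth(2)[OF f xi that])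
 have RSs: "sqint M (RS T n)" for n by (intro all_moments_sqint RS_sqint T0)
 have c: "sqint M (%w. RS T n w - expectation (RS T n))" for n by (intro sqint_diff RSs sqint_const)
 have "(%n. expectation (%w. F w * (RS T n w - expectation (RS T n)))) \<longlonglongrightarrow> ip F (Sk T)"
  by (rule l2_tendsto_inner[OF F F _ c Sk_moments(1)[OF T0] centred_RS_tendsto[OF T]]) simp
 moreover have "expectation (%w. F w * (RS T n w - expectation (RS T n))) = (\<Sum>i<k. ip (dF i) (AN T n (\<xi> i)))" for n
 proof -
  have "expectation (%w. F w * (RS T n w - expectation (RS T n))) = expectation (%w. F w * RS T n w - F w * expectation (RS T n))"
   by (simp only: right_diff_distrib)
  also have "\<dots> = ip F (RS T n) - expectation F * expectation (RS T n)"
   using sqint_mult[OF F RSs[of n]] sqint_integrable[OF F] by simp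
  also have "\<dots> = (\<Sum>i<k. ip (dF i) (AN T n (\<xi> i)))"
   unfolding F_def[abs_def] dF_def by (rule RS_duality[OF T0 f xi])
  finally show ?thesis .
 qed
 ultimately have "(%n. \<Sum>i<k. ip (dF i) (AN T n (\<xi> i))) \<longlonglongrightarrow> ip F (Sk T)" by simp
 moreover have "(%n. \<Sum>i<k. ip (dF i) (AN T n (\<xi> i))) \<longlonglongrightarrow> (\<Sum>i<k. ip (dF i) (AX T (\<xi> i)))"
 proof (rule tendsto_sum)
  fix i assume "i \<in> {..<k}"
  hence i: "i < k" by simp
  have xs: "sqint M (\<xi> i)" by (intro sqint_G xi i)
  show "(%n. ip (dF i) (AN T n (\<xi> i))) \<longlonglongrightarrow> ip (dF i) (AX T (\<xi> i))"
   by (rule l2_tendsto_inner[OF dF[OF i] dF[OF i] _ all_moments_sqint[OF AN_all_moments] AX_mean_square[OF T xs]]) simp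
 qed
 ultimately show ?thesis unfolding F_def dF_def using LIMSEQ_unique by blast
qed

lemma hinner_HX: assumes w: "w \<in> space M" and T: "0 <= T" and g: "g \<in> hilb M Y T"
 shows "hinner M Y g (HX T w) = AX T (iso M Y g) w"
 unfolding AX_def iX_def by (rule hinner_eq[OF g HX_hilb[OF w T]])

text \<open>The inner product is a limit of those with the Riemann step functions, which are explicit in finitely
 many values of \<open>X\<close>.\<close>

lemma hinner_HX_self_measurable:
 assumes T: "0 <= T" shows "(%w. hinner M Y (HX T w) (HX T w)) \<in> borel_measurable M"
proof (rule borel_measurable_LIMSEQ_real[where u="%n w. \<Sum>j<n. Xc (T * real j / real n) w * AX T (YI T n j) w"])
 have "AX T (YI T n j) \<in> borel_measurable M" if "j < n" for n j by (intro AX_measurable T sqint_G YI_in_G that)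
 thus "(%w. \<Sum>j<n. Xc (T * real j / real n) w * AX T (YI T n j) w) \<in> borel_measurable M" for n
  by (intro borel_measurable_sum borel_measurable_times Xc_measurable) simp
 fix w assume w: "w \<in> space M"
 define S where "S n = step_integral Y (riemann_step (%t. Xc t w) T n)" for n
 have S: "sqint M (S n)" for n unfolding S_def by (intro sqint_G step_integral_in_G[OF keys_riemann[OF T]])
 note i = iX_sqint[OF w T]
 have e: "(\<Sum>j<n. Xc (T * real j / real n) w * AX T (YI T n j) w) = expectation (%w'. S n w' * iX T w w')" for n
 proof -
  have "expectation (%w'. S n w' * iX T w w') = expectation (%w'. \<Sum>j<n. Xc (T * real j / real n) w * (YI T n j w' * iX T w w'))"
   unfolding S_def riemann_step_integral by (simp add: sum_distrib_right mult.assoc)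
  also have "\<dots> = (\<Sum>j<n. expectation (%w'. Xc (T * real j / real n) w * (YI T n j w' * iX T w w')))"
   by (rule bochner_sum) (intro integrable_mult_right sqint_mult[OF sqint_G[OF YI_in_G[OF T]] i], simp)
  finally show ?thesis by (simp add: AX_def)
 qed
 have "(%n. 4 * Kq * SE T n w) \<longlonglongrightarrow> 0" by (intro tendsto_mult_right_zero SE_tendsto w T)
 hence "(%n. (l2 M (%w'. S n w' - iX T w w'))^2) \<longlonglongrightarrow> 0"
  by (rule Lim_null_comparison[rotated]) (use iX_approximation[OF w T] in \<open>simp add: S_def\<close>)
 hence "(%n. l2 M (%w'. S n w' - iX T w w')) \<longlonglongrightarrow> 0" by simp
 from l2_tendsto_inner[OF S i this i i, simplified]
 have "(%n. expectation (%w'. S n w' * iX T w w')) \<longlonglongrightarrow> expectation (%w'. iX T w w' * iX T w w')" .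
 thus "(%n. \<Sum>j<n. Xc (T * real j / real n) w * AX T (YI T n j) w) \<longlonglongrightarrow> hinner M Y (HX T w) (HX T w)"
  unfolding e hinner_eq[OF HX_hilb[OF w T] HX_hilb[OF w T]] iX_def .
qed

lemma hinner_HX_self_le:
 assumes w: "w \<in> space M" and T: "0 <= T"
 shows "0 <= hinner M Y (HX T w) (HX T w)" "hinner M Y (HX T w) (HX T w) <= 4 * Kq * (LBINT s:{0..T}. (Xc s w)\<^sup>2)"
proof -
 have h: "hinner M Y (HX T w) (HX T w) = (l2 M (iX T w))^2"
  unfolding hinner_eq[OF HX_hilb[OF w T] HX_hilb[OF w T]] iX_def l2_squared by (simp only: power2_eq_square)
 show "0 <= hinner M Y (HX T w) (HX T w)" unfolding h by simp
 have i: "(%s. (step_fun 0 s - Xc s w)^2) integrable_on {0..T}" by (rule continuous_square_integrable[OF Xc_continuous[OF w]])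
 have "(l2 M (%w'. step_integral Y 0 w' - iX T w w'))^2 <= 4 * Kq * integral {0..T} (%s. (step_fun 0 s - Xc s w)^2)"
  unfolding iX_def by (rule iso_approximation[OF HX_represents(2)[OF w T] _ i]) simp
 moreover have "step_integral Y 0 w' = 0" "step_fun 0 s = 0" for w' s by (simp_all add: step_integral_eq step_fun_eq step_apply_zero)
 moreover have "(LBINT s:{0..T}. (Xc s w)\<^sup>2) = integral {0..T} (%s. (Xc s w)^2)"
  by (rule lborel_set_integral_continuous) (intro continuous_intros Xc_continuous w)
 ultimately show "hinner M Y (HX T w) (HX T w) <= 4 * Kq * (LBINT s:{0..T}. (Xc s w)\<^sup>2)"
  unfolding h by (simp add: l2_uminus)
qed

lemma X_L2_hilb: assumes T: "0 <= T" shows "L2_hilb M Y T X"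
 unfolding L2_hilb_def HX_def[symmetric]
proof (intro conjI ballI)
 show "\<exists>h. represents M Y T h (%t. X t w)" if "w \<in> space M" for w using HX_represents(1)[OF that T] by blast
 show "(%w. hinner M Y g (HX T w)) \<in> borel_measurable M" if g: "g \<in> hilb M Y T" for g
  using AX_measurable[OF T sqint_G[OF iso_properties(1)[OF g]]] hinner_HX[OF _ T g]
  by (simp cong: measurable_cong)
 define K where "K = CL / \<alpha> + KZ"
 have b: "\<bar>m s\<bar> <= K" "l2 M (Z s) <= K" for s
  using m_bound[of s] Z_l2[of s] KZ_nonneg abs_ge_zero[of "m s"] by (auto simp: K_def)
 have qb: "sqint M (%w. (Xc s w)^2) \<and> l2 M (%w. (Xc s w)^2) <= 6 * K^2" for s
  unfolding Xc_def using shifted_gaussian_square_l2[OF Z_in_G b] all_moments_sqint[OF all_moments_power[OF shifted_gaussian_sqint[OF Z_in_G]]] by blast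
 have qm: "case_prod (%s w. (Xc s w)^2) \<in> borel_measurable (borel \<Otimes>\<^sub>M M)" by measurable
 have i: "integrable M (%w. 4 * Kq * (LBINT s:{0..T}. (Xc s w)\<^sup>2))"
  by (intro integrable_mult_right sqint_integrable process_integral_sqint[OF qm T qb])
 show "integrable M (%w. hinner M Y (HX T w) (HX T w))"
 proof (rule bochner_integrable_bound[OF i hinner_HX_self_measurable[OF T]])
  show "AE w in M. norm (hinner M Y (HX T w) (HX T w)) <= norm (4 * Kq * (LBINT s:{0..T}. (Xc s w)\<^sup>2))"
   using AE_space by eventually_elim (use hinner_HX_self_le[OF _ T] in force)
 qed
qed

lemma Sk_skorohod_duality:
 assumes T: "0 < T" and f: "smooth_poly_growth k f" and h: "!!i. i < k ==> h i \<in> hilb M Y T"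
 shows "(\<integral>w. functional M Y f h w * Sk T w \<partial>M) = (\<integral>w. D_inner M Y k f h (HX T w) w \<partial>M)"
proof -
 have T0: "0 <= T" using T by simp
 have f': "C1_growth k f" by (rule smooth_poly_growth_imp_C1_growth[OF f])
 have xi: "iso M Y (h i) \<in> G" if "i < k" for i by (rule iso_properties(1)[OF h[OF that]])
 have "(\<integral>w. D_inner M Y k f h (HX T w) w \<partial>M) = expectation (%w. \<Sum>i<k. partial_deriv i f (%i. iso M Y (h i) w) * AX T (iso M Y (h i)) w)"
  by (rule bochner_cong) (simp_all add: D_inner_def functional_def hinner_HX[OF _ T0 h])
 also have "\<dots> = (\<Sum>i<k. expectation (%w. partial_deriv i f (%i. iso M Y (h i) w) * AX T (iso M Y (h i)) w))"
  by (rule bochner_sum)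
   (intro sqint_mult all_moments_sqint all_moments_C1_growth(2)[OF f' xi] AX_mean_square(1)[OF T] sqint_G xi, simp_all)
 also have "\<dots> = expectation (%w. f (%i. iso M Y (h i) w) * Sk T w)"
  by (rule Sk_duality[OF T f' xi, symmetric])
 finally show ?thesis by (simp add: functional_def)
qed

end

section \<open>The Skorohod integral of the solution\<close>

text \<open>The trigonometric test functions, closed under partial derivatives: these shift the phase and rescale
 the amplitude.\<close>

definition wave :: "nat => (nat => real) => real => real => (nat => real) => real" where
 "wave k c K a x = K * cos (a + (\<Sum>i<k. c i * x i))"

lemma wave_has_derivative:
 assumes i: "i < k"
 shows "((%y. wave k c K a (x(i := y))) has_real_derivative wave k c (K * c i) (a + pi / 2) x) (at (x i))"
proof -
 define S where "S = (\<Sum>j\<in>{..<k} - {i}. c j * x j)"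
 have u: "(\<Sum>j<k. c j * (x(i := y)) j) = c i * y + S" for y
 proof -
  have "(\<Sum>j<k. c j * (x(i := y)) j) = c i * (x(i := y)) i + (\<Sum>j\<in>{..<k} - {i}. c j * (x(i := y)) j)"
   by (rule sum.remove) (use i in auto)
  also have "(\<Sum>j\<in>{..<k} - {i}. c j * (x(i := y)) j) = S" unfolding S_def by (rule sum.cong) auto
  finally show ?thesis by simp
 qed
 have x: "(\<Sum>j<k. c j * x j) = c i * x i + S" using u[of "x i"] by simp
 have "((%y. K * cos (a + (c i * y + S))) has_real_derivative - (K * c i * sin (a + (c i * x i + S)))) (at (x i))"
  by (auto intro!: derivative_eq_intros)
 moreover have "wave k c (K * c i) (a + pi / 2) x = - (K * c i * sin (a + (c i * x i + S)))"
 proof -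
  have "cos (a + pi / 2 + (c i * x i + S)) = cos ((a + (c i * x i + S)) + pi / 2)" by (simp add: algebra_simps)
  also have "\<dots> = - sin (a + (c i * x i + S))" unfolding cos_add by simp
  finally show ?thesis unfolding wave_def x by simp
 qed
 ultimately show ?thesis unfolding wave_def u by simp
qed

lemma partial_deriv_wave: "i < k ==> partial_deriv i (wave k c K a) = wave k c (K * c i) (a + pi / 2)"
 unfolding partial_deriv_def by (rule ext, rule DERIV_imp_deriv, erule wave_has_derivative)

lemma partial_derivs_wave: "set js \<subseteq> {..<k} ==> \<exists>K' a'. partial_derivs js (wave k c K a) = wave k c K' a'"
proof (induction js)
 case Nil
 have "partial_derivs [] (wave k c K a) = wave k c K a" by (simp add: partial_derivs_def)
 thus ?case by blast
next
 case (Cons i js)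
 then obtain K' a' where "partial_derivs js (wave k c K a) = wave k c K' a'" by auto
 hence "partial_derivs (i # js) (wave k c K a) = wave k c (K' * c i) (a' + pi / 2)"
  using Cons.prems by (simp add: partial_derivs_def partial_deriv_wave)
 thus ?case by blast
qed

lemma smooth_poly_growth_wave: "smooth_poly_growth k (wave k c K a)"
 unfolding smooth_poly_growth_def
proof (intro conjI allI impI)
 fix x y :: "nat => real" assume "\<forall>i<k. x i = y i"
 thus "wave k c K a x = wave k c K a y" by (simp add: wave_def)
next
 fix js :: "nat list" assume "set js \<subseteq> {..<k}"
 then obtain K' a' where e: "partial_derivs js (wave k c K a) = wave k c K' a'" using partial_derivs_wave by blast
 show "continuous_on UNIV (partial_derivs js (wave k c K a))"
  unfolding e unfolding wave_def[abs_def] by (intro continuous_intros continuous_on_product_coordinates)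
 show "(%y. partial_derivs js (wave k c K a) (x(i := y))) differentiable at (x i)" if "i < k" for i x
  unfolding e real_differentiable_def using wave_has_derivative[OF that] by blast
 have "\<bar>wave k c K' a' x\<bar> <= \<bar>K'\<bar> * (1 + (\<Sum>i<k. \<bar>x i\<bar>)) ^ 0" for x
  unfolding wave_def abs_mult using abs_cos_le_one by (simp add: mult_left_le)
 thus "\<exists>C m. \<forall>x. \<bar>partial_derivs js (wave k c K a) x\<bar> <= C * (1 + (\<Sum>i<k. \<bar>x i\<bar>)) ^ m" unfolding e by blast
qed

lemma lint_jointly_measurable:
 fixes Q :: "real => 'b => real"
 assumes Q: "case_prod Q \<in> borel_measurable (borel \<Otimes>\<^sub>M S)"
 shows "(%w. LBINT t:{a..b}. Q t w) \<in> borel_measurable S"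
proof -
 have s: "sets (S \<Otimes>\<^sub>M lborel) = sets (S \<Otimes>\<^sub>M borel)" by (rule sets_pair_measure_cong) auto
 have "(%x. (snd x, fst x)) \<in> (S \<Otimes>\<^sub>M borel) \<rightarrow>\<^sub>M (borel \<Otimes>\<^sub>M S)" by measurable
 from measurable_compose[OF this Q] have [measurable]: "(%x. Q (snd x) (fst x)) \<in> borel_measurable (S \<Otimes>\<^sub>M borel)" by simp
 have "(%x. indicator {a..b} (snd x) *\<^sub>R Q (snd x) (fst x)) \<in> borel_measurable (S \<Otimes>\<^sub>M borel)" by measurable
 hence "case_prod (%w t. indicator {a..b} t *\<^sub>R Q t w) \<in> borel_measurable (S \<Otimes>\<^sub>M lborel)"
  unfolding case_prod_beta' measurable_cong_sets[OF s refl] .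
 from lborel.borel_measurable_lebesgue_integral[OF this] show ?thesis unfolding set_lebesgue_integral_def .
qed

context fbm begin

definition sigY :: "real => 'a measure" where
 "sigY T = sigma (space M) {Y t -` A \<inter> space M | t A. t \<in> {0..T} \<and> A \<in> sets borel}"

lemma space_sigY[simp]: "space (sigY T) = space M" by (simp add: sigY_def space_measure_of_conv)

lemma sets_sigY: "sets (sigY T) = sigma_sets (space M) {Y t -` A \<inter> space M | t A. t \<in> {0..T} \<and> A \<in> sets borel}"
 unfolding sigY_def by (rule sets_measure_of) auto

lemma Y_sigY_measurable: assumes t: "t \<in> {0..T}" shows "Y t \<in> borel_measurable (sigY T)"
proof (rule measurableI)
 fix A :: "real set" assume "A \<in> sets borel"
 thus "Y t -` A \<inter> space (sigY T) \<in> sets (sigY T)" unfolding sets_sigY using t by (auto intro!: sigma_sets.Basic)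
qed simp

lemma sigY_subset: "sets (sigY T) \<subseteq> sets M"
 unfolding sets_sigY
proof (rule sets.sigma_sets_subset, rule subsetI)
 fix x assume "x \<in> {Y t -` A \<inter> space M | t A. t \<in> {0..T} \<and> A \<in> sets borel}"
 then obtain t A where tA: "x = Y t -` A \<inter> space M" "t \<in> {0..T}" "A \<in> sets borel" by blast
 have "Y t \<in> borel_measurable M" using tA(2) Y_in_G measurable_G by auto
 thus "x \<in> sets M" unfolding tA(1) by (rule measurable_sets) (rule tA(3))
qed

lemma sigY_measurable_imp: "W \<in> borel_measurable (sigY T) ==> W \<in> borel_measurable M"
 using sigY_subset measurable_sets[of W "sigY T" borel] by (auto intro!: measurableI)

lemma single_hilb: assumes t: "t \<in> {0..T}"
 shows "(%_. Poly_Mapping.single t 1) \<in> hilb M Y T" and "AE w in M. iso M Y (%_. Poly_Mapping.single t 1) w = Y t w"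
proof -
 show h: "(%_. Poly_Mapping.single t 1) \<in> hilb M Y T" using t by (auto simp: hilb_def step_inner_def)
 have Y: "step_integral Y (Poly_Mapping.single t 1) = Y t" by (rule ext) (simp add: step_integral_eq step_apply_single)
 have "dl2 M (Y t) (iso M Y (%_. Poly_Mapping.single t 1)) = 0"
  using iso_properties(2)[OF h] unfolding Y by (simp add: LIMSEQ_const_iff)
 hence "AE w in M. Y t w - iso M Y (%_. Poly_Mapping.single t 1) w = 0"
  by (intro l2_eq_0_AE sqint_diff Y_sqint sqint_G[OF iso_properties(1)[OF h]]) (use t in auto)
 thus "AE w in M. iso M Y (%_. Poly_Mapping.single t 1) w = Y t w" by eventually_elim simp
qed

text \<open>A variable that is measurable for \<open>Y\<close> on \<open>[0,T]\<close> is determined by its products with the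
 smooth functionals, because these contain the trigonometric ones.\<close>

lemma sigY_measurable_zero:
 assumes W: "W \<in> borel_measurable (sigY T)" "sqint M W"
  and ort: "!!k f h. smooth_poly_growth k f ==> (!!i. i < k ==> h i \<in> hilb M Y T) ==> ip (functional M Y f h) W = 0"
 shows "AE w in M. W w = 0"
proof -
 have Wm[measurable]: "W \<in> borel_measurable M" and Wi: "integrable M W" using sqint_measurable[OF W(2)] sqint_integrable[OF W(2)] by auto
 have wave0: "expectation (%w. W w * cos (a + (\<Sum>t\<in>S. c t * Y t w))) = 0" if S: "finite S" "S \<subseteq> {0..T}" for S c a
 proof -
  obtain e where e: "bij_betw e {..<card S} S" using ex_bij_betw_nat_finite[OF S(1)] by (auto simp: atLeast0LessThan)
  have eS: "e i \<in> {0..T}" if "i < card S" for i using bij_betwE[OF e] that S(2) by auto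
  define h where "h i = (%_::nat. Poly_Mapping.single (e i) (1::real))" for i
  have "AE w in M. \<forall>i\<in>{..<card S}. iso M Y (h i) w = Y (e i) w"
   by (rule AE_finite_allI) (auto simp: h_def intro!: single_hilb(2)[of _ T] dest: eS)
  hence ae: "AE w in M. functional M Y (wave (card S) (%i. c (e i)) 1 a) h w * W w = W w * cos (a + (\<Sum>t\<in>S. c t * Y t w))"
  proof eventually_elim
   case (elim w)
   have "(\<Sum>i<card S. c (e i) * iso M Y (h i) w) = (\<Sum>i<card S. c (e i) * Y (e i) w)" using elim by (intro sum.cong) auto
   also have "\<dots> = (\<Sum>t\<in>S. c t * Y t w)" by (rule sum.reindex_bij_betw[OF e])
   finally show ?case by (simp add: functional_def wave_def)
  qed
  have Ym: "Y t \<in> borel_measurable M" if "t \<in> S" for t using that S(2) Y_in_G measurable_G by auto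
  have hH: "h i \<in> hilb M Y T" if "i < card S" for i unfolding h_def by (rule single_hilb(1)[OF eS[OF that]])
  have Fm: "functional M Y (wave (card S) (%i. c (e i)) 1 a) h \<in> borel_measurable M"
   unfolding functional_def[abs_def]
   by (rule all_moments_measurable[OF all_moments_C1_growth(1)[OF smooth_poly_growth_imp_C1_growth[OF smooth_poly_growth_wave]]])
    (rule iso_properties(1)[OF hH])
  have "expectation (%w. W w * cos (a + (\<Sum>t\<in>S. c t * Y t w))) = ip (functional M Y (wave (card S) (%i. c (e i)) 1 a) h) W"
  proof (rule integral_cong_AE)
   show "(%w. W w * cos (a + (\<Sum>t\<in>S. c t * Y t w))) \<in> borel_measurable M"
   proof -
    have [measurable]: "(%w. \<Sum>t\<in>S. c t * Y t w) \<in> borel_measurable M"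
     by (intro borel_measurable_sum borel_measurable_times borel_measurable_const Ym)
    show ?thesis by measurable
   qed
   show "(%w. functional M Y (wave (card S) (%i. c (e i)) 1 a) h w * W w) \<in> borel_measurable M"
    by (intro borel_measurable_times Wm Fm)
   show "AE w in M. W w * cos (a + (\<Sum>t\<in>S. c t * Y t w)) = functional M Y (wave (card S) (%i. c (e i)) 1 a) h w * W w"
    using ae by eventually_elim (rule sym)
  qed
  also have "\<dots> = 0" by (rule ort[OF smooth_poly_growth_wave hH])
  finally show ?thesis .
 qed
 have zero: "ip W (indicator A) = 0" if A: "A \<in> sets (sigY T)" for A
 proof (rule weighted_char_zero_family[where I="{0..T}" and \<xi>=Y, OF Wi])
  show "Y t \<in> borel_measurable M" if "t \<in> {0..T}" for t using that Y_in_G measurable_G by auto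
  show "A \<in> sigma_sets (space M) {Y i -` B \<inter> space M | i B. i \<in> {0..T} \<and> B \<in> sets borel}" using A unfolding sets_sigY .
 qed (rule wave0)
 define P where "P = {w \<in> space M. 0 <= W w}"
 have P: "P \<in> sets (sigY T)" "space M - P \<in> sets (sigY T)"
 proof -
  have "W -` {0..} \<inter> space (sigY T) \<in> sets (sigY T)" by (rule measurable_sets[OF W(1)]) simp
  moreover have "W -` {0..} \<inter> space (sigY T) = P" by (auto simp: P_def)
  ultimately show "P \<in> sets (sigY T)" by simp
  from sets.compl_sets[OF this] show "space M - P \<in> sets (sigY T)" by simp
 qed
 have [measurable]: "P \<in> sets M" using P(1) sigY_subset by blast
 have ip: "integrable M (%w. W w * indicator P w)" and im: "integrable M (%w. W w * indicator (space M - P) w)"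
  by (rule integrable_real_mult_indicator[OF _ Wi], measurable)+
 have "expectation (%w. \<bar>W w\<bar>) = expectation (%w. W w * indicator P w - W w * indicator (space M - P) w)"
  by (rule bochner_cong) (auto simp: P_def indicator_def)
 also have "\<dots> = 0" unfolding bochner_diff[OF ip im] using zero[OF P(1)] zero[OF P(2)] by simp
 finally have "expectation (%w. \<bar>W w\<bar>) = 0" .
 hence "AE w in M. \<bar>W w\<bar> = 0" using Wi by (subst (asm) integral_nonneg_eq_0_iff_AE) auto
 thus ?thesis by simp
qed

end

context ou begin

text \<open>The paths of \<open>Z\<close> are explicit functionals of those of \<open>Y\<close>.\<close>

lemma Z_sigY_measurable: assumes t: "t \<in> {0..T}" shows "Z t \<in> borel_measurable (sigY T)"
proof -
 define Yc where "Yc s w = Y (max 0 (min T s)) w" for s w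
 have T: "0 <= T" using t by simp
 have Yj: "case_prod Yc \<in> borel_measurable (borel \<Otimes>\<^sub>M sigY T)"
 proof (rule continuous_process_jointly_measurable)
  show "continuous_on UNIV (%s. Yc s w)" if "w \<in> space (sigY T)" for w
  proof -
   have "continuous_on {0..} (%t. Y t w)" using Y_continuous that by simp
   thus ?thesis unfolding Yc_def by (rule continuous_on_compose2) (auto intro!: continuous_intros)
  qed
  show "Yc s \<in> borel_measurable (sigY T)" for s unfolding Yc_def[abs_def] using T by (intro Y_sigY_measurable) auto
 qed
 have eq: "Z t w = Y t w + decay t * (LBINT s:{0..t}. exp (\<alpha> * s) * (- \<alpha> * Yc s w))" if w: "w \<in> space (sigY T)" for w
 proof -
  have w': "w \<in> space M" using w by simp
  have "Z t w = volterra \<alpha> (%t. Y t w) t"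
   by (rule volterra_unique[OF Y_continuous[OF w'] Z_path(1)[OF w']]) (use t Z_path(2)[OF w'] in auto)
  moreover have "integral {0..t} (%s. exp (\<alpha> * s) * (- \<alpha> * Y s w)) = integral {0..t} (%s. exp (\<alpha> * s) * (- \<alpha> * Yc s w))"
   by (rule hk_cong) (use t in \<open>simp add: Yc_def\<close>)
  moreover have "(LBINT s:{0..t}. exp (\<alpha> * s) * (- \<alpha> * Yc s w)) = integral {0..t} (%s. exp (\<alpha> * s) * (- \<alpha> * Yc s w))"
   by (rule lborel_set_integral_continuous)
    (auto simp: Yc_def intro!: continuous_intros continuous_on_compose2[OF Y_continuous[OF w']])
  ultimately show ?thesis unfolding volterra_def by simp
 qed
 have "case_prod (%s w. exp (\<alpha> * s) * (- \<alpha> * Yc s w)) \<in> borel_measurable (borel \<Otimes>\<^sub>M sigY T)"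
  using Yj by measurable
 from lint_jointly_measurable[OF this, of 0 t] Y_sigY_measurable[OF t]
 have "(%w. Y t w + decay t * (LBINT s:{0..t}. exp (\<alpha> * s) * (- \<alpha> * Yc s w))) \<in> borel_measurable (sigY T)"
  by measurable
 thus ?thesis by (subst measurable_cong[OF eq])
qed

lemma Sk_sigY_measurable: assumes T: "0 <= T" shows "Sk T \<in> borel_measurable (sigY T)"
proof -
 define Zc where "Zc s w = Z (max 0 (min T s)) w" for s w
 have Zj[measurable]: "case_prod Zc \<in> borel_measurable (borel \<Otimes>\<^sub>M sigY T)"
 proof (rule continuous_process_jointly_measurable)
  show "continuous_on UNIV (%s. Zc s w)" if "w \<in> space (sigY T)" for w
  proof -
   have "continuous_on UNIV (%t. Z t w)" using Z_continuous that by simp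
   thus ?thesis unfolding Zc_def by (rule continuous_on_compose2) (auto intro!: continuous_intros)
  qed
  show "Zc s \<in> borel_measurable (sigY T)" for s unfolding Zc_def[abs_def] using T by (intro Z_sigY_measurable) auto
 qed
 have cl: "(LBINT u:{0..T}. g u (Z u w)) = (LBINT u:{0..T}. g u (Zc u w))" for g :: "real => real => real" and w
  by (rule set_lebesgue_integral_cong) (auto simp: Zc_def)
 have [measurable]: "Z T \<in> borel_measurable (sigY T)" using T by (intro Z_sigY_measurable) simp
 have 1: "(%w. LBINT u:{0..T}. Lb u * Zc u w) \<in> borel_measurable (sigY T)"
  by (rule lint_jointly_measurable) measurable
 have 2: "(%w. LBINT u:{0..T}. m u * Zc u w) \<in> borel_measurable (sigY T)"
  by (rule lint_jointly_measurable) measurable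
 have 3: "(%w. LBINT u:{0..T}. (Zc u w)\<^sup>2) \<in> borel_measurable (sigY T)"
  by (rule lint_jointly_measurable) measurable
 show ?thesis
  unfolding Sk_def[abs_def] SZ_def cl[of "%u z. Lb u * z"] cl[of "%u z. m u * z"] cl[of "%u z. z^2"]
  using 1 2 3 by measurable
qed

lemma Sk_is_skorohod_integral: assumes T: "0 < T" shows "is_skorohod_integral M Y T X (Sk T)"
 unfolding is_skorohod_integral_def sigY_def[symmetric] HX_def[symmetric]
 using X_L2_hilb Sk_sigY_measurable Sk_moments(1) Sk_skorohod_duality[OF T] T by (auto simp: sqint_def)

text \<open>Two solutions of the duality relation differ by a functional of \<open>Y\<close> that is orthogonal to all smooth
 functionals, so by zero.\<close>

lemma skorohod_integral_eq: assumes T: "0 < T" shows "AE w in M. skorohod_integral M Y T X w = Sk T w"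
proof -
 define S where "S = skorohod_integral M Y T X"
 have "is_skorohod_integral M Y T X S"
  unfolding S_def skorohod_integral_def by (rule someI[where P="is_skorohod_integral M Y T X", OF Sk_is_skorohod_integral[OF T]])
 hence Sm: "S \<in> borel_measurable (sigY T)" and Si: "integrable M (%w. (S w)^2)"
  and Sd: "!!k f h. smooth_poly_growth k f ==> (!!i. i < k ==> h i \<in> hilb M Y T) ==>
    ip (functional M Y f h) S = expectation (%w. D_inner M Y k f h (HX T w) w)"
  unfolding is_skorohod_integral_def sigY_def[symmetric] HX_def[symmetric] by auto
 have Ss: "sqint M S" using sigY_measurable_imp[OF Sm] Si by (simp add: sqint_def)
 have T0: "0 <= T" using T by simp
 note Sks = Sk_moments(1)[OF T0]
 have "AE w in M. S w - Sk T w = 0"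
 proof (rule sigY_measurable_zero)
  show "(%w. S w - Sk T w) \<in> borel_measurable (sigY T)" by (intro borel_measurable_diff Sm Sk_sigY_measurable T0)
  show "sqint M (%w. S w - Sk T w)" by (rule sqint_diff[OF Ss Sks])
  fix k f h assume f: "smooth_poly_growth k f" and h: "!!i. i < k ==> h i \<in> hilb M Y T"
  have F: "sqint M (functional M Y f h)"
   unfolding functional_def[abs_def]
   by (rule all_moments_sqint[OF all_moments_C1_growth(1)[OF smooth_poly_growth_imp_C1_growth[OF f]]])
    (rule iso_properties(1)[OF h])
  have "expectation (%w. functional M Y f h w * (S w - Sk T w)) = expectation (%w. functional M Y f h w * S w - functional M Y f h w * Sk T w)"
   by (simp only: right_diff_distrib)
  also have "\<dots> = ip (functional M Y f h) S - ip (functional M Y f h) (Sk T)"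
   by (rule bochner_diff) (intro sqint_mult F Ss Sks)+
  also have "\<dots> = 0" using Sd[OF f h] Sk_skorohod_duality[OF T f h] by simp
  finally show "expectation (%w. functional M Y f h w * (S w - Sk T w)) = 0" .
 qed
 thus ?thesis by eventually_elim (simp add: S_def)
qed

end

section \<open>Strong consistency\<close>

lemma coercive_matrix_inverse:
 fixes A :: "real ^ 'n ^ 'n" and R :: "real ^ 'n"
 assumes c: "0 < c" and co: "!!y. c * (norm y)^2 <= y \<bullet> (A *v y)"
 shows "matrix_inv A ** A = mat 1" and "norm (matrix_inv A *v R) <= norm R / c"
proof -
 have ker: "y = 0" if "A *v y = 0" for y
 proof -
  have "c * (norm y)^2 <= 0" using co[of y] that by simp
  hence "(norm y)^2 <= 0" using c by (simp add: mult_le_0_iff)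
  thus ?thesis by simp
 qed
 have "\<exists>D. D ** A = mat 1" unfolding matrix_left_invertible_ker using ker by blast
 hence inv: "invertible A" by (simp add: invertible_left_inverse)
 have mi: "A ** matrix_inv A = mat 1" and mi': "matrix_inv A ** A = mat 1"
  using inv unfolding invertible_def matrix_inv_def by (metis (mono_tags, lifting) someI_ex)+
 show "matrix_inv A ** A = mat 1" by (rule mi')
 define y where "y = matrix_inv A *v R"
 have Ay: "A *v y = R" unfolding y_def by (simp add: matrix_vector_mul_assoc mi)
 have "c * (norm y)^2 <= norm y * norm R" using co[of y] norm_cauchy_schwarz[of y R] unfolding Ay by linarith
 hence "norm y * (c * norm y) <= norm y * norm R" by (simp add: power2_eq_square mult_ac)
 hence "c * norm y <= norm R" by (cases "y = 0") (auto simp: mult_le_cancel_left_pos)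
 thus "norm (matrix_inv A *v R) <= norm R / c" using c by (simp add: y_def field_simps)
qed

lemma sum_UNIV_option: "(\<Sum>i\<in>UNIV. f i) = f None + (\<Sum>i\<in>UNIV. f (Some i))" for f :: "'p::finite option => real"
 by (simp add: UNIV_option_conv sum.reindex)

text \<open>Unlike integrability alone, this property is inherited by products.\<close>

definition bdd_meas :: "real => (real => real) => bool" where
 "bdd_meas T f \<longleftrightarrow> f \<in> borel_measurable lebesgue \<and> (\<exists>K. \<forall>t\<in>{0..T}. \<bar>f t\<bar> <= K)"

lemma bdd_meas_integrable: "bdd_meas T f ==> f integrable_on {0..T}"
 unfolding bdd_meas_def using bounded_measurable_integrable_on by blast

lemma bdd_meas_mult: assumes "bdd_meas T f" "bdd_meas T g" shows "bdd_meas T (%t. f t * g t)"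
proof -
 obtain K K' where K: "!!t. t \<in> {0..T} ==> \<bar>f t\<bar> <= K" "!!t. t \<in> {0..T} ==> \<bar>g t\<bar> <= K'"
  using assms unfolding bdd_meas_def by blast
 have "\<bar>f t * g t\<bar> <= \<bar>K\<bar> * \<bar>K'\<bar>" if "t \<in> {0..T}" for t
  unfolding abs_mult using K[OF that] by (intro mult_mono) auto
 thus ?thesis using assms unfolding bdd_meas_def by (blast intro: borel_measurable_times)
qed

lemma bdd_meas_const: "bdd_meas T (%t. c)"
 unfolding bdd_meas_def by auto

lemma bdd_meas_add: assumes "bdd_meas T f" "bdd_meas T g" shows "bdd_meas T (%t. f t + g t)"
proof -
 obtain K K' where K: "!!t. t \<in> {0..T} ==> \<bar>f t\<bar> <= K" "!!t. t \<in> {0..T} ==> \<bar>g t\<bar> <= K'"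
  using assms unfolding bdd_meas_def by blast
 have "\<bar>f t + g t\<bar> <= K + K'" if "t \<in> {0..T}" for t
  using K[OF that] by linarith
 thus ?thesis using assms unfolding bdd_meas_def by (blast intro: borel_measurable_add)
qed

lemma bdd_meas_sum: "finite I ==> (!!i. i \<in> I ==> bdd_meas T (f i)) ==> bdd_meas T (%t. \<Sum>i\<in>I. f i t)"
 by (induction rule: finite_induct) (auto intro: bdd_meas_const bdd_meas_add)

lemma bdd_meas_cmult: "bdd_meas T f ==> bdd_meas T (%t. c * f t)"
 by (rule bdd_meas_mult[OF bdd_meas_const])

lemma bdd_meas_continuous: assumes f: "continuous_on UNIV f" shows "bdd_meas T f"
proof -
 have "compact (f ` {0..T})" by (intro compact_continuous_image continuous_on_subset[OF f]) auto
 then obtain K where "\<forall>x\<in>f ` {0..T}. norm x <= K" using compact_imp_bounded bounded_iff by blast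
 thus ?thesis unfolding bdd_meas_def using borel_imp_lebesgue_measurable[OF borel_measurable_continuous_onI[OF f]] by auto
qed

lemma integral_linear_combination:
 fixes f :: "'k::finite => real => real"
 assumes "!!i. bdd_meas T (f i)"
 shows "integral {0..T} (%t. \<Sum>i\<in>UNIV. c i * f i t) = (\<Sum>i\<in>UNIV. c i * integral {0..T} (f i))"
proof -
 have "integral {0..T} (%t. \<Sum>i\<in>UNIV. c i * f i t) = (\<Sum>i\<in>UNIV. integral {0..T} (%t. c i * f i t))"
  by (rule Henstock_Kurzweil_Integration.integral_sum) (auto intro: bdd_meas_integrable bdd_meas_cmult assms)
 thus ?thesis by simp
qed

definition gram :: "real => ('k::finite => real => real) => real ^ 'k ^ 'k" where
 "gram T h = (\<chi> i j. integral {0..T} (%t. h i t * h j t))"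

lemma gram_mult_vector:
 assumes h: "!!i. bdd_meas T (h i)"
 shows "(gram T h *v y) $ i = integral {0..T} (%t. h i t * (\<Sum>j\<in>UNIV. y $ j * h j t))"
proof -
 have "integral {0..T} (%t. h i t * (\<Sum>j\<in>UNIV. y $ j * h j t)) = integral {0..T} (%t. \<Sum>j\<in>UNIV. y $ j * (h i t * h j t))"
  by (simp add: sum_distrib_left mult.left_commute)
 also have "\<dots> = (\<Sum>j\<in>UNIV. y $ j * integral {0..T} (%t. h i t * h j t))"
  by (rule integral_linear_combination) (intro bdd_meas_mult h)
 finally show ?thesis by (simp add: gram_def matrix_vector_mult_def mult.commute)
qed

lemma gram_quadratic_form:
 assumes h: "!!i. bdd_meas T (h i)"
 shows "y \<bullet> (gram T h *v y) = integral {0..T} (%t. (\<Sum>j\<in>UNIV. y $ j * h j t)^2)"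
proof -
 define s where "s t = (\<Sum>j\<in>UNIV. y $ j * h j t)" for t
 have s: "bdd_meas T s" unfolding s_def by (intro bdd_meas_sum bdd_meas_cmult h) simp
 have "y \<bullet> (gram T h *v y) = (\<Sum>i\<in>UNIV. y $ i * integral {0..T} (%t. h i t * s t))"
  unfolding inner_vec_def gram_mult_vector[OF h] s_def by simp
 also have "\<dots> = integral {0..T} (%t. \<Sum>i\<in>UNIV. y $ i * (h i t * s t))"
  by (rule integral_linear_combination[symmetric]) (intro bdd_meas_mult h s)
 also have "\<dots> = integral {0..T} (%t. (s t)^2)"
  unfolding power2_eq_square s_def by (simp add: sum_distrib_right mult.assoc)
 finally show ?thesis by (simp add: s_def)
qed

locale periodic_ou = ou M H B \<phi> \<mu> \<alpha> C X
 for M :: "'a measure" and H :: real and B :: "real => 'a => real" and \<phi> :: "'p::finite => real => real"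
  and \<mu> :: "real ^ 'p" and \<alpha> C :: real and X :: "real => 'a => real" +
 assumes periodic: "!!i t. \<phi> i (t + 1) = \<phi> i t"
  and orthonormal: "!!i j. integral {0..1} (%t. \<phi> i t * \<phi> j t) = (if i = j then 1 else 0)"
begin

lemma \<phi>_bdd_meas: "bdd_meas T (\<phi> i)"
 unfolding bdd_meas_def using \<phi>_measurable \<phi>_bound by blast

lemma \<phi>_periodic_nat: "\<phi> i (t + real n) = \<phi> i t"
proof (induction n)
 case (Suc n)
 have "\<phi> i (t + real (Suc n)) = \<phi> i ((t + real n) + 1)" by (simp add: algebra_simps)
 thus ?case using Suc periodic by simp
qed simp

lemma \<phi>_gram: "integral {0..real n} (%t. \<phi> i t * \<phi> j t) = (if i = j then real n else 0)"
proof (induction n)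
 case (Suc n)
 have "integral {0..real n} (%t. \<phi> i t * \<phi> j t) + integral {real n..real (Suc n)} (%t. \<phi> i t * \<phi> j t) = integral {0..real (Suc n)} (%t. \<phi> i t * \<phi> j t)"
  by (rule hk_combine) (auto intro: bdd_meas_integrable bdd_meas_mult \<phi>_bdd_meas)
 moreover have "integral {real n..real (Suc n)} (%t. \<phi> i t * \<phi> j t) = integral {real n..real (Suc n)} (%t. \<phi> i (t - real n) * \<phi> j (t - real n))"
  using \<phi>_periodic_nat[of _ "_ - real n" n] by simp
 moreover have "\<dots> = integral {0..real (Suc n) - real n} (%t. \<phi> i t * \<phi> j t)"
  by (rule integral_shift_origin)
 ultimately show ?case using Suc orthonormal by (simp split: if_splits)
qed simp

text \<open>With \<open>h = (\<phi>\<^sub>1, \<dots>, \<phi>\<^sub>p, - X)\<close>, the matrix of the estimator is the Gram matrix of \<open>h\<close>, and the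
 drift is the combination of \<open>h\<close> whose coefficients are the parameters.\<close>

definition hX :: "'a => 'p option => real => real" where
 "hX w i t = (case i of Some j => \<phi> j t | None => - Xc t w)"

lemma hX_bdd_meas: assumes w: "w \<in> space M" shows "bdd_meas T (hX w i)"
proof (cases i)
 case None
 have "continuous_on UNIV (%t. - Xc t w)" by (intro continuous_intros Xc_continuous w)
 thus ?thesis unfolding hX_def None by (simp add: bdd_meas_continuous)
next
 case (Some j) thus ?thesis unfolding hX_def by (simp add: \<phi>_bdd_meas)
qed

lemma Q_tilde_eq_gram: assumes w: "w \<in> space M" shows "Q_tilde \<phi> X T w = gram T (hX w)"
proof -
 have c: "integral {0..T} (%t. \<phi> k t * X t w) = integral {0..T} (%t. \<phi> k t * Xc t w)" for k
  by (rule hk_cong) (simp add: X_eq_Xc w)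
 have d: "integral {0..T} (%t. (X t w)^2) = integral {0..T} (%t. (Xc t w)^2)"
  by (rule hk_cong) (simp add: X_eq_Xc w)
 show ?thesis
  unfolding vec_eq_iff Q_tilde_def gram_def hX_def
  by (auto simp: c d mult.commute[of "Xc _ _"] power2_eq_square[symmetric] split: option.splits)
qed

lemma drift_eq: assumes "w \<in> space M" "0 <= t"
 shows "drift \<phi> \<mu> \<alpha> X t w = (\<Sum>j\<in>UNIV. parameter \<mu> \<alpha> $ j * hX w j t)"
 unfolding sum_UNIV_option drift_def by (simp add: parameter_def hX_def X_eq_Xc assms)

definition noise :: "nat => 'a => real ^ 'p option" where
 "noise n w = (\<chi> i. case i of Some j => wiener_integral M Y (real n) (\<phi> j) w | None => - skorohod_integral M Y (real n) X w)"

lemma P_tilde_eq: assumes w: "w \<in> space M"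
 shows "P_tilde M Y \<phi> \<mu> \<alpha> X (real n) w = Q_tilde \<phi> X (real n) w *v parameter \<mu> \<alpha> + noise n w"
proof -
 have "(P_tilde M Y \<phi> \<mu> \<alpha> X (real n) w) $ i = (Q_tilde \<phi> X (real n) w *v parameter \<mu> \<alpha>) $ i + noise n w $ i" for i
 proof -
  have e: "(Q_tilde \<phi> X (real n) w *v parameter \<mu> \<alpha>) $ i = integral {0..real n} (%t. hX w i t * drift \<phi> \<mu> \<alpha> X t w)"
   unfolding Q_tilde_eq_gram[OF w] gram_mult_vector[OF hX_bdd_meas[OF w]]
   by (rule hk_cong) (simp add: drift_eq w)
  show ?thesis
  proof (cases i)
   case None
   have "integral {0..real n} (%t. hX w None t * drift \<phi> \<mu> \<alpha> X t w) = integral {0..real n} (%t. - (X t w * drift \<phi> \<mu> \<alpha> X t w))"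
    by (rule hk_cong) (simp add: hX_def X_eq_Xc w)
   thus ?thesis using e by (simp add: None P_tilde_def noise_def)
  next
   case (Some j)
   thus ?thesis using e by (simp add: P_tilde_def noise_def hX_def)
  qed
 qed
 thus ?thesis by (simp add: vec_eq_iff)
qed

text \<open>The integrals of \<open>Z\<close> against the deterministic parts of \<open>\<phi>\<^sub>1, \<dots>, \<phi>\<^sub>p, - X\<close>.\<close>

definition eZ :: "nat => 'a => 'p option => real" where
 "eZ n w i = (case i of Some j => LBINT t:{0..real n}. \<phi>b j t * Z t w | None => - (LBINT t:{0..real n}. m t * Z t w))"

text \<open>The quadratic form is \<open>\<integral> (g - z Z)\<^sup>2\<close> with \<open>z\<close> the last component of \<open>y\<close> and
 \<open>g = \<Sum> y\<^sub>i \<phi>\<^sub>i - z m\<close>. Its three terms are kept apart: the mixed one is negligible, \<open>z^2 \<integral> Z\<^sup>2\<close> controls \<open>z\<close>, and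
 \<open>\<integral> g\<^sup>2\<close> controls the other components up to a multiple of \<open>z^2\<close> which the parameter \<open>d\<close> makes small.\<close>

lemma Q_tilde_quadratic_form:
 assumes w: "w \<in> space M" and d: "0 <= d" "d <= 1/2"
 shows "y \<bullet> (Q_tilde \<phi> X (real n) w *v y)
  \<ge> d * real n * (\<Sum>i\<in>UNIV. (y $ Some i)^2) - 2 * d * (y $ None)^2 * (CL / \<alpha>)^2 * real n
   - 2 * (y $ None) * (\<Sum>i\<in>UNIV. y $ i * eZ n w i) + (y $ None)^2 * SZ (real n) w"
proof -
 define z where "z = y $ None"
 define hm where "hm i t = (case i of Some j => \<phi> j t | None => - m t)" for i :: "'p option" and t
 have hm: "bdd_meas T (hm i)" for T i
  by (cases i) (auto simp: hm_def[abs_def] \<phi>_bdd_meas intro!: bdd_meas_continuous continuous_intros m_continuous)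
 have Zb: "bdd_meas T (%t. Z t w)" for T by (intro bdd_meas_continuous Z_continuous w)
 define q where "q t = (\<Sum>i\<in>UNIV. y $ i * hm i t)" for t
 define f where "f t = (\<Sum>i\<in>UNIV. y $ Some i * \<phi> i t)" for t
 have qf: "q t = f t - z * m t" for t unfolding q_def f_def sum_UNIV_option hm_def z_def by simp
 have qb: "bdd_meas T q" for T unfolding q_def by (intro bdd_meas_sum bdd_meas_cmult hm) simp
 have fb: "bdd_meas T f" for T unfolding f_def by (intro bdd_meas_sum bdd_meas_cmult \<phi>_bdd_meas) simp
 have sq: "bdd_meas T (%t. (u t)^2)" if "bdd_meas T u" for T u unfolding power2_eq_square by (intro bdd_meas_mult that)
 have "y \<bullet> (Q_tilde \<phi> X (real n) w *v y) = integral {0..real n} (%t. (q t)^2 + ((- 2 * z) * (q t * Z t w) + z^2 * (Z t w)^2))"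
  unfolding Q_tilde_eq_gram[OF w] gram_quadratic_form[OF hX_bdd_meas[OF w]]
 proof (rule hk_cong)
  fix t assume "t \<in> {0..real n}"
  have "(\<Sum>j\<in>UNIV. y $ j * hX w j t) = q t - z * Z t w"
   unfolding q_def sum_UNIV_option hm_def hX_def z_def by (simp add: Xc_def algebra_simps)
  show "(\<Sum>j\<in>UNIV. y $ j * hX w j t)^2 = (q t)^2 + ((- 2 * z) * (q t * Z t w) + z^2 * (Z t w)^2)"
   unfolding \<open>(\<Sum>j\<in>UNIV. y $ j * hX w j t) = q t - z * Z t w\<close> by (simp add: power2_eq_square algebra_simps)
 qed
 also have "\<dots> = integral {0..real n} (%t. (q t)^2) + (integral {0..real n} (%t. (- 2 * z) * (q t * Z t w)) + integral {0..real n} (%t. z^2 * (Z t w)^2))"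
  by (subst hk_add | intro bdd_meas_integrable bdd_meas_add bdd_meas_cmult bdd_meas_mult sq qb Zb | rule refl)+
 also have "integral {0..real n} (%t. (- 2 * z) * (q t * Z t w)) = (- 2 * z) * integral {0..real n} (%t. q t * Z t w)" by (rule integral_mult_right)
 also have "integral {0..real n} (%t. z^2 * (Z t w)^2) = z^2 * SZ (real n) w" unfolding SZ_eq[OF w] by (rule integral_mult_right)
 also have "integral {0..real n} (%t. q t * Z t w) = (\<Sum>i\<in>UNIV. y $ i * eZ n w i)"
 proof -
  have hz: "integral {0..real n} (%t. hm i t * Z t w) = eZ n w i" for i
  proof (cases i)
   case None
   have "(LBINT t:{0..real n}. m t * Z t w) = integral {0..real n} (%t. m t * Z t w)"
    by (rule lborel_set_integral_continuous) (intro continuous_intros m_continuous Z_continuous w)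
   thus ?thesis by (simp add: None hm_def eZ_def)
  next
   case (Some j)
   show ?thesis unfolding Some hm_def eZ_def
    using integral_unique[OF integral_borel_version[OF \<phi>b_measurable[of j] \<phi>b_bound \<phi>b_AE Z_continuous[OF w], where s=0 and t="real n"]] by simp
  qed
  have "integral {0..real n} (%t. q t * Z t w) = integral {0..real n} (%t. \<Sum>i\<in>UNIV. y $ i * (hm i t * Z t w))"
   unfolding q_def by (simp add: sum_distrib_right mult.assoc)
  also have "\<dots> = (\<Sum>i\<in>UNIV. y $ i * integral {0..real n} (%t. hm i t * Z t w))"
   by (rule integral_linear_combination) (intro bdd_meas_mult hm Zb)
  finally show ?thesis by (simp only: hz)
 qed
 finally have e: "y \<bullet> (Q_tilde \<phi> X (real n) w *v y) = integral {0..real n} (%t. (q t)^2) + (- 2 * z * (\<Sum>i\<in>UNIV. y $ i * eZ n w i) + z^2 * SZ (real n) w)" .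
 \<comment> \<open>Applied with \<open>a = f t\<close> and \<open>b = z m t\<close>.\<close>
 have pw: "d * (a * a) - 2 * d * (b * b) <= (a - b)^2" for a b :: real
 proof -
  have "(a - b)^2 - (d * (a * a) - 2 * d * (b * b)) = (1 - 2 * d) * (a - b)^2 + d * (a - 2 * b)^2"
   by (simp add: power2_eq_square algebra_simps)
  moreover have "0 <= (1 - 2 * d) * (a - b)^2 + d * (a - 2 * b)^2" using d by (intro add_nonneg_nonneg mult_nonneg_nonneg) auto
  ultimately show ?thesis by linarith
 qed
 have ff: "integral {0..real n} (%t. (f t)^2) = real n * (\<Sum>i\<in>UNIV. (y $ Some i)^2)"
 proof -
  define y' :: "real ^ 'p" where "y' = (\<chi> i. y $ Some i)"
  have "integral {0..real n} (%t. (f t)^2) = y' \<bullet> (gram (real n) \<phi> *v y')"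
   unfolding gram_quadratic_form[OF \<phi>_bdd_meas] f_def y'_def by simp
  also have "gram (real n) \<phi> *v y' = real n *\<^sub>R y'"
   by (simp add: vec_eq_iff gram_def \<phi>_gram matrix_vector_mult_def if_distrib[of "%c. c * _"] sum.delta cong: if_cong)
  also have "y' \<bullet> (real n *\<^sub>R y') = real n * (\<Sum>i\<in>UNIV. (y $ Some i)^2)"
   by (simp add: inner_vec_def y'_def power2_eq_square sum_distrib_left mult_ac)
  finally show ?thesis .
 qed
 have "d * real n * (\<Sum>i\<in>UNIV. (y $ Some i)^2) - 2 * d * z^2 * (CL / \<alpha>)^2 * real n
  = integral {0..real n} (%t. d * (f t)^2) - integral {0..real n} (%t. 2 * d * z^2 * (CL / \<alpha>)^2)"
  by (simp add: ff)
 also have "\<dots> = integral {0..real n} (%t. d * (f t)^2 - 2 * d * z^2 * (CL / \<alpha>)^2)"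
  by (rule hk_diff[symmetric]) (intro bdd_meas_integrable bdd_meas_cmult sq fb, rule integrable_const_ivl)
 also have "\<dots> <= integral {0..real n} (%t. (q t)^2)"
 proof (rule integral_le)
  show "(%t. d * (f t)^2 - 2 * d * z^2 * (CL / \<alpha>)^2) integrable_on {0..real n}"
   by (intro integrable_diff bdd_meas_integrable bdd_meas_cmult sq fb integrable_const_ivl)
  show "(%t. (q t)^2) integrable_on {0..real n}" by (intro bdd_meas_integrable sq qb)
  fix t
  have "(m t)^2 <= (CL / \<alpha>)^2" by (rule abs_le_imp_square_le[OF m_bound])
  hence "2 * d * z^2 * (m t)^2 <= 2 * d * z^2 * (CL / \<alpha>)^2" using d by (intro mult_left_mono) auto
  moreover have "d * (f t)^2 - 2 * d * z^2 * (m t)^2 <= (q t)^2"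
   using pw[of "f t" "z * m t"] unfolding qf by (simp add: power2_eq_square mult_ac)
  ultimately show "d * (f t)^2 - 2 * d * z^2 * (CL / \<alpha>)^2 <= (q t)^2" by linarith
 qed
 finally show ?thesis unfolding e z_def[symmetric] by simp
qed

lemma norm_option_squared: "(norm y)^2 = (y $ None)^2 + (\<Sum>i\<in>UNIV. (y $ Some i)^2)" for y :: "real ^ 'p option"
 unfolding power2_norm_eq_inner inner_vec_def sum_UNIV_option by (simp add: power2_eq_square)

text \<open>For \<open>d\<close> small against the lower bound \<open>c\<sigma>\<close> of the variances, the term \<open>z^2 \<integral> Z\<^sup>2\<close> absorbs the loss in
 the quadratic form, which is then at least a constant times \<open>n\<close> for large \<open>n\<close>; the noise is \<open>o(n)\<close>.\<close>

lemma lse_tendsto: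
 assumes w: "w \<in> space M"
  and e: "!!i. (%n. eZ n w i / real n) \<longlonglongrightarrow> 0"
  and S: "(%n. (SZ (real n) w - AZ (real n)) / real n) \<longlonglongrightarrow> 0"
  and R: "!!i. (%n. noise n w $ i / real n) \<longlonglongrightarrow> 0"
 shows "(%n. lse M Y \<phi> \<mu> \<alpha> X (real n) w) \<longlonglongrightarrow> parameter \<mu> \<alpha>"
proof -
 define Km where "Km = (CL / \<alpha>)^2"
 \<comment> \<open>With this \<open>d\<close> the loss \<open>2 d Km z\<^sup>2 n\<close> in the quadratic form is at most half of the gain \<open>c\<sigma> z\<^sup>2 n / 4\<close> from \<open>\<integral> Z\<^sup>2\<close>.\<close>
 define d where "d = min (1/2) (c\<sigma> / (16 * (Km + 1)))"
 have Km: "0 <= Km" by (simp add: Km_def)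
 have d: "0 < d" using c\<sigma>_pos Km by (auto simp: d_def)
 have d2: "d <= 1/2" unfolding d_def by (rule min.cobounded1)
 have dK: "2 * d * Km <= c\<sigma> / 8"
 proof -
  have "d * (Km + 1) <= c\<sigma> / (16 * (Km + 1)) * (Km + 1)" using Km by (intro mult_right_mono) (auto simp: d_def)
  also have "\<dots> = c\<sigma> / 16" using Km by (simp add: field_simps)
  finally show ?thesis using d by (simp add: algebra_simps)
 qed
 define l where "l = min d (c\<sigma> / 8)"
 have l: "0 < l" using d c\<sigma>_pos by (simp add: l_def)
 define err where "err n = (\<Sum>i\<in>UNIV. \<bar>eZ n w i / real n\<bar>)" for n
 have "(%n. \<Sum>i\<in>UNIV. \<bar>eZ n w i / real n\<bar>) \<longlonglongrightarrow> (\<Sum>i\<in>(UNIV :: 'p option set). \<bar>0\<bar>)" by (intro tendsto_intros e)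
 hence err: "err \<longlonglongrightarrow> 0" by (simp add: err_def[abs_def])
 have ev1: "\<forall>\<^sub>F n in sequentially. err n < l / 4" using order_tendstoD(2)[OF err, of "l / 4"] l by simp
 have ev2: "\<forall>\<^sub>F n in sequentially. - (c\<sigma> / 4) < (SZ (real n) w - AZ (real n)) / real n"
  using order_tendstoD(1)[OF S, of "- (c\<sigma> / 4)"] c\<sigma>_pos by simp
 have ev3: "\<forall>\<^sub>F n in sequentially. 2 <= n" by (rule eventually_ge_at_top)
 have bound: "\<forall>\<^sub>F n in sequentially. norm (lse M Y \<phi> \<mu> \<alpha> X (real n) w - parameter \<mu> \<alpha>) <= 2 / l * (\<Sum>i\<in>UNIV. \<bar>noise n w $ i / real n\<bar>)"
  using ev1 ev2 ev3
 proof eventually_elim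
  case (elim n)
  have n: "2 <= real n" using elim(3) by simp
  have SZl: "c\<sigma> / 4 * real n <= SZ (real n) w"
  proof -
   have "c\<sigma> * (real n - 1) <= AZ (real n)" by (rule AZ_lower) (use n in simp)
   moreover have "c\<sigma> * (real n / 2) <= c\<sigma> * (real n - 1)" using n c\<sigma>_pos by (intro mult_left_mono) auto
   moreover have "- (c\<sigma> / 4) * real n <= SZ (real n) w - AZ (real n)" using elim(2) n by (simp add: field_simps)
   ultimately show ?thesis by (simp add: algebra_simps)
  qed
  have co: "(l / 2 * real n) * (norm y)^2 <= y \<bullet> (Q_tilde \<phi> X (real n) w *v y)" for y
  proof -
   define z where "z = y $ None"
   define s where "s = (\<Sum>i\<in>UNIV. (y $ Some i)^2)"
   have s0: "0 <= s" unfolding s_def by (rule sum_nonneg) simp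
   have ny: "(norm y)^2 = z^2 + s" by (simp add: norm_option_squared z_def s_def)
   have "\<bar>\<Sum>i\<in>UNIV. y $ i * eZ n w i\<bar> <= (\<Sum>i\<in>UNIV. norm y * (real n * \<bar>eZ n w i / real n\<bar>))"
    by (rule order_trans[OF sum_abs], rule sum_mono) (use n component_le_norm_cart[of y] in \<open>auto simp: abs_mult intro!: mult_right_mono\<close>)
   also have "\<dots> = norm y * (real n * err n)" by (simp add: err_def sum_distrib_left)
   also have "\<dots> <= norm y * (real n * (l / 4))" using elim(1) by (intro mult_left_mono) auto
   finally have x: "\<bar>\<Sum>i\<in>UNIV. y $ i * eZ n w i\<bar> <= norm y * (real n * (l / 4))" .
   have "\<bar>z * (\<Sum>i\<in>UNIV. y $ i * eZ n w i)\<bar> <= norm y * (norm y * (real n * (l / 4)))"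
    unfolding abs_mult using x component_le_norm_cart[of y None] by (intro mult_mono) (auto simp: z_def)
   hence cross: "2 * z * (\<Sum>i\<in>UNIV. y $ i * eZ n w i) <= (l / 2 * real n) * (norm y)^2"
    by (simp add: power2_eq_square mult_ac)
   have a1: "l * real n * s <= d * real n * s" using s0 by (intro mult_right_mono) (auto simp: l_def)
   have "l * real n <= c\<sigma> / 8 * real n" by (intro mult_right_mono) (auto simp: l_def)
   moreover have "2 * d * Km * real n <= c\<sigma> / 8 * real n" using dK by (intro mult_right_mono) auto
   ultimately have "l * real n <= SZ (real n) w - 2 * d * Km * real n" using SZl by (simp add: algebra_simps)
   hence a2: "z^2 * (l * real n) <= z^2 * (SZ (real n) w - 2 * d * Km * real n)" by (rule mult_left_mono) simp
   have "z^2 * (l * real n) <= z^2 * SZ (real n) w - 2 * d * z^2 * Km * real n" using a2 by (simp add: algebra_simps)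
   moreover have "l * real n * s + z^2 * (l * real n) = 2 * ((l / 2 * real n) * (norm y)^2)" unfolding ny by (simp add: algebra_simps)
   moreover have "d * real n * s - 2 * d * z^2 * Km * real n - 2 * z * (\<Sum>i\<in>UNIV. y $ i * eZ n w i) + z^2 * SZ (real n) w <= y \<bullet> (Q_tilde \<phi> X (real n) w *v y)"
    using Q_tilde_quadratic_form[OF w less_imp_le[OF d] d2, where y=y and n=n] unfolding z_def s_def Km_def .
   ultimately show ?thesis using a1 cross by linarith
  qed
  have c0: "0 < l / 2 * real n" using l n by simp
  note inv = coercive_matrix_inverse[OF c0 co]
  have "lse M Y \<phi> \<mu> \<alpha> X (real n) w - parameter \<mu> \<alpha> = matrix_inv (Q_tilde \<phi> X (real n) w) *v noise n w"
   unfolding lse_def P_tilde_eq[OF w] matrix_vector_right_distrib matrix_vector_mul_assoc inv(1) by simp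
  hence "norm (lse M Y \<phi> \<mu> \<alpha> X (real n) w - parameter \<mu> \<alpha>) <= norm (noise n w) / (l / 2 * real n)" using inv(2) by simp
  also have "\<dots> <= (\<Sum>i\<in>UNIV. \<bar>noise n w $ i\<bar>) / (l / 2 * real n)"
   using c0 norm_le_l1_cart[of "noise n w"] by (intro divide_right_mono) auto
  also have "\<dots> = 2 / l * (\<Sum>i\<in>UNIV. \<bar>noise n w $ i / real n\<bar>)" by (simp add: sum_divide_distrib[symmetric])
  finally show ?case .
 qed
 have "(%n. 2 / l * (\<Sum>i\<in>UNIV. \<bar>noise n w $ i / real n\<bar>)) \<longlonglongrightarrow> 2 / l * (\<Sum>i\<in>(UNIV :: 'p option set). \<bar>0\<bar>)" by (intro tendsto_intros R)
 hence "(%n. 2 / l * (\<Sum>i\<in>UNIV. \<bar>noise n w $ i / real n\<bar>)) \<longlonglongrightarrow> 0" by simp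
 hence "(%n. lse M Y \<phi> \<mu> \<alpha> X (real n) w - parameter \<mu> \<alpha>) \<longlonglongrightarrow> 0" by (rule Lim_null_comparison[OF bound])
 thus ?thesis by (rule LIM_zero_cancel)
qed

lemma bounded_over_n_tendsto_0: assumes "!!n. \<bar>a n\<bar> <= K" shows "(%n. a n / real n) \<longlonglongrightarrow> 0"
proof (rule Lim_null_comparison)
 show "\<forall>\<^sub>F n in sequentially. norm (a n / real n) <= K / real n"
  using assms by (intro always_eventually allI) (auto simp: abs_divide intro: divide_right_mono)
 show "(%n. K / real n) \<longlonglongrightarrow> 0" by (rule lim_const_over_n)
qed

lemma Sk_LLN: "AE w in M. (%n. Sk (real n) w / real n) \<longlonglongrightarrow> 0"
 using Z_mult_integral_LLN[OF Lb_measurable Lb_bound] Z_mult_integral_LLN[OF m_measurable m_bound] SZ_LLN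
  gaussian_square_over_n_AE_tendsto_0[of "%n. Z (real n)", OF Z_in_G Z_l2]
proof eventually_elim
 case (elim w)
 have v: "(%n. varZ (real n) / real n) \<longlonglongrightarrow> 0"
  by (rule bounded_over_n_tendsto_0[where K="KZ^2"]) (use varZ_bounds in simp)
 have mZ: "(%n. m (real n) * Z (real n) w / real n) \<longlonglongrightarrow> 0"
 proof (rule Lim_null_comparison)
  show "\<forall>\<^sub>F n in sequentially. norm (m (real n) * Z (real n) w / real n) <= (CL / \<alpha>) * (1 / real n + (Z (real n) w)^2 / real n)"
  proof (intro always_eventually allI)
   fix n
   have "2 * \<bar>Z (real n) w\<bar> <= 1 + (Z (real n) w)^2" using sum_squares_ge_zero[of "\<bar>Z (real n) w\<bar> - 1" 0] by (simp add: power2_eq_square algebra_simps)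
   hence "\<bar>Z (real n) w\<bar> <= 1 + (Z (real n) w)^2" by linarith
   hence "\<bar>m (real n)\<bar> * \<bar>Z (real n) w\<bar> <= (CL / \<alpha>) * (1 + (Z (real n) w)^2)" using m_bound[of "real n"] by (intro mult_mono) auto
   hence "\<bar>m (real n)\<bar> * \<bar>Z (real n) w\<bar> / real n <= (CL / \<alpha>) * (1 + (Z (real n) w)^2) / real n" by (rule divide_right_mono) simp
   thus "norm (m (real n) * Z (real n) w / real n) <= (CL / \<alpha>) * (1 / real n + (Z (real n) w)^2 / real n)"
    by (simp add: abs_mult abs_divide add_divide_distrib[symmetric])
  qed
  have "(%n. (CL / \<alpha>) * (1 / real n + (Z (real n) w)^2 / real n)) \<longlonglongrightarrow> (CL / \<alpha>) * (0 + 0)"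
   by (intro tendsto_intros elim(4) lim_1_over_n)
  thus "(%n. (CL / \<alpha>) * (1 / real n + (Z (real n) w)^2 / real n)) \<longlonglongrightarrow> 0" by simp
 qed
 have "(%n. m (real n) * Z (real n) w / real n + ((Z (real n) w)^2 / real n - varZ (real n) / real n) / 2
  - (LBINT u:{0..real n}. Lb u * Z u w) / real n
  + \<alpha> * (2 * ((LBINT u:{0..real n}. m u * Z u w) / real n) + (SZ (real n) w - AZ (real n)) / real n))
  \<longlonglongrightarrow> 0 + (0 - 0) / 2 - 0 + \<alpha> * (2 * 0 + 0)"
  by (intro tendsto_intros mZ v elim) simp
 moreover have "m (real n) * Z (real n) w / real n + ((Z (real n) w)^2 / real n - varZ (real n) / real n) / 2
  - (LBINT u:{0..real n}. Lb u * Z u w) / real n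
  + \<alpha> * (2 * ((LBINT u:{0..real n}. m u * Z u w) / real n) + (SZ (real n) w - AZ (real n)) / real n) = Sk (real n) w / real n" for n
  by (simp add: Sk_def add_divide_distrib diff_divide_distrib algebra_simps)
 ultimately show ?case by simp
qed

lemma noise_LLN: "AE w in M. (%n. noise n w $ i / real n) \<longlonglongrightarrow> 0"
proof (cases i)
 case (Some j)
 have "AE w in M. (%n. wiener_integral M Y (real n) (\<phi> j) w / real n) \<longlonglongrightarrow> 0"
  by (rule gaussian_over_n_AE_tendsto_0[OF wiener_integral_properties[OF _ \<phi>_measurable \<phi>_bound]]) auto
 thus ?thesis by (simp add: noise_def Some)
next
 case None
 have "AE w in M. \<forall>n. 0 < n \<longrightarrow> skorohod_integral M Y (real n) X w = Sk (real n) w"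
  unfolding AE_all_countable using skorohod_integral_eq by auto
 thus ?thesis
  using Sk_LLN
 proof eventually_elim
  case (elim w)
  have "(%n. - (Sk (real n) w / real n)) \<longlonglongrightarrow> - 0" by (intro tendsto_intros elim)
  moreover have "- (Sk (real n) w / real n) = noise n w $ i / real n" for n
   using elim(1) by (cases "n = 0") (simp_all add: noise_def None)
  ultimately show ?case by simp
 qed
qed

theorem lse_strongly_consistent: "AE w in M. (%n. lse M Y \<phi> \<mu> \<alpha> X (real n) w) \<longlonglongrightarrow> parameter \<mu> \<alpha>"
proof -
 have "AE w in M. (%n. eZ n w i / real n) \<longlonglongrightarrow> 0" for i
 proof (cases i)
  case None
  show ?thesis using Z_mult_integral_LLN[OF m_measurable m_bound]
  proof eventually_elim
   case (elim w)
   from tendsto_minus[OF elim] show ?case by (simp add: eZ_def None)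
  qed
 next
  case (Some j)
  show ?thesis using Z_mult_integral_LLN[OF \<phi>b_measurable \<phi>b_bound] by (simp add: eZ_def Some)
 qed
 hence e: "AE w in M. \<forall>i\<in>UNIV. (%n. eZ n w i / real n) \<longlonglongrightarrow> 0" by (intro AE_finite_allI) auto
 have "AE w in M. \<forall>i\<in>UNIV. (%n. noise n w $ i / real n) \<longlonglongrightarrow> 0" by (intro AE_finite_allI noise_LLN) auto
 with e SZ_LLN AE_space show ?thesis
 proof eventually_elim
  case (elim w)
  show ?case by (rule lse_tendsto) (use elim in auto)
 qed
qed

end

theorem theorem5:
  fixes M :: "'a measure" and B X :: "real \<Rightarrow> 'a \<Rightarrow> real"
    and \<phi> :: "'p::finite \<Rightarrow> real \<Rightarrow> real" and \<mu> :: "real ^ 'p" and \<alpha> C H :: real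
  assumes "prob_space M"
    and "1/2 < H" and "H < 1"
    and "fractional_brownian_motion M H B"
    and "\<And>i. \<phi> i \<in> borel_measurable lebesgue"
    and "C > 0" and "\<And>i t. \<bar>\<phi> i t\<bar> \<le> C"
    and "\<And>i t. \<phi> i (t + 1) = \<phi> i t"
    and "\<And>i j. integral {0..1} (\<lambda>t. \<phi> i t * \<phi> j t) = (if i = j then 1 else 0)"
    and "\<alpha> > 0"
    and "ou_solution M (Y1 H B) \<phi> \<mu> \<alpha> X"
  shows "AE \<omega> in M. (\<lambda>n::nat. lse M (Y1 H B) \<phi> \<mu> \<alpha> X (real n) \<omega>) \<longlonglongrightarrow> parameter \<mu> \<alpha>"
proof -
  interpret periodic_ou M H B \<phi> \<mu> \<alpha> C X
    by (intro periodic_ou.intro ou.intro fbm.intro hurst.intro periodic_ou_axioms.intro ou_axioms.intro fbm_axioms.intro) (use assms in auto)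
  show ?thesis by (rule lse_strongly_consistent)
qed

end
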